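(* Let $Z:=Z(\Gamma_a)$ and let $Z^{\#}:=\{y\in\bigoplus_{s=1}^a Z_s \mid \sum_{s=1}^a \mathrm{Tr}_{Z_s/K}(x_sy_s)\in R \text{ for all } x=(x_1,\ldots,x_a)\in Z\}$ be the dual of $Z$ with respect to the sum of the usual trace bilinear forms. Then there are units $x_s\in Z_s=Z(K\Gamma_a\epsilon_s)$, i.e. $x_s\in R_s^*$ ($s=1,\ldots,a$), such that $$p^aZ^{\#}=(x_1\pi_1,\ldots,x_a\pi_a)\,Z .$$ With the choice of these $x_s$, the order $\Gamma_a$ is generated by $Z$, $e_1,\ldots,e_n$, $e_{i+1,i}$ $(i=1,\ldots,n-1)$ and $$g_{1,n}:=(x_1\pi_1e^1_{1,n},\ldots,x_a\pi_ae^a_{1,n}).$$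
   Context: Block setting. $p$ is a prime, $G$ a finite group, $K$ a finite unramified extension of $\mathbb{Q}_p$ with ring of integers $R$, $k=R/pR$. $\mathcal{B}$ is a block of $RG$ with cyclic defect group of order $p^a$, and $k$ is a splitting field of $k\mathcal{B}$. $e$ is the number of simple $k\mathcal{B}$-modules. $J(\cdot)$ denotes the Jacobson radical. The central primitive idempotents $\epsilon_1,\ldots,\epsilon_{a+e}$ of $\mathcal{A}=K\mathcal{B}$ are numbered so that $Z(\mathcal{A}\epsilon_s)\cong K$ for $s=a+1,\ldots,a+e$, and $Z_s:=Z(\mathcal{A}\epsilon_s)$ is a totally ramified extension of $K$ of degree $\frac{p^s-p^{s-1}}{e}$ for $s=1,\ldots,a$ (these $a$ indices form the exceptional vertex of the Brauer tree). $R_s$ is the ring of integers of $Z_s$ and $\pi_s$ a prime element of $R_s$. The order $\Gamma_a$. $\Gamma_a:=(\epsilon_1+\cdots+\epsilon_a)\mathcal{B}$, replaced by its Morita equivalent basic order, so that all simple $\Gamma_a$-modules have dimension $1$ over $k$. Let $n$ be the number of simple $\Gamma_a$-modules; it is assumed that $n>1$. Let $e_1,\ldots,e_n\in\Gamma_a$ be orthogonal idempotents lifting the central primitive idempotents of $\Gamma_a/J(\Gamma_a)$. They are ordered cyclically according to the composition series of projective lattices: for every $s\le a$, the reduction modulo $\pi_s$ of the projective $\Gamma_a\epsilon_s$-lattice $\Gamma_a\epsilon_se_i$ is uniserial with composition factors, from top to bottom, the simple modules belonging to $e_i,e_{i+1},\ldots,e_n,e_1,\ldots,e_{i-1}$.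 Coordinates. By Plesken's description of such blocks one can choose bases such that, for $s=1,\ldots,a$, $\Gamma_a\epsilon_s=\{(x_{ij})\in R_s^{n\times n}\mid x_{ij}\in\pi_sR_s\text{ for } i<j\}\subset Z_s^{n\times n}$, with matrix units $e^s_{ij}$; $e_i=(e^1_{ii},\ldots,e^a_{ii})$; the elements $e_{i+1,i}:=(e^1_{i+1,i},\ldots,e^a_{i+1,i})$ lie in $\Gamma_a$ for $i=1,\ldots,n-1$; and $\Gamma_a$ is generated over its center $Z$ by $e_1,\ldots,e_n$, $e_{2,1},\ldots,e_{n,n-1}$ and one further element of $e_1\Gamma_ae_n$ of the form $(y_1\pi_1e^1_{1,n},\ldots,y_a\pi_ae^a_{1,n})$ with certain units $y_s\in R_s^*$. Such coordinates are fixed. $Z$ is regarded as a subring of $\bigoplus_{s=1}^aR_s$. *)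

theory Defs
  imports "HOL-Algebra.Algebra" "HOL-Library.Poly_Mapping"
begin

text \<open>
  The group \<open>G\<close> is a finite type of class \<open>group_add\<close>; this class does not assume
  commutativity, so \<open>G\<close> is an arbitrary finite group written additively. The group algebra
  \<open>KG\<close> is the convolution ring \<open>'g \<Rightarrow>\<^sub>0 'k\<close>. All orders, algebras, centres and
  lattices are subsets of it and usually have an identity different from \<open>1\<close>, so
  that \<open>sub_rng S u\<close> is \<open>S\<close> regarded as a ring with identity \<open>u\<close>.
\<close>

definition sub_rng :: "'a::ring_1 set \<Rightarrow> 'a \<Rightarrow> 'a ring"
  where "sub_rng S u = \<lparr>carrier = S, monoid.mult = (*), monoid.one = u, ring.zero = 0, ring.add = (+)\<rparr>"

section \<open>Rings and left modules\<close>

definition ring_center :: "('a, 'c) ring_scheme \<Rightarrow> 'a set"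
  where "ring_center S = {z \<in> carrier S. \<forall>x \<in> carrier S. z \<otimes>\<^bsub>S\<^esub> x = x \<otimes>\<^bsub>S\<^esub> z}"

text \<open>Primitive among the idempotents of \<open>S\<close> lying in \<open>C\<close>; \<open>C\<close> is \<open>carrier S\<close> for
  primitive and \<open>ring_center S\<close> for central primitive idempotents.\<close>

definition primitive_idem_in :: "('a, 'c) ring_scheme \<Rightarrow> 'a set \<Rightarrow> 'a \<Rightarrow> bool"
  where "primitive_idem_in S C h \<longleftrightarrow>
    h \<in> C \<and> h \<otimes>\<^bsub>S\<^esub> h = h \<and> h \<noteq> \<zero>\<^bsub>S\<^esub> \<and>
    (\<forall>h1 \<in> C. \<forall>h2 \<in> C.
       h1 \<otimes>\<^bsub>S\<^esub> h1 = h1 \<and> h2 \<otimes>\<^bsub>S\<^esub> h2 = h2 \<and> h1 \<otimes>\<^bsub>S\<^esub> h2 = \<zero>\<^bsub>S\<^esub> \<and> h2 \<otimes>\<^bsub>S\<^esub> h1 = \<zero>\<^bsub>S\<^esub> \<and>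
       h = h1 \<oplus>\<^bsub>S\<^esub> h2 \<longrightarrow> h1 = \<zero>\<^bsub>S\<^esub> \<or> h2 = \<zero>\<^bsub>S\<^esub>)"

definition primitive_idem :: "('a, 'c) ring_scheme \<Rightarrow> 'a \<Rightarrow> bool"
  where "primitive_idem S = primitive_idem_in S (carrier S)"

definition central_primitive_idem :: "('a, 'c) ring_scheme \<Rightarrow> 'a \<Rightarrow> bool"
  where "central_primitive_idem S = primitive_idem_in S (ring_center S)"

definition left_ideal :: "('a, 'c) ring_scheme \<Rightarrow> 'a set \<Rightarrow> bool"
  where "left_ideal S I \<longleftrightarrow>
    additive_subgroup I S \<and> (\<forall>r \<in> carrier S. \<forall>x \<in> I. r \<otimes>\<^bsub>S\<^esub> x \<in> I)"

definition jacobson_radical :: "('a, 'c) ring_scheme \<Rightarrow> 'a set"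
  where "jacobson_radical S = carrier S \<inter>
    \<Inter>{I. left_ideal S I \<and> I \<noteq> carrier S \<and>
          (\<forall>I'. left_ideal S I' \<and> I \<subseteq> I' \<longrightarrow> I' = I \<or> I' = carrier S)}"

text \<open>The library locale \<open>module\<close> requires a commutative ring of scalars. The fields
  \<open>mult\<close> and \<open>one\<close> of a module record carry no meaning.\<close>

definition left_module :: "('a, 'c) ring_scheme \<Rightarrow> ('a, 'b) module \<Rightarrow> bool"
  where "left_module S M \<longleftrightarrow> ring S \<and> abelian_group M \<and>
    (\<forall>r \<in> carrier S. \<forall>x \<in> carrier M. r \<odot>\<^bsub>M\<^esub> x \<in> carrier M) \<and>
    (\<forall>r \<in> carrier S. \<forall>r' \<in> carrier S. \<forall>x \<in> carrier M.
       (r \<oplus>\<^bsub>S\<^esub> r') \<odot>\<^bsub>M\<^esub> x = r \<odot>\<^bsub>M\<^esub> x \<oplus>\<^bsub>M\<^esub> r' \<odot>\<^bsub>M\<^esub> x) \<and>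
    (\<forall>r \<in> carrier S. \<forall>x \<in> carrier M. \<forall>x' \<in> carrier M.
       r \<odot>\<^bsub>M\<^esub> (x \<oplus>\<^bsub>M\<^esub> x') = r \<odot>\<^bsub>M\<^esub> x \<oplus>\<^bsub>M\<^esub> r \<odot>\<^bsub>M\<^esub> x') \<and>
    (\<forall>r \<in> carrier S. \<forall>r' \<in> carrier S. \<forall>x \<in> carrier M.
       (r \<otimes>\<^bsub>S\<^esub> r') \<odot>\<^bsub>M\<^esub> x = r \<odot>\<^bsub>M\<^esub> (r' \<odot>\<^bsub>M\<^esub> x)) \<and>
    (\<forall>x \<in> carrier M. \<one>\<^bsub>S\<^esub> \<odot>\<^bsub>M\<^esub> x = x)"

definition left_submodule :: "('a, 'c) ring_scheme \<Rightarrow> ('a, 'b) module \<Rightarrow> 'b set \<Rightarrow> bool"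
  where "left_submodule S M N \<longleftrightarrow>
    additive_subgroup N M \<and> (\<forall>r \<in> carrier S. \<forall>x \<in> N. r \<odot>\<^bsub>M\<^esub> x \<in> N)"

definition simple_module :: "('a, 'c) ring_scheme \<Rightarrow> ('a, 'b) module \<Rightarrow> bool"
  where "simple_module S M \<longleftrightarrow>
    left_module S M \<and> carrier M \<noteq> {\<zero>\<^bsub>M\<^esub>} \<and>
    (\<forall>N. left_submodule S M N \<longrightarrow> N = {\<zero>\<^bsub>M\<^esub>} \<or> N = carrier M)"

definition lmod_hom :: "('a, 'c) ring_scheme \<Rightarrow> ('a, 'b) module \<Rightarrow> ('a, 'd) module \<Rightarrow> ('b \<Rightarrow> 'd) \<Rightarrow> bool"
  where "lmod_hom S M N \<phi> \<longleftrightarrow>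
    (\<forall>x \<in> carrier M. \<phi> x \<in> carrier N) \<and>
    (\<forall>x \<in> carrier M. \<forall>y \<in> carrier M. \<phi> (x \<oplus>\<^bsub>M\<^esub> y) = \<phi> x \<oplus>\<^bsub>N\<^esub> \<phi> y) \<and>
    (\<forall>r \<in> carrier S. \<forall>x \<in> carrier M. \<phi> (r \<odot>\<^bsub>M\<^esub> x) = r \<odot>\<^bsub>N\<^esub> \<phi> x)"

definition lmod_iso :: "('a, 'c) ring_scheme \<Rightarrow> ('a, 'b) module \<Rightarrow> ('a, 'd) module \<Rightarrow> bool"
  where "lmod_iso S M N \<longleftrightarrow> (\<exists>\<phi>. lmod_hom S M N \<phi> \<and> bij_betw \<phi> (carrier M) (carrier N))"

text \<open>Every simple \<open>S\<close>-module is isomorphic to \<open>S/I\<close> for a maximal left ideal \<open>I\<close>, whose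
  elements are cosets. It is therefore no restriction, in the following definitions, to let
  modules have elements of type \<open>'a set\<close>.\<close>

definition num_simple_modules :: "('a, 'c) ring_scheme \<Rightarrow> nat"
  where "num_simple_modules S =
    card ({M :: ('a, 'a set) module. simple_module S M} //
          {(M, N). simple_module S M \<and> simple_module S N \<and> lmod_iso S M N})"

text \<open>In the next two definitions \<open>C\<close> is the image of the scalars in the centre of \<open>S\<close>.\<close>

definition splits :: "('a, 'c) ring_scheme \<Rightarrow> 'a set \<Rightarrow> bool"
  where "splits S C \<longleftrightarrow>
    (\<forall>M :: ('a, 'a set) module. simple_module S M \<longrightarrow>
       (\<forall>\<phi>. lmod_hom S M M \<phi> \<longrightarrow> (\<exists>c \<in> C. \<forall>m \<in> carrier M. \<phi> m = c \<odot>\<^bsub>M\<^esub> m)))"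

definition simples_one_dimensional :: "('a, 'c) ring_scheme \<Rightarrow> 'a set \<Rightarrow> bool"
  where "simples_one_dimensional S C \<longleftrightarrow>
    (\<forall>M :: ('a, 'a set) module. simple_module S M \<longrightarrow>
       (\<exists>m \<in> carrier M. m \<noteq> \<zero>\<^bsub>M\<^esub> \<and> carrier M = {c \<odot>\<^bsub>M\<^esub> m | c. c \<in> C}))"

text \<open>The quotient module \<open>L/L'\<close> of additive subgroups \<open>L' \<subseteq> L\<close> of a ring,
  on which elements of the ring act by left multiplication.\<close>

definition quot_module :: "'a::ring_1 set \<Rightarrow> 'a set \<Rightarrow> ('a, 'a set) module"
  where "quot_module L L' =
    \<lparr>carrier = {{x + l |l. l \<in> L'} |x. x \<in> L}, monoid.mult = undefined, monoid.one = undefined, ring.zero = L',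
     ring.add = (\<lambda>U W. {x + y |x y. x \<in> U \<and> y \<in> W}),
     smult = (\<lambda>r U. {r * x + l |x l. x \<in> U \<and> l \<in> L'})\<rparr>"

text \<open>\<open>M\<close> is uniserial of length \<open>m\<close>, and its \<open>j\<close>-th composition factor from the top
  (\<open>j = 0, \<dots>, m - 1\<close>) is a simple module not annihilated by the idempotent \<open>h j\<close>, i.e.
  the simple module belonging to \<open>h j\<close>. The chain \<open>N\<close> is a composition series
  because it contains all submodules.\<close>

definition uniserial_with :: "('a, 'c) ring_scheme \<Rightarrow> ('a, 'b) module \<Rightarrow> nat \<Rightarrow> (nat \<Rightarrow> 'a) \<Rightarrow> bool"
  where "uniserial_with S M m h \<longleftrightarrow> left_module S M \<and>
    (\<exists>N. N 0 = carrier M \<and> N m = {\<zero>\<^bsub>M\<^esub>} \<and>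
       {W. left_submodule S M W} = N ` {0..m} \<and>
       (\<forall>j<m. N (Suc j) \<subset> N j \<and> (\<exists>x \<in> N j. h j \<odot>\<^bsub>M\<^esub> x \<notin> N (Suc j))))"

section \<open>Local fields\<close>

definition integral_closure :: "('a, 'c) ring_scheme \<Rightarrow> 'a set \<Rightarrow> 'a set"
  where "integral_closure S A =
    {x \<in> carrier S. \<exists>q. polynomial\<^bsub>S\<^esub> A q \<and> q \<noteq> [] \<and> hd q = \<one>\<^bsub>S\<^esub> \<and> ring.eval S q x = \<zero>\<^bsub>S\<^esub>}"

definition padic_abs :: "nat \<Rightarrow> rat \<Rightarrow> real"
  where "padic_abs p q = (if q = 0 then 0 else
    real p powi (int (multiplicity (int p) (snd (quotient_of q))) -
                 int (multiplicity (int p) (fst (quotient_of q)))))"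

text \<open>\<open>Q\<close> with the absolute value \<open>v\<close> is the completion of the rationals with respect to the
  \<open>p\<close>-adic absolute value. The values of \<open>v\<close> outside \<open>Q\<close> are irrelevant.\<close>

definition is_padic_numbers :: "nat \<Rightarrow> 'k::field_char_0 set \<Rightarrow> ('k \<Rightarrow> real) \<Rightarrow> bool"
  where "is_padic_numbers p Q v \<longleftrightarrow>
    subfield Q (sub_rng UNIV 1) \<and>
    (\<forall>x \<in> Q. v x \<ge> 0 \<and> (v x = 0 \<longleftrightarrow> x = 0)) \<and>
    (\<forall>x \<in> Q. \<forall>y \<in> Q. v (x * y) = v x * v y \<and> v (x + y) \<le> v x + v y) \<and>
    (\<forall>q. v (of_rat q) = padic_abs p q) \<and>
    (\<forall>x \<in> Q. \<forall>\<delta>>0. \<exists>q. v (x - of_rat q) < \<delta>) \<and>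
    (\<forall>w :: nat \<Rightarrow> 'k. range w \<subseteq> Q \<and> (\<forall>\<delta>>0. \<exists>N. \<forall>i\<ge>N. \<forall>j\<ge>N. v (w i - w j) < \<delta>) \<longrightarrow>
       (\<exists>x \<in> Q. (\<lambda>i. v (w i - x)) \<longlonglongrightarrow> 0))"

text \<open>The field \<open>K\<close> is the whole type \<open>'k\<close>, and \<open>R\<close> is its ring of integers.\<close>

definition unramified_ext :: "nat \<Rightarrow> 'k::field_char_0 set \<Rightarrow> ('k \<Rightarrow> real) \<Rightarrow> 'k set \<Rightarrow> bool"
  where "unramified_ext p Q v R \<longleftrightarrow>
    is_padic_numbers p Q v \<and>
    ring.finite_dimension (sub_rng UNIV 1) Q UNIV \<and>
    R = integral_closure (sub_rng UNIV 1) {x \<in> Q. v x \<le> 1} \<and>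
    maximalideal {of_nat p * x |x. x \<in> R} (sub_rng R 1)"

section \<open>The group algebra\<close>

definition scal :: "'k::field \<Rightarrow> ('g::group_add \<Rightarrow>\<^sub>0 'k) \<Rightarrow> ('g \<Rightarrow>\<^sub>0 'k)"
  where "scal c x = Poly_Mapping.single 0 c * x"

global_interpretation kg: vector_space "scal :: 'k::field \<Rightarrow> ('g::group_add \<Rightarrow>\<^sub>0 'k) \<Rightarrow> _"
  by unfold_locales
    (simp_all add: scal_def algebra_simps single_add mult_single flip: mult.assoc)

text \<open>The trace \<open>Tr\<^bsub>L/K\<^esub>\<close> of a finite-dimensional commutative algebra \<open>L \<subseteq> KG\<close> is
  the trace of multiplication by \<open>x\<close> on \<open>L\<close>, computed in an arbitrary basis.\<close>

definition alg_trace :: "('g::group_add \<Rightarrow>\<^sub>0 'k::field) set \<Rightarrow> ('g \<Rightarrow>\<^sub>0 'k) \<Rightarrow> 'k"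
  where "alg_trace L x =
    (let Bs = (SOME Bs. kg.independent Bs \<and> kg.span Bs = L)
     in \<Sum>\<beta>\<in>Bs. kg.representation Bs (x * \<beta>) \<beta>)"

definition group_ring :: "'k::field set \<Rightarrow> ('g::group_add \<Rightarrow>\<^sub>0 'k) set"
  where "group_ring R = {x. \<forall>g. Poly_Mapping.lookup x g \<in> R}"

text \<open>Ring of integers of a finite extension \<open>L \<subseteq> KG\<close> of \<open>K\<close>, with identity \<open>u\<close>.\<close>

definition ring_of_integers :: "'k::field set \<Rightarrow> ('g::group_add \<Rightarrow>\<^sub>0 'k) set \<Rightarrow> ('g \<Rightarrow>\<^sub>0 'k) \<Rightarrow> ('g \<Rightarrow>\<^sub>0 'k) set"
  where "ring_of_integers R L u = integral_closure (sub_rng L u) {scal c u |c. c \<in> R}"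

text \<open>Since \<open>p\<close> is a prime element of \<open>R\<close>, the extension is totally ramified iff \<open>p\<close>
  is, up to a unit, the power of a prime element with exponent the degree.\<close>

definition totally_ramified ::
    "nat \<Rightarrow> 'k::field set \<Rightarrow> ('g::group_add \<Rightarrow>\<^sub>0 'k) set \<Rightarrow> ('g \<Rightarrow>\<^sub>0 'k) \<Rightarrow> bool"
  where "totally_ramified p R L u \<longleftrightarrow>
    field (sub_rng L u) \<and>
    (\<exists>\<pi> \<in> ring_of_integers R L u. ring_prime\<^bsub>sub_rng (ring_of_integers R L u) u\<^esub> \<pi> \<and>
       {scal (of_nat p) x |x. x \<in> ring_of_integers R L u} =
       {\<pi> ^ kg.dim L * x |x. x \<in> ring_of_integers R L u})"

section \<open>Blocks and defect groups\<close>

definition grp :: "'g::group_add monoid"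
  where "grp = \<lparr>carrier = UNIV, monoid.mult = (+), monoid.one = 0\<rparr>"

definition gconj :: "'g::group_add \<Rightarrow> ('g \<Rightarrow>\<^sub>0 'k::field) \<Rightarrow> ('g \<Rightarrow>\<^sub>0 'k)"
  where "gconj g x = Poly_Mapping.single g 1 * x * Poly_Mapping.single (- g) 1"

definition fixed_points :: "'k::field set \<Rightarrow> 'g::group_add set \<Rightarrow> ('g \<Rightarrow>\<^sub>0 'k) set"
  where "fixed_points R D = {x \<in> group_ring R. \<forall>d \<in> D. gconj d x = x}"

text \<open>The relative trace \<open>Tr\<^sub>D\<^sup>G\<close>, a sum over the left cosets of \<open>D\<close>.\<close>

definition rel_trace :: "'g::group_add set \<Rightarrow> ('g \<Rightarrow>\<^sub>0 'k::field) \<Rightarrow> ('g \<Rightarrow>\<^sub>0 'k)"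
  where "rel_trace D x = (\<Sum>C \<in> range (\<lambda>g. (+) g ` D). gconj (SOME g. g \<in> C) x)"

text \<open>Here \<open>b\<close> is the block idempotent.\<close>

definition defect_group :: "'k::field set \<Rightarrow> ('g::group_add \<Rightarrow>\<^sub>0 'k) \<Rightarrow> 'g set \<Rightarrow> bool"
  where "defect_group R b D \<longleftrightarrow>
    subgroup D grp \<and> b \<in> rel_trace D ` fixed_points R D \<and>
    (\<forall>D'. subgroup D' grp \<and> D' \<subset> D \<longrightarrow> b \<notin> rel_trace D' ` fixed_points R D')"

definition block_of :: "'k::field set \<Rightarrow> ('g::group_add \<Rightarrow>\<^sub>0 'k) \<Rightarrow> ('g \<Rightarrow>\<^sub>0 'k) set"
  where "block_of R b = {x * b |x. x \<in> group_ring R}"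

text \<open>The algebra \<open>kB = B/pB\<close> for \<open>B = block_of R b\<close>, and the image of \<open>k\<close> in it.\<close>

definition red_block :: "nat \<Rightarrow> 'k::field set \<Rightarrow> ('g::group_add \<Rightarrow>\<^sub>0 'k) \<Rightarrow> ('g \<Rightarrow>\<^sub>0 'k) set ring"
  where "red_block p R b =
    sub_rng (block_of R b) b Quot {scal (of_nat p) x |x. x \<in> block_of R b}"

definition red_scalars :: "nat \<Rightarrow> 'k::field set \<Rightarrow> ('g::group_add \<Rightarrow>\<^sub>0 'k) \<Rightarrow> ('g \<Rightarrow>\<^sub>0 'k) set set"
  where "red_scalars p R b =
    {{scal (of_nat p) x |x. x \<in> block_of R b} +>\<^bsub>sub_rng (block_of R b) b\<^esub> scal c b |c. c \<in> R}"

section \<open>The Brauer tree\<close>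

text \<open>Primitive idempotents \<open>h\<close>, \<open>h'\<close> are equivalent iff the projective
  indecomposable modules \<open>Sh\<close> and \<open>Sh'\<close> are isomorphic.\<close>

definition idem_equiv :: "('a, 'c) ring_scheme \<Rightarrow> 'a \<Rightarrow> 'a \<Rightarrow> bool"
  where "idem_equiv S h h' \<longleftrightarrow>
    (\<exists>u \<in> carrier S. \<exists>w \<in> carrier S. u \<otimes>\<^bsub>S\<^esub> w = h \<and> w \<otimes>\<^bsub>S\<^esub> u = h')"

text \<open>
  Vertices are sets of indices of the central primitive idempotents \<open>\<epsilon> s\<close> of \<open>KB\<close>: the
  exceptional vertex \<open>{1..a}\<close> and the singletons \<open>{s}\<close>, \<open>s = a + 1, \<dots>, a + e\<close>. Edges are
  the simple \<open>kB\<close>-modules, represented by the primitive idempotents \<open>h\<close> of \<open>B\<close> belonging to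
  them (up to equivalence). The decomposition number \<open>d\<close> of \<open>h\<close> at \<open>s\<close> is given by
  \<open>h KB \<epsilon> s h \<cong> Mat\<^sub>d(Z(KB \<epsilon> s))\<close>: it is \<open>0\<close> iff \<open>h * \<epsilon> s = 0\<close>, and
  \<open>1\<close> iff \<open>h KB \<epsilon> s h = Z(KB \<epsilon> s) h \<noteq> 0\<close>. The conditions say that
  each edge joins two distinct vertices, with decomposition number \<open>1\<close> at all constituents of
  its end points and \<open>0\<close> elsewhere, and that the resulting graph is a tree, i.e. connected with
  one edge less than vertices.
\<close>

definition brauer_vertices :: "nat \<Rightarrow> nat \<Rightarrow> nat set set"
  where "brauer_vertices a e = insert {1..a} ((\<lambda>s. {s}) ` {a+1..a+e})"

definition brauer_tree ::
    "'k::field set \<Rightarrow> ('g::group_add \<Rightarrow>\<^sub>0 'k) \<Rightarrow> nat \<Rightarrow> nat \<Rightarrow> (nat \<Rightarrow> 'g \<Rightarrow>\<^sub>0 'k) \<Rightarrow> bool"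
  where "brauer_tree R b a e \<epsilon> \<longleftrightarrow>
    (let B = sub_rng (block_of R b) b; P = {h. primitive_idem B h};
         V = brauer_vertices a e;
         ends = (\<lambda>h. {v \<in> V. \<exists>s \<in> v. h * \<epsilon> s \<noteq> 0});
         A = (\<lambda>s. sub_rng {x * b * \<epsilon> s |x. True} (\<epsilon> s))
     in (\<forall>h \<in> P. card (ends h) = 2 \<and>
           (\<forall>v \<in> ends h. \<forall>s \<in> v. h * \<epsilon> s \<noteq> 0 \<and>
              {h * x * h |x. x \<in> carrier (A s)} = {z * h |z. z \<in> ring_center (A s)})) \<and>
        (\<forall>v \<in> V. \<forall>w \<in> V. (v, w) \<in> {(v, w). \<exists>h \<in> P. v \<in> ends h \<and> w \<in> ends h}\<^sup>*) \<and>
        card (P // {(h, h'). h \<in> P \<and> h' \<in> P \<and> idem_equiv B h h'}) + 1 = card V)"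

section \<open>Coordinates, generators and the trace dual\<close>

text \<open>Matrices over \<open>Z\<^sub>s\<close> are written as combinations of matrix units \<open>E i j\<close>.\<close>

definition mat_units :: "nat \<Rightarrow> 'a::ring_1 \<Rightarrow> (nat \<Rightarrow> nat \<Rightarrow> 'a) \<Rightarrow> bool"
  where "mat_units n u E \<longleftrightarrow>
    (\<Sum>i=1..n. E i i) = u \<and>
    (\<forall>i\<in>{1..n}. \<forall>j\<in>{1..n}. \<forall>k\<in>{1..n}. \<forall>l\<in>{1..n}.
       E i j * E k l = (if j = k then E i l else 0))"

definition order_gens ::
    "nat \<Rightarrow> nat \<Rightarrow> 'a::ring_1 set \<Rightarrow> (nat \<Rightarrow> nat \<Rightarrow> nat \<Rightarrow> 'a) \<Rightarrow> (nat \<Rightarrow> 'a) \<Rightarrow> (nat \<Rightarrow> 'a) \<Rightarrow> 'a set"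
  where "order_gens a n Z E y \<pi> =
    Z \<union> {\<Sum>s=1..a. E s i i |i. i \<in> {1..n}} \<union> {\<Sum>s=1..a. E s (i+1) i |i. i \<in> {1..n-1}}
      \<union> {\<Sum>s=1..a. y s * \<pi> s * E s 1 n}"

text \<open>\<open>\<Oplus>\<^sub>s Z\<^sub>s\<close> is an internal direct sum in \<open>KG\<close>, and the
  \<open>s\<close>-th component of \<open>x\<close> is \<open>x * \<epsilon> s\<close>.\<close>

definition trace_dual ::
    "'k::field set \<Rightarrow> nat \<Rightarrow> (nat \<Rightarrow> 'g::group_add \<Rightarrow>\<^sub>0 'k) \<Rightarrow> (nat \<Rightarrow> ('g \<Rightarrow>\<^sub>0 'k) set) \<Rightarrow>
     ('g \<Rightarrow>\<^sub>0 'k) set \<Rightarrow> ('g \<Rightarrow>\<^sub>0 'k) set"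
  where "trace_dual R a \<epsilon> Zs Z =
    {y \<in> {\<Sum>s=1..a. z s |z. \<forall>s\<in>{1..a}. z s \<in> Zs s}.
       \<forall>x \<in> Z. (\<Sum>s=1..a. alg_trace (Zs s) ((x * \<epsilon> s) * (y * \<epsilon> s))) \<in> R}"

end

theory Submission
  imports Defs
begin

text \<open>
  Write \<open>e\<^sub>i\<^sub>j = \<Sum>\<^sub>s e\<^sup>s\<^sub>i\<^sub>j\<close> and \<open>w = \<Sum>\<^sub>s y\<^sub>s \<pi>\<^sub>s\<close>. Since \<open>\<Gamma>\<close> is generated by \<open>Z\<close>, the \<open>e\<^sub>i\<^sub>i\<close>, the \<open>e\<^sub>i\<^sub>+\<^sub>1\<^sub>,\<^sub>i\<close> and
  \<open>w e\<^sub>1\<^sub>n\<close>, the entries of \<open>\<Gamma>\<close> below and on the diagonal form \<open>Z\<close> and those above it form \<open>wZ\<close>. It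
  suffices to show \<open>p\<^sup>a Z\<^sup># = wZ\<close>, for then any units \<open>x\<^sub>s\<close> as in the theorem differ from \<open>y\<^sub>s\<close> by
  elements of \<open>Z\<close>.

  The group ring is self-dual for the form \<open>(x, y) \<mapsto> coeff1 (x y)\<close>, the coefficient of
  the neutral element. The simple modules belonging to \<open>e\<^sub>1\<close> and \<open>e\<^sub>n\<close> are edges at the exceptional
  vertex of a tree, so they have no other vertex in common, and therefore
  \<open>e\<^sub>1 \<Gamma> e\<^sub>n\<close> is contained in \<open>RG\<close>. Hence \<open>wZ\<close> and \<open>Z\<close> are the entries at \<open>(1, n)\<close> and \<open>(n, 1)\<close> of
  corners that are dual to each other, so that \<open>wZ\<close> is the dual of \<open>Z\<close> for
  \<open>(x, z) \<mapsto> coeff1 (x z e\<^sub>1\<^sub>1)\<close>. Computing the trace of multiplications on \<open>KG\<close> shows that this form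
  is \<open>\<kappa>\<close> times the sum of the trace forms, with a constant \<open>\<kappa>\<close> independent of \<open>s\<close>.

  The valuation of \<open>\<kappa>\<close> is obtained by counting. The corner at \<open>e\<^sub>1\<close> of the block is an order of which
  \<open>Z\<close> and \<open>R\<close> are the projections to the two vertices of the edge, so that \<open>Z = R + wZ\<close>. As \<open>\<Sum>\<^sub>s [Z\<^sub>s : K] = (p\<^sup>a - 1) / e\<close> is prime to \<open>p\<close>, this gives
  \<open>R \<inter> wZ = {r \<in> R. \<kappa> r \<in> R}\<close>, while \<open>[Z : wZ] = \<Prod>\<^sub>s [R\<^sub>s : \<pi>\<^sub>s R\<^sub>s] = |R/pR|\<^sup>a\<close>. Hence \<open>\<kappa> p\<^sup>a\<close> is a unit.
\<close>

text \<open>Neither \<open>f\<close> nor \<open>\<Gamma>\<close> need lie in \<open>RG\<close>; they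
  lie in \<open>\<epsilon>e RG\<close>, where denominators may occur. The way back: an element
  \<open>r\<close> of \<open>RG\<close> with \<open>r \<epsilon>e = r\<close> stays in
  \<open>RG\<close> when multiplied by elements of \<open>\<epsilon>e RG\<close>, and elements of
  \<open>h RG h'\<close> have this property when the edges of \<open>h\<close> and \<open>h'\<close>
  meet in the exceptional vertex only.

  The \<open>e\<^sub>i\<^sub>i\<close> are idempotents of \<open>\<Gamma>\<close>, whereas edges are
  idempotents of the block. A Krull-Schmidt argument connects them; it needs \<open>Z\<close> to be
  local, which follows from the number of simple \<open>\<Gamma>\<close>-modules being
  \<open>n\<close>.

  The index of \<open>wZ\<close> is hard to see in \<open>Z\<close>, but easy in the overorder
  \<open>\<Oplus>\<^sub>s R\<^sub>s\<close>, where \<open>w\<close> has the components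
  \<open>y\<^sub>s \<pi>\<^sub>s\<close>; an injective endomorphism has the same index on both. All
  these counts rest on the finiteness of \<open>R/pR\<close>, which has to be extracted from the
  description of the field \<open>Q\<close> as a completion.

  The constant \<open>\<kappa>\<close> is \<open>\<chi>(1) / |G|\<close> for an exceptional
  character \<open>\<chi>\<close>. It does not depend on \<open>s\<close> because the exceptional
  characters form one vertex and so meet the same primitive idempotents, each with decomposition
  number \<open>1\<close>.\<close>

lemma sub_rng_simps [simp]:
  "carrier (sub_rng S u) = S" "x \<otimes>\<^bsub>sub_rng S u\<^esub> y = x * y" "\<one>\<^bsub>sub_rng S u\<^esub> = u"
  "\<zero>\<^bsub>sub_rng S u\<^esub> = 0" "x \<oplus>\<^bsub>sub_rng S u\<^esub> y = x + y"
  by (simp_all add: sub_rng_def)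

lemma ring_sub_rngI:
  assumes "u \<in> S" "0 \<in> S" "\<And>x. x \<in> S \<Longrightarrow> u * x = x \<and> x * u = x" "\<And>x. x \<in> S \<Longrightarrow> - x \<in> S"
    "\<And>x y. x \<in> S \<Longrightarrow> y \<in> S \<Longrightarrow> x + y \<in> S" "\<And>x y. x \<in> S \<Longrightarrow> y \<in> S \<Longrightarrow> x * y \<in> S"
  shows "ring (sub_rng S u)"
proof (rule ringI)
  show "abelian_group (sub_rng S u)"
    by (rule abelian_groupI) (use assms in \<open>auto simp: add.assoc add.commute intro!: bexI[of _ "- _"]\<close>)
  show "monoid (sub_rng S u)"
    by (rule monoidI) (use assms in \<open>auto simp: mult.assoc\<close>)
qed (auto simp: algebra_simps)

lemma ring_sub_rng_UNIV: "ring (sub_rng UNIV (1::'a::ring_1))"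
  by (rule ring_sub_rngI) auto

lemma field_sub_rng_UNIV: "field (sub_rng UNIV (1::'a::field))"
proof -
  have "cring (sub_rng UNIV (1::'a))"
    by (rule cringI) (auto intro!: abelian_groupI comm_monoidI exI[of _ "- _"] simp: algebra_simps)
  moreover have "Units (sub_rng UNIV (1::'a)) = UNIV - {0}"
    by (auto simp: Units_def) (metis left_inverse right_inverse)
  ultimately show ?thesis by (intro cring.cring_fieldI) auto
qed

lemma a_inv_sub_rng:
  assumes "ring (sub_rng S u)" "x \<in> S" shows "\<ominus>\<^bsub>sub_rng S u\<^esub> x = - x"
proof -
  interpret ring "sub_rng S u" by fact
  have "x + (\<ominus>\<^bsub>sub_rng S u\<^esub> x) = 0" using r_neg[of x] assms(2) by simp
  then show ?thesis by (simp add: eq_neg_iff_add_eq_0 add.commute)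
qed

lemma sub_rng_closed:
  assumes "ring (sub_rng S u)"
  shows "u \<in> S" "0 \<in> S" "\<And>x. x \<in> S \<Longrightarrow> u * x = x" "\<And>x. x \<in> S \<Longrightarrow> x * u = x" "\<And>x. x \<in> S \<Longrightarrow> - x \<in> S"
    "\<And>x y. x \<in> S \<Longrightarrow> y \<in> S \<Longrightarrow> x + y \<in> S" "\<And>x y. x \<in> S \<Longrightarrow> y \<in> S \<Longrightarrow> x * y \<in> S"
    "\<And>x y. x \<in> S \<Longrightarrow> y \<in> S \<Longrightarrow> x - y \<in> S"
proof -
  interpret ring "sub_rng S u" by fact
  show "u \<in> S" "0 \<in> S" "\<And>x. x \<in> S \<Longrightarrow> u * x = x" "\<And>x. x \<in> S \<Longrightarrow> x * u = x"
    and P: "\<And>x y. x \<in> S \<Longrightarrow> y \<in> S \<Longrightarrow> x + y \<in> S" "\<And>x y. x \<in> S \<Longrightarrow> y \<in> S \<Longrightarrow> x * y \<in> S"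
    using one_closed zero_closed l_one r_one add.m_closed m_closed by simp_all
  show N: "\<And>x. x \<in> S \<Longrightarrow> - x \<in> S" using a_inv_closed a_inv_sub_rng[OF assms] by simp
  show "\<And>x y. x \<in> S \<Longrightarrow> y \<in> S \<Longrightarrow> x - y \<in> S" using P(1) N by (metis add_uminus_conv_diff)
qed

lemma pow_sub_rng: "x [^]\<^bsub>sub_rng UNIV 1\<^esub> (n::nat) = x ^ n"
  by (induction n) (simp_all add: nat_pow_def power_Suc2 del: power_Suc)

lemma eval_sub_rng:
  "ring.eval (sub_rng UNIV 1) q x = (\<Sum>i<length q. q ! i * x ^ (length q - 1 - i))"
proof (induction q)
  case Nil
  then show ?case by (simp add: ring.eval.simps(1)[OF ring_sub_rng_UNIV])
next
  case (Cons c q)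
  show ?case
    by (simp add: ring.eval.simps(2)[OF ring_sub_rng_UNIV] Cons.IH pow_sub_rng sum.lessThan_Suc_shift
        del: sum.lessThan_Suc)
qed

text \<open>Polynomials of HOL-Algebra are lists with the leading coefficient first, hence the index
  reversal \<open>d - 1 - i\<close>. In this form integrality is a monic equation between ordinary
  power sums.\<close>

lemma integral_closure_UNIV:
  fixes A :: "'a::field set"
  assumes "1 \<in> A"
  shows "x \<in> integral_closure (sub_rng UNIV 1) A \<longleftrightarrow>
    (\<exists>d c. (\<forall>i<d. c i \<in> A) \<and> x ^ d + (\<Sum>i<d. c i * x ^ i) = 0)"
proof
  assume "x \<in> integral_closure (sub_rng UNIV 1) A"
  then obtain q where q: "polynomial\<^bsub>sub_rng UNIV 1\<^esub> A q" "q \<noteq> []" "hd q = 1"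
    "ring.eval (sub_rng UNIV 1) q x = 0" unfolding integral_closure_def by auto
  then obtain r where r: "q = 1 # r" by (cases q) auto
  define d where "d = length r"
  have "set r \<subseteq> A" using q r unfolding polynomial_def by auto
  moreover have "(\<Sum>i<d. r ! i * x ^ (d - 1 - i)) = (\<Sum>i<d. r ! (d - 1 - i) * x ^ i)"
    by (rule sum.reindex_bij_witness[of _ "\<lambda>i. d - 1 - i" "\<lambda>i. d - 1 - i"]) auto
  moreover have "x ^ d + (\<Sum>i<d. r ! i * x ^ (d - 1 - i)) = 0"
    using q(4) unfolding r eval_sub_rng d_def by (simp add: sum.lessThan_Suc_shift del: sum.lessThan_Suc)
  ultimately show "\<exists>d c. (\<forall>i<d. c i \<in> A) \<and> x ^ d + (\<Sum>i<d. c i * x ^ i) = 0"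
    by (intro exI[of _ d] exI[of _ "\<lambda>i. r ! (d - 1 - i)"]) (auto simp: d_def subset_iff)
next
  assume "\<exists>d c. (\<forall>i<d. c i \<in> A) \<and> x ^ d + (\<Sum>i<d. c i * x ^ i) = 0"
  then obtain d c where c: "\<forall>i<d. c i \<in> A" "x ^ d + (\<Sum>i<d. c i * x ^ i) = 0" by blast
  let ?q = "1 # map (\<lambda>i. c (d - 1 - i)) [0..<d]"
  have "(\<Sum>i<d. c (d - 1 - i) * x ^ (d - 1 - i)) = (\<Sum>i<d. c i * x ^ i)"
    by (rule sum.reindex_bij_witness[of _ "\<lambda>i. d - 1 - i" "\<lambda>i. d - 1 - i"]) auto
  then have "ring.eval (sub_rng UNIV 1) ?q x = 0" using c(2)
    unfolding eval_sub_rng by (simp add: sum.lessThan_Suc_shift del: sum.lessThan_Suc)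
  moreover have "polynomial\<^bsub>sub_rng UNIV 1\<^esub> A ?q" using c(1) assms unfolding polynomial_def by auto
  ultimately show "x \<in> integral_closure (sub_rng UNIV 1) A" unfolding integral_closure_def
    by (auto intro!: exI[of _ ?q])
qed

text \<open>The bound \<open>N\<close> is uniform in the family \<open>x\<close>. Applied to the
  powers of one element it gives algebraicity over \<open>Q\<close>; the uniformity bounds the
  residue field.\<close>

lemma finite_dimension_dependent:
  assumes "subfield Q (sub_rng UNIV (1::'k::field))" "ring.finite_dimension (sub_rng UNIV (1::'k)) Q UNIV"
  shows "\<exists>N. \<forall>x :: nat \<Rightarrow> 'k. \<exists>q. (\<forall>i\<le>N. q i \<in> Q) \<and> (\<exists>i\<le>N. q i \<noteq> 0) \<and> (\<Sum>i\<le>N. q i * x i) = 0"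
proof -
  interpret field "sub_rng UNIV (1::'k)" by (rule field_sub_rng_UNIV)
  obtain N where N: "dimension N Q UNIV" using assms(2) by (elim finite_dimensionE')
  have "\<exists>q. (\<forall>i\<le>N. q i \<in> Q) \<and> (\<exists>i\<le>N. q i \<noteq> 0) \<and> (\<Sum>i\<le>N. q i * x i) = 0" for x :: "nat \<Rightarrow> 'k"
  proof -
    let ?U = "map x [0..<Suc N]"
    have "\<not> independent Q ?U" using independent_length_le_dimension[OF assms(1) N, of ?U] by auto
    then obtain Ks where Ks: "length Ks = length ?U" "combine Ks ?U = 0" "set Ks \<subseteq> Q" "set Ks \<noteq> {0}"
      using dependent_imp_non_trivial_combine[OF assms(1), of ?U] by auto
    have comb: "combine Ks Us = (\<Sum>i<length Us. Ks ! i * Us ! i)" if "length Ks = length Us" for Ks Us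
      using that by (induction Ks Us rule: list_induct2)
        (simp_all add: sum.lessThan_Suc_shift del: sum.lessThan_Suc)
    have "(\<Sum>i<Suc N. Ks ! i * ?U ! i) = 0" using comb[OF Ks(1)] Ks(2) by simp
    moreover have "(\<Sum>i<Suc N. Ks ! i * ?U ! i) = (\<Sum>i\<le>N. Ks ! i * x i)"
      unfolding lessThan_Suc_atMost by (intro sum.cong) (auto simp: nth_append le_less simp del: upt_Suc)
    moreover have "\<exists>i\<le>N. Ks ! i \<noteq> 0"
    proof (rule ccontr)
      assume "\<not> (\<exists>i\<le>N. Ks ! i \<noteq> 0)"
      then have "set Ks \<subseteq> {0}" using Ks(1) by (auto simp: in_set_conv_nth less_Suc_eq_le)
      then show False using Ks(1,4) by (cases Ks) auto
    qed
    moreover have "\<forall>i\<le>N. Ks ! i \<in> Q" using Ks(1,3) by (auto simp: subset_iff less_Suc_eq_le)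
    ultimately show ?thesis by auto
  qed
  then show ?thesis by blast
qed

section \<open>Unramified extensions of the \<open>p\<close>-adic numbers\<close>

locale unramified_field =
  fixes p :: nat and Q R :: "'k::field_char_0 set" and v :: "'k \<Rightarrow> real"
  assumes prime_p: "Factorial_Ring.prime p" and unram: "unramified_ext p Q v R"
begin

definition pR where "pR = {of_nat p * x |x. x \<in> R}"

lemma p_gt_1: "p > 1" using prime_gt_1_nat[OF prime_p] .

lemma p_nonzero: "(of_nat p :: 'k) \<noteq> 0" using p_gt_1 by simp

lemma max_pR: "maximalideal pR (sub_rng R 1)"
  using unram unfolding unramified_ext_def pR_def by blast

lemma R_def: "R = integral_closure (sub_rng UNIV 1) {x \<in> Q. v x \<le> 1}"
  using unram unfolding unramified_ext_def by blast

lemma R_ring: "ring (sub_rng R 1)"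
  using max_pR maximalideal.axioms(1) ideal.axioms(2) by blast

lemmas R_one [simp, intro] = sub_rng_closed(1)[OF R_ring]
  and R_zero [simp, intro] = sub_rng_closed(2)[OF R_ring]
  and R_minus [intro] = sub_rng_closed(5)[OF R_ring]
  and R_add [intro] = sub_rng_closed(6)[OF R_ring]
  and R_mult [intro] = sub_rng_closed(7)[OF R_ring]
  and R_diff [intro] = sub_rng_closed(8)[OF R_ring]

lemma R_sum [intro]: "(\<And>i. i \<in> I \<Longrightarrow> h i \<in> R) \<Longrightarrow> sum h I \<in> R"
  by (induction I rule: infinite_finite_induct) auto

lemma R_of_nat [simp, intro]: "of_nat m \<in> R"
  by (induction m) auto

lemma R_power [intro]: "r \<in> R \<Longrightarrow> r ^ m \<in> R"
  by (induction m) auto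

lemma pR_R: "x \<in> pR \<Longrightarrow> x \<in> R" unfolding pR_def by auto

lemma pR_add: "x \<in> pR \<Longrightarrow> y \<in> pR \<Longrightarrow> x + y \<in> pR"
  unfolding pR_def by (auto simp flip: distrib_left)

lemma pR_mult: "x \<in> pR \<Longrightarrow> y \<in> R \<Longrightarrow> y * x \<in> pR"
  unfolding pR_def using R_mult by (auto simp: mult.left_commute)

lemma pR_zero [simp]: "0 \<in> pR" using pR_mult pR_def by force

lemma pR_diff: "x \<in> pR \<Longrightarrow> y \<in> pR \<Longrightarrow> x - y \<in> pR"
  using pR_add[of x "(- 1) * y"] pR_mult[of y "- 1"] by auto

lemma pR_sum: "(\<And>i. i \<in> I \<Longrightarrow> h i \<in> pR) \<Longrightarrow> sum h I \<in> pR"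
  by (induction I rule: infinite_finite_induct) (auto intro: pR_add)

lemma one_notin_pR: "1 \<notin> pR"
proof
  assume "1 \<in> pR"
  then have "R \<subseteq> pR" using pR_mult by fastforce
  then show False using maximalideal.I_notcarr[OF max_pR] pR_R by auto
qed

text \<open>Maximality of \<open>pR\<close> makes the ideal \<open>rR + pR\<close> all of
  \<open>R\<close>; writing \<open>1\<close> in it inverts \<open>r\<close> modulo \<open>p\<close>.
  The passage to a true inverse is \<open>R_unit\<close>.\<close>

lemma unit_mod_p:
  assumes "r \<in> R" "r \<notin> pR"
  obtains r' z where "r' \<in> R" "z \<in> R" "r * r' = 1 + of_nat p * z"
proof -
  interpret ring "sub_rng R 1" by (rule R_ring)
  let ?J = "{r * x + of_nat p * y |x y. x \<in> R \<and> y \<in> R}"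
  have "ideal ?J (sub_rng R 1)"
  proof (rule idealI[OF R_ring])
    have ainv: "\<ominus>\<^bsub>sub_rng R 1\<^esub> x = - x" if "x \<in> R" for x using a_inv_sub_rng[OF R_ring that] .
    show "subgroup ?J (add_monoid (sub_rng R 1))"
    proof (rule add.subgroupI)
      show "?J \<subseteq> carrier (sub_rng R 1)" using assms(1) by auto
      show "?J \<noteq> {}" by auto
      show "\<ominus>\<^bsub>sub_rng R 1\<^esub> a \<in> ?J" if a: "a \<in> ?J" for a
      proof -
        obtain x y where xy: "a = r * x + of_nat p * y" "x \<in> R" "y \<in> R" using a by auto
        then have "- a = r * (- x) + of_nat p * (- y)" by simp
        moreover have "a \<in> R" using xy assms(1) by auto
        ultimately show ?thesis unfolding ainv[OF \<open>a \<in> R\<close>] using xy by blast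
      qed
      show "a \<oplus>\<^bsub>sub_rng R 1\<^esub> b \<in> ?J" if "a \<in> ?J" "b \<in> ?J" for a b
      proof -
        obtain x y x' y' where *: "a = r * x + of_nat p * y" "b = r * x' + of_nat p * y'"
          "x \<in> R" "y \<in> R" "x' \<in> R" "y' \<in> R" using \<open>a \<in> ?J\<close> \<open>b \<in> ?J\<close> by auto
        then have "a + b = r * (x + x') + of_nat p * (y + y')" by (simp add: algebra_simps)
        then show ?thesis using * by auto
      qed
    qed
    have mem: "x * a \<in> ?J" if "a \<in> ?J" "x \<in> R" for a x
    proof -
      obtain s y where *: "a = r * s + of_nat p * y" "s \<in> R" "y \<in> R" using \<open>a \<in> ?J\<close> by auto
      then have "x * a = r * (x * s) + of_nat p * (x * y)" by (simp add: algebra_simps)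
      then show ?thesis using * \<open>x \<in> R\<close> by auto
    qed
    then show "x \<otimes>\<^bsub>sub_rng R 1\<^esub> a \<in> ?J" "a \<otimes>\<^bsub>sub_rng R 1\<^esub> x \<in> ?J"
      if "a \<in> ?J" "x \<in> carrier (sub_rng R 1)" for a x
      using that by (auto simp: mult.commute)
  qed
  moreover have "pR \<subseteq> ?J" unfolding pR_def
  proof clarify
    fix x assume "x \<in> R"
    then show "\<exists>x' y. of_nat p * x = r * x' + of_nat p * y \<and> x' \<in> R \<and> y \<in> R"
      by (intro exI[of _ 0] exI[of _ x]) auto
  qed
  moreover have "r \<in> ?J" using R_zero R_one by force
  moreover have "?J \<subseteq> R" using assms(1) by auto
  ultimately have "?J = R"
    using maximalideal.I_maximal[OF max_pR, of ?J] assms(2) unfolding sub_rng_simps by blast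
  then have "1 \<in> ?J" by auto
  then obtain x y where *: "1 = r * x + of_nat p * y" "x \<in> R" "y \<in> R" by auto
  then have "r * x = 1 + of_nat p * (- y)" by (simp add: algebra_simps)
  with * show ?thesis using that by blast
qed

section \<open>The p-adic absolute value on \<open>Q\<close>\<close>

lemma padic:
  shows Q_subfield: "subfield Q (sub_rng UNIV 1)"
    and v_nonneg: "x \<in> Q \<Longrightarrow> v x \<ge> 0" and v_zero_iff: "x \<in> Q \<Longrightarrow> v x = 0 \<longleftrightarrow> x = 0"
    and v_mult: "x \<in> Q \<Longrightarrow> y \<in> Q \<Longrightarrow> v (x * y) = v x * v y"
    and v_add: "x \<in> Q \<Longrightarrow> y \<in> Q \<Longrightarrow> v (x + y) \<le> v x + v y"
    and v_rat: "v (of_rat q) = padic_abs p q"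
    and v_dense: "x \<in> Q \<Longrightarrow> \<delta> > 0 \<Longrightarrow> \<exists>q. v (x - of_rat q) < \<delta>"
  using unram unfolding unramified_ext_def is_padic_numbers_def by blast+

lemma Q_ring: "0 \<in> Q" "1 \<in> Q" "x \<in> Q \<Longrightarrow> - x \<in> Q" "x \<in> Q \<Longrightarrow> y \<in> Q \<Longrightarrow> x + y \<in> Q"
  "x \<in> Q \<Longrightarrow> y \<in> Q \<Longrightarrow> x * y \<in> Q"
proof -
  interpret K: field "sub_rng UNIV (1::'k)" by (rule field_sub_rng_UNIV)
  note s = subringE[OF subfieldE(1)[OF Q_subfield]]
  show "0 \<in> Q" "1 \<in> Q" "x \<in> Q \<Longrightarrow> y \<in> Q \<Longrightarrow> x + y \<in> Q" "x \<in> Q \<Longrightarrow> y \<in> Q \<Longrightarrow> x * y \<in> Q"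
    using s by auto
  show "x \<in> Q \<Longrightarrow> - x \<in> Q" using s(5)[of x] a_inv_sub_rng[OF K.ring_axioms, of x] by simp
qed

lemma Q_inverse: "x \<in> Q \<Longrightarrow> inverse x \<in> Q"
proof (cases "x = 0")
  case False
  interpret K: field "sub_rng UNIV (1::'k)" by (rule field_sub_rng_UNIV)
  assume "x \<in> Q"
  then have "inv\<^bsub>sub_rng UNIV 1\<^esub> x \<in> Q" "x * inv\<^bsub>sub_rng UNIV 1\<^esub> x = 1"
    using K.subfield_m_inv[OF Q_subfield, of x] False by auto
  then show ?thesis using False by (metis inverse_unique)
qed (simp add: Q_ring)

lemma Q_diff: "x \<in> Q \<Longrightarrow> y \<in> Q \<Longrightarrow> x - y \<in> Q"
  using Q_ring(3,4) by (metis add_uminus_conv_diff)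

lemma Q_of_nat: "of_nat m \<in> Q"
  by (induction m) (auto intro: Q_ring)

lemma Q_of_int: "of_int m \<in> Q"
  by (cases m) (auto simp del: of_nat_Suc intro!: Q_ring Q_of_nat)

lemma Q_of_rat: "of_rat q \<in> Q"
  by (cases q) (auto simp: of_rat_rat divide_inverse intro!: Q_ring Q_inverse Q_of_int)

lemma Q_power: "x \<in> Q \<Longrightarrow> x ^ m \<in> Q"
  by (induction m) (auto intro: Q_ring)

lemma v_one: "v 1 = 1"
  using v_rat[of 1] by (simp add: padic_abs_def)

lemma v_power: "x \<in> Q \<Longrightarrow> v (x ^ m) = v x ^ m"
  by (induction m) (auto simp: v_one v_mult Q_power)

lemma v_minus: "x \<in> Q \<Longrightarrow> v (- x) = v x"
proof -
  assume x: "x \<in> Q"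
  have m: "(- 1 :: 'k) \<in> Q" by (intro Q_ring)
  have "v (- 1) ^ 2 = 1" using v_mult[OF m m] v_one by (simp add: power2_eq_square)
  then have "v (- 1) = 1" using v_nonneg[OF m] unfolding power2_eq_1_iff by auto
  then show ?thesis using v_mult[OF m x] by simp
qed

lemma v_of_int: "m \<noteq> 0 \<Longrightarrow> v (of_int m) = real p powi (- int (multiplicity (int p) m))"
  using v_rat[of "of_int m"] by (simp add: padic_abs_def)

lemma v_of_int_le_1: "v (of_int m) \<le> 1"
proof (cases "m = 0")
  case False
  have "real p powi - int (multiplicity (int p) m) \<le> 1"
    using p_gt_1 by (simp add: power_int_minus inverse_le_1_iff)
  then show ?thesis using v_of_int[OF False] by simp
qed (use v_zero_iff[of 0] Q_ring in simp)

lemma v_p: "v (of_nat p) = 1 / p"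
proof -
  have "multiplicity (int p) (int p) = 1" using p_gt_1 by (intro multiplicity_self) auto
  then show ?thesis using v_of_int[of "int p"] p_gt_1 by (simp add: power_int_minus field_simps)
qed

lemma v_sum: "finite I \<Longrightarrow> (\<And>i. i \<in> I \<Longrightarrow> h i \<in> Q) \<Longrightarrow> v (sum h I) \<le> (\<Sum>i\<in>I. v (h i)) \<and> sum h I \<in> Q"
proof (induction I rule: finite_induct)
  case (insert i I)
  then have "v (h i + sum h I) \<le> v (h i) + v (sum h I)" by (intro v_add) auto
  with insert show ?case by (auto intro: Q_ring)
qed (use v_zero_iff[of 0] Q_ring in simp)

section \<open>Integral elements and the residue field of \<open>R\<close>\<close>

lemma R_iff: "x \<in> R \<longleftrightarrow> (\<exists>d c. (\<forall>i<d. c i \<in> Q \<and> v (c i) \<le> 1) \<and> x ^ d + (\<Sum>i<d. c i * x ^ i) = 0)"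
  unfolding R_def using integral_closure_UNIV[of "{x \<in> Q. v x \<le> 1}"] by (simp add: v_one Q_ring)

lemma Zp_R: "x \<in> Q \<Longrightarrow> v x \<le> 1 \<Longrightarrow> x \<in> R"
  unfolding R_iff by (rule exI[of _ 1], rule exI[of _ "\<lambda>_. - x"]) (simp add: Q_ring v_minus)

text \<open>An element algebraic over \<open>Q\<close> becomes integral after multiplication by a
  large power \<open>t\<close> of \<open>p\<close>: the equation of \<open>t * x\<close> has the
  coefficients \<open>t ^ (d - i) * c i\<close>, and a single factor \<open>t\<close> already brings
  \<open>c i\<close> down to absolute value at most \<open>1\<close>.\<close>

lemma dense: "\<exists>m. of_nat p ^ m * x \<in> R"
proof -
  have "ring.finite_dimension (sub_rng UNIV (1::'k)) Q UNIV"
    using unram unfolding unramified_ext_def by blast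
  from finite_dimension_dependent[OF Q_subfield this] obtain N where
    N: "\<forall>x :: nat \<Rightarrow> 'k. \<exists>q. (\<forall>i\<le>N. q i \<in> Q) \<and> (\<exists>i\<le>N. q i \<noteq> 0) \<and> (\<Sum>i\<le>N. q i * x i) = (0::'k)" by blast
  obtain q where q: "\<forall>i\<le>N. q i \<in> Q" "\<exists>i\<le>N. q i \<noteq> 0" "(\<Sum>i\<le>N. q i * x ^ i) = 0"
    using spec[OF N, of "\<lambda>i. x ^ i"] by blast
  \<comment> \<open>The top nonzero coefficient, so that division by \<open>q d\<close> leaves a
    monic equation of degree \<open>d\<close>.\<close>
  define d where "d = Max {i. i \<le> N \<and> q i \<noteq> 0}"
  have fin: "finite {i. i \<le> N \<and> q i \<noteq> 0}" by simp
  have "d \<in> {i. i \<le> N \<and> q i \<noteq> 0}" unfolding d_def using q(2) by (intro Max_in) auto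
  then have d: "d \<le> N" "q d \<noteq> 0" by auto
  have "(\<Sum>i\<le>d. q i * x ^ i) = (\<Sum>i\<le>N. q i * x ^ i)"
    using d(1) Max_ge[OF fin] unfolding d_def[symmetric] by (intro sum.mono_neutral_left) force+
  then have eq: "q d * x ^ d + (\<Sum>i<d. q i * x ^ i) = 0"
    using q(3) by (simp add: lessThan_Suc_atMost[symmetric] add.commute)
  define c where "c i = q i / q d" for i
  have c: "c i \<in> Q" if "i < d" for i
    using that d q(1) unfolding c_def divide_inverse by (intro Q_ring Q_inverse) auto
  have "q d * (x ^ d + (\<Sum>i<d. c i * x ^ i)) = 0"
    using eq d(2) by (simp add: c_def distrib_left sum_distrib_left)
  then have eq: "x ^ d + (\<Sum>i<d. c i * x ^ i) = 0" using d(2) by simp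
  define C where "C = (\<Sum>i<d. v (c i))"
  obtain m where m: "C < real p ^ m" using real_arch_pow[of "real p"] p_gt_1 by auto
  define t where "t = (of_nat p ^ m :: 'k)"
  have tQ: "t \<in> Q" unfolding t_def by (intro Q_power Q_of_nat)
  have vt: "v t = 1 / p ^ m" unfolding t_def using v_power[OF Q_of_nat] v_p by (simp add: power_one_over)
  have "v (t ^ (d - i) * c i) \<le> 1" if i: "i < d" for i
  proof -
    have "v (c i) \<le> C" unfolding C_def using i by (intro member_le_sum) (auto intro: v_nonneg c)
    then have "v (c i) \<le> real p ^ m" using m by simp
    then have ci: "v t * v (c i) \<le> 1" unfolding vt using p_gt_1 by (simp add: field_simps)
    have "v t \<le> 1" unfolding vt using p_gt_1 by simp
    have "v (t ^ (d - i) * c i) = v t ^ Suc (d - i - 1) * v (c i)"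
      using i by (simp add: v_mult v_power tQ Q_power c Suc_diff_Suc del: power_Suc)
    also have "\<dots> = v t ^ (d - i - 1) * (v t * v (c i))" by simp
    also have "\<dots> \<le> 1" using \<open>v t \<le> 1\<close> ci v_nonneg[OF tQ] v_nonneg[OF c[OF i]]
      by (intro mult_le_one[OF power_le_one]) auto
    finally show ?thesis .
  qed
  moreover have "t ^ (d - i) * c i \<in> Q" if "i < d" for i using that c tQ by (intro Q_ring Q_power)
  moreover have "(t * x) ^ d + (\<Sum>i<d. (t ^ (d - i) * c i) * (t * x) ^ i) = 0"
  proof -
    have "(t ^ (d - i) * c i) * (t * x) ^ i = t ^ d * (c i * x ^ i)" if "i < d" for i
    proof -
      have "t ^ (d - i) * t ^ i = t ^ d" using that by (simp flip: power_add)
      then show ?thesis by (simp add: power_mult_distrib) 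
    qed
    then have "(\<Sum>i<d. (t ^ (d - i) * c i) * (t * x) ^ i) = t ^ d * (\<Sum>i<d. c i * x ^ i)"
      unfolding sum_distrib_left by (intro sum.cong) auto
    then show ?thesis using eq by (simp add: power_mult_distrib flip: distrib_left)
  qed
  ultimately have "t * x \<in> R" unfolding R_iff
    by (intro exI[of _ d] exI[of _ "\<lambda>i. t ^ (d - i) * c i"]) simp
  then show ?thesis unfolding t_def by blast
qed

text \<open>In place of a geometric series: the inverse \<open>t\<close> satisfies
  \<open>t = 1 - p z t\<close>, so \<open>p ^ i t\<close> in \<open>R\<close> with
  \<open>i > 0\<close> implies \<open>p ^ (i - 1) t\<close> in \<open>R\<close>. The start of this
  descent comes from \<open>dense\<close>.\<close>

lemma one_plus_p_unit:
  assumes "z \<in> R" shows "inverse (1 + of_nat p * z) \<in> R"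
proof (cases "1 + of_nat p * z = 0")
  case False
  define t where "t = inverse (1 + of_nat p * z)"
  obtain m where m: "of_nat p ^ m * t \<in> R" using dense by blast
  have "of_nat p ^ (m - j) * t \<in> R" for j
  proof (induction j)
    case (Suc j)
    show ?case
    proof (cases "j < m")
      case True
      have t: "t = 1 - of_nat p * z * t" using False unfolding t_def by (simp add: field_simps)
      have q: "(of_nat p ^ (m - j) :: 'k) = of_nat p ^ (m - Suc j) * of_nat p"
        using True by (metis Suc_diff_Suc power_Suc2)
      have "of_nat p ^ (m - Suc j) * t = of_nat p ^ (m - Suc j) * (1 - of_nat p * z * t)"
        by (subst t) simp
      also have "\<dots> = of_nat p ^ (m - Suc j) - z * (of_nat p ^ (m - j) * t)"
        unfolding q by (simp add: algebra_simps)
      finally have "of_nat p ^ (m - Suc j) * t = of_nat p ^ (m - Suc j) - z * (of_nat p ^ (m - j) * t)" .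
      then show ?thesis using Suc assms by auto
    qed (use Suc in auto)
  qed (use m in simp)
  from this[of m] show ?thesis unfolding t_def by simp
qed auto

lemma R_unit: assumes "r \<in> R" "r \<notin> pR" shows "inverse r \<in> R"
proof -
  obtain r' z where *: "r' \<in> R" "z \<in> R" "r * r' = 1 + of_nat p * z" using unit_mod_p[OF assms] .
  show ?thesis
  proof (cases "r = 0")
    case False
    have "1 + of_nat p * z \<noteq> 0"
    proof
      assume "1 + of_nat p * z = 0"
      then have "1 = of_nat p * (- z)" by (simp add: eq_neg_iff_add_eq_0)
      then show False using one_notin_pR *(2) unfolding pR_def by blast
    qed
    then have "inverse r = r' * inverse (1 + of_nat p * z)"
      using *(3) False by (simp add: field_simps)
    then show ?thesis using one_plus_p_unit[OF *(2)] *(1) by auto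
  qed auto
qed

text \<open>Otherwise \<open>inverse y\<close> would be integral with absolute value above
  \<open>1\<close>. Only the triangle inequality is used, so a power of absolute value above
  \<open>2\<close> is taken: then the geometric sum of the lower terms stays below the leading term
  of the integral equation.\<close>

lemma small_in_pR:
  assumes y: "y \<in> Q" "v y < 1" shows "y \<in> pR"
proof (rule ccontr)
  assume n: "y \<notin> pR"
  have "y \<in> R" using y by (intro Zp_R) auto
  with n have iR: "inverse y \<in> R" by (intro R_unit)
  have y0: "y \<noteq> 0" using n by auto
  have iQ: "inverse y \<in> Q" using y by (intro Q_inverse)
  have "v (inverse y) * v y = 1" using v_mult[OF iQ y(1)] y0 v_one by simp
  then have "v (inverse y) > 1" using y v_nonneg[OF y(1)] v_nonneg[OF iQ]
    by (smt (verit) mult_cancel_right1 mult_left_le)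
  then obtain M where M: "2 < v (inverse y) ^ M" using real_arch_pow by blast
  define z where "z = inverse y ^ M"
  have z: "z \<in> R" "z \<in> Q" and vz: "v z > 2"
    unfolding z_def using iR iQ M by (auto intro: Q_power simp: v_power)
  obtain d c where c: "\<forall>i<d. c i \<in> Q \<and> v (c i) \<le> 1" "z ^ d + (\<Sum>i<d. c i * z ^ i) = 0"
    using z(1) unfolding R_iff by blast
  have cQ: "c i * z ^ i \<in> Q" if "i \<in> {..<d}" for i using c(1) z that by (intro Q_ring Q_power) auto
  have "z ^ d = - (\<Sum>i<d. c i * z ^ i)" using c(2) by (simp only: eq_neg_iff_add_eq_0)
  then have "v (z ^ d) = v (- (\<Sum>i<d. c i * z ^ i))" by simp
  also have "\<dots> = v (\<Sum>i<d. c i * z ^ i)" using v_sum[OF finite_lessThan cQ] by (intro v_minus) (rule conjunct2)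
  also have "\<dots> \<le> (\<Sum>i<d. v (c i * z ^ i))" using v_sum[OF finite_lessThan cQ] by (rule conjunct1)
  also have "\<dots> \<le> (\<Sum>i<d. v z ^ i)"
  proof (rule sum_mono)
    fix i assume "i \<in> {..<d}"
    then have "v (c i * z ^ i) = v (c i) * v z ^ i" "v (c i) \<le> 1" using c z by (auto simp: v_mult v_power Q_power)
    then show "v (c i * z ^ i) \<le> v z ^ i" using vz mult_right_mono[of "v (c i)" 1 "v z ^ i"] by simp
  qed
  finally have le: "v z ^ d \<le> (\<Sum>i<d. v z ^ i)" using z by (simp add: v_power)
  have "(\<Sum>i<d. v z ^ i) = (v z ^ d - 1) / (v z - 1)" using vz by (intro geometric_sum) auto
  also have "\<dots> \<le> (v z ^ d - 1) / 1" using vz by (intro divide_left_mono) (auto intro: one_le_power)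
  finally show False using le by simp
qed

lemma Zp_residue:
  assumes q: "q \<in> Q" "v q \<le> 1" obtains m where "m < p" "q - of_nat m \<in> pR"
proof -
  \<comment> \<open>The tolerance serves twice: \<open>1 + 1/4 < 2 \<le> p\<close> keeps
    \<open>p\<close> out of the denominator of \<open>q'\<close>, and \<open>1/4 + 1/2 < 1\<close>
    gives the final estimate.\<close>
  obtain q' where q': "v (q - of_rat q') < 1/4" using v_dense[OF q(1), of "1/4"] by auto
  obtain x y where xy: "quotient_of q' = (x, y)" by (cases "quotient_of q'")
  then have cop: "coprime x y" "y > 0" and q'eq: "q' = of_int x / of_int y"
    by (auto simp: quotient_of_coprime quotient_of_denom_pos quotient_of_div)
  have Q1: "q - of_rat q' \<in> Q" using q Q_of_rat by (intro Q_diff)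
  have "v (of_rat q') \<le> v (- (q - of_rat q')) + v q"
    using v_add[OF Q_ring(3)[OF Q1] q(1)] by simp
  then have v2: "v (of_rat q') < 2" using q q' v_minus[OF Q1] by linarith
  have py: "\<not> int p dvd y"
  proof
    assume d: "int p dvd y"
    have pp: "Factorial_Ring.prime (int p)" using prime_p by simp
    have "\<not> int p dvd x" using coprime_common_divisor[OF cop(1), of "int p"] d p_gt_1
      by (auto simp: zdvd1_eq)
    then have "multiplicity (int p) x = 0" by (rule not_dvd_imp_multiplicity_0)
    moreover have "multiplicity (int p) y \<ge> 1" using d cop p_gt_1
      by (intro multiplicity_geI) (auto simp: zdvd1_eq)
    moreover have "x \<noteq> 0" using \<open>\<not> int p dvd x\<close> by auto
    ultimately have "v (of_rat q') = real p ^ multiplicity (int p) y"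
      unfolding v_rat padic_abs_def xy using cop(2) q'eq by simp
    also have "\<dots> \<ge> real p ^ 1" using \<open>multiplicity (int p) y \<ge> 1\<close> p_gt_1 by (intro power_increasing) auto
    finally show False using v2 p_gt_1 by simp
  qed
  have "coprime y (int p)" using py prime_p by (metis coprime_commute prime_imp_coprime prime_nat_int_transfer)
  \<comment> \<open>\<open>i\<close> inverts the denominator \<open>y\<close> modulo
    \<open>p\<close>, so \<open>i * x\<close> reduced modulo \<open>p\<close> is the residue of
    \<open>x / y\<close>.\<close>
  then obtain i j where i: "i * y + j * int p = 1" using bezout_int[of y "int p"] by auto
  define m where "m = nat ((i * x) mod int p)"
  have m: "m < p" "int m = (i * x) mod int p" unfolding m_def using p_gt_1 by (auto simp: nat_less_iff)
  have "x - y * int m = x - y * (i * x - int p * ((i * x) div int p))"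
    unfolding m(2) by (simp add: minus_mult_div_eq_mod)
  also have "\<dots> = int p * (j * x + y * ((i * x) div int p)) + x * (1 - (i * y + j * int p))"
    by (simp add: algebra_simps)
  finally have "int p dvd x - y * int m" unfolding i by simp
  then obtain k where k: "x - y * int m = int p * k" by (elim dvdE)
  have vy: "v (of_int y) = 1" using v_of_int[of y] cop(2) not_dvd_imp_multiplicity_0[OF py] by simp
  have Qm: "of_rat q' - of_nat m \<in> Q" by (intro Q_diff Q_of_nat Q_of_rat)
  have "(of_rat q' - of_nat m) * of_int y = (of_int (x - y * int m) :: 'k)"
    unfolding q'eq using cop(2) by (simp add: of_rat_divide field_simps)
  then have "(of_rat q' - of_nat m) * of_int y = (of_nat p * of_int k :: 'k)" unfolding k by simp
  then have "v (of_rat q' - of_nat m) = v (of_nat p) * v (of_int k)"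
    using v_mult[OF Qm Q_of_int[of y]] v_mult[OF Q_of_nat Q_of_int, of p k] vy by simp
  also have "\<dots> \<le> v (of_nat p) * 1" using v_of_int_le_1 v_nonneg[OF Q_of_nat] by (intro mult_left_mono)
  also have "\<dots> \<le> 1 / 2" using p_gt_1 unfolding v_p by (simp add: field_simps)
  finally have "v ((q - of_rat q') + (of_rat q' - of_nat m)) < 1"
    using v_add[OF Q1 Qm] q' by linarith
  then have "q - of_nat m \<in> pR" using q(1) by (intro small_in_pR Q_diff Q_of_nat) auto
  with m(1) that show ?thesis by blast
qed


text \<open>Linear independence of the residues of \<open>x 0, ..., x (k - 1)\<close> over the prime
  field, whose elements are represented by the digits below \<open>p\<close>.\<close>

definition residue_free :: "nat \<Rightarrow> (nat \<Rightarrow> 'k) \<Rightarrow> bool"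
  where "residue_free k x \<longleftrightarrow> (\<forall>i<k. x i \<in> R) \<and>
    (\<forall>m. (\<forall>i<k. m i < p) \<and> (\<Sum>i<k. of_nat (m i) * x i) \<in> pR \<longrightarrow> (\<forall>i<k. m i = 0))"

text \<open>Dividing a dependence over \<open>Q\<close> by a coefficient of largest absolute value
  makes all coefficients p-adic integers and one of them \<open>1\<close>. Such a relation stays
  nontrivial modulo \<open>p\<close>, so a residue-free system cannot be longer than the bound on
  independent ones.\<close>

lemma residue_free_bound: "\<exists>N. \<forall>k x. residue_free k x \<longrightarrow> k \<le> N"
proof -
  have "ring.finite_dimension (sub_rng UNIV (1::'k)) Q UNIV"
    using unram unfolding unramified_ext_def by blast
  from finite_dimension_dependent[OF Q_subfield this] obtain N where
    N: "\<forall>x :: nat \<Rightarrow> 'k. \<exists>q. (\<forall>i\<le>N. q i \<in> Q) \<and> (\<exists>i\<le>N. q i \<noteq> 0) \<and> (\<Sum>i\<le>N. q i * x i) = (0::'k)" by blast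
  have "k \<le> N" if free: "residue_free k x" for k x
  proof (rule ccontr)
    assume "\<not> k \<le> N"
    obtain q0 where q0: "\<forall>i\<le>N. q0 i \<in> Q" "\<exists>i\<le>N. q0 i \<noteq> 0" "(\<Sum>i\<le>N. q0 i * x i) = 0"
      using spec[OF N, of x] by blast
    have fin: "finite ((\<lambda>i. v (q0 i)) ` {..N})" and ne: "(\<lambda>i. v (q0 i)) ` {..N} \<noteq> {}" by auto
    obtain j where j: "j \<le> N" and jmax: "\<And>i. i \<le> N \<Longrightarrow> v (q0 i) \<le> v (q0 j)"
      using Max_in[OF fin ne] Max_ge[OF fin] by fastforce
    have j0: "q0 j \<noteq> 0"
    proof
      assume "q0 j = 0"
      then have "v (q0 i) \<le> 0" if "i \<le> N" for i using jmax[OF that] v_zero_iff[of 0] Q_ring(1) by simp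
      then have "q0 i = 0" if "i \<le> N" for i using that q0(1) v_nonneg v_zero_iff by (metis order_antisym)
      then show False using q0(2) by blast
    qed
    define q where "q i = q0 i * inverse (q0 j)" for i
    have qQ: "q i \<in> Q" if "i \<le> N" for i unfolding q_def using that q0(1) j by (intro Q_ring Q_inverse) auto
    have vq: "v (q i) \<le> 1" if i: "i \<le> N" for i
    proof -
      have jQ: "q0 j \<in> Q" using q0(1) j by auto
      have "v (q i) * v (q0 j) = v (q0 i)" using v_mult[OF qQ[OF i] jQ] j0 by (simp add: q_def mult.assoc)
      moreover have "v (q0 j) > 0" using v_nonneg[OF jQ] v_zero_iff[OF jQ] j0 by simp
      ultimately show ?thesis using jmax[OF i] mult_le_cancel_right_pos[of "v (q0 j)" "v (q i)" 1] by simp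
    qed
    have "\<forall>i. \<exists>m. i \<le> N \<longrightarrow> m < p \<and> q i - of_nat m \<in> pR" using Zp_residue[OF qQ vq] by metis
    then obtain m where m: "\<And>i. i \<le> N \<Longrightarrow> m i < p \<and> q i - of_nat (m i) \<in> pR" by metis
    \<comment> \<open>The relation involves \<open>x 0, ..., x N\<close> only and is padded with
      zeros up to length \<open>k\<close>.\<close>
    define m' where "m' i = (if i \<le> N then m i else 0)" for i
    have xR: "x i \<in> R" if "i < k" for i using free that unfolding residue_free_def by blast
    have sub: "{..N} \<subseteq> {..<k}" using \<open>\<not> k \<le> N\<close> by auto
    have "(\<Sum>i\<le>N. q i * x i) = (\<Sum>i\<le>N. q0 i * x i) * inverse (q0 j)"
      by (simp add: q_def sum_distrib_left sum_distrib_right mult_ac)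
    then have "(\<Sum>i\<le>N. of_nat (m i) * x i) = - (\<Sum>i\<le>N. x i * (q i - of_nat (m i)))"
      using q0(3) by (simp add: right_diff_distrib sum_subtractf mult.commute)
    also have "\<dots> = (\<Sum>i\<le>N. (- x i) * (q i - of_nat (m i)))" by (simp add: sum_negf)
    also have "\<dots> \<in> pR" using m xR sub by (intro pR_sum pR_mult) auto
    also have "(\<Sum>i\<le>N. of_nat (m i) * x i) = (\<Sum>i<k. of_nat (m' i) * x i)"
      using sub by (intro sum.mono_neutral_cong_left) (auto simp: m'_def)
    finally have "(\<Sum>i<k. of_nat (m' i) * x i) \<in> pR" .
    moreover have "\<forall>i<k. m' i < p" using m p_gt_1 by (auto simp: m'_def)
    ultimately have "\<forall>i<k. m' i = 0" using free unfolding residue_free_def by blast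
    then have "m' j = 0" using j sub by auto
    then have "q j \<in> pR" using m[OF j] j by (simp add: m'_def)
    then show False using one_notin_pR j0 by (simp add: q_def)
  qed
  then show ?thesis by blast
qed

text \<open>A residue-free system of maximal length spans \<open>R/pR\<close> over the prime field:
  adjoining \<open>y\<close> creates a relation in which the digit of \<open>y\<close> is prime to
  \<open>p\<close>, and it can be solved for \<open>y\<close>. Hence the finitely many digit
  combinations meet every residue class.\<close>

lemma finite_residues: "\<exists>S. finite S \<and> S \<subseteq> R \<and> (\<forall>x\<in>R. \<exists>s\<in>S. x - s \<in> pR)"
proof -
  obtain N where N: "\<And>k x. residue_free k x \<Longrightarrow> k \<le> N" using residue_free_bound by blast
  have "\<exists>x. residue_free 0 x" unfolding residue_free_def by simp
  then obtain k where k: "\<exists>x. residue_free k x" and kmax: "\<And>k' x. residue_free k' x \<Longrightarrow> k' \<le> k"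
    using Nat.ex_has_greatest_nat[of "\<lambda>k. \<exists>x. residue_free k x" 0 N] N by metis
  obtain x where x: "residue_free k x" using k by blast
  have xR: "x i \<in> R" if "i < k" for i using x that unfolding residue_free_def by blast
  define S where "S = (\<lambda>m. \<Sum>i<k. of_nat (m i) * x i) ` ({..<k} \<rightarrow>\<^sub>E {..<p})"
  have "finite S" unfolding S_def by (intro finite_imageI finite_PiE) auto
  moreover have "S \<subseteq> R" unfolding S_def using xR by auto
  moreover have "\<exists>s\<in>S. y - s \<in> pR" if y: "y \<in> R" for y
  proof -
    let ?x = "x(k := y)"
    have "\<not> residue_free (Suc k) ?x" using kmax[of "Suc k" ?x] by auto
    moreover have "\<forall>i<Suc k. ?x i \<in> R" using xR y by auto
    ultimately obtain m where m: "\<forall>i<Suc k. m i < p" "(\<Sum>i<Suc k. of_nat (m i) * ?x i) \<in> pR"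
      "\<exists>i<Suc k. m i \<noteq> 0" unfolding residue_free_def by blast
    have sum: "(\<Sum>i<k. of_nat (m i) * x i) + of_nat (m k) * y \<in> pR" using m(2) by simp
    have mk: "m k \<noteq> 0"
    proof
      assume "m k = 0"
      then have "(\<Sum>i<k. of_nat (m i) * x i) \<in> pR" using sum by simp
      then have "\<forall>i<k. m i = 0" using x m(1) unfolding residue_free_def by simp
      then show False using m(3) \<open>m k = 0\<close> by (auto simp: less_Suc_eq)
    qed
    have "of_nat (m k) \<notin> pR"
    proof
      assume *: "of_nat (m k) \<in> pR"
      have "coprime (int (m k)) (int p)"
        using mk m(1) prime_p by (metis coprime_commute dvd_imp_le int_dvd_int_iff lessI linorder_not_le
          not_gr_zero prime_imp_coprime prime_nat_int_transfer)
      then obtain i j where ij: "i * int (m k) + j * int p = 1" using bezout_int[of "int (m k)" "int p"] by auto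
      have intR: "(of_int z :: 'k) \<in> R" for z by (cases z) (auto simp del: of_nat_Suc)
      have eq: "of_int (i * int (m k) + j * int p) = (of_int i * of_nat (m k) + of_int j * of_nat p :: 'k)" by simp
      have "(of_nat p :: 'k) \<in> pR" unfolding pR_def by force
      have "of_int i * of_nat (m k) + of_int j * of_nat p \<in> pR"
        using * \<open>of_nat p \<in> pR\<close> intR by (intro pR_add pR_mult)
      then have "(1::'k) \<in> pR" using eq unfolding ij by simp
      then show False using one_notin_pR by simp
    qed
    then have inv: "inverse (of_nat (m k)) \<in> R" by (intro R_unit) auto
    define c where "c i = - (inverse (of_nat (m k)) * of_nat (m i) :: 'k)" for i
    have "inverse (of_nat (m k)) * ((\<Sum>i<k. of_nat (m i) * x i) + of_nat (m k) * y) \<in> pR"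
      using sum inv by (rule pR_mult)
    moreover have "inverse (of_nat (m k)) * ((\<Sum>i<k. of_nat (m i) * x i) + of_nat (m k) * y) = y - (\<Sum>i<k. c i * x i)"
      using mk by (simp add: c_def distrib_left sum_distrib_left sum_negf mult.assoc)
    ultimately have yc: "y - (\<Sum>i<k. c i * x i) \<in> pR" by simp
    \<comment> \<open>The solved coefficients \<open>c i\<close> are p-adic integers in
      \<open>Q\<close> rather than digits, so they are replaced by their residues.\<close>
    have cR: "\<exists>n<p. c i - of_nat n \<in> pR" if "i < k" for i
    proof -
      have "(of_nat (m k) :: 'k) \<in> R" by simp
      have cQ: "c i \<in> Q" unfolding c_def by (intro Q_ring Q_inverse Q_of_nat)
      have "v (of_nat (m k)) \<ge> 1"
        using small_in_pR[OF Q_of_nat[of "m k"]] \<open>of_nat (m k) \<notin> pR\<close> by linarith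
      moreover have "v (inverse (of_nat (m k))) * v (of_nat (m k)) = 1"
        using v_mult[OF Q_inverse[OF Q_of_nat] Q_of_nat, of "m k" "m k"] mk v_one by simp
      ultimately have "v (inverse (of_nat (m k))) \<le> 1"
        using v_nonneg[OF Q_inverse[OF Q_of_nat[of "m k"]]] by (metis mult_right_mono mult_1 mult.commute)
      then have "v (c i) \<le> 1 * 1" unfolding c_def
        using v_minus v_mult[OF Q_inverse[OF Q_of_nat] Q_of_nat, of "m k" "m i"] v_of_int_le_1[of "int (m i)"]
          v_nonneg[OF Q_of_nat[of "m i"]] v_minus[OF Q_ring(5)[OF Q_inverse[OF Q_of_nat] Q_of_nat], of "m k" "m i"]
          v_nonneg[OF Q_inverse[OF Q_of_nat[of "m k"]]]
        by (auto intro!: mult_le_one)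
      then show ?thesis using Zp_residue[OF cQ] by auto
    qed
    then have "\<forall>i. \<exists>n. i < k \<longrightarrow> n < p \<and> c i - of_nat n \<in> pR" by blast
    then obtain n where n: "\<And>i. i < k \<Longrightarrow> n i < p \<and> c i - of_nat (n i) \<in> pR" by metis
    define n' where "n' = restrict n {..<k}"
    have "(y - (\<Sum>i<k. c i * x i)) + (\<Sum>i<k. x i * (c i - of_nat (n i))) \<in> pR"
      using yc xR n by (intro pR_add pR_sum pR_mult) auto
    moreover have "(y - (\<Sum>i<k. c i * x i)) + (\<Sum>i<k. x i * (c i - of_nat (n i))) = y - (\<Sum>i<k. of_nat (n' i) * x i)"
      by (simp add: right_diff_distrib sum_subtractf mult.commute n'_def)
    moreover have "n' \<in> {..<k} \<rightarrow>\<^sub>E {..<p}" using n unfolding n'_def by auto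
    ultimately show ?thesis unfolding S_def by auto
  qed
  ultimately show ?thesis by blast
qed

end

section \<open>Transversals\<close>

definition add_closed :: "'a::ab_group_add set \<Rightarrow> bool"
  where "add_closed A \<longleftrightarrow> 0 \<in> A \<and> (\<forall>x\<in>A. \<forall>y\<in>A. x - y \<in> A)"

lemma add_closedD:
  assumes "add_closed A"
  shows "0 \<in> A" "x \<in> A \<Longrightarrow> y \<in> A \<Longrightarrow> x - y \<in> A" "x \<in> A \<Longrightarrow> - x \<in> A" "x \<in> A \<Longrightarrow> y \<in> A \<Longrightarrow> x + y \<in> A"
proof -
  show *: "0 \<in> A" "\<And>x y. x \<in> A \<Longrightarrow> y \<in> A \<Longrightarrow> x - y \<in> A" using assms unfolding add_closed_def by auto
  show m: "x \<in> A \<Longrightarrow> - x \<in> A" for x using *(2)[OF *(1), of x] by simp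
  show "x \<in> A \<Longrightarrow> y \<in> A \<Longrightarrow> x + y \<in> A" using *(2)[of x "- y"] m[of y] by simp
qed

text \<open>Existence of a transversal says that the index of \<open>B\<close> in \<open>A\<close>
  is finite, and \<open>card S\<close> is that index. Quotient groups are avoided in this
  way.\<close>

definition transversal :: "'a::ab_group_add set \<Rightarrow> 'a set \<Rightarrow> 'a set \<Rightarrow> bool"
  where "transversal A B S \<longleftrightarrow> finite S \<and> S \<subseteq> A \<and> (\<forall>x\<in>A. \<exists>!s. s \<in> S \<and> x - s \<in> B)"

lemma transversalD:
  assumes "transversal A B S"
  shows "finite S" "S \<subseteq> A" "x \<in> A \<Longrightarrow> \<exists>s\<in>S. x - s \<in> B"
    "x \<in> A \<Longrightarrow> s \<in> S \<Longrightarrow> t \<in> S \<Longrightarrow> x - s \<in> B \<Longrightarrow> x - t \<in> B \<Longrightarrow> s = t"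
  using assms unfolding transversal_def by blast+

lemma transversalI:
  assumes "add_closed B" "finite S" "S \<subseteq> A" "\<And>x. x \<in> A \<Longrightarrow> \<exists>s\<in>S. x - s \<in> B"
    "\<And>s t. s \<in> S \<Longrightarrow> t \<in> S \<Longrightarrow> s - t \<in> B \<Longrightarrow> s = t"
  shows "transversal A B S"
  unfolding transversal_def
proof (intro conjI ballI ex_ex1I)
  show "\<exists>s. s \<in> S \<and> x - s \<in> B" if "x \<in> A" for x using assms(4)[OF that] by blast
next
  fix x s t assume "s \<in> S \<and> x - s \<in> B" "t \<in> S \<and> x - t \<in> B"
  moreover have "s - t = (x - t) - (x - s)" by simp
  ultimately show "s = t" using assms(5) add_closedD(2)[OF assms(1)] by metis
qed (rule assms(2,3))+

lemma transversal_inj: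
  assumes "transversal A B S" "add_closed B" "s \<in> S" "t \<in> S" "s - t \<in> B" shows "s = t"
  using transversalD(4)[OF assms(1), of s s t] transversalD(2)[OF assms(1)] assms(3-5) add_closedD(1)[OF assms(2)]
  by auto

lemma transversal_exists:
  assumes "add_closed B" "B \<subseteq> A" "add_closed A" "finite C" "\<And>x. x \<in> A \<Longrightarrow> \<exists>c\<in>C. x - c \<in> B"
  shows "\<exists>S. transversal A B S"
proof -
  define C' where "C' = C \<inter> A"
  have C'_fin: "finite C'" and C'_sub: "C' \<subseteq> A" unfolding C'_def using assms(4) by auto
  have C'_ex: "\<exists>c\<in>C'. x - c \<in> B" if x: "x \<in> A" for x
  proof -
    obtain c where c: "c \<in> C" "x - c \<in> B" using assms(5) x by blast
    then have "x - (x - c) \<in> A" using assms(2) x by (intro add_closedD(2)[OF assms(3), of x "x - c"]) auto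
    then show ?thesis using c unfolding C'_def by auto
  qed
  \<comment> \<open>The chosen representative depends only on the coset of \<open>c\<close>, because
    the condition on \<open>d\<close> does; this is \<open>req\<close> below.\<close>
  define r where "r c = (SOME d. d \<in> C' \<and> c - d \<in> B)" for c
  have r: "r x \<in> C' \<and> x - r x \<in> B" if "x \<in> A" for x
    unfolding r_def by (rule someI_ex) (use C'_ex[OF that] in blast)
  have req: "r x = r y" if "x - y \<in> B" "x \<in> A" "y \<in> A" for x y
  proof -
    have "x - d \<in> B \<longleftrightarrow> y - d \<in> B" for d
    proof
      assume "x - d \<in> B"
      from add_closedD(2)[OF assms(1) this that(1)] show "y - d \<in> B" by simp
    next
      assume "y - d \<in> B"
      from add_closedD(4)[OF assms(1) that(1) this] show "x - d \<in> B" by simp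
    qed
    then show ?thesis unfolding r_def by simp
  qed
  have "transversal A B (r ` A)"
  proof (rule transversalI[OF assms(1)])
    have "r ` A \<subseteq> C'" using r by auto
    then show "finite (r ` A)" "r ` A \<subseteq> A" using C'_fin C'_sub finite_subset by blast+
    show "\<exists>s\<in>r ` A. x - s \<in> B" if "x \<in> A" for x using r that by blast
    show "s = t" if "s \<in> r ` A" "t \<in> r ` A" "s - t \<in> B" for s t
    proof -
      obtain x y where xy: "s = r x" "t = r y" "x \<in> A" "y \<in> A" using \<open>s \<in> r ` A\<close> \<open>t \<in> r ` A\<close> by blast
      have "(x - r x) + (r x - r y) \<in> B"
        using r[OF xy(3)] \<open>s - t \<in> B\<close> unfolding xy(1,2) by (intro add_closedD(4)[OF assms(1)]) auto
      then have "x - r y - (y - r y) \<in> B"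
        using r[OF xy(4)] by (intro add_closedD(2)[OF assms(1), of "x - r y"]) simp_all
      then show ?thesis using req[of x y] xy by simp
    qed
  qed
  then show ?thesis by blast
qed

lemma transversal_card_unique:
  assumes "transversal A B S" "transversal A B S'" "add_closed B" shows "card S = card S'"
proof -
  have le: "card S \<le> card S'" if S: "transversal A B S" "transversal A B S'" for S S'
  proof -
    have "\<forall>s\<in>S. \<exists>s'\<in>S'. s - s' \<in> B" using transversalD(3)[OF S(2)] transversalD(2)[OF S(1)] by blast
    then obtain g where g: "\<And>s. s \<in> S \<Longrightarrow> g s \<in> S' \<and> s - g s \<in> B" by metis
    have "inj_on g S"
    proof (rule inj_onI)
      fix s t assume *: "s \<in> S" "t \<in> S" "g s = g t"
      then have "(s - g s) - (t - g t) \<in> B" using g by (metis add_closedD(2)[OF assms(3)])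
      then show "s = t" using * transversal_inj[OF S(1) assms(3)] by simp
    qed
    then show ?thesis using g transversalD(1)[OF S(2)] by (intro card_inj_on_le[of g]) auto
  qed
  show ?thesis using le[OF assms(1,2)] le[OF assms(2,1)] by simp
qed

text \<open>The tower law for indices: the sums \<open>s + t\<close> represent the cosets of
  \<open>C\<close> in \<open>A\<close>.\<close>

lemma transversal_trans:
  assumes "transversal A B S" "transversal B C S'" "add_closed A" "add_closed B" "add_closed C" "B \<subseteq> A" "C \<subseteq> B"
  shows "\<exists>T. transversal A C T \<and> card T = card S * card S'"
proof -
  define T where "T = (\<lambda>(s, t). s + t) ` (S \<times> S')"
  have sub: "S \<subseteq> A" "S' \<subseteq> B" using transversalD(2)[OF assms(1)] transversalD(2)[OF assms(2)] by auto
  have eq: "s = s' \<and> t = t'" if *: "s \<in> S" "s' \<in> S" "t \<in> S'" "t' \<in> S'" "(s + t) - (s' + t') \<in> C" for s s' t t'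
  proof -
    have "((s + t) - (s' + t')) - (t - t') \<in> B"
      using * sub assms(7) by (intro add_closedD(2)[OF assms(4), of "_ - _"]) (auto intro: add_closedD(2)[OF assms(4)])
    then have "s = s'" using transversal_inj[OF assms(1,4)] * by (simp add: algebra_simps)
    then show ?thesis using transversal_inj[OF assms(2,5), of t t'] * by simp
  qed
  have "inj_on (\<lambda>(s, t). s + t) (S \<times> S')"
    using eq add_closedD(1)[OF assms(5)] by (auto simp: inj_on_def)
  then have "card T = card S * card S'" unfolding T_def by (simp add: card_image card_cartesian_product)
  moreover have "transversal A C T"
  proof (rule transversalI[OF assms(5)])
    show "finite T" unfolding T_def using transversalD(1)[OF assms(1)] transversalD(1)[OF assms(2)] by simp
    show "T \<subseteq> A" unfolding T_def using sub assms(6) by (auto intro!: add_closedD(4)[OF assms(3)])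
    show "\<exists>s\<in>T. x - s \<in> C" if "x \<in> A" for x
    proof -
      obtain s where s: "s \<in> S" "x - s \<in> B" using transversalD(3)[OF assms(1) \<open>x \<in> A\<close>] by blast
      obtain t where t: "t \<in> S'" "x - s - t \<in> C" using transversalD(3)[OF assms(2) s(2)] by blast
      then show ?thesis using s unfolding T_def by (intro bexI[of _ "s + t"]) (auto simp: algebra_simps)
    qed
    show "s = t" if "s \<in> T" "t \<in> T" "s - t \<in> C" for s t
      using that eq unfolding T_def by fastforce
  qed
  ultimately show ?thesis by blast
qed

lemma transversal_image:
  assumes "transversal A B S" "add_closed B" "\<And>x y. x \<in> A \<Longrightarrow> y \<in> A \<Longrightarrow> \<phi> (x - y) = \<phi> x - \<phi> y"
    "\<And>x. x \<in> A \<Longrightarrow> \<phi> x = 0 \<Longrightarrow> x = 0" "B \<subseteq> A" "add_closed A"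
  shows "\<exists>T. transversal (\<phi> ` A) (\<phi> ` B) T \<and> card T = card S"
proof -
  have S: "S \<subseteq> A" by (rule transversalD(2)[OF assms(1)])
  have z: "\<phi> 0 = 0" using assms(3)[of 0 0] add_closedD(1)[OF assms(6)] by simp
  have inj: "x = y" if "\<phi> x = \<phi> y" "x \<in> A" "y \<in> A" for x y
    using assms(3)[of x y] assms(4)[of "x - y"] that add_closedD(2)[OF assms(6)] by auto
  have "transversal (\<phi> ` A) (\<phi> ` B) (\<phi> ` S)"
  proof (rule transversalI)
    show "add_closed (\<phi> ` B)" unfolding add_closed_def
    proof (intro conjI ballI)
      show "0 \<in> \<phi> ` B" using z add_closedD(1)[OF assms(2)] by force
      show "x - y \<in> \<phi> ` B" if xy: "x \<in> \<phi> ` B" "y \<in> \<phi> ` B" for x y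
      proof -
        obtain x' y' where *: "x = \<phi> x'" "y = \<phi> y'" "x' \<in> B" "y' \<in> B" using xy by auto
        then have "x - y = \<phi> (x' - y')" using assms(3)[of x' y'] assms(5) by (simp add: subset_iff)
        then show ?thesis using * add_closedD(2)[OF assms(2)] by blast
      qed
    qed
    show "finite (\<phi> ` S)" using transversalD(1)[OF assms(1)] by simp
    show "\<phi> ` S \<subseteq> \<phi> ` A" using S by auto
    show "\<exists>s\<in>\<phi> ` S. x - s \<in> \<phi> ` B" if x: "x \<in> \<phi> ` A" for x
    proof -
      obtain x' where x': "x = \<phi> x'" "x' \<in> A" using x by auto
      obtain s where s: "s \<in> S" "x' - s \<in> B" using transversalD(3)[OF assms(1) x'(2)] by auto
      then have "\<phi> x' - \<phi> s = \<phi> (x' - s)" using assms(3) x' S by auto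
      then show ?thesis using s x' by auto
    qed
    show "s = t" if st: "s \<in> \<phi> ` S" "t \<in> \<phi> ` S" "s - t \<in> \<phi> ` B" for s t
    proof -
      obtain s' t' u where *: "s = \<phi> s'" "t = \<phi> t'" "s - t = \<phi> u" "s' \<in> S" "t' \<in> S" "u \<in> B" using st by auto
      have st': "s' \<in> A" "t' \<in> A" "u \<in> A" using * S assms(5) by auto
      then have "\<phi> (s' - t') = \<phi> u" using * assms(3)[of s' t'] by simp
      then have "s' - t' = u" using inj st' add_closedD(2)[OF assms(6) st'(1,2)] by simp
      then show ?thesis using transversal_inj[OF assms(1,2)] * by auto
    qed
  qed
  moreover have "card (\<phi> ` S) = card S" by (rule card_image) (use inj S in \<open>auto intro!: inj_onI\<close>)
  ultimately show ?thesis by blast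
qed

text \<open>If \<open>Z\<close> has finite index in \<open>M\<close>, an injective endomorphism \<open>\<phi>\<close> of \<open>M\<close> with
  \<open>\<phi> Z \<subseteq> Z\<close> satisfies \<open>[M : Z] [Z : \<phi> Z] = [M : \<phi> M] [\<phi> M : \<phi> Z]\<close>, and
  \<open>[\<phi> M : \<phi> Z] = [M : Z]\<close>.\<close>

lemma transversal_endomorphism:
  assumes "add_closed M" "add_closed Z" "Z \<subseteq> M" "transversal M Z S0"
    and "\<And>x y. x \<in> M \<Longrightarrow> y \<in> M \<Longrightarrow> \<phi> (x - y) = \<phi> x - \<phi> y"
    and "\<And>x. x \<in> M \<Longrightarrow> \<phi> x = 0 \<Longrightarrow> x = 0"
    and "\<phi> ` M \<subseteq> M" "\<phi> ` Z \<subseteq> Z" "transversal M (\<phi> ` M) S" "transversal Z (\<phi> ` Z) T"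
  shows "card S = card T"
proof -
  have cl: "add_closed (\<phi> ` A)" if "add_closed A" "A \<subseteq> M" for A
    unfolding add_closed_def
  proof (intro conjI ballI)
    have "\<phi> 0 = 0" using assms(5)[of 0 0] add_closedD(1)[OF assms(1)] by simp
    then show "0 \<in> \<phi> ` A" using add_closedD(1)[OF that(1)] by force
    show "x - y \<in> \<phi> ` A" if xy: "x \<in> \<phi> ` A" "y \<in> \<phi> ` A" for x y
    proof -
      obtain x' y' where *: "x = \<phi> x'" "y = \<phi> y'" "x' \<in> A" "y' \<in> A" using xy by auto
      then have "x - y = \<phi> (x' - y')" using assms(5)[of x' y'] \<open>A \<subseteq> M\<close> by (simp add: subset_iff)
      then show ?thesis using * add_closedD(2)[OF \<open>add_closed A\<close>] by blast
    qed
  qed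
  obtain S1 where S1: "transversal (\<phi> ` M) (\<phi> ` Z) S1" "card S1 = card S0"
    using transversal_image[OF assms(4,2,5,6,3,1)] by blast
  obtain U where U: "transversal M (\<phi> ` Z) U" "card U = card S0 * card T"
    using transversal_trans[OF assms(4,10,1,2) cl[OF assms(2,3)] assms(3,8)] by metis
  have "\<phi> ` Z \<subseteq> \<phi> ` M" using assms(3) by auto
  then obtain V where V: "transversal M (\<phi> ` Z) V" "card V = card S * card S1"
    using transversal_trans[OF assms(9) S1(1) assms(1) cl[OF assms(1) order_refl] cl[OF assms(2,3)] assms(7)]
    by blast
  have "card S0 * card T = card S * card S0"
    using transversal_card_unique[OF U(1) V(1) cl[OF assms(2,3)]] U V S1 by simp
  moreover have "S0 \<noteq> {}" using transversalD(3)[OF assms(4) add_closedD(1)[OF assms(1)]] by auto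
  then have "card S0 > 0" using transversalD(1)[OF assms(4)] by (simp add: card_gt_0_iff)
  ultimately show ?thesis by simp
qed

lemma transversal_quotient_submodules:
  assumes "add_closed A" "add_closed B" "add_closed C" "B \<subseteq> A" "C \<subseteq> B" "transversal A C S"
  shows "\<exists>T. transversal A B T" "\<exists>T. transversal B C T"
proof -
  show "\<exists>T. transversal A B T"
  proof (rule transversal_exists[OF assms(2,4,1) transversalD(1)[OF assms(6)]])
    show "\<exists>c\<in>S. x - c \<in> B" if "x \<in> A" for x using transversalD(3)[OF assms(6) that] assms(5) by blast
  qed
  show "\<exists>T. transversal B C T"
  proof (rule transversal_exists[OF assms(3,5,2) transversalD(1)[OF assms(6)]])
    show "\<exists>c\<in>S. x - c \<in> C" if "x \<in> B" for x using transversalD(3)[OF assms(6), of x] assms(4) that by blast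
  qed
qed

section \<open>The group algebra\<close>

lemma scal_mult_left [simp]: "scal c x * y = scal c (x * y)"
  by (simp add: scal_def mult.assoc)

lemma lookup_times_finite:
  fixes x y :: "'g::{finite,group_add} \<Rightarrow>\<^sub>0 'k::field"
  shows "Poly_Mapping.lookup (x * y) k = (\<Sum>l\<in>UNIV. Poly_Mapping.lookup x l * Poly_Mapping.lookup y (- l + k))"
proof -
  have "(\<Sum>q. Poly_Mapping.lookup y q when k = l + q) = Poly_Mapping.lookup y (- l + k)" for l
  proof -
    have "(\<lambda>q. Poly_Mapping.lookup y q when k = l + q) = (\<lambda>q. Poly_Mapping.lookup y (- l + k) when q = - l + k)"
      by (auto simp: when_def fun_eq_iff)
    then show ?thesis by (simp only: Sum_any_when_equal)
  qed
  then show ?thesis unfolding lookup_mult by (simp add: Sum_any.expand_superset[of UNIV])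
qed

lemma lookup_scal [simp]:
  fixes x :: "'g::{finite,group_add} \<Rightarrow>\<^sub>0 'k::field"
  shows "Poly_Mapping.lookup (scal c x) k = c * Poly_Mapping.lookup x k"
proof -
  have "(\<Sum>l\<in>UNIV. (c when 0 = l) * Poly_Mapping.lookup x (- l + k)) = (\<Sum>l\<in>{0}. c * Poly_Mapping.lookup x (- l + k))"
    by (intro sum.mono_neutral_cong_right) auto
  then show ?thesis unfolding scal_def lookup_times_finite by (simp add: lookup_single)
qed

lemma scal_mult_right [simp]:
  fixes x :: "'g::{finite,group_add} \<Rightarrow>\<^sub>0 'k::field"
  shows "x * scal c y = scal c (x * y)"
  by (rule poly_mapping_eqI) (simp add: lookup_times_finite sum_distrib_left mult.left_commute)

lemma poly_mapping_expansion:
  fixes x :: "'g::{finite,group_add} \<Rightarrow>\<^sub>0 'k::field"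
  shows "x = (\<Sum>g\<in>UNIV. scal (Poly_Mapping.lookup x g) (Poly_Mapping.single g 1))"
proof (rule poly_mapping_eqI)
  fix k
  have "(\<Sum>g\<in>UNIV. Poly_Mapping.lookup x g * (1 when g = k)) = (\<Sum>g\<in>{k}. Poly_Mapping.lookup x g)"
    by (intro sum.mono_neutral_cong_right) (auto simp: when_def)
  then show "Poly_Mapping.lookup x k = Poly_Mapping.lookup (\<Sum>g\<in>UNIV. scal (Poly_Mapping.lookup x g) (Poly_Mapping.single g 1)) k"
    by (simp add: lookup_sum lookup_single)
qed

lemma lookup_mult_single:
  fixes x :: "'g::{finite,group_add} \<Rightarrow>\<^sub>0 'k::field"
  shows "Poly_Mapping.lookup (x * Poly_Mapping.single h 1) h = Poly_Mapping.lookup x 0"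
proof -
  have "h = - l + h \<longleftrightarrow> l = 0" for l :: 'g
    by (metis add.left_neutral add_right_cancel neg_equal_0_iff_equal)
  then have "(\<Sum>l\<in>UNIV. Poly_Mapping.lookup x l * (1 when h = - l + h)) = (\<Sum>l\<in>{0}. Poly_Mapping.lookup x l)"
    by (intro sum.mono_neutral_cong_right) (auto simp: when_def)
  then show ?thesis by (simp add: lookup_times_finite lookup_single)
qed

text \<open>The symmetrizing form of the group algebra.\<close>

definition coeff1 :: "('g::group_add \<Rightarrow>\<^sub>0 'k::zero) \<Rightarrow> 'k"
  where "coeff1 x = Poly_Mapping.lookup x 0"

lemma coeff1_commute:
  fixes x y :: "'g::{finite,group_add} \<Rightarrow>\<^sub>0 'k::field"
  shows "coeff1 (x * y) = coeff1 (y * x)"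
  unfolding coeff1_def lookup_times_finite
  by (rule sum.reindex_bij_witness[of _ uminus uminus]) auto

lemma coeff1_add: "coeff1 (x + y) = coeff1 x + coeff1 y"
  by (simp add: coeff1_def lookup_add)

lemma coeff1_sum: "coeff1 (sum h I) = (\<Sum>i\<in>I. coeff1 (h i))"
  by (simp add: coeff1_def lookup_sum)

lemma coeff1_scal:
  fixes x :: "'g::{finite,group_add} \<Rightarrow>\<^sub>0 'k::field"
  shows "coeff1 (scal c x) = c * coeff1 x"
  by (simp add: coeff1_def)

lemma coeff1_mult_single:
  fixes x :: "'g::{finite,group_add} \<Rightarrow>\<^sub>0 'k::field"
  shows "coeff1 (x * Poly_Mapping.single (- h) 1) = Poly_Mapping.lookup x h"
proof -
  have "(\<Sum>l\<in>UNIV. Poly_Mapping.lookup x l * (1 when - h = - l)) = (\<Sum>l\<in>{h}. Poly_Mapping.lookup x l)"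
    by (intro sum.mono_neutral_cong_right) (auto simp: when_def)
  then show ?thesis by (simp add: coeff1_def lookup_times_finite lookup_single)
qed

text \<open>The trace of left multiplication by \<open>x\<close>, computed in the basis \<open>G\<close>.\<close>

lemma regular_trace:
  fixes x :: "'g::{finite,group_add} \<Rightarrow>\<^sub>0 'k::field"
  shows "of_nat (card (UNIV :: 'g set)) * coeff1 x =
    (\<Sum>g\<in>UNIV. Poly_Mapping.lookup (x * Poly_Mapping.single g 1) g)"
  by (simp add: lookup_mult_single coeff1_def)

lemma kg_linear_expansion:
  fixes x :: "'g::{finite,group_add} \<Rightarrow>\<^sub>0 'k::field"
  assumes "Vector_Spaces.linear scal scal \<psi>"
  shows "\<psi> x = (\<Sum>g\<in>UNIV. scal (Poly_Mapping.lookup x g) (\<psi> (Poly_Mapping.single g 1)))"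
proof -
  interpret Vector_Spaces.linear scal scal \<psi> by fact
  show ?thesis by (subst poly_mapping_expansion[of x]) (simp add: sum scale)
qed

lemma kg_finite_independent:
  fixes Bs :: "('g::{finite,group_add} \<Rightarrow>\<^sub>0 'k::field) set"
  assumes "kg.independent Bs" shows "finite Bs" "card Bs \<le> card (UNIV :: 'g set)"
proof -
  let ?G = "range (\<lambda>g. Poly_Mapping.single g 1 :: 'g \<Rightarrow>\<^sub>0 'k)"
  have "x \<in> kg.span ?G" for x
    by (subst poly_mapping_expansion[of x]) (intro kg.span_sum kg.span_scale kg.span_base, auto)
  then show "finite Bs" "card Bs \<le> card (UNIV :: 'g set)"
    using kg.independent_span_bound[OF _ assms, of ?G] card_image_le[of UNIV "\<lambda>g. Poly_Mapping.single g 1 :: 'g \<Rightarrow>\<^sub>0 'k"]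
    by (auto intro: le_trans)
qed

text \<open>If \<open>\<psi>\<close> maps the group algebra linearly to \<open>L\<close>, then the endomorphisms
  \<open>x \<mapsto> \<psi> x * \<alpha>\<close> of the group algebra and \<open>y \<mapsto> \<psi> (y * \<alpha>)\<close> of \<open>L\<close> have the same trace.\<close>

lemma alg_trace_eq:
  fixes L :: "('g::{finite,group_add} \<Rightarrow>\<^sub>0 'k::field) set"
  assumes "kg.subspace L" and lin: "Vector_Spaces.linear scal scal \<psi>" and rng: "\<And>x. \<psi> x \<in> L"
    and z: "\<And>x. x \<in> L \<Longrightarrow> \<psi> (x * \<alpha>) = z * x"
  shows "(\<Sum>g\<in>UNIV. Poly_Mapping.lookup (\<psi> (Poly_Mapping.single g 1) * \<alpha>) g) = alg_trace L z"
proof -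
  obtain B where "B \<subseteq> L" "kg.independent B" "L \<subseteq> kg.span B" by (rule kg.basis_exists[of L])
  then have "kg.independent B" "kg.span B = L" using kg.span_minimal[OF _ assms(1)] by auto
  then have ex: "\<exists>Bs. kg.independent Bs \<and> kg.span Bs = L" by blast
  define Bs where "Bs = (SOME Bs. kg.independent Bs \<and> kg.span Bs = L)"
  have Bs: "kg.independent Bs" "kg.span Bs = L" using someI_ex[OF ex] unfolding Bs_def by blast+
  let ?r = "kg.representation Bs"
  have fin: "finite Bs" by (rule kg_finite_independent(1)[OF Bs(1)])
  interpret Vector_Spaces.linear scal scal \<psi> by (rule lin)
  let ?s = "\<lambda>g. Poly_Mapping.single g 1 :: 'g \<Rightarrow>\<^sub>0 'k"
  have rep: "x = (\<Sum>\<beta>\<in>Bs. scal (?r x \<beta>) \<beta>)" if "x \<in> L" for x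
    using kg.sum_representation_eq[OF Bs(1) _ fin order_refl] Bs(2) that by simp
  have Lin: "?r (sum h I) \<beta> = (\<Sum>i\<in>I. ?r (h i) \<beta>)" if "\<And>i. i \<in> I \<Longrightarrow> h i \<in> L" for h \<beta> and I :: "'g set"
    using kg.representation_sum[OF Bs(1), of I h] Bs(2) that by simp
  have "(\<Sum>g\<in>UNIV. Poly_Mapping.lookup (\<psi> (?s g) * \<alpha>) g) = (\<Sum>g\<in>UNIV. \<Sum>\<beta>\<in>Bs. ?r (\<psi> (?s g)) \<beta> * Poly_Mapping.lookup (\<beta> * \<alpha>) g)"
  proof (rule sum.cong)
    fix g
    have "\<psi> (?s g) * \<alpha> = (\<Sum>\<beta>\<in>Bs. scal (?r (\<psi> (?s g)) \<beta>) (\<beta> * \<alpha>))"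
      by (subst rep[OF rng]) (simp add: sum_distrib_right)
    then show "Poly_Mapping.lookup (\<psi> (?s g) * \<alpha>) g = (\<Sum>\<beta>\<in>Bs. ?r (\<psi> (?s g)) \<beta> * Poly_Mapping.lookup (\<beta> * \<alpha>) g)"
      by (simp add: lookup_sum)
  qed simp
  \<comment> \<open>Exchanging the sums is the identity between the traces of \<open>S T\<close> and
    \<open>T S\<close>, written in coordinates.\<close>
  also have "\<dots> = (\<Sum>\<beta>\<in>Bs. \<Sum>g\<in>UNIV. Poly_Mapping.lookup (\<beta> * \<alpha>) g * ?r (\<psi> (?s g)) \<beta>)"
    by (subst sum.swap) (simp add: mult.commute)
  also have "\<dots> = (\<Sum>\<beta>\<in>Bs. ?r (z * \<beta>) \<beta>)"
  proof (rule sum.cong)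
    fix \<beta> assume \<beta>: "\<beta> \<in> Bs"
    have "z * \<beta> = \<psi> (\<beta> * \<alpha>)" using z \<beta> Bs(2) kg.span_base by metis
    also have "\<dots> = (\<Sum>g\<in>UNIV. scal (Poly_Mapping.lookup (\<beta> * \<alpha>) g) (\<psi> (?s g)))" by (rule kg_linear_expansion[OF lin])
    also have "?r \<dots> \<beta> = (\<Sum>g\<in>UNIV. ?r (scal (Poly_Mapping.lookup (\<beta> * \<alpha>) g) (\<psi> (?s g))) \<beta>)"
      using rng assms(1) by (intro Lin) (simp add: kg.subspace_scale)
    also have "\<dots> = (\<Sum>g\<in>UNIV. Poly_Mapping.lookup (\<beta> * \<alpha>) g * ?r (\<psi> (?s g)) \<beta>)"
      using kg.representation_scale[OF Bs(1)] rng Bs(2) by simp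
    finally show "(\<Sum>g\<in>UNIV. Poly_Mapping.lookup (\<beta> * \<alpha>) g * ?r (\<psi> (?s g)) \<beta>) = ?r (z * \<beta>) \<beta>" by simp
  qed simp
  finally show ?thesis unfolding alg_trace_def Let_def Bs_def .
qed

lemma alg_trace_one:
  fixes L :: "('g::{finite,group_add} \<Rightarrow>\<^sub>0 'k::field) set"
  assumes "kg.subspace L" "\<And>x. x \<in> L \<Longrightarrow> u * x = x"
  shows "alg_trace L u = of_nat (kg.dim L)"
proof -
  obtain B where "B \<subseteq> L" "kg.independent B" "L \<subseteq> kg.span B" by (rule kg.basis_exists[of L])
  then have "kg.independent B" "kg.span B = L" using kg.span_minimal[OF _ assms(1)] by auto
  then have ex: "\<exists>Bs. kg.independent Bs \<and> kg.span Bs = L" by blast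
  define Bs where "Bs = (SOME Bs. kg.independent Bs \<and> kg.span Bs = L)"
  have Bs: "kg.independent Bs" "kg.span Bs = L" using someI_ex[OF ex] unfolding Bs_def by blast+
  have "(\<Sum>\<beta>\<in>Bs. kg.representation Bs (u * \<beta>) \<beta>) = (\<Sum>\<beta>\<in>Bs. 1)"
  proof (rule sum.cong)
    fix \<beta> assume \<beta>: "\<beta> \<in> Bs"
    then have "\<beta> \<in> L" using Bs(2) kg.span_base by metis
    then show "kg.representation Bs (u * \<beta>) \<beta> = 1"
      using assms(2) kg.representation_basis[OF Bs(1) \<beta>] by simp
  qed simp
  also have "\<dots> = of_nat (kg.dim L)" using kg.dim_eq_card[OF _ Bs(1), of L] Bs(2)
    by (metis kg.span_span of_nat_1 sum_constant mult.right_neutral)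
  finally show ?thesis unfolding alg_trace_def Let_def Bs_def .
qed

lemma kg_dim_less:
  fixes V W :: "('g::{finite,group_add} \<Rightarrow>\<^sub>0 'k::field) set"
  assumes "kg.subspace V" "kg.subspace W" "V \<subset> W"
  shows "kg.dim V < kg.dim W"
proof -
  obtain C where C: "C \<subseteq> V" "kg.independent C" "V \<subseteq> kg.span C" "card C = kg.dim V"
    by (rule kg.basis_exists[of V])
  obtain D where D: "D \<subseteq> W" "kg.independent D" "W \<subseteq> kg.span D" "card D = kg.dim W"
    by (rule kg.basis_exists[of W])
  obtain x where x: "x \<in> W" "x \<notin> V" using assms(3) by auto
  have "kg.span C \<subseteq> V" using C(1) assms(1) by (rule kg.span_minimal)
  then have "kg.independent (insert x C)" using x C(2) by (intro kg.independent_insertI) auto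
  moreover have "insert x C \<subseteq> kg.span D" using x D(3) C(1) assms(3) by auto
  ultimately have "card (insert x C) \<le> card D"
    using kg.independent_span_bound kg_finite_independent(1)[OF D(2)] by blast
  moreover have "x \<notin> C" using C(1) x(2) by auto
  ultimately show ?thesis using C(4) D(4) kg_finite_independent(1)[OF C(2)] by simp
qed

lemma subspace_mult_range:
  fixes h :: "'g::{finite,group_add} \<Rightarrow>\<^sub>0 'k::field"
  shows "kg.subspace (range ((*) h))"
  unfolding kg.subspace_def
proof (intro conjI ballI allI)
  show "0 \<in> range ((*) h)" by (rule range_eqI[of _ _ 0]) simp
  show "x + y \<in> range ((*) h)" if "x \<in> range ((*) h)" "y \<in> range ((*) h)" for x y
    using that by (auto simp flip: distrib_left)
  show "scal c x \<in> range ((*) h)" if "x \<in> range ((*) h)" for c x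
    using that by (auto simp flip: scal_mult_right)
qed

text \<open>Induction on the dimension of the right ideal generated by \<open>h\<close>, which
  shrinks whenever \<open>h\<close> splits. As \<open>C\<close> is arbitrary, one proof serves for
  centrally primitive idempotents of \<open>KB\<close> and for primitive idempotents of the
  block.\<close>

lemma primitive_decomposition:
  fixes h :: "'g::{finite,group_add} \<Rightarrow>\<^sub>0 'k::field"
  assumes "h \<in> C" "h * h = h"
  shows "\<exists>P. finite P \<and> \<Sum>P = h \<and> (\<forall>k\<in>P. primitive_idem_in (sub_rng S u) C k) \<and>
    (\<forall>k\<in>P. \<forall>k'\<in>P. k \<noteq> k' \<longrightarrow> k * k' = 0)"
  using assms
proof (induction "kg.dim (range ((*) h))" arbitrary: h rule: less_induct)
  case less
  consider "h = 0" | "primitive_idem_in (sub_rng S u) C h" | "h \<noteq> 0" "\<not> primitive_idem_in (sub_rng S u) C h"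
    by blast
  then show ?case
  proof cases
    case 1
    then show ?thesis by (intro exI[of _ "{}"]) auto
  next
    case 2
    then show ?thesis by (intro exI[of _ "{h}"]) auto
  next
    case 3
    obtain h1 h2 where h: "h1 \<in> C" "h2 \<in> C" "h1 * h1 = h1" "h2 * h2 = h2" "h1 * h2 = 0" "h2 * h1 = 0"
      "h = h1 + h2" "h1 \<noteq> 0" "h2 \<noteq> 0"
      using 3 less.prems unfolding primitive_idem_in_def sub_rng_simps by blast
    have dim: "kg.dim (range ((*) k1)) < kg.dim (range ((*) h))"
      if "k1 * k1 = k1" "k2 * k2 = k2" "k1 * k2 = 0" "k2 * k1 = 0" "h = k1 + k2" "k2 \<noteq> 0" for k1 k2
    proof (rule kg_dim_less[OF subspace_mult_range subspace_mult_range])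
      have "k1 * x = h * (k1 * x)" for x using that by (simp add: distrib_right flip: mult.assoc)
      then have "range ((*) k1) \<subseteq> range ((*) h)" by (metis image_subsetI rangeI)
      moreover have "k2 \<in> range ((*) h)" using that by (intro range_eqI[of _ _ k2]) (simp add: distrib_right)
      moreover have "k2 \<notin> range ((*) k1)"
      proof
        assume "k2 \<in> range ((*) k1)"
        then obtain x where "k2 = k1 * x" by auto
        then have "k2 * k2 = k2 * k1 * x" by (metis mult.assoc)
        then show False using that by simp
      qed
      ultimately show "range ((*) k1) \<subset> range ((*) h)" by blast
    qed
    obtain P1 where P1: "finite P1" "\<Sum>P1 = h1" "\<forall>k\<in>P1. primitive_idem_in (sub_rng S u) C k"
      "\<forall>k\<in>P1. \<forall>k'\<in>P1. k \<noteq> k' \<longrightarrow> k * k' = 0"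
      using less.hyps[of h1] dim[of h1 h2] h by blast
    obtain P2 where P2: "finite P2" "\<Sum>P2 = h2" "\<forall>k\<in>P2. primitive_idem_in (sub_rng S u) C k"
      "\<forall>k\<in>P2. \<forall>k'\<in>P2. k \<noteq> k' \<longrightarrow> k * k' = 0"
      using less.hyps[of h2] dim[of h2 h1] h by (metis add.commute)
    have abs: "k * \<Sum>P = k" "\<Sum>P * k = k"
      if "finite P" "\<forall>k\<in>P. primitive_idem_in (sub_rng S u) C k"
        "\<forall>k\<in>P. \<forall>k'\<in>P. k \<noteq> k' \<longrightarrow> k * k' = 0" "k \<in> P" for P k
    proof -
      have kk: "k * k = k" using that unfolding primitive_idem_in_def by simp
      have "k * \<Sum>P = (\<Sum>k'\<in>P. if k' = k then k else 0)"
        unfolding sum_distrib_left using that kk by (intro sum.cong) auto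
      then show "k * \<Sum>P = k" using that by simp
      have "\<Sum>P * k = (\<Sum>k'\<in>P. if k' = k then k else 0)"
        unfolding sum_distrib_right using that kk by (intro sum.cong) auto
      then show "\<Sum>P * k = k" using that by simp
    qed
    have orth: "k * k' = 0" "k' * k = 0" if k: "k \<in> P1" "k' \<in> P2" for k k'
    proof -
      have e: "k * h1 = k" "h1 * k = k" "k' * h2 = k'" "h2 * k' = k'"
        using abs[OF P1(1,3,4) k(1)] abs[OF P2(1,3,4) k(2)] P1(2) P2(2) by auto
      have "k * k' = (k * h1) * (h2 * k')" using e by simp
      then show "k * k' = 0" using h(5) by (metis mult.assoc mult_zero_left mult_zero_right)
      have "k' * k = (k' * h2) * (h1 * k)" using e by simp
      then show "k' * k = 0" using h(6) by (metis mult.assoc mult_zero_left mult_zero_right)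
    qed
    have "P1 \<inter> P2 = {}"
    proof (rule ccontr)
      assume "P1 \<inter> P2 \<noteq> {}"
      then obtain k where k: "k \<in> P1" "k \<in> P2" by auto
      then have "k * k = 0" by (rule orth)
      then show False using P1(3) k(1) unfolding primitive_idem_in_def by simp
    qed
    then have "\<Sum>(P1 \<union> P2) = h" using P1 P2 h(7) by (simp add: sum.union_disjoint)
    then show ?thesis using P1 P2 orth by (intro exI[of _ "P1 \<union> P2"]) auto
  qed
qed

section \<open>The lattice \<open>RG\<close> in the group algebra\<close>

context unramified_field
begin

abbreviation RG :: "('g::{finite,group_add} \<Rightarrow>\<^sub>0 'k) set" where "RG \<equiv> group_ring R"

lemma RG_zero [simp, intro]: "0 \<in> RG" by (simp add: group_ring_def)

lemma RG_single [simp, intro]: "c \<in> R \<Longrightarrow> Poly_Mapping.single g c \<in> RG"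
  by (auto simp: group_ring_def lookup_single when_def)

lemma RG_one [simp, intro]: "1 \<in> RG"
  using RG_single[OF R_one, of 0] by simp

lemma RG_add [intro]: "x \<in> RG \<Longrightarrow> y \<in> RG \<Longrightarrow> x + y \<in> RG"
  by (auto simp: group_ring_def lookup_add)

lemma RG_minus [intro]: "x \<in> RG \<Longrightarrow> - x \<in> RG"
  by (auto simp: group_ring_def)

lemma RG_diff [intro]: "x \<in> RG \<Longrightarrow> y \<in> RG \<Longrightarrow> x - y \<in> RG"
  by (auto simp: group_ring_def lookup_minus)

lemma RG_mult [intro]: "x \<in> RG \<Longrightarrow> y \<in> RG \<Longrightarrow> x * y \<in> RG"
  by (auto simp: group_ring_def lookup_times_finite)

lemma RG_scal [intro]: "c \<in> R \<Longrightarrow> x \<in> RG \<Longrightarrow> scal c x \<in> RG"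
  by (auto simp: group_ring_def)

lemma RG_dense:
  fixes x :: "'g::{finite,group_add} \<Rightarrow>\<^sub>0 'k"
  shows "\<exists>m. scal (of_nat p ^ m) x \<in> RG"
proof -
  have "\<forall>g. \<exists>m. of_nat p ^ m * Poly_Mapping.lookup x g \<in> R" using dense by blast
  then obtain m where m: "\<And>g. of_nat p ^ m g * Poly_Mapping.lookup x g \<in> R" by metis
  define N where "N = Max (range m)"
  have "of_nat p ^ N * Poly_Mapping.lookup x g \<in> R" for g
  proof -
    have "m g \<le> N" unfolding N_def by (rule Max_ge) auto
    then have "of_nat p ^ N = (of_nat p ^ (N - m g) * of_nat p ^ m g :: 'k)" by (simp flip: power_add)
    then show ?thesis using m[of g] by (auto simp: mult.assoc)
  qed
  then show ?thesis by (auto simp: group_ring_def)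
qed

text \<open>Pairing with the group element \<open>- g\<close> reads off the coefficient at
  \<open>g\<close>.\<close>

lemma RG_self_dual:
  fixes x :: "'g::{finite,group_add} \<Rightarrow>\<^sub>0 'k"
  assumes "\<And>y. y \<in> RG \<Longrightarrow> coeff1 (x * y) \<in> R"
  shows "x \<in> RG"
proof -
  have "Poly_Mapping.lookup x g \<in> R" for g
    using assms[of "Poly_Mapping.single (- g) 1"] coeff1_mult_single[of x g] by auto
  then show ?thesis by (simp add: group_ring_def)
qed

lemma commutes_RG:
  fixes x :: "'g::{finite,group_add} \<Rightarrow>\<^sub>0 'k"
  assumes "\<And>y. y \<in> RG \<Longrightarrow> x * y = y * x"
  shows "x * y = y * x"
proof -
  obtain m where "scal (of_nat p ^ m) y \<in> RG" using RG_dense by blast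
  then have "scal (of_nat p ^ m) (x * y) = scal (of_nat p ^ m) (y * x)" using assms by fastforce
  then show ?thesis using p_nonzero by (simp add: kg.scale_cancel_left)
qed

end

section \<open>The order and its coordinates\<close>

text \<open>The names that the theorem introduces by equations for the block, its components,
  \<open>\<Lambda>\<close> and the identities of the components are substituted here. The condition
  \<open>a_pos\<close> is derived in the proof of the theorem, from the distinctness of the classes
  of \<open>idem 1\<close> and \<open>idem 2\<close>.\<close>

locale exceptional_order = unramified_field p Q R v
  for p :: nat and Q R :: "'k::field_char_0 set" and v :: "'k \<Rightarrow> real" +
  fixes a e n :: nat
    and b f :: "'g::{finite,group_add} \<Rightarrow>\<^sub>0 'k"
    and \<epsilon> :: "nat \<Rightarrow> 'g \<Rightarrow>\<^sub>0 'k"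
    and \<Gamma> Z :: "('g \<Rightarrow>\<^sub>0 'k) set"
    and \<pi> y :: "nat \<Rightarrow> 'g \<Rightarrow>\<^sub>0 'k"
    and Zs Rs :: "nat \<Rightarrow> ('g \<Rightarrow>\<^sub>0 'k) set"
    and E :: "nat \<Rightarrow> nat \<Rightarrow> nat \<Rightarrow> 'g \<Rightarrow>\<^sub>0 'k"
  assumes block_idem: "central_primitive_idem (sub_rng (group_ring R) 1) b"
    and eps: "bij_betw \<epsilon> {1..a+e} {c. central_primitive_idem (sub_rng {x * b |x. True} b) c}"
    and nonexceptional: "\<And>s. s \<in> {a+1..a+e} \<Longrightarrow>
          ring_center (sub_rng {x * b * \<epsilon> s |x. True} (\<epsilon> s)) = {scal c (\<epsilon> s) |c. True}"
    and ramified: "\<And>s. s \<in> {1..a} \<Longrightarrow>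
          totally_ramified p R (ring_center (sub_rng {x * b * \<epsilon> s |x. True} (\<epsilon> s))) (\<epsilon> s)"
    and degree: "\<And>s. s \<in> {1..a} \<Longrightarrow>
          e * kg.dim (ring_center (sub_rng {x * b * \<epsilon> s |x. True} (\<epsilon> s))) = p ^ s - p ^ (s - 1)"
    and tree: "brauer_tree R b a e \<epsilon>"
    and basic_idem: "f \<in> {(\<Sum>s=1..a. \<epsilon> s) * x |x. x \<in> block_of R b}" "f * f = f"
      "Idl\<^bsub>sub_rng {(\<Sum>s=1..a. \<epsilon> s) * x |x. x \<in> block_of R b} (\<Sum>s=1..a. \<epsilon> s)\<^esub> {f}
        = {(\<Sum>s=1..a. \<epsilon> s) * x |x. x \<in> block_of R b}"
    and Gamma_eq: "\<Gamma> = {f * x * f |x. x \<in> {(\<Sum>s=1..a. \<epsilon> s) * x |x. x \<in> block_of R b}}"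
    and Gamma_basic: "simples_one_dimensional (sub_rng \<Gamma> f) {scal c f |c. c \<in> R}"
    and n_eq: "n = num_simple_modules (sub_rng \<Gamma> f)"
    and n_gt_1: "n > 1"
    and a_pos: "a \<ge> 1"
    and Z_eq: "Z = ring_center (sub_rng \<Gamma> f)"
    and Zs_eq: "\<And>s. Zs s = ring_center (sub_rng {x * \<epsilon> s |x. x \<in> kg.span \<Gamma>} (f * \<epsilon> s))"
    and Rs_eq: "\<And>s. Rs s = ring_of_integers R (Zs s) (f * \<epsilon> s)"
    and pi_prime: "\<And>s. s \<in> {1..a} \<Longrightarrow> \<pi> s \<in> Rs s \<and> ring_prime\<^bsub>sub_rng (Rs s) (f * \<epsilon> s)\<^esub> (\<pi> s)"
    and units: "\<And>s. s \<in> {1..a} \<Longrightarrow> mat_units n (f * \<epsilon> s) (E s)"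
          "\<And>s i j. s \<in> {1..a} \<Longrightarrow> i \<in> {1..n} \<Longrightarrow> j \<in> {1..n} \<Longrightarrow> E s i j \<in> {x * \<epsilon> s |x. x \<in> kg.span \<Gamma>}"
    and coord_K: "\<And>s. s \<in> {1..a} \<Longrightarrow> {x * \<epsilon> s |x. x \<in> kg.span \<Gamma>} =
          {\<Sum>i=1..n. \<Sum>j=1..n. c i j * E s i j |c. \<forall>i\<in>{1..n}. \<forall>j\<in>{1..n}. c i j \<in> Zs s}"
    and coord_Gamma: "\<And>s. s \<in> {1..a} \<Longrightarrow> {x * \<epsilon> s |x. x \<in> \<Gamma>} =
          {\<Sum>i=1..n. \<Sum>j=1..n. c i j * E s i j |c. \<forall>i\<in>{1..n}. \<forall>j\<in>{1..n}.
            c i j \<in> Rs s \<and> (i < j \<longrightarrow> c i j \<in> {\<pi> s * r |r. r \<in> Rs s})}"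
    and diag_Gamma: "\<And>i. i \<in> {1..n} \<Longrightarrow> (\<Sum>s=1..a. E s i i) \<in> \<Gamma>"
    and coord_sub: "\<And>i. i \<in> {1..n-1} \<Longrightarrow> (\<Sum>s=1..a. E s (i+1) i) \<in> \<Gamma>"
    and y_unit: "\<And>s. s \<in> {1..a} \<Longrightarrow> y s \<in> Units (sub_rng (Rs s) (f * \<epsilon> s))"
    and y_elem: "(\<Sum>s=1..a. y s * \<pi> s * E s 1 n) \<in>
          {(\<Sum>s=1..a. E s 1 1) * x * (\<Sum>s=1..a. E s n n) |x. x \<in> \<Gamma>}"
    and y_gen: "generate_ring (sub_rng \<Gamma> f) (order_gens a n Z E y \<pi>) = \<Gamma>"
begin

section \<open>Central idempotents of the block\<close>

lemma b_props: shows b_RG: "b \<in> RG" and b_idem: "b * b = b" and b_central: "b * x = x * b" and b_nonzero: "b \<noteq> 0"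
proof -
  have "b \<in> ring_center (sub_rng RG 1) \<and> b * b = b \<and> b \<noteq> 0"
    using block_idem unfolding central_primitive_idem_def primitive_idem_in_def sub_rng_simps by (elim conjE) simp
  then have *: "b \<in> RG" "\<And>x. x \<in> RG \<Longrightarrow> b * x = x * b" "b * b = b" "b \<noteq> 0"
    unfolding ring_center_def sub_rng_simps by blast+
  show "b \<in> RG" "b * b = b" "b \<noteq> 0" by (rule *)+
  show "b * x = x * b" by (rule commutes_RG) (rule *(2))
qed

definition "KB = sub_rng {x * b |x. True} b"

text \<open>As \<open>b\<close> is central, commuting with all \<open>z * b\<close> amounts to
  commuting with all \<open>z\<close>. Centrality can therefore be used in the whole group algebra
  from here on.\<close>

lemma central_KB: "c \<in> ring_center KB \<longleftrightarrow> c * b = c \<and> (\<forall>x. c * x = x * c)"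
proof
  assume c: "c \<in> ring_center KB"
  then obtain x where "c = x * b" unfolding ring_center_def KB_def by auto
  then have cb: "c * b = c" using b_idem by (simp add: mult.assoc)
  have "c * z = z * c" for z
  proof -
    have "z * b \<in> carrier KB" unfolding KB_def by auto
    then have "c * (z * b) = (z * b) * c" using c unfolding ring_center_def KB_def by auto
    then show ?thesis using cb b_central by (metis mult.assoc)
  qed
  with cb show "c * b = c \<and> (\<forall>x. c * x = x * c)" by blast
next
  assume c: "c * b = c \<and> (\<forall>x. c * x = x * c)"
  have 1: "c \<in> {x * b |x. True}" by (intro CollectI exI[of _ c] conjI TrueI) (rule conjunct1[OF c, symmetric])
  have 2: "\<forall>x\<in>{x * b |x. True}. c * x = x * c" by (rule ballI) (rule conjunct2[OF c, rule_format])
  show "c \<in> ring_center KB" unfolding ring_center_def KB_def sub_rng_simps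
    by (rule CollectI, rule conjI[OF 1 2])
qed

lemma eps_cpi: "s \<in> {1..a+e} \<Longrightarrow> primitive_idem_in KB (ring_center KB) (\<epsilon> s)"
  using bspec[OF bij_betwE[OF eps]] unfolding central_primitive_idem_def KB_def mem_Collect_eq .

lemma eps_props:
  assumes "s \<in> {1..a+e}"
  shows eps_b: "\<epsilon> s * b = \<epsilon> s" and eps_central: "\<epsilon> s * x = x * \<epsilon> s"
    and eps_idem: "\<epsilon> s * \<epsilon> s = \<epsilon> s" and eps_nonzero: "\<epsilon> s \<noteq> 0"
  using eps_cpi[OF assms] unfolding primitive_idem_in_def central_KB unfolding KB_def sub_rng_simps by blast+

text \<open>If \<open>c d\<close> were nonzero, primitivity and the splitting
  \<open>c = c d + (c - c d)\<close> would force \<open>c = c d\<close>, and by symmetry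
  \<open>d = c d\<close>.\<close>

lemma cpi_orth:
  assumes "primitive_idem_in KB (ring_center KB) c" "primitive_idem_in KB (ring_center KB) d" "c \<noteq> d"
  shows "c * d = 0"
proof (rule ccontr)
  assume nz: "c * d \<noteq> 0"
  have eq: "c * d = c" if c: "primitive_idem_in KB (ring_center KB) c"
    and d: "primitive_idem_in KB (ring_center KB) d" and "c * d \<noteq> 0" for c d
  proof -
    have c': "c * b = c" "c * x = x * c" "c * c = c" and d': "d * b = d" "d * x = x * d" "d * d = d" for x
      using c d unfolding primitive_idem_in_def central_KB unfolding KB_def sub_rng_simps by blast+
    have cdc: "c * d * c = c * d" using c' by (metis mult.assoc)
    have cdd: "c * d * (c * d) = c * d" using cdc d' by (metis mult.assoc)
    have ccd: "c * (c * d) = c * d" using c'(3) by (simp flip: mult.assoc)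
    have "c * d \<in> ring_center KB" unfolding central_KB using c'(2) d' by (metis mult.assoc)
    moreover have "(c - c * d) * b = c - c * d" using c'(1) d'(1) by (simp add: left_diff_distrib mult.assoc)
    moreover have "(c - c * d) * x = x * (c - c * d)" for x
    proof -
      have "c * d * x = x * (c * d)" using c'(2) d'(2) by (metis mult.assoc)
      then show ?thesis using c'(2)[of x] by (simp only: left_diff_distrib right_diff_distrib)
    qed
    ultimately have m: "c * d \<in> ring_center KB" "c - c * d \<in> ring_center KB" unfolding central_KB by auto
    have "(c - c * d) * (c - c * d) = c - c * d" "(c * d) * (c - c * d) = 0" "(c - c * d) * (c * d) = 0"
      using cdc cdd ccd c'(3) by (simp_all add: left_diff_distrib right_diff_distrib)
    moreover have "c = c * d + (c - c * d)" by simp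
    moreover have "\<forall>h1\<in>ring_center KB. \<forall>h2\<in>ring_center KB. h1 * h1 = h1 \<and> h2 * h2 = h2 \<and> h1 * h2 = 0 \<and>
        h2 * h1 = 0 \<and> c = h1 + h2 \<longrightarrow> h1 = 0 \<or> h2 = 0"
      using c unfolding primitive_idem_in_def KB_def sub_rng_simps by (elim conjE)
    ultimately have "c * d = 0 \<or> c - c * d = 0" using cdd m by blast
    then show ?thesis using \<open>c * d \<noteq> 0\<close> by auto
  qed
  have dc: "d * c = c * d" using assms(1) unfolding primitive_idem_in_def central_KB by metis
  show False using eq[OF assms(1,2) nz] eq[OF assms(2,1)] nz dc assms(3) by simp
qed

lemma eps_orth: "s \<in> {1..a+e} \<Longrightarrow> t \<in> {1..a+e} \<Longrightarrow> s \<noteq> t \<Longrightarrow> \<epsilon> s * \<epsilon> t = 0"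
  using cpi_orth[OF eps_cpi eps_cpi] inj_on_eq_iff[OF bij_betw_imp_inj_on[OF eps]] by metis

text \<open>A decomposition of \<open>b\<close> into central primitive idempotents must contain
  every \<open>\<epsilon> s\<close>: one that is missing would be orthogonal to all summands, hence
  to \<open>b\<close>.\<close>

lemma b_eq_sum_eps: "b = (\<Sum>s=1..a+e. \<epsilon> s)"
proof -
  have "b \<in> ring_center KB" unfolding central_KB by (intro conjI allI b_idem b_central)
  then obtain P where P: "finite P" "\<Sum>P = b" "\<forall>k\<in>P. primitive_idem_in KB (ring_center KB) k"
    using primitive_decomposition[OF _ b_idem, of "ring_center KB" "{x * b |x. True}" b] unfolding KB_def by blast
  have sub: "P \<subseteq> \<epsilon> ` {1..a+e}"
    using P(3) bij_betw_imp_surj_on[OF eps] unfolding KB_def central_primitive_idem_def by auto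
  have "\<epsilon> ` {1..a+e} \<subseteq> P"
  proof
    fix c assume "c \<in> \<epsilon> ` {1..a+e}"
    then obtain s where s: "s \<in> {1..a+e}" "c = \<epsilon> s" by auto
    show "c \<in> P"
    proof (rule ccontr)
      assume "c \<notin> P"
      then have "c * \<Sum>P = 0" unfolding sum_distrib_left
        using P(3) eps_cpi[OF s(1)] s(2) by (intro sum.neutral ballI cpi_orth) auto
      then show False using P(2) eps_b[OF s(1)] eps_nonzero[OF s(1)] s(2) by simp
    qed
  qed
  then have "P = \<epsilon> ` {1..a+e}" using sub by auto
  then show ?thesis using P(2) bij_betw_imp_inj_on[OF eps] by (simp add: sum.reindex)
qed

definition "\<epsilon>e = (\<Sum>s=1..a. \<epsilon> s)"

lemma exc_index: "s \<in> {1..a} \<Longrightarrow> s \<in> {1..a+e}" by auto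

lemma ee_central: "\<epsilon>e * x = x * \<epsilon>e"
  unfolding \<epsilon>e_def sum_distrib_left sum_distrib_right by (intro sum.cong refl eps_central exc_index)

lemma ee_eps: assumes "s \<in> {1..a}" shows "\<epsilon>e * \<epsilon> s = \<epsilon> s"
proof -
  have "(\<Sum>t=1..a. \<epsilon> t * \<epsilon> s) = (\<Sum>t=1..a. if t = s then \<epsilon> s else 0)"
    using assms by (intro sum.cong) (auto intro: eps_orth simp: eps_idem)
  then show ?thesis using assms unfolding \<epsilon>e_def sum_distrib_right by simp
qed

lemma ee_b: "\<epsilon>e * b = \<epsilon>e"
  unfolding \<epsilon>e_def sum_distrib_right using eps_b exc_index by (intro sum.cong) auto

lemma ee_idem: "\<epsilon>e * \<epsilon>e = \<epsilon>e"
proof -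
  have "\<epsilon>e * \<epsilon>e = (\<Sum>s=1..a. \<epsilon>e * \<epsilon> s)" by (subst (2) \<epsilon>e_def) (simp add: sum_distrib_left)
  also have "\<dots> = \<epsilon>e" unfolding \<epsilon>e_def[symmetric] by (subst (2) \<epsilon>e_def) (intro sum.cong, auto simp: ee_eps)
  finally show ?thesis .
qed

section \<open>The order \<open>\<Gamma>\<close>, its span and its centre\<close>

lemma f_props: shows f_idem: "f * f = f" and f_ee: "f * \<epsilon>e = f" "\<epsilon>e * f = f" and f_b: "f * b = f" "b * f = f"
  and f_RG: "\<exists>x\<in>RG. f = \<epsilon>e * x"
proof -
  show "f * f = f" by (rule basic_idem)
  obtain x where x: "f = \<epsilon>e * (x * b)" "x \<in> RG" using basic_idem(1) unfolding block_of_def \<epsilon>e_def by auto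
  show "\<epsilon>e * f = f" unfolding x using ee_idem by (simp flip: mult.assoc)
  then show "f * \<epsilon>e = f" using ee_central by metis
  show "f * b = f" unfolding x using b_idem by (simp add: mult.assoc)
  then show "b * f = f" using b_central by metis
  show "\<exists>x\<in>RG. f = \<epsilon>e * x" using x b_RG by auto
qed

lemma Gamma_iff: "x \<in> \<Gamma> \<longleftrightarrow> (\<exists>z\<in>RG. x = f * z * f)"
proof
  assume "x \<in> \<Gamma>"
  then obtain z where "x = f * (\<epsilon>e * (z * b)) * f" "z \<in> RG" unfolding Gamma_eq block_of_def \<epsilon>e_def by auto
  then have "x = f * (z * b) * f" using f_ee by (simp flip: mult.assoc)
  then show "\<exists>z\<in>RG. x = f * z * f" using \<open>z \<in> RG\<close> b_RG by auto
next
  assume "\<exists>z\<in>RG. x = f * z * f"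
  then obtain z where z: "z \<in> RG" "x = f * z * f" by auto
  have "x = f * (\<epsilon>e * (z * b)) * f" using z f_ee f_b by (metis mult.assoc)
  then show "x \<in> \<Gamma>" unfolding Gamma_eq block_of_def \<epsilon>e_def using z(1) by blast
qed

lemma f_RG': obtains x where "x \<in> RG" "f = \<epsilon>e * x" "f = x * \<epsilon>e"
  using f_RG ee_central by metis

lemma Gamma_f: assumes "x \<in> \<Gamma>" shows "f * x = x" "x * f = x"
proof -
  obtain z where x: "x = f * z * f" using assms unfolding Gamma_iff by auto
  show "f * x = x" unfolding x using f_idem by (simp flip: mult.assoc)
  show "x * f = x" unfolding x using f_idem by (simp add: mult.assoc)
qed

lemma f_Gamma: "f \<in> \<Gamma>"
  unfolding Gamma_iff using f_idem by (intro bexI[of _ 1]) auto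

lemma Gamma_add: "x \<in> \<Gamma> \<Longrightarrow> z \<in> \<Gamma> \<Longrightarrow> x + z \<in> \<Gamma>"
  unfolding Gamma_iff by (auto simp flip: distrib_left distrib_right)

lemma Gamma_scal: "x \<in> \<Gamma> \<Longrightarrow> c \<in> R \<Longrightarrow> scal c x \<in> \<Gamma>"
  unfolding Gamma_iff by (auto intro!: bexI[of _ "scal c _"])

lemma Gamma_zero: "0 \<in> \<Gamma>" unfolding Gamma_iff by (intro bexI[of _ 0]) auto

lemma Gamma_minus: "x \<in> \<Gamma> \<Longrightarrow> - x \<in> \<Gamma>"
  unfolding Gamma_iff by (auto intro!: bexI[of _ "- _"])

lemma RG_cut_Gamma: "z \<in> RG \<Longrightarrow> f * z * f \<in> \<Gamma>" unfolding Gamma_iff by blast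

text \<open>\<open>f\<close> does not lie in the group ring, but it acts as an element of the group ring on the exceptional part.\<close>

lemma Gamma_mult: assumes "x \<in> \<Gamma>" "z \<in> \<Gamma>" shows "x * z \<in> \<Gamma>"
proof -
  obtain x' z' where *: "x = f * x' * f" "z = f * z' * f" "x' \<in> RG" "z' \<in> RG" using assms unfolding Gamma_iff by auto
  obtain h where h: "h \<in> RG" "f = \<epsilon>e * h" using f_RG' by metis
  have "x * z = f * x' * f * (z' * f)" using * f_idem by (metis mult.assoc)
  also have "\<dots> = f * x' * (\<epsilon>e * h) * z' * f" using h by (simp add: mult.assoc)
  also have "\<dots> = f * (x' * \<epsilon>e) * h * z' * f" by (simp add: mult.assoc)
  also have "\<dots> = f * (\<epsilon>e * x') * h * z' * f" by (simp only: ee_central[of x'])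
  also have "\<dots> = (f * \<epsilon>e) * (x' * h * z') * f" by (simp add: mult.assoc)
  finally show ?thesis using f_ee RG_cut_Gamma[of "x' * h * z'"] * h by auto
qed

lemma Gamma_ring: "ring (sub_rng \<Gamma> f)"
  by (rule ring_sub_rngI) (auto intro: f_Gamma Gamma_zero Gamma_minus Gamma_add Gamma_mult simp: Gamma_f)

lemma Gamma_diff: "x \<in> \<Gamma> \<Longrightarrow> z \<in> \<Gamma> \<Longrightarrow> x - z \<in> \<Gamma>"
  using sub_rng_closed(8)[OF Gamma_ring] .

lemma Gamma_sum: "(\<And>i. i \<in> I \<Longrightarrow> h i \<in> \<Gamma>) \<Longrightarrow> sum h I \<in> \<Gamma>"
  by (induction I rule: infinite_finite_induct) (auto intro: Gamma_zero Gamma_add)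

text \<open>\<open>H\<close> is \<open>K\<Gamma>\<close>, see \<open>span_Gamma\<close> below, and \<open>C\<close> is its centre.\<close>

definition "H = {x. f * x = x \<and> x * f = x}"

definition "C = {z \<in> H. \<forall>x\<in>H. z * x = x * z}"

lemma H_closed: "f \<in> H" "0 \<in> H" "x \<in> H \<Longrightarrow> z \<in> H \<Longrightarrow> x + z \<in> H" "x \<in> H \<Longrightarrow> z \<in> H \<Longrightarrow> x * z \<in> H"
  "x \<in> H \<Longrightarrow> scal c x \<in> H" "x \<in> H \<Longrightarrow> - x \<in> H" "x \<in> H \<Longrightarrow> z \<in> H \<Longrightarrow> x - z \<in> H" "f * z * f \<in> H"
proof -
  show "f * z * f \<in> H" unfolding H_def using f_idem mult.assoc[of f z f, symmetric]
    by (simp add: mult.assoc) (simp add: mult.assoc[symmetric])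
  show "x \<in> H \<Longrightarrow> z \<in> H \<Longrightarrow> x * z \<in> H" unfolding H_def using mult.assoc[of f x z] by (simp add: mult.assoc)
qed (use f_idem in \<open>auto simp: H_def distrib_left distrib_right left_diff_distrib right_diff_distrib\<close>)

lemma H_sum: "(\<And>i. i \<in> I \<Longrightarrow> h i \<in> H) \<Longrightarrow> sum h I \<in> H"
  by (induction I rule: infinite_finite_induct) (auto intro: H_closed)

lemma H_f: "x \<in> H \<Longrightarrow> f * x = x" "x \<in> H \<Longrightarrow> x * f = x" unfolding H_def by auto

lemma Gamma_H: "x \<in> \<Gamma> \<Longrightarrow> x \<in> H" unfolding H_def using Gamma_f by auto

lemma eps_H: assumes "s \<in> {1..a+e}" "x \<in> H" shows "x * \<epsilon> s \<in> H"
proof -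
  have x: "f * x = x" "x * f = x" using assms(2) unfolding H_def by auto
  have "f * (x * \<epsilon> s) = x * \<epsilon> s" using x by (simp flip: mult.assoc)
  moreover have "(x * \<epsilon> s) * f = x * f * \<epsilon> s" using eps_central[OF assms(1), of f] by (simp add: mult.assoc)
  ultimately have "f * (x * \<epsilon> s) = x * \<epsilon> s" "(x * \<epsilon> s) * f = x * \<epsilon> s" using x by simp_all
  then show ?thesis unfolding H_def by blast
qed

lemma H_dense: assumes "x \<in> H" shows "\<exists>m. scal (of_nat p ^ m) x \<in> \<Gamma>"
proof -
  obtain m where "scal (of_nat p ^ m) x \<in> RG" using RG_dense by blast
  from RG_cut_Gamma[OF this] have "scal (of_nat p ^ m) x \<in> \<Gamma>" using H_f[OF assms] by simp
  then show ?thesis ..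
qed

lemma span_Gamma: "kg.span \<Gamma> = H"
proof
  have "kg.subspace H" unfolding kg.subspace_def using H_closed by auto
  then show "kg.span \<Gamma> \<subseteq> H" using Gamma_H by (intro kg.span_minimal) auto
  show "H \<subseteq> kg.span \<Gamma>"
  proof
    fix x assume "x \<in> H"
    then obtain m where m: "scal (of_nat p ^ m) x \<in> \<Gamma>" using H_dense by blast
    have "x = scal (inverse (of_nat p ^ m)) (scal (of_nat p ^ m) x)" using p_nonzero by simp
    then show "x \<in> kg.span \<Gamma>" using kg.span_scale[OF kg.span_base[OF m]] by metis
  qed
qed

lemma KGamma_iff: "s \<in> {1..a} \<Longrightarrow> x \<in> {z * \<epsilon> s |z. z \<in> kg.span \<Gamma>} \<longleftrightarrow> x \<in> H \<and> x * \<epsilon> s = x"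
  unfolding span_Gamma using eps_H[OF exc_index] eps_idem[OF exc_index] by (auto simp: mult.assoc) metis

lemma C_I: "z \<in> H \<Longrightarrow> (\<And>x. x \<in> H \<Longrightarrow> z * x = x * z) \<Longrightarrow> z \<in> C" unfolding C_def by blast

lemma C_comm: "z \<in> C \<Longrightarrow> x \<in> H \<Longrightarrow> z * x = x * z" unfolding C_def by blast

lemma C_H: "z \<in> C \<Longrightarrow> z \<in> H" unfolding C_def by blast

lemma C_iff_Gamma: "z \<in> C \<longleftrightarrow> z \<in> H \<and> (\<forall>x\<in>\<Gamma>. z * x = x * z)"
proof
  assume z: "z \<in> H \<and> (\<forall>x\<in>\<Gamma>. z * x = x * z)"
  have "z * x = x * z" if x: "x \<in> H" for x
  proof -
    obtain m where "scal (of_nat p ^ m) x \<in> \<Gamma>" using H_dense[OF x] by blast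
    with z have "scal (of_nat p ^ m) (z * x) = scal (of_nat p ^ m) (x * z)" by fastforce
    then show ?thesis using p_nonzero by simp
  qed
  with z show "z \<in> C" by (intro C_I) auto
qed (use C_comm C_H Gamma_H in blast)

lemma Z_iff: "z \<in> Z \<longleftrightarrow> z \<in> \<Gamma> \<and> z \<in> C"
  unfolding Z_eq ring_center_def C_iff_Gamma sub_rng_simps using Gamma_H by blast

lemma C_closed: "f \<in> C" "0 \<in> C" "x \<in> C \<Longrightarrow> z \<in> C \<Longrightarrow> x + z \<in> C" "x \<in> C \<Longrightarrow> z \<in> C \<Longrightarrow> x * z \<in> C"
  "x \<in> C \<Longrightarrow> scal c x \<in> C" "x \<in> C \<Longrightarrow> - x \<in> C" "x \<in> C \<Longrightarrow> z \<in> C \<Longrightarrow> x - z \<in> C"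
proof -
  show "f \<in> C" "0 \<in> C" by (intro C_I; simp add: H_closed H_f)+
  show "x * z \<in> C" if "x \<in> C" "z \<in> C"
  proof (rule C_I)
    fix t assume t: "t \<in> H"
    have "x * z * t = x * (z * t)" by (rule mult.assoc)
    also have "\<dots> = x * t * z" using C_comm[OF that(2) t] by (simp only: mult.assoc)
    also have "\<dots> = t * (x * z)" using C_comm[OF that(1) t] by (simp only: mult.assoc)
    finally show "x * z * t = t * (x * z)" .
  qed (use H_closed(4) C_H that in blast)
  show "x + z \<in> C" "x - z \<in> C" if "x \<in> C" "z \<in> C"
    using that[THEN C_comm] that[THEN C_H]
    by (intro C_I; simp add: H_closed(3,7) distrib_left distrib_right left_diff_distrib right_diff_distrib)+
  show "scal c x \<in> C" "- x \<in> C" if "x \<in> C"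
    using that[THEN C_comm] that[THEN C_H] by (intro C_I; simp add: H_closed(5,6))+
qed

lemma C_sum: "(\<And>i. i \<in> I \<Longrightarrow> h i \<in> C) \<Longrightarrow> sum h I \<in> C"
  by (induction I rule: infinite_finite_induct) (auto intro: C_closed)

lemma C_eps: assumes "s \<in> {1..a+e}" "z \<in> C" shows "z * \<epsilon> s \<in> C"
proof -
  have "z * \<epsilon> s * x = x * (z * \<epsilon> s)" if "x \<in> H" for x
    using C_comm[OF assms(2) that] eps_central[OF assms(1), of x] by (metis mult.assoc)
  then show ?thesis using eps_H[OF assms(1) C_H[OF assms(2)]] by (intro C_I)
qed

text \<open>The separate centres become components of the single commutative ring \<open>C\<close>,
  in which sums over \<open>s\<close> can be formed.\<close>

lemma Zs_iff: assumes "s \<in> {1..a}" shows "z \<in> Zs s \<longleftrightarrow> z \<in> C \<and> z * \<epsilon> s = z"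
proof
  assume z: "z \<in> Zs s"
  then have z': "z \<in> H" "z * \<epsilon> s = z"
    using KGamma_iff[OF assms, of z] unfolding Zs_eq ring_center_def sub_rng_simps by blast+
  have "z * x = x * z" if x: "x \<in> H" for x
  proof -
    have "x * \<epsilon> s \<in> {x * \<epsilon> s |x. x \<in> kg.span \<Gamma>}" unfolding span_Gamma using x by blast
    then have "z * (x * \<epsilon> s) = (x * \<epsilon> s) * z" using z unfolding Zs_eq ring_center_def sub_rng_simps by blast
    then show ?thesis using z'(2) eps_central[OF exc_index[OF assms]] by (metis mult.assoc)
  qed
  then show "z \<in> C \<and> z * \<epsilon> s = z" using z' by (auto intro: C_I)
next
  assume "z \<in> C \<and> z * \<epsilon> s = z"
  then have z: "z \<in> C" "z * \<epsilon> s = z" by auto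
  have 1: "z \<in> {x * \<epsilon> s |x. x \<in> kg.span \<Gamma>}" using KGamma_iff[OF assms, of z] z C_H by blast
  have 2: "\<forall>x\<in>{x * \<epsilon> s |x. x \<in> kg.span \<Gamma>}. z * x = x * z"
  proof
    fix x assume "x \<in> {x * \<epsilon> s |x. x \<in> kg.span \<Gamma>}"
    then have "x \<in> H" using KGamma_iff[OF assms, of x] by simp
    then show "z * x = x * z" by (rule C_comm[OF z(1)])
  qed
  show "z \<in> Zs s" unfolding Zs_eq ring_center_def sub_rng_simps
    by (rule CollectI, rule conjI[OF 1 2])
qed

lemma Z_closed: "f \<in> Z" "0 \<in> Z" "x \<in> Z \<Longrightarrow> z \<in> Z \<Longrightarrow> x + z \<in> Z" "x \<in> Z \<Longrightarrow> z \<in> Z \<Longrightarrow> x * z \<in> Z"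
  "x \<in> Z \<Longrightarrow> r \<in> R \<Longrightarrow> scal r x \<in> Z" "x \<in> Z \<Longrightarrow> - x \<in> Z" "x \<in> Z \<Longrightarrow> z \<in> Z \<Longrightarrow> x - z \<in> Z"
  unfolding Z_iff using C_closed f_Gamma Gamma_zero Gamma_add Gamma_mult Gamma_scal Gamma_minus Gamma_diff by auto

lemma Z_sum: "(\<And>i. i \<in> I \<Longrightarrow> h i \<in> Z) \<Longrightarrow> sum h I \<in> Z"
  by (induction I rule: infinite_finite_induct) (auto intro: Z_closed)

lemma Z_C: "z \<in> Z \<Longrightarrow> z \<in> C" and Z_Gamma: "z \<in> Z \<Longrightarrow> z \<in> \<Gamma>" and Z_H: "z \<in> Z \<Longrightarrow> z \<in> H"
  unfolding Z_iff using C_H by auto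

lemma Rs_Zs: "r \<in> Rs s \<Longrightarrow> r \<in> Zs s"
  unfolding Rs_eq ring_of_integers_def integral_closure_def by auto

section \<open>Matrix units and matrix entries over the centre\<close>

lemma E_props:
  assumes "s \<in> {1..a}" "i \<in> {1..n}" "j \<in> {1..n}"
  shows E_H: "E s i j \<in> H" and E_eps: "E s i j * \<epsilon> s = E s i j"
  using units(2)[OF assms] KGamma_iff[OF assms(1)] by auto

lemma E_mult:
  assumes "s \<in> {1..a}" "i \<in> {1..n}" "j \<in> {1..n}" "k \<in> {1..n}" "l \<in> {1..n}"
  shows "E s i j * E s k l = (if j = k then E s i l else 0)"
  using units(1)[OF assms(1)] assms unfolding mat_units_def by blast

lemma E_eps_other:
  assumes "s \<in> {1..a}" "t \<in> {1..a}" "s \<noteq> t" "i \<in> {1..n}" "j \<in> {1..n}"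
  shows "E s i j * \<epsilon> t = 0"
proof -
  have "E s i j * \<epsilon> t = E s i j * (\<epsilon> s * \<epsilon> t)" using E_eps[OF assms(1,4,5)] by (simp flip: mult.assoc)
  then show ?thesis using eps_orth[OF exc_index[OF assms(1)] exc_index[OF assms(2)] assms(3)] by simp
qed

lemma E_orth:
  assumes "s \<in> {1..a}" "t \<in> {1..a}" "s \<noteq> t" "i \<in> {1..n}" "j \<in> {1..n}" "k \<in> {1..n}" "l \<in> {1..n}"
  shows "E s i j * E t k l = 0"
proof -
  have "E s i j * E t k l = E s i j * (E t k l * \<epsilon> t)" using E_eps[OF assms(2,6,7)] by simp
  also have "\<dots> = E s i j * \<epsilon> t * E t k l"
    using eps_central[OF exc_index[OF assms(2)], of "E t k l"] by (simp add: mult.assoc)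
  finally show ?thesis using E_eps_other[OF assms(1-5)] by simp
qed

definition "M i j = (\<Sum>s=1..a. E s i j)"

definition "w = (\<Sum>s=1..a. y s * \<pi> s)"

definition "wZ = {w * z |z. z \<in> Z}"

text \<open>The entry \<open>x\<^sub>i\<^sub>j\<close> of \<open>x = \<Sum> x\<^sub>i\<^sub>j e\<^sub>i\<^sub>j\<close>, as an element of the centre.\<close>

definition "coord i j x = (\<Sum>k=1..n. M k i * x * M j k)"

lemma M_H: "i \<in> {1..n} \<Longrightarrow> j \<in> {1..n} \<Longrightarrow> M i j \<in> H"
  unfolding M_def by (intro H_sum E_H)

lemma M_eps: assumes "s \<in> {1..a}" "i \<in> {1..n}" "j \<in> {1..n}" shows "M i j * \<epsilon> s = E s i j"
proof -
  have "M i j * \<epsilon> s = (\<Sum>t=1..a. if t = s then E s i j else 0)"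
    unfolding M_def sum_distrib_right using assms by (intro sum.cong) (auto simp: E_eps E_eps_other)
  then show ?thesis using assms by simp
qed

lemma M_mult:
  assumes "i \<in> {1..n}" "j \<in> {1..n}" "k \<in> {1..n}" "l \<in> {1..n}"
  shows "M i j * M k l = (if j = k then M i l else 0)"
proof -
  have "M i j * M k l = (\<Sum>s=1..a. \<Sum>t=1..a. E s i j * E t k l)"
    unfolding M_def sum_product ..
  also have "\<dots> = (\<Sum>s=1..a. \<Sum>t=1..a. if t = s then (if j = k then E s i l else 0) else 0)"
    using assms by (intro sum.cong) (auto simp: E_mult E_orth)
  finally show ?thesis by (simp add: M_def)
qed

lemma sum_E: "s \<in> {1..a} \<Longrightarrow> (\<Sum>i=1..n. E s i i) = f * \<epsilon> s"
  using units(1) unfolding mat_units_def by blast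

lemma sum_M: "(\<Sum>i=1..n. M i i) = f"
proof -
  have "(\<Sum>i=1..n. M i i) = (\<Sum>s=1..a. \<Sum>i=1..n. E s i i)" unfolding M_def by (rule sum.swap)
  also have "\<dots> = (\<Sum>s=1..a. f * \<epsilon> s)" by (intro sum.cong refl sum_E)
  also have "\<dots> = f * \<epsilon>e" unfolding \<epsilon>e_def sum_distrib_left ..
  finally show ?thesis using f_ee by simp
qed

lemma H_sum_eps: assumes "x \<in> H" shows "x = (\<Sum>s=1..a. x * \<epsilon> s)"
proof -
  have "x = x * (f * \<epsilon>e)" using f_ee H_f[OF assms] by simp
  also have "\<dots> = x * \<epsilon>e" using H_f[OF assms] by (simp flip: mult.assoc)
  finally show ?thesis unfolding \<epsilon>e_def sum_distrib_left .
qed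

lemma Zs_C: "s \<in> {1..a} \<Longrightarrow> z \<in> Zs s \<Longrightarrow> z \<in> C" using Zs_iff by blast

lemma Rs_C: "s \<in> {1..a} \<Longrightarrow> z \<in> Rs s \<Longrightarrow> z \<in> C" using Rs_Zs Zs_C by blast

lemma Rs_eps: "s \<in> {1..a} \<Longrightarrow> z \<in> Rs s \<Longrightarrow> z * \<epsilon> s = z" using Rs_Zs Zs_iff by blast

lemma pi_Rs: "s \<in> {1..a} \<Longrightarrow> \<pi> s \<in> Rs s" using pi_prime by blast

lemma y_Rs: "s \<in> {1..a} \<Longrightarrow> y s \<in> Rs s" using y_unit unfolding Units_def by auto

lemma w_C: "w \<in> C" unfolding w_def by (rule C_sum, rule C_closed(4); rule Rs_C; (assumption | erule y_Rs pi_Rs))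

lemma sum_eps_component:
  assumes "\<And>s. s \<in> {1..a} \<Longrightarrow> x s * \<epsilon> s = x s" "t \<in> {1..a}"
  shows "(\<Sum>s=1..a. x s) * \<epsilon> t = x t"
proof -
  have "x s * \<epsilon> t = (if s = t then x t else 0)" if "s \<in> {1..a}" for s
  proof (cases "s = t")
    case False
    have "x s * \<epsilon> t = x s * (\<epsilon> s * \<epsilon> t)" using assms(1)[OF that] by (simp flip: mult.assoc)
    then show ?thesis using eps_orth[OF exc_index[OF that] exc_index[OF assms(2)] False] False by simp
  qed (use assms in auto)
  then have "(\<Sum>s=1..a. x s) * \<epsilon> t = (\<Sum>s=1..a. if s = t then x t else 0)"
    unfolding sum_distrib_right by (intro sum.cong) auto
  then show ?thesis using assms(2) by simp
qed

lemma w_eps: assumes "s \<in> {1..a}" shows "w * \<epsilon> s = y s * \<pi> s"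
  unfolding w_def by (rule sum_eps_component) (use assms Rs_eps pi_Rs in \<open>auto simp: mult.assoc\<close>)

lemma sum_times_M:
  assumes "\<And>s. s \<in> {1..a} \<Longrightarrow> x s \<in> C \<and> x s * \<epsilon> s = x s" "i \<in> {1..n}" "j \<in> {1..n}"
  shows "(\<Sum>s=1..a. x s) * M i j = (\<Sum>s=1..a. x s * E s i j)"
proof -
  have "x s * M i j = x s * E s i j" if s: "s \<in> {1..a}" for s
  proof -
    have "x s * M i j = x s * (\<epsilon> s * M i j)" using assms(1)[OF s] by (simp flip: mult.assoc)
    also have "\<epsilon> s * M i j = E s i j" using eps_central[OF exc_index[OF s], of "M i j"] M_eps[OF s assms(2,3)] by simp
    finally show ?thesis .
  qed
  then show ?thesis unfolding sum_distrib_right by (intro sum.cong) auto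
qed

lemma n_index: "1 \<in> {1..n}" "n \<in> {1..n}" using n_gt_1 by auto

lemma M_diag_Gamma: "i \<in> {1..n} \<Longrightarrow> M i i \<in> \<Gamma>"
  unfolding M_def by (rule diag_Gamma)

text \<open>Below the diagonal, \<open>M i j\<close> is a product of the subdiagonal generators
  \<open>M (Suc k) k\<close>.\<close>

lemma M_lower_Gamma: assumes "1 \<le> j" "j \<le> i" "i \<le> n" shows "M i j \<in> \<Gamma>"
  using assms(2,3)
proof (induction i rule: dec_induct)
  case base
  then show ?case using assms(1) by (intro M_diag_Gamma) auto
next
  case (step i)
  have "M (Suc i) i \<in> \<Gamma>" using coord_sub[of i] step assms(1) unfolding M_def by auto
  then have "M (Suc i) i * M i j \<in> \<Gamma>" using step by (intro Gamma_mult) auto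
  then show ?case using step assms(1) by (simp add: M_mult)
qed

lemma wM_1n: "w * M 1 n = (\<Sum>s=1..a. y s * \<pi> s * E s 1 n)"
  unfolding w_def
proof (rule sum_times_M[OF _ n_index])
  fix s assume s: "s \<in> {1..a}"
  show "y s * \<pi> s \<in> C \<and> y s * \<pi> s * \<epsilon> s = y s * \<pi> s"
    using C_closed(4)[OF Rs_C Rs_C] y_Rs pi_Rs Rs_eps[OF s pi_Rs] s by (simp add: mult.assoc)
qed

text \<open>The corner \<open>w * M 1 n\<close> can be moved to any position, because the flanking
  units \<open>M i 1\<close> and \<open>M n j\<close> lie on or below the diagonal.\<close>

lemma wM_Gamma: assumes "i \<in> {1..n}" "j \<in> {1..n}" shows "w * M i j \<in> \<Gamma>"
proof -
  have "M i 1 * (w * M 1 n) * M n j \<in> \<Gamma>"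
  proof (rule Gamma_mult[OF Gamma_mult])
    obtain x where x: "w * M 1 n = M 1 1 * x * M n n" "x \<in> \<Gamma>"
      using y_elem unfolding wM_1n[symmetric] M_def[symmetric] by (elim CollectE exE conjE)
    show "w * M 1 n \<in> \<Gamma>" unfolding x(1) by (intro Gamma_mult M_diag_Gamma n_index x(2))
  qed (use assms in \<open>auto intro: M_lower_Gamma\<close>)
  also have "M i 1 * (w * M 1 n) * M n j = w * (M i 1 * M 1 n * M n j)"
    using C_comm[OF w_C M_H[OF assms(1) n_index(1)]] by (metis mult.assoc)
  also have "M i 1 * M 1 n * M n j = M i j" using assms n_index by (simp add: M_mult)
  finally show ?thesis .
qed

lemma w_Z: "w \<in> Z"
proof -
  have "w = w * (\<Sum>i=1..n. M i i)" using sum_M H_f C_H[OF w_C] by simp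
  also have "\<dots> = (\<Sum>i=1..n. w * M i i)" by (rule sum_distrib_left)
  also have "\<dots> \<in> \<Gamma>" by (intro Gamma_sum wM_Gamma)
  finally show ?thesis using w_C unfolding Z_iff by simp
qed

lemma wZ_closed: "0 \<in> wZ" "x \<in> wZ \<Longrightarrow> z \<in> wZ \<Longrightarrow> x + z \<in> wZ" "x \<in> wZ \<Longrightarrow> - x \<in> wZ"
  "x \<in> wZ \<Longrightarrow> z \<in> Z \<Longrightarrow> x * z \<in> wZ" "x \<in> wZ \<Longrightarrow> z \<in> Z \<Longrightarrow> z * x \<in> wZ" "x \<in> wZ \<Longrightarrow> x \<in> Z"
proof -
  show "0 \<in> wZ" unfolding wZ_def using Z_closed(2) by force
  show "x \<in> wZ \<Longrightarrow> z \<in> wZ \<Longrightarrow> x + z \<in> wZ" unfolding wZ_def using Z_closed(3) by (auto simp flip: distrib_left)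
  show "x \<in> wZ \<Longrightarrow> - x \<in> wZ" unfolding wZ_def using Z_closed(6) by (auto simp flip: mult_minus_right)
  show *: "x \<in> wZ \<Longrightarrow> z \<in> Z \<Longrightarrow> x * z \<in> wZ" for x z unfolding wZ_def using Z_closed(4) by (auto simp: mult.assoc)
  show xZ: "x \<in> wZ \<Longrightarrow> x \<in> Z" for x unfolding wZ_def using Z_closed(4) w_Z by auto
  show "x \<in> wZ \<Longrightarrow> z \<in> Z \<Longrightarrow> z * x \<in> wZ" using * C_comm[OF Z_C Z_H, of z x] xZ by metis
qed

lemma wZ_sum: "(\<And>i. i \<in> I \<Longrightarrow> h i \<in> wZ) \<Longrightarrow> sum h I \<in> wZ"
  by (induction I rule: infinite_finite_induct) (auto intro: wZ_closed)

lemma coord_times_M: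
  assumes "z \<in> C" "i \<in> {1..n}" "j \<in> {1..n}" "k \<in> {1..n}" "l \<in> {1..n}"
  shows "coord i j (z * M k l) = (if i = k \<and> j = l then z else 0)"
proof -
  have "coord i j (z * M k l) = (\<Sum>m=1..n. z * (M m i * M k l * M j m))"
    unfolding coord_def
  proof (rule sum.cong)
    fix m assume "m \<in> {1..n}"
    then have "M m i * z = z * M m i" using C_comm[OF assms(1) M_H] assms by simp
    then show "M m i * (z * M k l) * M j m = z * (M m i * M k l * M j m)" by (metis mult.assoc)
  qed simp
  also have "\<dots> = (\<Sum>m=1..n. if i = k \<and> j = l then z * M m m else 0)"
    using assms by (intro sum.cong) (auto simp: M_mult)
  also have "\<dots> = (if i = k \<and> j = l then z else 0)"
    using sum_M H_f(2)[OF C_H[OF assms(1)]] by (auto simp flip: sum_distrib_left)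
  finally show ?thesis .
qed

lemma coord_add: "coord i j (x + z) = coord i j x + coord i j z"
  unfolding coord_def by (simp add: distrib_left distrib_right sum.distrib)

lemma coord_minus: "coord i j (- x) = - coord i j x"
  unfolding coord_def by (simp add: sum_negf)

lemma coord_sum: "coord i j (sum h I) = (\<Sum>k\<in>I. coord i j (h k))"
proof (induction I rule: infinite_finite_induct)
  case (insert x F)
  then show ?case by (simp add: coord_add)
qed (simp_all add: coord_def)

lemma coord_mult:
  assumes "i \<in> {1..n}" "j \<in> {1..n}" "x \<in> H" "z \<in> H"
  shows "coord i j (x * z) = (\<Sum>k=1..n. coord i k x * coord k j z)"
proof -
  have "(\<Sum>k=1..n. coord i k x * coord k j z) = (\<Sum>k=1..n. \<Sum>l=1..n. \<Sum>m=1..n. M l i * x * M k l * (M m k * z * M j m))"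
    unfolding coord_def sum_product ..
  also have "\<dots> = (\<Sum>k=1..n. \<Sum>l=1..n. \<Sum>m=1..n. if m = l then M l i * x * M k k * z * M j l else 0)"
  proof (intro sum.cong refl)
    fix k l m assume k: "k \<in> {1..n}" "l \<in> {1..n}" "m \<in> {1..n}"
    have "M l i * x * M k l * (M m k * z * M j m) = M l i * x * (M k l * M m k) * z * M j m"
      by (simp add: mult.assoc)
    then show "M l i * x * M k l * (M m k * z * M j m) = (if m = l then M l i * x * M k k * z * M j l else 0)"
      using k by (simp add: M_mult)
  qed
  also have "\<dots> = (\<Sum>k=1..n. \<Sum>l=1..n. M l i * x * M k k * z * M j l)" by simp
  also have "\<dots> = (\<Sum>l=1..n. \<Sum>k=1..n. M l i * x * M k k * z * M j l)" by (rule sum.swap)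
  also have "\<dots> = (\<Sum>l=1..n. M l i * x * (\<Sum>k=1..n. M k k) * z * M j l)"
    by (simp only: sum_distrib_left sum_distrib_right)
  also have "\<dots> = coord i j (x * z)"
    unfolding coord_def sum_M by (intro sum.cong refl) (simp add: mult.assoc H_f(1)[OF assms(4)] flip: mult.assoc[of f])
  finally show ?thesis by simp
qed

lemma coord_times_M_corner:
  assumes "i \<in> {1..n}" "j \<in> {1..n}"
  shows "coord i j x * M i j = M i i * x * M j j"
proof -
  have "coord i j x * M i j = (\<Sum>k=1..n. M k i * x * (M j k * M i j))"
    unfolding coord_def sum_distrib_right by (simp add: mult.assoc)
  also have "\<dots> = (\<Sum>k=1..n. if k = i then M i i * x * M j j else 0)"
    using assms by (intro sum.cong) (auto simp: M_mult)
  finally show ?thesis using assms by simp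
qed

lemma coord_diag: "z \<in> C \<Longrightarrow> i \<in> {1..n} \<Longrightarrow> j \<in> {1..n} \<Longrightarrow> coord i j z = (if i = j then z else 0)"
proof -
  assume *: "z \<in> C" "i \<in> {1..n}" "j \<in> {1..n}"
  have "z = (\<Sum>k=1..n. z * M k k)" using sum_M H_f(2)[OF C_H[OF *(1)]] by (simp flip: sum_distrib_left)
  then have "coord i j z = (\<Sum>k=1..n. coord i j (z * M k k))" using coord_sum by metis
  also have "\<dots> = (\<Sum>k=1..n. if k = i then (if i = j then z else 0) else 0)"
    using * by (intro sum.cong) (auto simp: coord_times_M)
  finally show ?thesis using * by simp
qed

definition "cell (i::nat) (j::nat) = (if i < j then wZ else Z)"

lemma cell_closed: "0 \<in> cell i j" "x \<in> cell i j \<Longrightarrow> z \<in> cell i j \<Longrightarrow> x + z \<in> cell i j"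
  "x \<in> cell i j \<Longrightarrow> - x \<in> cell i j"
  unfolding cell_def using wZ_closed Z_closed by auto

text \<open>If \<open>i < j\<close>, then \<open>i < k\<close> or \<open>k < j\<close>, so one of
  the two factors lies in the ideal \<open>wZ\<close>. This is why matrices with entries in the
  cells form a ring.\<close>

lemma cell_mult: "x \<in> cell i k \<Longrightarrow> z \<in> cell k j \<Longrightarrow> x * z \<in> cell i j"
  unfolding cell_def using wZ_closed(4-6) Z_closed(4) by (cases "i < k"; cases "k < j") auto

lemma cell_sum: "(\<And>k. k \<in> I \<Longrightarrow> h k \<in> cell i j) \<Longrightarrow> sum h I \<in> cell i j"
  by (induction I rule: infinite_finite_induct) (auto intro: cell_closed)

text \<open>The generators have their entries in the cells, and the cells are closed under the ring
  operations. Here the generating set of \<open>\<Gamma>\<close> enters.\<close>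

lemma Gamma_coord_cell:
  assumes "x \<in> \<Gamma>" "i \<in> {1..n}" "j \<in> {1..n}" shows "coord i j x \<in> cell i j"
proof -
  have "x \<in> generate_ring (sub_rng \<Gamma> f) (order_gens a n Z E y \<pi>)" using assms(1) y_gen by simp
  \<comment> \<open>Membership in \<open>\<Gamma>\<close> is carried along, because the additive
    inverse is taken in \<open>sub_rng \<Gamma> f\<close> and \<open>coord_mult\<close> requires
    both factors in \<open>H\<close>.\<close>
  then have "x \<in> \<Gamma> \<and> (\<forall>i\<in>{1..n}. \<forall>j\<in>{1..n}. coord i j x \<in> cell i j)"
  proof (induction rule: generate_ring.induct)
    case one
    then show ?case using f_Gamma coord_diag[OF C_closed(1)] wZ_closed(1) Z_closed(1,2) by (auto simp: cell_def)
  next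
    case (incl h)
    have "h \<in> \<Gamma>" using y_gen generate_ring.incl[OF incl] by blast
    moreover have "coord i j h \<in> cell i j" if ij: "i \<in> {1..n}" "j \<in> {1..n}" for i j
    proof -
      have fM: "f * M k l = M k l" if "k \<in> {1..n}" "l \<in> {1..n}" for k l using H_f(1)[OF M_H[OF that]] .
      have fM': "coord i j (M k l) = (if i = k \<and> j = l then f else 0)" if "k \<in> {1..n}" "l \<in> {1..n}" for k l
        using coord_times_M[OF C_closed(1) ij that] fM[OF that] by simp
      consider "h \<in> Z" | k where "h = M k k" "k \<in> {1..n}" | k where "h = M (k+1) k" "k \<in> {1..n-1}" | "h = w * M 1 n"
        using incl unfolding order_gens_def M_def[symmetric] wM_1n[symmetric] by auto
      then show ?thesis
      proof cases
        case 1
        then show ?thesis using coord_diag[OF Z_C ij] wZ_closed(1) Z_closed(2) by (auto simp: cell_def)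
      next
        case 2
        then show ?thesis using fM' wZ_closed(1) Z_closed(1,2) by (auto simp: cell_def)
      next
        case 3
        then have "k \<in> {1..n}" "k + 1 \<in> {1..n}" by auto
        then show ?thesis using 3 fM'[of "k + 1" k] wZ_closed(1) Z_closed(1,2) by (auto simp: cell_def)
      next
        case 4
        have "w \<in> wZ" unfolding wZ_def using H_f(2)[OF C_H[OF w_C]] Z_closed(1) by force
        then show ?thesis using 4 coord_times_M[OF w_C ij n_index] wZ_closed(1) Z_closed(2) w_Z by (auto simp: cell_def)
      qed
    qed
    ultimately show ?case by blast
  next
    case (a_inv h)
    then show ?case using a_inv_sub_rng[OF Gamma_ring] by (auto simp: Gamma_minus coord_minus cell_closed)
  next
    case (eng_add h1 h2)
    then show ?case by (auto simp: Gamma_add coord_add cell_closed)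
  next
    case (eng_mult h1 h2)
    have "coord i j (h1 * h2) \<in> cell i j" if "i \<in> {1..n}" "j \<in> {1..n}" for i j
    proof -
      have "h1 \<in> H" "h2 \<in> H" using eng_mult.IH Gamma_H by auto
      from coord_mult[OF that this] show ?thesis using eng_mult.IH that by (auto intro!: cell_sum cell_mult)
    qed
    then show ?case using eng_mult.IH by (auto intro: Gamma_mult)
  qed
  then show ?thesis using assms by blast
qed

lemma coord_Z: "x \<in> \<Gamma> \<Longrightarrow> i \<in> {1..n} \<Longrightarrow> j \<in> {1..n} \<Longrightarrow> coord i j x \<in> Z"
  using Gamma_coord_cell[of x i j] wZ_closed(6) unfolding cell_def by (auto split: if_splits)

end

section \<open>The components of the centre\<close>

lemma kg_dim_image:
  fixes V :: "('g::{finite,group_add} \<Rightarrow>\<^sub>0 'k::field) set" and \<phi> :: "('g \<Rightarrow>\<^sub>0 'k) \<Rightarrow> 'g \<Rightarrow>\<^sub>0 'k"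
  assumes "kg.subspace V" "Vector_Spaces.linear scal scal \<phi>" "inj_on \<phi> V"
  shows "kg.dim (\<phi> ` V) = kg.dim V"
proof -
  interpret P: vector_space_pair "scal :: 'k \<Rightarrow> ('g \<Rightarrow>\<^sub>0 'k) \<Rightarrow> _" "scal :: 'k \<Rightarrow> ('g \<Rightarrow>\<^sub>0 'k) \<Rightarrow> _" ..
  obtain B where B: "B \<subseteq> V" "kg.independent B" "V \<subseteq> kg.span B" "card B = kg.dim V"
    by (rule kg.basis_exists[of V])
  have sp: "kg.span B = V" using kg.span_minimal[OF B(1) assms(1)] B(3) by auto
  have "kg.independent (\<phi> ` B)"
    using P.linear_independent_injective_image[OF assms(2) B(2)] assms(3) sp by simp
  moreover have "kg.span (\<phi> ` B) = \<phi> ` V" using P.linear_span_image[OF assms(2)] sp by metis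
  ultimately have "kg.dim (\<phi> ` V) = card (\<phi> ` B)" using kg.dim_eq_card[of "\<phi> ` B" "\<phi> ` V"] 
    by (metis kg.span_span)
  also have "\<dots> = card B" using assms(3) B(1) by (intro card_image) (rule inj_on_subset)
  finally show ?thesis using B(4) by simp
qed

text \<open>A monic equation can be pulled back along an injective homomorphism. Polynomials of
  HOL-Algebra have nonzero leading coefficient, so that monic ones require
  \<open>\<one> \<noteq> \<zero>\<close>.\<close>

lemma integral_closure_hom:
  assumes "ring_hom_ring S S' h" "inj_on h (carrier S)" "A \<subseteq> carrier S" "x \<in> carrier S" "\<one>\<^bsub>S\<^esub> \<noteq> \<zero>\<^bsub>S\<^esub>"
  shows "h x \<in> integral_closure S' (h ` A) \<longleftrightarrow> x \<in> integral_closure S A"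
proof -
  interpret ring_hom_ring S S' h by fact
  have h1: "h \<one>\<^bsub>S\<^esub> \<noteq> \<zero>\<^bsub>S'\<^esub>"
    using inj_onD[OF assms(2), of "\<one>\<^bsub>S\<^esub>" "\<zero>\<^bsub>S\<^esub>"] assms(5) hom_zero by auto
  have eval: "eval (map h q) (h x) = h (R.eval q x)" if "set q \<subseteq> A" for q
    using eval_hom'[OF assms(4), of q] that assms(3) by simp
  show ?thesis
  proof
    assume "h x \<in> integral_closure S' (h ` A)"
    then obtain q' where q': "polynomial\<^bsub>S'\<^esub> (h ` A) q'" "q' \<noteq> []" "hd q' = \<one>\<^bsub>S'\<^esub>" "eval q' (h x) = \<zero>\<^bsub>S'\<^esub>"
      unfolding integral_closure_def by auto
    then have "q' \<in> lists (h ` A)" unfolding polynomial_def by auto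
    then obtain q where q: "q' = map h q" "set q \<subseteq> A" unfolding lists_image by auto
    have qc: "set q \<subseteq> carrier S" using q(2) assms(3) by auto
    have "hd q \<in> carrier S" using q' q(1) qc by (cases q) auto
    moreover have "h (hd q) = h \<one>\<^bsub>S\<^esub>" using q'(2,3) q(1) by (cases q) auto
    ultimately have hd: "hd q = \<one>\<^bsub>S\<^esub>" using inj_onD[OF assms(2)] by auto
    have "h (R.eval q x) = h \<zero>\<^bsub>S\<^esub>" using q'(4) eval[OF q(2)] q(1) by simp
    then have "R.eval q x = \<zero>\<^bsub>S\<^esub>" using inj_onD[OF assms(2)] R.eval_in_carrier[OF qc assms(4)] by auto
    then show "x \<in> integral_closure S A"
      unfolding integral_closure_def polynomial_def using assms(4,5) q(2) hd q'(2) q(1) by auto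
  next
    assume "x \<in> integral_closure S A"
    then obtain q where q: "polynomial\<^bsub>S\<^esub> A q" "q \<noteq> []" "hd q = \<one>\<^bsub>S\<^esub>" "R.eval q x = \<zero>\<^bsub>S\<^esub>"
      unfolding integral_closure_def by auto
    then have "set q \<subseteq> A" unfolding polynomial_def by auto
    then have "polynomial\<^bsub>S'\<^esub> (h ` A) (map h q)" "hd (map h q) = \<one>\<^bsub>S'\<^esub>" "eval (map h q) (h x) = \<zero>\<^bsub>S'\<^esub>"
      unfolding polynomial_def using q eval h1 by (auto simp: hd_map)
    then show "h x \<in> integral_closure S' (h ` A)"
      unfolding integral_closure_def using q(2) assms(4) by (auto intro!: exI[of _ "map h q"])
  qed
qed

context exceptional_order
begin

abbreviation "u s \<equiv> f * \<epsilon> s"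

lemma eps_component_C: "s \<in> {1..a} \<Longrightarrow> z \<in> C \<Longrightarrow> z * \<epsilon> s \<in> Zs s"
  using Zs_iff C_eps[OF exc_index] eps_idem[OF exc_index] by (auto simp: mult.assoc)

lemma coord_matrix:
  assumes s: "s \<in> {1..a}" and c: "\<forall>i\<in>{1..n}. \<forall>j\<in>{1..n}. c i j \<in> Zs s" and kl: "k \<in> {1..n}" "l \<in> {1..n}"
  shows "coord k l (\<Sum>i=1..n. \<Sum>j=1..n. c i j * E s i j) = c k l"
proof -
  have cM: "c i j * E s i j = c i j * M i j" if "i \<in> {1..n}" "j \<in> {1..n}" for i j
  proof -
    have cs: "c i j \<in> C" "c i j * \<epsilon> s = c i j" using c that Zs_iff[OF s] by blast+
    have "c i j * M i j = c i j * (\<epsilon> s * M i j)" using cs(2) by (simp flip: mult.assoc)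
    also have "\<epsilon> s * M i j = E s i j"
      using eps_central[OF exc_index[OF s], of "M i j"] M_eps[OF s that] by simp
    finally show ?thesis by simp
  qed
  have "coord k l (\<Sum>i=1..n. \<Sum>j=1..n. c i j * E s i j) = (\<Sum>i=1..n. \<Sum>j=1..n. coord k l (c i j * M i j))"
    unfolding coord_sum by (intro sum.cong refl) (simp only: cM)
  also have "\<dots> = (\<Sum>i=1..n. \<Sum>j=1..n. if j = l then (if i = k then c k l else 0) else 0)"
    using c Zs_C[OF s] kl by (intro sum.cong refl) (auto simp: coord_times_M)
  finally show ?thesis using kl by simp
qed

lemma coord_eps:
  assumes "s \<in> {1..a+e}" shows "coord i j (x * \<epsilon> s) = coord i j x * \<epsilon> s"
proof -
  have "M k i * (x * \<epsilon> s) * M j k = M k i * x * M j k * \<epsilon> s" for k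
    using eps_central[OF assms, of "M j k"] by (simp add: mult.assoc)
  then show ?thesis unfolding coord_def sum_distrib_right by simp
qed

lemma coord_C:
  assumes "x \<in> H" "i \<in> {1..n}" "j \<in> {1..n}" shows "coord i j x \<in> C"
proof -
  have "coord i j (x * \<epsilon> s) \<in> C" if s: "s \<in> {1..a}" for s
  proof -
    have "x * \<epsilon> s \<in> {x * \<epsilon> s |x. x \<in> kg.span \<Gamma>}" unfolding span_Gamma using assms(1) by blast
    then obtain c where c: "x * \<epsilon> s = (\<Sum>i=1..n. \<Sum>j=1..n. c i j * E s i j)"
      "\<forall>i\<in>{1..n}. \<forall>j\<in>{1..n}. c i j \<in> Zs s" unfolding coord_K[OF s] by blast
    show ?thesis unfolding c(1) coord_matrix[OF s c(2) assms(2,3)] using c(2) Zs_C[OF s] assms(2,3) by blast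
  qed
  then have "coord i j (\<Sum>s=1..a. x * \<epsilon> s) \<in> C" unfolding coord_sum by (intro C_sum)
  then show ?thesis using H_sum_eps[OF assms(1)] by simp
qed

text \<open>An element \<open>r\<close> of \<open>Rs s\<close>, placed at position
  \<open>(1, 1)\<close>, is a matrix of the component of \<open>\<Gamma>\<close> at
  \<open>s\<close>. Any lift of it to \<open>\<Gamma>\<close> has its \<open>(1, 1)\<close> entry in
  \<open>Z\<close>, and the component of this entry at \<open>s\<close> is \<open>r\<close>.\<close>

lemma Rs_iff: assumes s: "s \<in> {1..a}" shows "r \<in> Rs s \<longleftrightarrow> (\<exists>z\<in>Z. r = z * \<epsilon> s)"
proof -
  have Z_Rs: "z * \<epsilon> s \<in> Rs s" if z: "z \<in> Z" for z
  proof -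
    have "z * \<epsilon> s \<in> {x * \<epsilon> s |x. x \<in> \<Gamma>}" using z Z_Gamma by blast
    then obtain c where c: "z * \<epsilon> s = (\<Sum>i=1..n. \<Sum>j=1..n. c i j * E s i j)"
      "\<forall>i\<in>{1..n}. \<forall>j\<in>{1..n}. c i j \<in> Rs s \<and> (i < j \<longrightarrow> c i j \<in> {\<pi> s * r |r. r \<in> Rs s})"
      unfolding coord_Gamma[OF s] by blast
    have cZ: "\<forall>i\<in>{1..n}. \<forall>j\<in>{1..n}. c i j \<in> Zs s" using c(2) Rs_Zs by blast
    have "z * \<epsilon> s = coord 1 1 (z * \<epsilon> s)"
      using coord_diag[OF Z_C[OF z] n_index(1,1)] coord_eps[OF exc_index[OF s]] by simp
    also have "\<dots> = c 1 1" unfolding c(1) by (rule coord_matrix[OF s cZ n_index(1,1)])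
    finally show ?thesis using c(2) n_index by auto
  qed
  have zero: "0 \<in> Rs s" using Z_Rs[OF Z_closed(2)] by simp
  show ?thesis
  proof
    assume r: "r \<in> Rs s"
    define c where "c i j = (if i = 1 \<and> j = 1 then r else 0)" for i j :: nat
    have c: "\<forall>i\<in>{1..n}. \<forall>j\<in>{1..n}. c i j \<in> Rs s \<and> (i < j \<longrightarrow> c i j \<in> {\<pi> s * r |r. r \<in> Rs s})"
      unfolding c_def using r zero by (auto intro: exI[of _ 0])
    then have "(\<Sum>i=1..n. \<Sum>j=1..n. c i j * E s i j) \<in> {x * \<epsilon> s |x. x \<in> \<Gamma>}"
      unfolding coord_Gamma[OF s] by blast
    then obtain x where x: "(\<Sum>i=1..n. \<Sum>j=1..n. c i j * E s i j) = x * \<epsilon> s" "x \<in> \<Gamma>" by blast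
    have "c 1 1 = coord 1 1 (x * \<epsilon> s)"
      unfolding x(1)[symmetric] using c Rs_Zs by (intro coord_matrix[OF s _ n_index(1,1), symmetric]) blast
    then have "r = coord 1 1 x * \<epsilon> s" unfolding coord_eps[OF exc_index[OF s]] by (simp add: c_def)
    then show "\<exists>z\<in>Z. r = z * \<epsilon> s" using coord_Z[OF x(2) n_index(1,1)] by blast
  qed (use Z_Rs in blast)
qed

lemma eps_distrib: "s \<in> {1..a} \<Longrightarrow> (x * \<epsilon> s) * (z * \<epsilon> s) = (x * z) * \<epsilon> s"
  using eps_central[OF exc_index, of s z] eps_idem[OF exc_index, of s] by (metis mult.assoc)

lemma Rs_closed:
  assumes s: "s \<in> {1..a}"
  shows "u s \<in> Rs s" "0 \<in> Rs s" "x \<in> Rs s \<Longrightarrow> z \<in> Rs s \<Longrightarrow> x + z \<in> Rs s" "x \<in> Rs s \<Longrightarrow> z \<in> Rs s \<Longrightarrow> x * z \<in> Rs s"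
    "x \<in> Rs s \<Longrightarrow> - x \<in> Rs s" "x \<in> Rs s \<Longrightarrow> z \<in> Rs s \<Longrightarrow> x - z \<in> Rs s" "x \<in> Rs s \<Longrightarrow> r \<in> R \<Longrightarrow> scal r x \<in> Rs s"
proof -
  note I = Rs_iff[OF s]
  show "u s \<in> Rs s" "0 \<in> Rs s" unfolding I using Z_closed(1,2) by force+
  show "x \<in> Rs s \<Longrightarrow> z \<in> Rs s \<Longrightarrow> x + z \<in> Rs s" unfolding I using Z_closed(3) by (auto simp flip: distrib_right)
  show "x \<in> Rs s \<Longrightarrow> z \<in> Rs s \<Longrightarrow> x * z \<in> Rs s" unfolding I using Z_closed(4) eps_distrib[OF s] by blast
  show "x \<in> Rs s \<Longrightarrow> - x \<in> Rs s" unfolding I using Z_closed(6) by (auto simp flip: mult_minus_left)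
  show "x \<in> Rs s \<Longrightarrow> z \<in> Rs s \<Longrightarrow> x - z \<in> Rs s" unfolding I using Z_closed(7) by (auto simp flip: left_diff_distrib)
  show "x \<in> Rs s \<Longrightarrow> r \<in> R \<Longrightarrow> scal r x \<in> Rs s" unfolding I using Z_closed(5) by (auto simp flip: scal_mult_left)
qed

lemma u_unit: "s \<in> {1..a} \<Longrightarrow> z \<in> Zs s \<Longrightarrow> z * u s = z" "s \<in> {1..a} \<Longrightarrow> z \<in> Zs s \<Longrightarrow> u s * z = z"
proof -
  assume s: "s \<in> {1..a}" and z: "z \<in> Zs s"
  have *: "z * \<epsilon> s = z" "z * f = z" "f * z = z" using Zs_iff[OF s] z H_f[OF C_H] by blast+
  have "z * u s = z * f * \<epsilon> s" by (rule mult.assoc[symmetric])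
  then show "z * u s = z" unfolding * .
  have "u s * z = f * (\<epsilon> s * z)" by (rule mult.assoc)
  also have "\<dots> = f * (z * \<epsilon> s)" by (simp only: eps_central[OF exc_index[OF s]])
  finally show "u s * z = z" unfolding * .
qed

lemma Rs_u: "s \<in> {1..a} \<Longrightarrow> z \<in> Rs s \<Longrightarrow> z * u s = z" "s \<in> {1..a} \<Longrightarrow> z \<in> Rs s \<Longrightarrow> u s * z = z"
  using u_unit Rs_Zs by blast+

lemma Zs_comm: "s \<in> {1..a} \<Longrightarrow> x \<in> Zs s \<Longrightarrow> z \<in> Zs s \<Longrightarrow> x * z = z * x"
  using C_comm Zs_C C_H by blast

lemma Rs_comm: "s \<in> {1..a} \<Longrightarrow> x \<in> Rs s \<Longrightarrow> z \<in> Rs s \<Longrightarrow> x * z = z * x"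
  using Zs_comm Rs_Zs by blast

lemma Rs_ring: "s \<in> {1..a} \<Longrightarrow> ring (sub_rng (Rs s) (u s))"
  by (rule ring_sub_rngI) (auto simp: Rs_closed Rs_u simp del: atLeastAtMost_iff)

lemma Rs_dense: assumes s: "s \<in> {1..a}" and x: "x \<in> Zs s" shows "\<exists>m. scal (of_nat p ^ m) x \<in> Rs s"
proof -
  have xC: "x \<in> C" "x * \<epsilon> s = x" using x Zs_iff[OF s] by auto
  obtain m where "scal (of_nat p ^ m) x \<in> \<Gamma>" using H_dense[OF C_H[OF xC(1)]] by blast
  then have "scal (of_nat p ^ m) x \<in> Z" using C_closed(5)[OF xC(1)] unfolding Z_iff by simp
  then show ?thesis unfolding Rs_iff[OF s] using xC(2) by (intro exI[of _ m] bexI[of _ "scal (of_nat p ^ m) x"]) simp_all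
qed

text \<open>The ideal generated by \<open>f\<close> contains the identity \<open>\<epsilon>e\<close>; hence \<open>A\<^sub>s = A\<^sub>s f A\<^sub>s\<close>.\<close>

lemma ee_in_ideal_f: "\<exists>xs. \<epsilon>e = sum_list (map (\<lambda>(x, z). x * f * z) xs)"
proof -
  define \<Lambda> where "\<Lambda> = {\<epsilon>e * x |x. x \<in> block_of R b}"
  have \<Lambda>_iff: "x \<in> \<Lambda> \<longleftrightarrow> (\<exists>z\<in>RG. x = \<epsilon>e * z)" for x
  proof
    show "x \<in> \<Lambda> \<Longrightarrow> \<exists>z\<in>RG. x = \<epsilon>e * z" unfolding \<Lambda>_def block_of_def using b_RG by auto
    assume "\<exists>z\<in>RG. x = \<epsilon>e * z"
    then obtain z where z: "z \<in> RG" "x = \<epsilon>e * z" by auto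
    have "\<epsilon>e * z = \<epsilon>e * (b * z)" using ee_b by (simp flip: mult.assoc)
    also have "\<dots> = \<epsilon>e * (z * b)" by (simp only: b_central[of z])
    finally show "x \<in> \<Lambda>" unfolding \<Lambda>_def block_of_def z(2) using z(1) by blast
  qed
  have mult: "x * z \<in> \<Lambda>" if xz: "x \<in> \<Lambda>" "z \<in> \<Lambda>" for x z
  proof -
    obtain x' where x': "x = \<epsilon>e * x'" "x' \<in> RG" using xz(1) unfolding \<Lambda>_iff by blast
    obtain z' where z': "z = \<epsilon>e * z'" "z' \<in> RG" using xz(2) unfolding \<Lambda>_iff by blast
    note * = x'(1) z'(1) x'(2) z'(2)
    have "x * z = \<epsilon>e * (x' * \<epsilon>e) * z'" unfolding * by (simp add: mult.assoc)
    also have "\<dots> = \<epsilon>e * (\<epsilon>e * x') * z'" by (simp only: ee_central[of x'])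
    also have "\<dots> = \<epsilon>e * (x' * z')" using ee_idem by (simp flip: mult.assoc)
    finally show ?thesis unfolding \<Lambda>_iff using * by auto
  qed
  have one: "\<epsilon>e \<in> \<Lambda>" unfolding \<Lambda>_iff by (intro bexI[of _ 1]) auto
  have ring: "ring (sub_rng \<Lambda> \<epsilon>e)"
  proof (rule ring_sub_rngI)
    show "0 \<in> \<Lambda>" unfolding \<Lambda>_iff by (intro bexI[of _ 0]) auto
    show "\<epsilon>e * x = x \<and> x * \<epsilon>e = x" if "x \<in> \<Lambda>" for x
      using that ee_idem ee_central[of x] unfolding \<Lambda>_iff by (auto simp flip: mult.assoc)
    show "- x \<in> \<Lambda>" if "x \<in> \<Lambda>" for x using that unfolding \<Lambda>_iff by (auto simp flip: mult_minus_right)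
    show "x + z \<in> \<Lambda>" if "x \<in> \<Lambda>" "z \<in> \<Lambda>" for x z using that unfolding \<Lambda>_iff by (auto simp flip: distrib_left)
  qed (use one mult in auto)
  \<comment> \<open>The factors \<open>x\<close> and \<open>z\<close> of a summand may come from the
    whole group algebra, only the sum has to lie in \<open>\<Lambda>\<close>. Closure under the ring
    operations is then mere list manipulation.\<close>
  define J where "J = {x \<in> \<Lambda>. \<exists>xs. x = sum_list (map (\<lambda>(x, z). x * f * z) xs)}"
  interpret L: ring "sub_rng \<Lambda> \<epsilon>e" by (rule ring)
  have sl: "r * sum_list (map (\<lambda>(x, z). x * f * z) xs) = sum_list (map (\<lambda>(x, z). x * f * z) (map (\<lambda>(x, z). (r * x, z)) xs))"
    "sum_list (map (\<lambda>(x, z). x * f * z) xs) * r = sum_list (map (\<lambda>(x, z). x * f * z) (map (\<lambda>(x, z). (x, z * r)) xs))"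
    for r xs by (induction xs) (auto simp: distrib_left distrib_right mult.assoc)
  have "ideal J (sub_rng \<Lambda> \<epsilon>e)"
  proof (rule idealI[OF ring])
    show "subgroup J (add_monoid (sub_rng \<Lambda> \<epsilon>e))"
    proof (rule L.add.subgroupI)
      show "J \<subseteq> carrier (sub_rng \<Lambda> \<epsilon>e)" unfolding J_def by auto
      have "0 \<in> J" unfolding J_def using sub_rng_closed(2)[OF ring] by (auto intro: exI[of _ "[]"])
      then show "J \<noteq> {}" by auto
      show "\<ominus>\<^bsub>sub_rng \<Lambda> \<epsilon>e\<^esub> x \<in> J" if x: "x \<in> J" for x
      proof -
        obtain xs where xs: "x = sum_list (map (\<lambda>(x, z). x * f * z) xs)" "x \<in> \<Lambda>" using x unfolding J_def by auto
        have "- x = (- 1) * x" by simp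
        also have "\<dots> = sum_list (map (\<lambda>(x, z). x * f * z) (map (\<lambda>(x, z). (- 1 * x, z)) xs))"
          unfolding xs(1) by (rule sl)
        finally show ?thesis unfolding a_inv_sub_rng[OF ring xs(2)] J_def using sub_rng_closed(5)[OF ring xs(2)] by blast
      qed
      show "x \<oplus>\<^bsub>sub_rng \<Lambda> \<epsilon>e\<^esub> z \<in> J" if xz: "x \<in> J" "z \<in> J" for x z
      proof -
        obtain xs zs where *: "x = sum_list (map (\<lambda>(x, z). x * f * z) xs)" "x \<in> \<Lambda>"
          "z = sum_list (map (\<lambda>(x, z). x * f * z) zs)" "z \<in> \<Lambda>" using xz unfolding J_def by auto
        then have "x + z = sum_list (map (\<lambda>(x, z). x * f * z) (xs @ zs))" by simp
        then show ?thesis unfolding J_def sub_rng_simps using sub_rng_closed(6)[OF ring *(2,4)] by blast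
      qed
    qed
    show "r \<otimes>\<^bsub>sub_rng \<Lambda> \<epsilon>e\<^esub> x \<in> J" "x \<otimes>\<^bsub>sub_rng \<Lambda> \<epsilon>e\<^esub> r \<in> J" if xr: "x \<in> J" "r \<in> carrier (sub_rng \<Lambda> \<epsilon>e)" for x r
    proof -
      obtain xs where xs: "x = sum_list (map (\<lambda>(x, z). x * f * z) xs)" "x \<in> \<Lambda>" using xr unfolding J_def by auto
      have r: "r \<in> \<Lambda>" using xr by simp
      have e1: "r * x = sum_list (map (\<lambda>(x, z). x * f * z) (map (\<lambda>(x, z). (r * x, z)) xs))"
        unfolding xs(1) by (rule sl)
      have e2: "x * r = sum_list (map (\<lambda>(x, z). x * f * z) (map (\<lambda>(x, z). (x, z * r)) xs))"
        unfolding xs(1) by (rule sl)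
      have "r * x \<in> \<Lambda>" "x * r \<in> \<Lambda>" using mult xs(2) r by auto
      then show "r \<otimes>\<^bsub>sub_rng \<Lambda> \<epsilon>e\<^esub> x \<in> J" "x \<otimes>\<^bsub>sub_rng \<Lambda> \<epsilon>e\<^esub> r \<in> J"
        unfolding J_def sub_rng_simps using e1 e2 by blast+
    qed
  qed
  moreover have "f \<in> J"
    unfolding J_def \<Lambda>_iff using f_RG f_idem by (auto intro!: exI[of _ "[(1, f)]"])
  ultimately have "Idl\<^bsub>sub_rng \<Lambda> \<epsilon>e\<^esub> {f} \<subseteq> J" unfolding genideal_def by blast
  moreover have "Idl\<^bsub>sub_rng \<Lambda> \<epsilon>e\<^esub> {f} = \<Lambda>" using basic_idem(3) unfolding \<Lambda>_def \<epsilon>e_def .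
  ultimately have "\<epsilon>e \<in> J" using one by blast
  then show ?thesis unfolding J_def by blast
qed

text \<open>The centre of the component of \<open>KB\<close> at \<open>s\<close>, for which
  ramification and degree are known. The map \<open>\<zeta> \<mapsto> \<zeta> f\<close> will
  identify it with \<open>Zs s\<close> for \<open>s \<le> a\<close>.\<close>

definition "L s = ring_center (sub_rng {x * b * \<epsilon> s |x. True} (\<epsilon> s))"

lemma L_iff: assumes "s \<in> {1..a+e}" shows "\<zeta> \<in> L s \<longleftrightarrow> \<zeta> * \<epsilon> s = \<zeta> \<and> (\<forall>x. \<zeta> * x = x * \<zeta>)"
proof
  assume \<zeta>: "\<zeta> \<in> L s"
  then obtain x where "\<zeta> = x * b * \<epsilon> s" unfolding L_def ring_center_def by auto
  then have \<zeta>s: "\<zeta> * \<epsilon> s = \<zeta>" using eps_idem[OF assms] by (simp add: mult.assoc)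
  have "\<zeta> * z = z * \<zeta>" for z
  proof -
    have bs: "b * \<epsilon> s = \<epsilon> s" using b_central[of "\<epsilon> s"] eps_b[OF assms] by simp
    have "z * b * \<epsilon> s \<in> {x * b * \<epsilon> s |x. True}" by auto
    then have "\<zeta> * (z * b * \<epsilon> s) = z * b * \<epsilon> s * \<zeta>" using \<zeta> unfolding L_def ring_center_def sub_rng_simps by blast
    then have "\<zeta> * (z * \<epsilon> s) = z * (\<epsilon> s * \<zeta>)" using bs by (simp add: mult.assoc)
    then have "\<zeta> * (\<epsilon> s * z) = z * (\<zeta> * \<epsilon> s)" by (simp only: eps_central[OF assms])
    then show ?thesis using \<zeta>s by (simp flip: mult.assoc)
  qed
  with \<zeta>s show "\<zeta> * \<epsilon> s = \<zeta> \<and> (\<forall>x. \<zeta> * x = x * \<zeta>)" by blast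
next
  assume \<zeta>: "\<zeta> * \<epsilon> s = \<zeta> \<and> (\<forall>x. \<zeta> * x = x * \<zeta>)"
  have bs: "b * \<epsilon> s = \<epsilon> s" using b_central[of "\<epsilon> s"] eps_b[OF assms] by simp
  have 1: "\<zeta> \<in> {x * b * \<epsilon> s |x. True}"
    by (intro CollectI exI[of _ \<zeta>] conjI TrueI) (simp only: mult.assoc bs conjunct1[OF \<zeta>])
  have 2: "\<forall>x\<in>{x * b * \<epsilon> s |x. True}. \<zeta> * x = x * \<zeta>" by (rule ballI) (rule conjunct2[OF \<zeta>, rule_format])
  show "\<zeta> \<in> L s" unfolding L_def ring_center_def sub_rng_simps
    by (rule CollectI, rule conjI[OF 1 2])
qed

lemma L_props:
  assumes "s \<in> {1..a+e}" "\<zeta> \<in> L s"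
  shows L_eps: "\<zeta> * \<epsilon> s = \<zeta>" "\<epsilon> s * \<zeta> = \<zeta>" and L_comm: "\<zeta> * x = x * \<zeta>"
  using assms(2) eps_central[OF assms(1), of \<zeta>] unfolding L_iff[OF assms(1)] by metis+

lemma L_I: "s \<in> {1..a+e} \<Longrightarrow> \<zeta> * \<epsilon> s = \<zeta> \<Longrightarrow> (\<And>x. \<zeta> * x = x * \<zeta>) \<Longrightarrow> \<zeta> \<in> L s"
  using L_iff by blast

lemma L_mult: assumes "s \<in> {1..a+e}" "\<zeta> \<in> L s" "\<xi> \<in> L s" shows "\<zeta> * \<xi> \<in> L s"
proof (rule L_I[OF assms(1)])
  show "\<zeta> * \<xi> * \<epsilon> s = \<zeta> * \<xi>" using L_eps[OF assms(1,3)] by (simp add: mult.assoc)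
  show "\<zeta> * \<xi> * x = x * (\<zeta> * \<xi>)" for x
    using L_comm[OF assms(1,2), of x] L_comm[OF assms(1,3), of x] by (metis mult.assoc)
qed

lemma L_field: "s \<in> {1..a} \<Longrightarrow> field (sub_rng (L s) (\<epsilon> s))"
  using ramified unfolding totally_ramified_def L_def by blast

lemma L_ring: "s \<in> {1..a} \<Longrightarrow> ring (sub_rng (L s) (\<epsilon> s))"
  using L_field by (simp add: field_def domain_def cring_def)

lemma L_inverse:
  assumes "s \<in> {1..a}" "\<zeta> \<in> L s" "\<zeta> \<noteq> 0" obtains \<xi> where "\<xi> \<in> L s" "\<zeta> * \<xi> = \<epsilon> s"
proof -
  interpret field "sub_rng (L s) (\<epsilon> s)" by (rule L_field[OF assms(1)])
  have "\<zeta> \<in> Units (sub_rng (L s) (\<epsilon> s))" using assms field_Units by simp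
  then show ?thesis using that unfolding Units_def by auto
qed

lemma L_f_Zs: assumes s: "s \<in> {1..a}" and z: "\<zeta> \<in> L s" shows "\<zeta> * f \<in> Zs s"
proof -
  note c = L_comm[OF exc_index[OF s] z]
  have "\<zeta> * f \<in> H" using f_idem c[of f] unfolding H_def by (simp add: mult.assoc) (metis mult.assoc)
  moreover have "\<zeta> * f * x = x * (\<zeta> * f)" if "x \<in> H" for x
    using H_f[OF that] c[of x] by (metis mult.assoc)
  moreover have "\<zeta> * f * \<epsilon> s = \<zeta> * f"
    using eps_central[OF exc_index[OF s], of f] L_eps[OF exc_index[OF s] z] by (metis mult.assoc)
  ultimately show ?thesis unfolding Zs_iff[OF s] by (auto intro: C_I)
qed

text \<open>Writing \<open>\<epsilon>\<^sub>s = \<Sum> x f z\<close>, a central element \<open>c\<close> of \<open>f A\<^sub>s f\<close> is the image of \<open>\<Sum> x c z\<close>.\<close>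

lemma Zs_eq_L_f: assumes s: "s \<in> {1..a}" and c: "c \<in> Zs s" shows "\<exists>\<zeta>\<in>L s. c = \<zeta> * f"
proof -
  obtain xs where xs: "\<epsilon>e = sum_list (map (\<lambda>(x, z). x * f * z) xs)" using ee_in_ideal_f by blast
  define \<Phi> where "\<Phi> d = (\<Sum>(x, z)\<leftarrow>xs. x * d * z)" for d
  have cC: "c \<in> C" "c * \<epsilon> s = c" "c * f = c" "f * c = c" using c Zs_iff[OF s] H_f C_H by blast+
  have \<Phi>_f: "\<Phi> f = \<epsilon>e" unfolding \<Phi>_def xs by simp
  have es: "\<epsilon> s * \<epsilon>e = \<epsilon> s" using ee_central[of "\<epsilon> s"] ee_eps[OF s] by simp
  have push: "c * (f * t * f) = f * t * (f * c)" for t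
  proof -
    have "c * (f * t * f) = (f * t * f) * c" by (rule C_comm[OF cC(1) H_closed(8)])
    then show ?thesis by (simp add: mult.assoc)
  qed
  \<comment> \<open>With \<open>\<Phi> f = \<epsilon>e\<close> this becomes the centrality of
    \<open>\<Phi> c\<close>. The element \<open>c\<close> is moved from the left factor to the right
    one across some \<open>f t f\<close>, with which it commutes.\<close>
  have move: "\<Phi> c * t * \<Phi> f = \<Phi> f * t * \<Phi> c" for t
  proof -
    have prod: "\<Phi> d * t * \<Phi> d' = (\<Sum>(x, z)\<leftarrow>xs. \<Sum>(x', z')\<leftarrow>xs. x * d * z * t * x' * d' * z')" for d d'
    proof -
      have A: "\<Phi> d * r = (\<Sum>(x, z)\<leftarrow>xs. x * d * z * r)" for r
        unfolding \<Phi>_def by (induction xs) (auto simp: distrib_right)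
      have B: "r * \<Phi> d' = (\<Sum>(x', z')\<leftarrow>xs. r * x' * d' * z')" for r
        unfolding \<Phi>_def by (induction xs) (auto simp: distrib_left mult.assoc)
      have "x * d * z * (t * \<Phi> d') = (\<Sum>(x', z')\<leftarrow>xs. x * d * z * t * x' * d' * z')" for x z
        using B[of "x * d * z * t"] by (simp add: mult.assoc)
      then show ?thesis unfolding mult.assoc[of "\<Phi> d" t "\<Phi> d'"] unfolding A by simp
    qed
    have exchange: "x * c * z * t * x' * f * z' = x * f * z * t * x' * c * z'" for x z x' z'
    proof -
      have "x * c * z * t * x' * f * z' = x * (c * f) * (z * t * x') * f * z'" using cC by (simp add: mult.assoc)
      also have "\<dots> = x * (c * (f * (z * t * x') * f)) * z'" by (simp only: mult.assoc)
      also have "\<dots> = x * (f * (z * t * x') * (f * c)) * z'" unfolding push ..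
      also have "\<dots> = x * f * z * t * x' * c * z'" unfolding cC by (simp only: mult.assoc)
      finally show ?thesis .
    qed
    show ?thesis unfolding prod exchange ..
  qed
  have \<Phi>_left: "\<Phi> c * \<epsilon>e = \<epsilon>e * \<Phi> c" by (rule ee_central[symmetric])
  have \<Phi>_s: "\<Phi> c * \<epsilon> s = \<Phi> c"
  proof -
    have "x * c * z * \<epsilon> s = x * c * z" for x z
      using cC(2) eps_central[OF exc_index[OF s], of z] by (metis mult.assoc)
    then show ?thesis unfolding \<Phi>_def by (induction xs) (auto simp: distrib_right)
  qed
  have \<Phi>_ee: "\<Phi> c * \<epsilon>e = \<Phi> c" using \<Phi>_s es by (metis mult.assoc)
  have "\<Phi> c * t = t * \<Phi> c" for t
  proof -
    have "\<Phi> c * t = \<Phi> c * \<epsilon>e * t" using \<Phi>_ee by simp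
    also have "\<dots> = \<Phi> c * t * \<epsilon>e" using ee_central[of t] by (simp add: mult.assoc)
    also have "\<dots> = \<epsilon>e * t * \<Phi> c" using move \<Phi>_f by simp
    also have "\<dots> = t * (\<epsilon>e * \<Phi> c)" using ee_central[of t] by (simp add: mult.assoc)
    finally show ?thesis using \<Phi>_left \<Phi>_ee by simp
  qed
  then have L: "\<Phi> c \<in> L s" using \<Phi>_s by (intro L_I[OF exc_index[OF s]])
  have "\<Phi> c * f = \<epsilon>e * c"
  proof -
    have "x * c * z * f = x * f * z * f * c" for x z
    proof -
      have "x * c * z * f = x * (c * (f * z * f))" using cC by (simp add: mult.assoc) (metis mult.assoc)
      then show ?thesis unfolding push unfolding cC by (simp add: mult.assoc cC)
    qed
    then have "\<Phi> c * f = \<Phi> f * f * c" unfolding \<Phi>_def by (induction xs) (auto simp: distrib_right)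
    then show ?thesis unfolding \<Phi>_f using f_ee cC by (metis mult.assoc)
  qed
  moreover have "\<epsilon>e * c = c" using f_ee cC(4) by (metis mult.assoc)
  ultimately show ?thesis using L by metis
qed

lemma u_Zs: "s \<in> {1..a} \<Longrightarrow> u s \<in> Zs s" using Rs_closed(1) Rs_Zs by blast

text \<open>Since \<open>\<epsilon>e\<close> lies in the ideal generated by \<open>f\<close>, the
  idempotent \<open>\<epsilon> s\<close> would vanish together with \<open>u s\<close>.\<close>

lemma u_nonzero: assumes s: "s \<in> {1..a}" shows "u s \<noteq> 0"
proof
  assume u: "u s = 0"
  obtain xs where xs: "\<epsilon>e = sum_list (map (\<lambda>(x, z). x * f * z) xs)" using ee_in_ideal_f by blast
  have "x * f * z * \<epsilon> s = 0" for x z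
    using u eps_central[OF exc_index[OF s], of z] by (metis mult.assoc mult_zero_left mult_zero_right)
  then have "sum_list (map (\<lambda>(x, z). x * f * z) xs) * \<epsilon> s = 0" by (induction xs) (auto simp: distrib_right)
  then show False using ee_eps[OF s] eps_nonzero[OF exc_index[OF s]] xs by simp
qed

lemma L_f_inj: assumes s: "s \<in> {1..a}" and "\<zeta> \<in> L s" "\<xi> \<in> L s" "\<zeta> * f = \<xi> * f" shows "\<zeta> = \<xi>"
proof (rule ccontr)
  assume "\<zeta> \<noteq> \<xi>"
  have "\<zeta> - \<xi> \<in> L s" using sub_rng_closed(8)[OF L_ring[OF s]] assms by blast
  then obtain \<eta> where \<eta>: "\<eta> \<in> L s" "(\<zeta> - \<xi>) * \<eta> = \<epsilon> s" using L_inverse[OF s, of "\<zeta> - \<xi>"] \<open>\<zeta> \<noteq> \<xi>\<close> by auto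
  have "(\<zeta> - \<xi>) * f = 0" using assms(4) by (simp add: left_diff_distrib)
  then have "(\<zeta> - \<xi>) * \<eta> * f = 0" using L_comm[OF exc_index[OF s] \<eta>(1), of f] by (metis mult.assoc mult_zero_left)
  then have "\<epsilon> s * f = 0" using \<eta>(2) by simp
  then show False using u_nonzero[OF s] eps_central[OF exc_index[OF s], of f] by simp
qed

lemma L_f_mult: assumes s: "s \<in> {1..a}" and "\<zeta> \<in> L s" "\<xi> \<in> L s" shows "(\<zeta> * f) * (\<xi> * f) = \<zeta> * \<xi> * f"
proof -
  have "(\<zeta> * f) * (\<xi> * f) = \<zeta> * (\<xi> * f) * f" using L_comm[OF exc_index[OF s] assms(3), of f] by (metis mult.assoc)
  then show ?thesis using f_idem by (simp add: mult.assoc)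
qed

lemma Zs_inverse:
  assumes s: "s \<in> {1..a}" and z: "z \<in> Zs s" "z \<noteq> 0" obtains t where "t \<in> Zs s" "z * t = u s"
proof -
  obtain \<zeta> where \<zeta>: "\<zeta> \<in> L s" "z = \<zeta> * f" using Zs_eq_L_f[OF s z(1)] by blast
  have "\<zeta> \<noteq> 0" using z(2) \<zeta>(2) by auto
  then obtain \<xi> where \<xi>: "\<xi> \<in> L s" "\<zeta> * \<xi> = \<epsilon> s" using L_inverse[OF s \<zeta>(1)] by blast
  have "z * (\<xi> * f) = u s" using L_f_mult[OF s \<zeta>(1) \<xi>(1)] \<zeta>(2) \<xi>(2) eps_central[OF exc_index[OF s], of f] by simp
  then show ?thesis using that L_f_Zs[OF s \<xi>(1)] by blast
qed

lemma Zs_mult: assumes s: "s \<in> {1..a}" "x \<in> Zs s" "z \<in> Zs s" shows "x * z \<in> Zs s"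
  using assms C_closed(4) unfolding Zs_iff[OF s(1)] by (simp add: mult.assoc)

lemma Zs_diff: assumes s: "s \<in> {1..a}" "x \<in> Zs s" "z \<in> Zs s" shows "x - z \<in> Zs s"
  using assms C_closed(7) unfolding Zs_iff[OF s(1)] by (simp add: left_diff_distrib)

lemma Zs_no_zero_divisors:
  assumes s: "s \<in> {1..a}" "x \<in> Zs s" "z \<in> Zs s" "x * z = 0" shows "x = 0 \<or> z = 0"
proof (rule ccontr)
  assume *: "\<not> (x = 0 \<or> z = 0)"
  then obtain t where t: "t \<in> Zs s" "x * t = u s" using Zs_inverse[OF s(1,2)] by auto
  have "z = t * x * z" using t(2) Zs_comm[OF s(1) t(1) s(2)] u_unit(2)[OF s(1,3)] by simp
  then show False using s(4) * by (simp add: mult.assoc)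
qed

lemma Zs_cancel:
  assumes s: "s \<in> {1..a}" "x \<in> Zs s" "z \<in> Zs s" "t \<in> Zs s" "x \<noteq> 0" "x * z = x * t" shows "z = t"
  using Zs_no_zero_divisors[OF s(1,2) Zs_diff[OF s(1,3,4)]] s(5,6) by (simp add: right_diff_distrib)

lemma Zs_subspace: assumes s: "s \<in> {1..a}" shows "kg.subspace (Zs s)"
  unfolding kg.subspace_def
proof (intro conjI ballI allI)
  show "0 \<in> Zs s" using C_closed(2) unfolding Zs_iff[OF s] by simp
  show "x + z \<in> Zs s" if "x \<in> Zs s" "z \<in> Zs s" for x z
    using that C_closed(3) unfolding Zs_iff[OF s] by (simp add: distrib_right)
  show "scal c x \<in> Zs s" if "x \<in> Zs s" for c x
    using that C_closed(5) unfolding Zs_iff[OF s] by simp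
qed

lemma L_subspace: assumes s: "s \<in> {1..a}" shows "kg.subspace (L s)"
proof -
  have "scal c x \<in> L s" if "x \<in> L s" for c x
    using L_eps[OF exc_index[OF s] that] L_comm[OF exc_index[OF s] that] by (intro L_I[OF exc_index[OF s]]) simp_all
  then show ?thesis unfolding kg.subspace_def using sub_rng_closed(2,6)[OF L_ring[OF s]] by blast
qed

lemma dim_Zs: assumes s: "s \<in> {1..a}" shows "kg.dim (Zs s) = kg.dim (L s)"
proof -
  have "Zs s = (\<lambda>\<zeta>. \<zeta> * f) ` L s" using Zs_eq_L_f[OF s] L_f_Zs[OF s] by blast
  moreover have "Vector_Spaces.linear scal scal (\<lambda>\<zeta>. \<zeta> * f :: 'g \<Rightarrow>\<^sub>0 'k)"
    by unfold_locales (simp_all add: distrib_right)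
  moreover have "inj_on (\<lambda>\<zeta>. \<zeta> * f) (L s)" using L_f_inj[OF s] by (auto intro: inj_onI)
  ultimately show ?thesis using kg_dim_image[OF L_subspace[OF s]] by simp
qed

definition "O_L s = ring_of_integers R (L s) (\<epsilon> s)"

text \<open>Ramification is assumed for \<open>L s\<close>, while the coordinates live in
  \<open>Zs s\<close>; the isomorphism \<open>\<zeta> \<mapsto> \<zeta> f\<close> carries one ring
  of integers to the other.\<close>

lemma O_L_Rs: assumes s: "s \<in> {1..a}" "\<zeta> \<in> L s" shows "\<zeta> * f \<in> Rs s \<longleftrightarrow> \<zeta> \<in> O_L s"
proof -
  have Zs_ring: "ring (sub_rng (Zs s) (u s))"
  proof (rule ring_sub_rngI)
    show "- x \<in> Zs s" if "x \<in> Zs s" for x using kg.subspace_neg[OF Zs_subspace[OF s(1)] that] .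
    show "x + z \<in> Zs s" if "x \<in> Zs s" "z \<in> Zs s" for x z using kg.subspace_add[OF Zs_subspace[OF s(1)] that] .
    show "0 \<in> Zs s" using kg.subspace_0[OF Zs_subspace[OF s(1)]] .
  qed (use s u_Zs u_unit Zs_mult in blast)+
  have hom: "ring_hom_ring (sub_rng (L s) (\<epsilon> s)) (sub_rng (Zs s) (u s)) (\<lambda>\<zeta>. \<zeta> * f)"
  proof (rule ring_hom_ringI2[OF L_ring[OF s(1)] Zs_ring], rule ring_hom_memI)
    show "\<one>\<^bsub>sub_rng (L s) (\<epsilon> s)\<^esub> * f = \<one>\<^bsub>sub_rng (Zs s) (u s)\<^esub>"
      using eps_central[OF exc_index[OF s(1)], of f] by simp
  qed (use L_f_Zs[OF s(1)] L_f_mult[OF s(1)] in \<open>auto simp: distrib_right\<close>)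
  have inj: "inj_on (\<lambda>\<zeta>. \<zeta> * f) (carrier (sub_rng (L s) (\<epsilon> s)))" using L_f_inj[OF s(1)] by (auto intro: inj_onI)
  have one: "\<epsilon> s \<in> L s" using sub_rng_closed(1)[OF L_ring[OF s(1)]] .
  have sub: "{scal c (\<epsilon> s) |c. c \<in> R} \<subseteq> carrier (sub_rng (L s) (\<epsilon> s))"
    using kg.subspace_scale[OF L_subspace[OF s(1)] one] by auto
  have img: "(\<lambda>\<zeta>. \<zeta> * f) ` {scal c (\<epsilon> s) |c. c \<in> R} = {scal c (u s) |c. c \<in> R}"
    using eps_central[OF exc_index[OF s(1)], of f] by (auto simp: image_def)
  show ?thesis unfolding Rs_eq O_L_def ring_of_integers_def
    using integral_closure_hom[OF hom inj sub, of \<zeta>] s(2) eps_nonzero[OF exc_index[OF s(1)]] unfolding img by simp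
qed

lemma O_L_L: "\<zeta> \<in> O_L s \<Longrightarrow> \<zeta> \<in> L s"
  unfolding O_L_def ring_of_integers_def integral_closure_def by auto

section \<open>Divisibility by \<open>\<pi> s\<close> in \<open>Rs s\<close>\<close>

lemma pi_props:
  assumes s: "s \<in> {1..a}"
  shows pi_nonzero: "\<pi> s \<noteq> 0"
    and pi_nonunit: "\<not> (\<exists>r\<in>Rs s. \<pi> s * r = u s)"
    and pi_prime': "x \<in> Rs s \<Longrightarrow> z \<in> Rs s \<Longrightarrow> t \<in> Rs s \<Longrightarrow> x * z = \<pi> s * t \<Longrightarrow>
      (\<exists>r\<in>Rs s. x = \<pi> s * r) \<or> (\<exists>r\<in>Rs s. z = \<pi> s * r)"
proof -
  have p: "\<pi> s \<noteq> 0" "\<pi> s \<notin> Units (sub_rng (Rs s) (u s))"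
    "\<forall>x\<in>Rs s. \<forall>z\<in>Rs s. (\<exists>t\<in>Rs s. x * z = \<pi> s * t) \<longrightarrow> (\<exists>r\<in>Rs s. x = \<pi> s * r) \<or> (\<exists>r\<in>Rs s. z = \<pi> s * r)"
    using pi_prime[OF s] unfolding ring_prime_def prime_def factor_def sub_rng_simps by blast+
  show "\<pi> s \<noteq> 0" by (rule p)
  show "\<not> (\<exists>r\<in>Rs s. \<pi> s * r = u s)"
  proof
    assume "\<exists>r\<in>Rs s. \<pi> s * r = u s"
    then obtain r where r: "r \<in> Rs s" "\<pi> s * r = u s" by blast
    then have "r * \<pi> s = u s" using Rs_comm[OF s r(1) pi_Rs[OF s]] by simp
    then have "\<pi> s \<in> Units (sub_rng (Rs s) (u s))" unfolding Units_def using r pi_Rs[OF s] by auto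
    then show False using p by blast
  qed
  show "x \<in> Rs s \<Longrightarrow> z \<in> Rs s \<Longrightarrow> t \<in> Rs s \<Longrightarrow> x * z = \<pi> s * t \<Longrightarrow>
      (\<exists>r\<in>Rs s. x = \<pi> s * r) \<or> (\<exists>r\<in>Rs s. z = \<pi> s * r)" using p(3) by blast
qed

text \<open>The power \<open>x ^ 0\<close> is the identity of the group algebra, so powers are
  multiplied by \<open>u s\<close> to remain in \<open>Rs s\<close>.\<close>

lemma Rs_power: "s \<in> {1..a} \<Longrightarrow> x \<in> Rs s \<Longrightarrow> x ^ m * u s \<in> Rs s"
  by (induction m) (auto simp: mult.assoc Rs_closed simp del: atLeastAtMost_iff)

lemma pi_dvd_power:
  assumes s: "s \<in> {1..a}" and x: "x \<in> Rs s" and t: "t \<in> Rs s" "x ^ m * u s = \<pi> s * t"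
  shows "\<exists>r\<in>Rs s. x = \<pi> s * r"
  using t
proof (induction m arbitrary: t)
  case 0
  then show ?case using pi_nonunit[OF s] by fastforce
next
  case (Suc m)
  have "x * (x ^ m * u s) = \<pi> s * t" using Suc.prems by (simp add: mult.assoc)
  from pi_prime'[OF s x Rs_power[OF s x] Suc.prems(1) this] show ?case using Suc.IH by blast
qed

text \<open>The inverse of \<open>\<pi> s\<close> in the field \<open>Zs s\<close> has a power of
  \<open>p\<close> as denominator. Thus \<open>\<pi> s\<close> divides a power of \<open>p\<close>
  and, being prime, divides \<open>p\<close>.\<close>

lemma pi_dvd_p: assumes s: "s \<in> {1..a}" shows "\<exists>r\<in>Rs s. scal (of_nat p) (u s) = \<pi> s * r"
proof -
  obtain t where t: "t \<in> Zs s" "\<pi> s * t = u s"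
    using Zs_inverse[OF s Rs_Zs[OF pi_Rs[OF s]] pi_nonzero[OF s]] by blast
  obtain m where m: "scal (of_nat p ^ m) t \<in> Rs s" using Rs_dense[OF s t(1)] by blast
  have u2: "u s * u s = u s" using u_unit(1)[OF s u_Zs[OF s]] .
  have "scal (of_nat p) (u s) ^ m * u s = scal (of_nat p ^ m) (u s)"
  proof (induction m)
    case (Suc m)
    have "scal (of_nat p) (u s) ^ Suc m * u s = scal (of_nat p) (u s) * (scal (of_nat p) (u s) ^ m * u s)"
      by (simp only: power_Suc mult.assoc)
    also have "\<dots> = scal (of_nat p) (scal (of_nat p ^ m) (u s * u s))"
      unfolding Suc by (simp only: scal_mult_left scal_mult_right kg.scale_left_commute)
    finally show ?case unfolding u2 by simp
  qed simp
  also have "\<dots> = \<pi> s * scal (of_nat p ^ m) t" using t(2) by simp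
  finally show ?thesis using pi_dvd_power[OF s _ m] Rs_closed(7)[OF s Rs_closed(1)[OF s] R_of_nat] by blast
qed

lemma power_L_f: assumes s: "s \<in> {1..a}" "\<zeta> \<in> L s" shows "(\<zeta> * f) ^ Suc m = \<zeta> ^ Suc m * f"
proof (induction m)
  case (Suc m)
  have "f * \<zeta> ^ k = \<zeta> ^ k * f" for k
  proof (induction k)
    case (Suc k)
    have "f * \<zeta> ^ Suc k = (f * \<zeta>) * \<zeta> ^ k" unfolding power_Suc by (rule mult.assoc[symmetric])
    also have "f * \<zeta> = \<zeta> * f" by (rule L_comm[OF exc_index[OF s(1)] s(2), of f, symmetric])
    also have "\<zeta> * f * \<zeta> ^ k = \<zeta> * (\<zeta> ^ k * f)" unfolding Suc[symmetric] by (rule mult.assoc)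
    finally show ?case unfolding power_Suc mult.assoc .
  qed simp
  then have comm: "f * \<zeta> ^ Suc m = \<zeta> ^ Suc m * f" .
  have "(\<zeta> * f) ^ Suc (Suc m) = \<zeta> * f * (\<zeta> ^ Suc m * f)"
    unfolding power_Suc[of "\<zeta> * f" "Suc m"] Suc ..
  also have "\<dots> = \<zeta> * (f * \<zeta> ^ Suc m) * f" by (simp only: mult.assoc)
  also have "\<dots> = \<zeta> * \<zeta> ^ Suc m * (f * f)" unfolding comm by (simp only: mult.assoc)
  finally show ?case unfolding f_idem power_Suc[of \<zeta> "Suc m"] .
qed simp

text \<open>Total ramification supplies a prime \<open>q\<close> with \<open>q ^ d\<close>
  associated to \<open>p\<close>. As \<open>\<pi> s\<close> divides \<open>p\<close>, it divides
  \<open>q\<close>, say \<open>q = \<pi> s * t\<close>. The prime \<open>q\<close> divides one of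
  the two factors; if it were \<open>t\<close>, cancelling \<open>q\<close> would make
  \<open>\<pi> s\<close> a unit. So \<open>q\<close> divides \<open>\<pi> s\<close>, and
  \<open>p\<close> divides a power of it.\<close>

lemma pi_power_dvd_p: assumes s: "s \<in> {1..a}" shows "\<exists>N. \<exists>t\<in>Rs s. \<pi> s ^ N * u s = scal (of_nat p) t"
proof -
  note s' = exc_index[OF s]
  define d where "d = kg.dim (L s)"
  have "e * d = p ^ s - p ^ (s - 1)" using degree[OF s] unfolding d_def L_def .
  moreover have "p ^ (s - 1) < p ^ s" using s p_gt_1 by (intro power_strict_increasing) auto
  ultimately have "d > 0" by (cases d) auto
  \<comment> \<open>A positive exponent is required by \<open>power_L_f\<close>, since the power
    with exponent \<open>0\<close> of \<open>\<zeta> * f\<close> is \<open>1\<close> and not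
    \<open>f\<close>.\<close>
  then obtain d' where d': "d = Suc d'" by (cases d) auto
  obtain q where q: "q \<in> O_L s" "ring_prime\<^bsub>sub_rng (O_L s) (\<epsilon> s)\<^esub> q"
    "{scal (of_nat p) x |x. x \<in> O_L s} = {q ^ d * x |x. x \<in> O_L s}"
    using ramified[OF s] unfolding totally_ramified_def d_def O_L_def L_def by blast
  have qL: "q \<in> L s" by (rule O_L_L[OF q(1)])
  have q0: "q \<noteq> 0" using q(2) unfolding ring_prime_def by simp
  have one: "\<epsilon> s \<in> O_L s"
    using O_L_Rs[OF s, of "\<epsilon> s"] sub_rng_closed(1)[OF L_ring[OF s]] Rs_closed(1)[OF s] eps_central[OF s', of f] by simp
  define q' where "q' = q * f"
  have q'R: "q' \<in> Rs s" unfolding q'_def using O_L_Rs[OF s qL] q(1) by simp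
  have "q ^ d * \<epsilon> s \<in> {scal (of_nat p) x |x. x \<in> O_L s}" unfolding q(3) using one by blast
  then obtain x where x: "x \<in> O_L s" "q ^ d * \<epsilon> s = scal (of_nat p) x" by blast
  have "q' ^ d = q ^ d * f" unfolding q'_def d' by (rule power_L_f[OF s qL])
  then have "q' ^ d * u s = q ^ d * (f * u s)" by (simp add: mult.assoc)
  also have "f * u s = \<epsilon> s * f" using f_idem eps_central[OF s', of f] by (simp flip: mult.assoc)
  also have "q ^ d * (\<epsilon> s * f) = scal (of_nat p) (x * f)" using x(2) by (metis mult.assoc scal_mult_left)
  finally have q'd: "q' ^ d * u s = scal (of_nat p) (x * f)" .
  have xR: "x * f \<in> Rs s" using O_L_Rs[OF s O_L_L[OF x(1)]] x(1) by simp
  obtain r where r: "r \<in> Rs s" "scal (of_nat p) (u s) = \<pi> s * r" using pi_dvd_p[OF s] by blast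
  have "scal (of_nat p) (x * f) = scal (of_nat p) (u s) * (x * f)" using Rs_u(2)[OF s xR] by simp
  then have "q' ^ d * u s = \<pi> s * (r * (x * f))" using q'd r(2) by (simp add: mult.assoc)
  from pi_dvd_power[OF s q'R Rs_closed(4)[OF s r(1) xR] this]
  obtain t where t: "t \<in> Rs s" "q' = \<pi> s * t" by blast
  obtain \<zeta>1 where \<zeta>1: "\<zeta>1 \<in> L s" "\<pi> s = \<zeta>1 * f" using Zs_eq_L_f[OF s Rs_Zs[OF pi_Rs[OF s]]] by blast
  obtain \<zeta>2 where \<zeta>2: "\<zeta>2 \<in> L s" "t = \<zeta>2 * f" using Zs_eq_L_f[OF s Rs_Zs[OF t(1)]] by blast
  have O: "\<zeta>1 \<in> O_L s" "\<zeta>2 \<in> O_L s"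
    using O_L_Rs[OF s \<zeta>1(1)] O_L_Rs[OF s \<zeta>2(1)] \<zeta>1(2) \<zeta>2(2) pi_Rs[OF s] t(1) by auto
  have "q * f = \<zeta>1 * \<zeta>2 * f" using t(2) L_f_mult[OF s \<zeta>1(1) \<zeta>2(1)] \<zeta>1(2) \<zeta>2(2) unfolding q'_def by simp
  then have qz: "q = \<zeta>1 * \<zeta>2" using L_f_inj[OF s qL L_mult[OF s' \<zeta>1(1) \<zeta>2(1)]] by simp
  have "\<zeta>1 * \<zeta>2 = q * \<epsilon> s" using qz L_eps[OF s' qL] by simp
  then have "(\<exists>c\<in>O_L s. \<zeta>1 = q * c) \<or> (\<exists>c\<in>O_L s. \<zeta>2 = q * c)"
    using q(2) O one unfolding ring_prime_def prime_def factor_def sub_rng_simps by blast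
  then show ?thesis
  proof
    assume "\<exists>c\<in>O_L s. \<zeta>2 = q * c"
    then obtain c where c: "c \<in> O_L s" "\<zeta>2 = q * c" by blast
    have cR: "c * f \<in> Rs s" using O_L_Rs[OF s O_L_L[OF c(1)]] c(1) by simp
    have "t = q' * (c * f)" using \<zeta>2(2) c(2) L_f_mult[OF s qL O_L_L[OF c(1)]] unfolding q'_def by simp
    then have "q' * u s = \<pi> s * (q' * (c * f))" using t(2) Rs_u(1)[OF s q'R] by simp
    also have "\<dots> = q' * (\<pi> s * (c * f))" using Rs_comm[OF s pi_Rs[OF s] q'R] by (metis mult.assoc)
    finally have eq: "q' * u s = q' * (\<pi> s * (c * f))" .
    have "q' \<noteq> 0"
    proof
      assume "q' = 0"
      then have "q * f = 0 * f" unfolding q'_def by simp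
      then show False using L_f_inj[OF s qL] kg.subspace_0[OF L_subspace[OF s]] q0 by blast
    qed
    then have "u s = \<pi> s * (c * f)"
      using Zs_cancel[OF s Rs_Zs[OF q'R] u_Zs[OF s] Rs_Zs[OF Rs_closed(4)[OF s pi_Rs[OF s] cR]] _ eq] by blast
    then show ?thesis using pi_nonunit[OF s] cR by metis
  next
    assume "\<exists>c\<in>O_L s. \<zeta>1 = q * c"
    then obtain c where c: "c \<in> O_L s" "\<zeta>1 = q * c" by blast
    have cR: "c * f \<in> Rs s" using O_L_Rs[OF s O_L_L[OF c(1)]] c(1) by simp
    have pc: "\<pi> s = q' * (c * f)" using \<zeta>1(2) c(2) L_f_mult[OF s qL O_L_L[OF c(1)]] unfolding q'_def by simp
    have "(q' * (c * f)) ^ m * u s = (q' ^ m * u s) * ((c * f) ^ m * u s)" for m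
    proof (induction m)
      case (Suc m)
      have "(q' * (c * f)) ^ Suc m * u s = q' * (c * f) * ((q' ^ m * u s) * ((c * f) ^ m * u s))"
        using Suc by (simp add: mult.assoc)
      also have "\<dots> = q' * ((c * f) * (q' ^ m * u s)) * ((c * f) ^ m * u s)" by (simp only: mult.assoc)
      also have "(c * f) * (q' ^ m * u s) = (q' ^ m * u s) * (c * f)" by (rule Rs_comm[OF s cR Rs_power[OF s q'R]])
      also have "q' * ((q' ^ m * u s) * (c * f)) * ((c * f) ^ m * u s) = (q' ^ Suc m * u s) * ((c * f) ^ Suc m * u s)"
        by (simp add: mult.assoc)
      finally show ?case .
    qed (use u_unit(1)[OF s u_Zs[OF s]] in simp)
    from this[of d] have "\<pi> s ^ d * u s = scal (of_nat p) (x * f * ((c * f) ^ d * u s))"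
      unfolding pc[symmetric] q'd by simp
    then show ?thesis using Rs_closed(4)[OF s xR Rs_power[OF s cR]] by blast
  qed
qed

lemma Rs_dvd_p_power:
  assumes s: "s \<in> {1..a}" and x: "x \<in> Rs s" "x \<noteq> 0"
  shows "\<exists>m. \<exists>t\<in>Rs s. x * t = scal (of_nat p ^ m) (u s)"
proof -
  obtain t where t: "t \<in> Zs s" "x * t = u s" using Zs_inverse[OF s Rs_Zs[OF x(1)] x(2)] by blast
  obtain m where m: "scal (of_nat p ^ m) t \<in> Rs s" using Rs_dense[OF s t(1)] by blast
  then show ?thesis using t(2) by (intro exI[of _ m] bexI[of _ "scal (of_nat p ^ m) t"]) simp_all
qed

lemma p_power_dvd_pi_power:
  assumes s: "s \<in> {1..a}" shows "\<exists>M. \<exists>t\<in>Rs s. scal (of_nat p ^ m) (u s) * t = \<pi> s ^ M * u s"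
proof (induction m)
  case 0
  then show ?case using Rs_closed(1)[OF s] u_unit(1)[OF s u_Zs[OF s]]
    by (intro exI[of _ 0] bexI[of _ "u s"]) simp_all
next
  case (Suc m)
  then obtain M t where Mt: "t \<in> Rs s" "scal (of_nat p ^ m) (u s) * t = \<pi> s ^ M * u s" by blast
  obtain N t' where Nt: "t' \<in> Rs s" "\<pi> s ^ N * u s = scal (of_nat p) t'" using pi_power_dvd_p[OF s] by blast
  have "\<pi> s ^ (M + N) * u s = \<pi> s ^ M * (\<pi> s ^ N * u s)" by (simp add: power_add mult.assoc)
  also have "\<dots> = scal (of_nat p) (\<pi> s ^ M * t')" using Nt by simp
  also have "\<pi> s ^ M * t' = \<pi> s ^ M * u s * t'" using Rs_u(2)[OF s Nt(1)] by (simp add: mult.assoc)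
  also have "\<dots> = scal (of_nat p ^ m) (u s * (t * t'))" unfolding Mt(2)[symmetric] by (simp add: mult.assoc)
  finally have "scal (of_nat p ^ Suc m) (u s) * (t * t') = \<pi> s ^ (M + N) * u s" by simp
  then show ?case using Rs_closed(4)[OF s Mt(1) Nt(1)] by blast
qed

text \<open>Every nonzero element divides a power of \<open>p\<close>, hence a power of
  \<open>\<pi> s\<close>. If \<open>\<pi> s\<close> does not divide \<open>x\<close>, it divides the
  cofactor and can be cancelled there until the power is used up. So \<open>Rs s\<close> is
  local.\<close>

lemma Rs_unit:
  assumes s: "s \<in> {1..a}" and x: "x \<in> Rs s" and nd: "\<not> (\<exists>r\<in>Rs s. x = \<pi> s * r)"
  shows "\<exists>t\<in>Rs s. x * t = u s"
proof -
  have "x \<noteq> 0" using nd Rs_closed(2)[OF s] by force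
  obtain m t where t: "t \<in> Rs s" "x * t = scal (of_nat p ^ m) (u s)"
    using Rs_dvd_p_power[OF s x \<open>x \<noteq> 0\<close>] by blast
  obtain M t' where t': "t' \<in> Rs s" "scal (of_nat p ^ m) (u s) * t' = \<pi> s ^ M * u s"
    using p_power_dvd_pi_power[OF s] by blast
  have "t * t' \<in> Rs s" "x * (t * t') = \<pi> s ^ M * u s"
    using Rs_closed(4)[OF s t(1) t'(1)] t(2) t'(2) by (simp_all flip: mult.assoc)
  then show ?thesis
  proof (induction M arbitrary: t t')
    case 0
    then show ?case by (intro bexI[of _ "t * t'"]) simp_all
  next
    case (Suc M)
    define r where "r = t * t'"
    have r: "r \<in> Rs s" "x * r = \<pi> s * (\<pi> s ^ M * u s)" using Suc.prems unfolding r_def by (simp_all add: mult.assoc)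
    have "\<exists>r'\<in>Rs s. r = \<pi> s * r'"
      using pi_prime'[OF s x r(1) Rs_power[OF s pi_Rs[OF s]] r(2)] nd by blast
    then obtain r' where r': "r' \<in> Rs s" "r = \<pi> s * r'" by blast
    have "\<pi> s * (x * r') = x * r" unfolding r'(2) using Rs_comm[OF s x pi_Rs[OF s]] by (metis mult.assoc)
    then have "\<pi> s * (x * r') = \<pi> s * (\<pi> s ^ M * u s)" using r(2) by simp
    then have "x * r' = \<pi> s ^ M * u s"
      using Zs_cancel[OF s Rs_Zs[OF pi_Rs[OF s]] Rs_Zs[OF Rs_closed(4)[OF s x r'(1)]]
        Rs_Zs[OF Rs_power[OF s pi_Rs[OF s]]] pi_nonzero[OF s]] by blast
    then show ?case using Suc.IH[of r' "u s"] r' Rs_u(1)[OF s r'(1)] by simp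
  qed
qed

section \<open>Primitive idempotents of the block and the edges of the tree\<close>

definition "PI = (SOME P. finite P \<and> \<Sum>P = b \<and> (\<forall>h\<in>P. primitive_idem (sub_rng (block_of R b) b) h) \<and>
    (\<forall>h\<in>P. \<forall>h'\<in>P. h \<noteq> h' \<longrightarrow> h * h' = 0))"

lemma PI_props: shows PI_finite: "finite PI" and PI_sum: "\<Sum>PI = b"
  and PI_prim: "h \<in> PI \<Longrightarrow> primitive_idem (sub_rng (block_of R b) b) h"
proof -
  have bB: "b \<in> block_of R b" unfolding block_of_def using b_RG b_idem by force
  have "\<exists>P. finite P \<and> \<Sum>P = b \<and> (\<forall>h\<in>P. primitive_idem (sub_rng (block_of R b) b) h) \<and>
    (\<forall>h\<in>P. \<forall>h'\<in>P. h \<noteq> h' \<longrightarrow> h * h' = 0)"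
    unfolding primitive_idem_def using primitive_decomposition[OF bB b_idem] by simp
  from someI_ex[OF this] show "finite PI" "\<Sum>PI = b" "h \<in> PI \<Longrightarrow> primitive_idem (sub_rng (block_of R b) b) h"
    unfolding PI_def by blast+
qed

lemma prim_props:
  assumes "primitive_idem (sub_rng (block_of R b) b) h"
  shows prim_RG: "h \<in> RG" and prim_b: "h * b = h" "b * h = h" and prim_idem: "h * h = h" and prim_nonzero: "h \<noteq> 0"
proof -
  have h: "h \<in> block_of R b" "h * h = h" "h \<noteq> 0" using assms unfolding primitive_idem_def primitive_idem_in_def by auto
  then obtain x where x: "x \<in> RG" "h = x * b" unfolding block_of_def by auto
  show "h \<in> RG" using x b_RG by auto
  show "h * b = h" using x b_idem by (simp add: mult.assoc)
  then show "b * h = h" using b_central by metis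
  show "h * h = h" "h \<noteq> 0" by (rule h)+
qed

definition "ends h = {V \<in> brauer_vertices a e. \<exists>s \<in> V. h * \<epsilon> s \<noteq> 0}"

definition "PR = {h. primitive_idem (sub_rng (block_of R b) b) h}"

lemma tree_props:
  shows ends_card: "h \<in> PR \<Longrightarrow> card (ends h) = 2"
    and ends_all: "h \<in> PR \<Longrightarrow> V \<in> ends h \<Longrightarrow> s \<in> V \<Longrightarrow> h * \<epsilon> s \<noteq> 0"
    and ends_local: "h \<in> PR \<Longrightarrow> V \<in> ends h \<Longrightarrow> s \<in> V \<Longrightarrow>
      {h * x * h |x. x \<in> {x * b * \<epsilon> s |x. True}} = {z * h |z. z \<in> L s}"
    and tree_connected: "V \<in> brauer_vertices a e \<Longrightarrow> W \<in> brauer_vertices a e \<Longrightarrow>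
      (V, W) \<in> {(v, w). \<exists>h \<in> PR. v \<in> ends h \<and> w \<in> ends h}\<^sup>*"
    and tree_card: "card (PR // {(h, h'). h \<in> PR \<and> h' \<in> PR \<and> idem_equiv (sub_rng (block_of R b) b) h h'}) + 1
      = card (brauer_vertices a e)"
proof -
  note t = tree[unfolded brauer_tree_def Let_def, folded PR_def, folded ends_def, folded L_def, unfolded sub_rng_simps]
  show "h \<in> PR \<Longrightarrow> card (ends h) = 2"
    "h \<in> PR \<Longrightarrow> V \<in> ends h \<Longrightarrow> s \<in> V \<Longrightarrow> h * \<epsilon> s \<noteq> 0"
    "h \<in> PR \<Longrightarrow> V \<in> ends h \<Longrightarrow> s \<in> V \<Longrightarrow> {h * x * h |x. x \<in> {x * b * \<epsilon> s |x. True}} = {z * h |z. z \<in> L s}"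
    using conjunct1[OF t] by blast+
  show "V \<in> brauer_vertices a e \<Longrightarrow> W \<in> brauer_vertices a e \<Longrightarrow>
      (V, W) \<in> {(v, w). \<exists>h \<in> PR. v \<in> ends h \<and> w \<in> ends h}\<^sup>*"
    using conjunct1[OF conjunct2[OF t]] by blast
  show "card (PR // {(h, h'). h \<in> PR \<and> h' \<in> PR \<and> idem_equiv (sub_rng (block_of R b) b) h h'}) + 1
      = card (brauer_vertices a e)" using conjunct2[OF conjunct2[OF t]] .
qed

end

section \<open>The trace formula\<close>

context exceptional_order
begin

lemma times_E: assumes s: "s \<in> {1..a}" and z: "z \<in> C" and ij: "i \<in> {1..n}" "j \<in> {1..n}"
  shows "z * E s i j = z * \<epsilon> s * M i j"
proof -
  have "z * \<epsilon> s * M i j = z * (M i j * \<epsilon> s)" by (simp only: mult.assoc eps_central[OF exc_index[OF s]])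
  then show ?thesis unfolding M_eps[OF s ij] by simp
qed

lemma times_E': "s \<in> {1..a} \<Longrightarrow> z \<in> Zs s \<Longrightarrow> i \<in> {1..n} \<Longrightarrow> j \<in> {1..n} \<Longrightarrow> z * E s i j = z * M i j"
  using times_E Zs_iff by metis

lemma M_E: assumes "s \<in> {1..a}" "i \<in> {1..n}" "j \<in> {1..n}" "k \<in> {1..n}" "l \<in> {1..n}"
  shows "M i j * E s k l = (if j = k then E s i l else 0)"
proof -
  have "M i j * E s k l = M i j * M k l * \<epsilon> s" using M_eps[OF assms(1,4,5)] by (simp add: mult.assoc)
  then show ?thesis using assms M_eps[OF assms(1,2,5)] by (simp add: M_mult)
qed

lemma E_M: assumes "s \<in> {1..a}" "i \<in> {1..n}" "j \<in> {1..n}" "k \<in> {1..n}" "l \<in> {1..n}"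
  shows "E s i j * M k l = (if j = k then E s i l else 0)"
proof -
  have "E s i j * M k l = M i j * \<epsilon> s * M k l" using M_eps[OF assms(1-3)] by simp
  also have "\<dots> = M i j * M k l * \<epsilon> s" by (simp only: mult.assoc eps_central[OF exc_index[OF assms(1)]])
  finally show ?thesis using assms M_eps[OF assms(1,2,5)] by (simp add: M_mult)
qed

abbreviation "E1 s \<equiv> E s 1 1"

lemma exc_vertex: assumes "h \<in> PR" "s \<in> {1..a}" "h * \<epsilon> s \<noteq> 0" shows "{1..a} \<in> ends h"
  unfolding ends_def brauer_vertices_def using assms by blast

text \<open>Two rank-one idempotents of a simple algebra are equivalent. For \<open>h\<close> the
  rank is one because \<open>h\<close> cuts the component at \<open>s\<close> down to the field
  \<open>L s\<close>; a nonzero product through \<open>E s k k\<close> is thus invertible there and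
  can be normalized.\<close>

lemma primitive_equiv_E1:
  assumes h: "h \<in> PR" and s: "s \<in> {1..a}" and nz: "h * \<epsilon> s \<noteq> 0"
  shows "\<exists>\<alpha> \<beta>. \<alpha> * \<beta> = E1 s \<and> \<beta> * \<alpha> = h * \<epsilon> s \<and> E1 s * \<alpha> = \<alpha> \<and> \<beta> * E1 s = \<beta> \<and> \<alpha> * h = \<alpha> \<and> h * \<beta> = \<beta>"
proof -
  note s' = exc_index[OF s] and one = n_index(1)
  have hprim: "primitive_idem (sub_rng (block_of R b) b) h" using h unfolding PR_def by simp
  note hh = prim_idem[OF hprim]
  obtain xs where xs: "\<epsilon>e = sum_list (map (\<lambda>(x, z). x * f * z) xs)" using ee_in_ideal_f by blast
  \<comment> \<open>Otherwise \<open>h * \<epsilon> s\<close> would vanish, because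
    \<open>\<epsilon>e\<close> is the sum of the \<open>x * f * z\<close>.\<close>
  have "\<exists>(x, z)\<in>set xs. h * (x * f * z) * \<epsilon> s * h \<noteq> 0"
  proof (rule ccontr)
    assume "\<not> ?thesis"
    then have "h * sum_list (map (\<lambda>(x, z). x * f * z) xs) * \<epsilon> s * h = 0"
      by (induction xs) (auto simp: distrib_left distrib_right)
    then have "h * (\<epsilon>e * \<epsilon> s) * h = 0" unfolding xs[symmetric] by (simp add: mult.assoc)
    then have "h * (h * \<epsilon> s) = 0" using ee_eps[OF s] eps_central[OF s', of h] by (simp add: mult.assoc)
    then show False using hh nz by (simp flip: mult.assoc)
  qed
  then obtain x z where xz: "h * (x * f * z) * \<epsilon> s * h \<noteq> 0" by auto
  have "h * (x * f * z) * \<epsilon> s * h = h * x * u s * z * h"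
    using eps_central[OF s', of z] by (metis mult.assoc)
  also have "\<dots> = (\<Sum>k=1..n. h * x * E s k k * z * h)"
    unfolding sum_E[OF s, symmetric] by (simp only: sum_distrib_left sum_distrib_right)
  finally have "(\<Sum>k=1..n. h * x * E s k k * z * h) \<noteq> 0" using xz by simp
  then obtain k where k: "k \<in> {1..n}" "h * x * E s k k * z * h \<noteq> 0" by (meson sum.neutral)
  define \<alpha> where "\<alpha> = E s 1 k * z * h"
  define \<beta>0 where "\<beta>0 = h * x * E s k 1"
  have Ekk: "E s k 1 * E s 1 k = E s k k" using E_mult[OF s k(1) one one k(1)] by simp
  have ba: "\<beta>0 * \<alpha> = h * (x * E s k k * z) * h"
    unfolding \<alpha>_def \<beta>0_def Ekk[symmetric] by (simp only: mult.assoc)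
  define W where "W = x * E s k k * z"
  have "W * \<epsilon> s = x * (E s k k * \<epsilon> s) * z" unfolding W_def by (simp only: mult.assoc eps_central[OF s', of z])
  then have W\<epsilon>: "W * \<epsilon> s = W" unfolding E_eps[OF s k(1,1)] W_def .
  have "b * \<epsilon> s = \<epsilon> s" using b_central[of "\<epsilon> s"] eps_b[OF s'] by simp
  then have "W * b * \<epsilon> s = W" using W\<epsilon> by (simp add: mult.assoc)
  then have "W \<in> {x * b * \<epsilon> s |x. True}" by (intro CollectI exI[of _ W] conjI TrueI) (rule sym)
  then have "h * W * h \<in> {h * x * h |x. x \<in> {x * b * \<epsilon> s |x. True}}" by blast
  also have "\<dots> = {z * h |z. z \<in> L s}" by (rule ends_local[OF h exc_vertex[OF h s nz] s])
  finally obtain \<zeta> where \<zeta>: "\<zeta> \<in> L s" "h * W * h = \<zeta> * h" by blast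
  have nz2: "\<zeta> * h \<noteq> 0" using k(2) \<zeta>(2) unfolding W_def by (simp add: mult.assoc)
  then have "\<zeta> \<noteq> 0" by auto
  then obtain \<xi> where \<xi>: "\<xi> \<in> L s" "\<zeta> * \<xi> = \<epsilon> s" using L_inverse[OF s \<zeta>(1)] by blast
  have \<xi>\<zeta>: "\<xi> * \<zeta> = \<epsilon> s" using L_comm[OF s' \<zeta>(1), of \<xi>] \<xi>(2) by (rule subst)
  define \<beta> where "\<beta> = \<xi> * \<beta>0"
  have "\<beta> * \<alpha> = \<xi> * (\<beta>0 * \<alpha>)" unfolding \<beta>_def by (rule mult.assoc)
  also have "\<beta>0 * \<alpha> = \<zeta> * h" unfolding ba W_def[symmetric] by (rule \<zeta>(2))
  also have "\<xi> * (\<zeta> * h) = \<epsilon> s * h" unfolding \<xi>\<zeta>[symmetric] by (rule mult.assoc[symmetric])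
  finally have ba': "\<beta> * \<alpha> = h * \<epsilon> s" using eps_central[OF s', of h] by simp
  have \<alpha>1: "E1 s * \<alpha> = \<alpha>" unfolding \<alpha>_def using E_mult[OF s one one one k(1)] by (simp flip: mult.assoc)
  have \<alpha>h: "\<alpha> * h = \<alpha>" unfolding \<alpha>_def using hh by (simp add: mult.assoc)
  have \<beta>1: "\<beta> * E1 s = \<beta>" unfolding \<beta>_def \<beta>0_def using E_mult[OF s k(1) one one one] by (simp add: mult.assoc)
  have \<beta>h: "h * \<beta> = \<beta>"
  proof -
    have "h * \<beta> = \<xi> * (h * \<beta>0)" unfolding \<beta>_def using L_comm[OF s' \<xi>(1), of h] by (metis mult.assoc)
    then show ?thesis unfolding \<beta>_def \<beta>0_def using hh by (simp flip: mult.assoc)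
  qed
  have \<alpha>\<epsilon>: "\<alpha> * \<epsilon> s = \<alpha>" using \<alpha>1 E_eps[OF s one one] eps_central[OF s', of \<alpha>] by (metis mult.assoc)
  \<comment> \<open>The product in the other order is a nonzero idempotent in the corner at
    \<open>E1 s\<close>. That corner is the field \<open>Zs s\<close>, up to the factor
    \<open>M 1 1\<close>, so the idempotent is \<open>E1 s\<close> itself.\<close>
  define q where "q = \<alpha> * \<beta>"
  have qq: "q * q = q"
  proof -
    have "q * q = \<alpha> * (\<beta> * \<alpha>) * \<beta>" unfolding q_def by (simp only: mult.assoc)
    also have "\<dots> = \<alpha> * h * \<epsilon> s * \<beta>" unfolding ba' by (simp only: mult.assoc)
    finally show ?thesis unfolding \<alpha>h \<alpha>\<epsilon> q_def .
  qed
  have q1: "E1 s * q = q" "q * E1 s = q" unfolding q_def using \<alpha>1 \<beta>1 by (simp_all add: mult.assoc) (simp flip: mult.assoc)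
  have qM: "M 1 1 * q = q" "q * M 1 1 = q"
    using q1 M_E[OF s one one one one] E_M[OF s one one one one] by (metis mult.assoc)+
  have qH: "q \<in> H"
  proof -
    have "f * q = f * E1 s * q" "q * f = q * (E1 s * f)" using q1 by (metis mult.assoc)+
    then show ?thesis using H_f[OF E_H[OF s one one]] q1 unfolding H_def by simp
  qed
  define c where "c = coord 1 1 q"
  have cM: "c * M 1 1 = q" unfolding c_def coord_times_M_corner[OF one one] qM ..
  have cC: "c \<in> C" unfolding c_def by (rule coord_C[OF qH one one])
  have q\<epsilon>: "q * \<epsilon> s = q" using q1(2) E_eps[OF s one one] by (metis mult.assoc)
  have cZ: "c \<in> Zs s" using eps_component_C[OF s cC] unfolding c_def coord_eps[OF s', symmetric] q\<epsilon> .
  have "c * c * M 1 1 = c * M 1 1"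
  proof -
    have "c * c * M 1 1 = c * q" using cM by (simp add: mult.assoc)
    also have "c * q = c * (M 1 1 * q)" using qM by simp
    also have "\<dots> = q" using cM qq by (simp flip: mult.assoc)
    finally show ?thesis using cM by simp
  qed
  then have "coord 1 1 (c * c * M 1 1) = coord 1 1 (c * M 1 1)" by simp
  then have "c * c = c"
    unfolding coord_times_M[OF C_closed(4)[OF cC cC] one one one one] coord_times_M[OF cC one one one one] by simp
  then have "c * (c - u s) = 0" using u_unit(1)[OF s cZ] by (simp add: right_diff_distrib)
  then have "c = 0 \<or> c - u s = 0" using Zs_no_zero_divisors[OF s cZ Zs_diff[OF s cZ u_Zs[OF s]]] by blast
  moreover have "c \<noteq> 0"
  proof
    assume "c = 0"
    then have "q = 0" using cM by simp
    then have "\<beta> * q * \<alpha> = 0" by simp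
    moreover have "\<beta> * q * \<alpha> = (\<beta> * \<alpha>) * (\<beta> * \<alpha>)" unfolding q_def by (simp only: mult.assoc)
    moreover have "(h * \<epsilon> s) * (h * \<epsilon> s) = h * \<epsilon> s" unfolding eps_distrib[OF s] hh ..
    ultimately show False using ba' nz by simp
  qed
  ultimately have "c = u s" by simp
  then have "q = u s * M 1 1" using cM by simp
  also have "\<dots> = u s * E1 s" using times_E'[OF s u_Zs[OF s] one one] by simp
  also have "\<dots> = E1 s"
    using H_f(1)[OF E_H[OF s one one]] E_eps[OF s one one] eps_central[OF s', of "E1 s"] by (simp add: mult.assoc)
  finally show ?thesis using ba' \<alpha>1 \<beta>1 \<alpha>h \<beta>h unfolding q_def by blast
qed

text \<open>Each \<open>h * \<epsilon> s\<close> has rank \<open>0\<close> or \<open>1\<close>, so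
  this is the matrix degree of the component at \<open>s\<close>, that is, the degree of an
  exceptional character. It is the same for all \<open>s \<le> a\<close>, as these indices form one
  vertex.\<close>

definition "mult_exc = card {h \<in> PI. {1..a} \<in> ends h}"

lemma PI_PR: "h \<in> PI \<Longrightarrow> h \<in> PR" unfolding PR_def using PI_prim by simp

text \<open>The left side is the trace of left multiplication by \<open>z * E1 s\<close> on the
  group algebra (\<open>regular_trace\<close>), which splits along the left ideals generated by the
  \<open>h\<close> in \<open>PI\<close>. A summand whose edge meets the exceptional vertex
  contributes the trace of \<open>z\<close> on the line \<open>E1 s * KG * h\<close> over
  \<open>Zs s\<close>; the others contribute \<open>0\<close>.\<close>

lemma component_trace:
  assumes s: "s \<in> {1..a}" and z: "z \<in> Zs s"
  shows "of_nat (card (UNIV :: 'g set)) * coeff1 (z * E1 s) = of_nat mult_exc * alg_trace (Zs s) z"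
proof -
  note s' = exc_index[OF s] and one = n_index(1)
  let ?sg = "\<lambda>g. Poly_Mapping.single g 1 :: 'g \<Rightarrow>\<^sub>0 'k"
  define x where "x = z * E1 s"
  have x\<epsilon>: "x * \<epsilon> s = x" unfolding x_def using E_eps[OF s one one] by (simp add: mult.assoc)
  have xb: "x * b = x" using x\<epsilon> eps_b[OF s'] by (metis mult.assoc)
  have split: "x * v = (\<Sum>h\<in>PI. x * v * h)" for v
  proof -
    have "x * v = x * b * v" using xb by simp
    also have "\<dots> = x * v * b" by (simp only: mult.assoc b_central[of v])
    also have "\<dots> = x * v * \<Sum>PI" by (simp only: PI_sum)
    finally show ?thesis unfolding sum_distrib_left .
  qed
  have part: "(\<Sum>g\<in>UNIV. Poly_Mapping.lookup (x * ?sg g * h) g) = (if {1..a} \<in> ends h then alg_trace (Zs s) z else 0)"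
    if hP: "h \<in> PI" for h
  proof (cases "{1..a} \<in> ends h")
    case False
    have h0: "h * \<epsilon> s = 0" using exc_vertex[OF PI_PR[OF hP] s] False by blast
    have "x * v * h = 0" for v
    proof -
      have "x * v * h = x * \<epsilon> s * (v * h)" using x\<epsilon> by (simp add: mult.assoc)
      also have "\<dots> = x * v * (h * \<epsilon> s)" by (simp only: mult.assoc eps_central[OF s', of "v * h"])
      finally show ?thesis using h0 by simp
    qed
    then show ?thesis using False by simp
  next
    case True
    have nz: "h * \<epsilon> s \<noteq> 0" by (rule ends_all[OF PI_PR[OF hP] True s])
    obtain \<alpha> \<beta> where ab: "\<alpha> * \<beta> = E1 s" "\<beta> * \<alpha> = h * \<epsilon> s" "E1 s * \<alpha> = \<alpha>" "\<beta> * E1 s = \<beta>" "\<alpha> * h = \<alpha>" "h * \<beta> = \<beta>"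
      using primitive_equiv_E1[OF PI_PR[OF hP] s nz] by blast
    \<comment> \<open>The coordinate of \<open>x * v * h\<close> on that line with respect to its
      basis vector \<open>\<alpha>\<close>, see \<open>\<psi>\<alpha>\<close>. The trace is then
      computed by \<open>alg_trace_eq\<close>.\<close>
    define \<psi> where "\<psi> v = coord 1 1 (x * v * \<beta>)" for v
    have M1: "M 1 1 * E1 s = E1 s" "E1 s * M 1 1 = E1 s" using M_E[OF s one one one one] E_M[OF s one one one one] by simp_all
    have zM: "M 1 1 * z = z * M 1 1" using C_comm[OF Zs_C[OF s z] M_H[OF one one]] by simp
    have Mx: "M 1 1 * x = x" unfolding x_def using zM M1 by (metis mult.assoc)
    have bM: "\<beta> * M 1 1 = \<beta>" using ab(4) M1 by (metis mult.assoc)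
    have aM: "M 1 1 * \<alpha> = \<alpha>" using ab(3) M1 by (metis mult.assoc)
    have f1: "f * M 1 1 = M 1 1" "M 1 1 * f = M 1 1" using H_f[OF M_H[OF one one]] by auto
    have YH: "x * v * \<beta> \<in> H" for v
    proof -
      have "f * x = x" "\<beta> * f = \<beta>" using Mx bM f1 by (metis mult.assoc)+
      then show ?thesis unfolding H_def by (simp add: mult.assoc) (simp flip: mult.assoc)
    qed
    have Y\<epsilon>: "x * v * \<beta> * \<epsilon> s = x * v * \<beta>" for v
    proof -
      have "x * v * \<beta> * \<epsilon> s = x * \<epsilon> s * (v * \<beta>)" by (simp only: mult.assoc eps_central[OF s', of "v * \<beta>"])
      then show ?thesis using x\<epsilon> by (simp add: mult.assoc)
    qed
    have rng: "\<psi> v \<in> Zs s" for v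
      using eps_component_C[OF s coord_C[OF YH[of v] one one]]
      unfolding \<psi>_def coord_eps[OF s', symmetric] Y\<epsilon> .
    have lin: "Vector_Spaces.linear scal scal \<psi>"
      unfolding \<psi>_def coord_def
      by unfold_locales (simp_all add: distrib_left distrib_right sum.distrib kg.scale_sum_right)
    have \<psi>\<alpha>: "\<psi> v * \<alpha> = x * v * h" for v
    proof -
      have "\<psi> v * \<alpha> = \<psi> v * M 1 1 * \<alpha>" using aM by (simp add: mult.assoc)
      also have "\<psi> v * M 1 1 = M 1 1 * (x * v * \<beta>) * M 1 1"
        unfolding \<psi>_def by (rule coord_times_M_corner[OF one one])
      also have "\<dots> = x * v * \<beta>" using Mx bM by (metis mult.assoc)
      also have "x * v * \<beta> * \<alpha> = x * v * (h * \<epsilon> s)" using ab(2) by (simp add: mult.assoc)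
      also have "\<dots> = x * \<epsilon> s * (v * h)" by (simp only: mult.assoc eps_central[OF s', of "v * h"])
      finally show ?thesis using x\<epsilon> by (simp add: mult.assoc)
    qed
    have \<psi>z: "\<psi> (t * \<alpha>) = z * t" if t: "t \<in> Zs s" for t
    proof -
      have "x * (t * \<alpha>) * \<beta> = x * t * E1 s" using ab(1) by (simp add: mult.assoc)
      also have "\<dots> = z * (E1 s * t) * E1 s" unfolding x_def by (simp only: mult.assoc)
      also have "E1 s * t = t * E1 s" using C_comm[OF Zs_C[OF s t] E_H[OF s one one]] by simp
      also have "z * (t * E1 s) * E1 s = (z * t) * E1 s" using E_mult[OF s one one one one] by (simp add: mult.assoc)
      also have "\<dots> = (z * t) * M 1 1" by (rule times_E'[OF s Zs_mult[OF s z t] one one])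
      finally have "\<psi> (t * \<alpha>) = coord 1 1 ((z * t) * M 1 1)" unfolding \<psi>_def by simp
      then show ?thesis using coord_times_M[OF Zs_C[OF s Zs_mult[OF s z t]] one one one one] by simp
    qed
    show ?thesis using alg_trace_eq[OF Zs_subspace[OF s] lin rng \<psi>z] \<psi>\<alpha> True by simp
  qed
  have "of_nat (card (UNIV :: 'g set)) * coeff1 x = (\<Sum>g\<in>UNIV. \<Sum>h\<in>PI. Poly_Mapping.lookup (x * ?sg g * h) g)"
    unfolding regular_trace
  proof (rule sum.cong)
    fix g
    show "Poly_Mapping.lookup (x * ?sg g) g = (\<Sum>h\<in>PI. Poly_Mapping.lookup (x * ?sg g * h) g)"
      by (subst split) (simp add: lookup_sum)
  qed simp
  also have "\<dots> = (\<Sum>h\<in>PI. \<Sum>g\<in>UNIV. Poly_Mapping.lookup (x * ?sg g * h) g)" by (rule sum.swap)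
  also have "\<dots> = (\<Sum>h\<in>PI. if {1..a} \<in> ends h then alg_trace (Zs s) z else 0)" by (intro sum.cong refl part)
  also have "\<dots> = of_nat mult_exc * alg_trace (Zs s) z"
    using PI_finite by (simp add: mult_exc_def sum.inter_filter[symmetric])
  finally show ?thesis unfolding x_def .
qed

definition "tr z = (\<Sum>s=1..a. alg_trace (Zs s) (z * \<epsilon> s))"

text \<open>The constant \<open>\<kappa>\<close> of the overview, an exceptional character degree
  divided by the group order.\<close>

definition "cst = (of_nat mult_exc / of_nat (card (UNIV :: 'g set)) :: 'k)"

lemma trace_formula: assumes z: "z \<in> C" shows "coeff1 (z * M 1 1) = cst * tr z"
proof -
  have G: "(of_nat (card (UNIV :: 'g set)) :: 'k) \<noteq> 0" by simp
  have "z * M 1 1 = (\<Sum>s=1..a. z * M 1 1 * \<epsilon> s)"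
    by (rule H_sum_eps) (intro H_closed(4) C_H z M_H n_index)
  also have "\<dots> = (\<Sum>s=1..a. z * \<epsilon> s * E1 s)"
  proof (intro sum.cong refl)
    fix s assume s: "s \<in> {1..a}"
    have "z * M 1 1 * \<epsilon> s = z * E1 s" using M_eps[OF s n_index(1,1)] by (simp add: mult.assoc)
    also have "\<dots> = z * (\<epsilon> s * E1 s)"
      using E_eps[OF s n_index(1,1)] eps_central[OF exc_index[OF s], of "E1 s"] by simp
    finally show "z * M 1 1 * \<epsilon> s = z * \<epsilon> s * E1 s" by (simp add: mult.assoc)
  qed
  finally have "of_nat (card (UNIV :: 'g set)) * coeff1 (z * M 1 1)
      = (\<Sum>s=1..a. of_nat (card (UNIV :: 'g set)) * coeff1 (z * \<epsilon> s * E1 s))"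
    by (simp add: coeff1_sum sum_distrib_left)
  also have "\<dots> = (\<Sum>s=1..a. of_nat mult_exc * alg_trace (Zs s) (z * \<epsilon> s))"
    by (intro sum.cong refl component_trace eps_component_C z)
  also have "\<dots> = of_nat mult_exc * tr z" unfolding tr_def sum_distrib_left ..
  finally show ?thesis using G unfolding cst_def by (simp add: field_simps)
qed

lemma tr_f: "tr f = of_nat (\<Sum>s=1..a. kg.dim (L s))"
proof -
  have "tr f = (\<Sum>s=1..a. of_nat (kg.dim (Zs s)))"
    unfolding tr_def by (intro sum.cong refl alg_trace_one Zs_subspace u_unit(2)) auto
  then show ?thesis using dim_Zs by simp
qed

text \<open>The degrees \<open>(p ^ s - p ^ (s - 1)) / e\<close> telescope.\<close>

lemma degree_sum: "e * (\<Sum>s=1..a. kg.dim (L s)) = p ^ a - 1"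
proof -
  have "e * (\<Sum>s=1..t. kg.dim (L s)) = p ^ t - 1" if "t \<le> a" for t
    using that
  proof (induction t)
    case (Suc t)
    have "e * kg.dim (L (Suc t)) = p ^ Suc t - p ^ t" using degree[of "Suc t"] Suc.prems unfolding L_def by simp
    moreover have "p ^ t \<le> p ^ Suc t" "1 \<le> p ^ t" using p_gt_1 by simp_all
    ultimately show ?case using Suc by (simp add: distrib_left)
  qed simp
  then show ?thesis by simp
qed

end

section \<open>Residue fields\<close>

text \<open>The ring \<open>T\<close> as an \<open>S\<close>-module along \<open>\<chi>\<close>. For
  a quotient ring \<open>T\<close> its elements are cosets, hence of the element type that
  \<open>num_simple_modules\<close> counts.\<close>

definition hom_module :: "('b, 'c) ring_scheme \<Rightarrow> ('a \<Rightarrow> 'b) \<Rightarrow> ('a, 'b) module"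
  where "hom_module T \<chi> = \<lparr>carrier = carrier T, monoid.mult = monoid.mult T, monoid.one = monoid.one T,
    ring.zero = ring.zero T, ring.add = ring.add T, smult = (\<lambda>r x. \<chi> r \<otimes>\<^bsub>T\<^esub> x)\<rparr>"

lemma hom_module_simps [simp]:
  "carrier (hom_module T \<chi>) = carrier T" "\<zero>\<^bsub>hom_module T \<chi>\<^esub> = \<zero>\<^bsub>T\<^esub>"
  "x \<oplus>\<^bsub>hom_module T \<chi>\<^esub> y = x \<oplus>\<^bsub>T\<^esub> y" "r \<odot>\<^bsub>hom_module T \<chi>\<^esub> x = \<chi> r \<otimes>\<^bsub>T\<^esub> x"
  by (simp_all add: hom_module_def)

lemma hom_module_simple:
  assumes "ring_hom_ring S T \<chi>" "\<chi> ` carrier S = carrier T" "\<one>\<^bsub>T\<^esub> \<noteq> \<zero>\<^bsub>T\<^esub>"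
    and inv: "\<And>x. x \<in> carrier T \<Longrightarrow> x \<noteq> \<zero>\<^bsub>T\<^esub> \<Longrightarrow> \<exists>y\<in>carrier T. y \<otimes>\<^bsub>T\<^esub> x = \<one>\<^bsub>T\<^esub>"
  shows "simple_module S (hom_module T \<chi>)"
proof -
  interpret ring_hom_ring S T \<chi> by fact
  let ?M = "hom_module T \<chi>"
  have "abelian_group ?M"
  proof (rule abelian_groupI)
    show "\<exists>y\<in>carrier ?M. y \<oplus>\<^bsub>?M\<^esub> x = \<zero>\<^bsub>?M\<^esub>" if "x \<in> carrier ?M" for x
      using that by (intro bexI[of _ "\<ominus>\<^bsub>T\<^esub> x"]) (simp_all add: S.l_neg)
  qed (simp_all add: S.a_ac)
  then have "left_module S ?M"
    unfolding left_module_def using R.ring_axioms by (auto simp: S.l_distr S.r_distr S.m_assoc)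
  moreover have "carrier ?M \<noteq> {\<zero>\<^bsub>?M\<^esub>}" using assms(3) S.one_closed by auto
  moreover have "N = {\<zero>\<^bsub>?M\<^esub>} \<or> N = carrier ?M" if N: "left_submodule S ?M N" for N
  proof (cases "N \<subseteq> {\<zero>\<^bsub>T\<^esub>}")
    case True
    have "additive_subgroup N ?M" using N unfolding left_submodule_def by blast
    then have "subgroup N (add_monoid ?M)" unfolding additive_subgroup_def .
    then have "\<zero>\<^bsub>T\<^esub> \<in> N" using subgroup.one_closed[of N "add_monoid ?M"] by simp
    then show ?thesis using True by auto
  next
    case False
    have sub: "subgroup N (add_monoid ?M)" and smul: "\<And>r x. r \<in> carrier S \<Longrightarrow> x \<in> N \<Longrightarrow> \<chi> r \<otimes>\<^bsub>T\<^esub> x \<in> N"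
      using N unfolding left_submodule_def additive_subgroup_def by auto
    have NT: "N \<subseteq> carrier T" using subgroup.subset[OF sub] by simp
    obtain x where x: "x \<in> N" "x \<noteq> \<zero>\<^bsub>T\<^esub>" using False by auto
    obtain y where y: "y \<in> carrier T" "y \<otimes>\<^bsub>T\<^esub> x = \<one>\<^bsub>T\<^esub>" using inv x NT by blast
    have "t \<in> N" if t: "t \<in> carrier T" for t
    proof -
      obtain r where r: "r \<in> carrier S" "\<chi> r = t \<otimes>\<^bsub>T\<^esub> y"
        using assms(2) S.m_closed[OF t y(1)] by (metis imageE)
      have "\<chi> r \<otimes>\<^bsub>T\<^esub> x = t" using r(2) y t x(1) NT by (simp add: S.m_assoc subset_iff)
      then show ?thesis using smul[OF r(1) x(1)] by simp
    qed
    then show ?thesis using NT by auto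
  qed
  ultimately show ?thesis unfolding simple_module_def by blast
qed

text \<open>The kernel of \<open>\<chi>\<close> is the annihilator of the module and so an
  isomorphism invariant. It will tell the simple modules apart.\<close>

lemma hom_module_iso_kernel:
  assumes "ring_hom_ring S T \<chi>" "ring_hom_ring S T' \<chi>'"
    and "lmod_iso S (hom_module T \<chi>) (hom_module T' \<chi>')" and r: "r \<in> carrier S"
  shows "\<chi> r = \<zero>\<^bsub>T\<^esub> \<longleftrightarrow> \<chi>' r = \<zero>\<^bsub>T'\<^esub>"
proof -
  interpret c: ring_hom_ring S T \<chi> by fact
  interpret c': ring_hom_ring S T' \<chi>' by fact
  obtain \<phi> where \<phi>: "\<And>x. x \<in> carrier T \<Longrightarrow> \<phi> x \<in> carrier T'"
    "\<And>x y. x \<in> carrier T \<Longrightarrow> y \<in> carrier T \<Longrightarrow> \<phi> (x \<oplus>\<^bsub>T\<^esub> y) = \<phi> x \<oplus>\<^bsub>T'\<^esub> \<phi> y"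
    "\<And>r x. r \<in> carrier S \<Longrightarrow> x \<in> carrier T \<Longrightarrow> \<phi> (\<chi> r \<otimes>\<^bsub>T\<^esub> x) = \<chi>' r \<otimes>\<^bsub>T'\<^esub> \<phi> x"
    "bij_betw \<phi> (carrier T) (carrier T')"
    using assms(3) unfolding lmod_iso_def lmod_hom_def hom_module_simps by blast
  have "\<phi> \<zero>\<^bsub>T\<^esub> \<oplus>\<^bsub>T'\<^esub> \<phi> \<zero>\<^bsub>T\<^esub> = \<phi> \<zero>\<^bsub>T\<^esub>" using \<phi>(2)[of "\<zero>\<^bsub>T\<^esub>" "\<zero>\<^bsub>T\<^esub>"] by simp
  then have z: "\<phi> \<zero>\<^bsub>T\<^esub> = \<zero>\<^bsub>T'\<^esub>" using \<phi>(1)[of "\<zero>\<^bsub>T\<^esub>"] by (simp add: c'.S.add.l_cancel_one')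
  show ?thesis
  proof
    assume r0: "\<chi> r = \<zero>\<^bsub>T\<^esub>"
    obtain x where x: "x \<in> carrier T" "\<phi> x = \<one>\<^bsub>T'\<^esub>" using \<phi>(4) c'.S.one_closed unfolding bij_betw_def by (metis imageE)
    have "\<chi>' r \<otimes>\<^bsub>T'\<^esub> \<phi> x = \<zero>\<^bsub>T'\<^esub>" using \<phi>(3)[OF r x(1)] r0 x z by simp
    then show "\<chi>' r = \<zero>\<^bsub>T'\<^esub>" using x r by simp
  next
    assume r0: "\<chi>' r = \<zero>\<^bsub>T'\<^esub>"
    have "\<phi> (\<chi> r \<otimes>\<^bsub>T\<^esub> \<one>\<^bsub>T\<^esub>) = \<zero>\<^bsub>T'\<^esub>" using \<phi>(3)[OF r c.S.one_closed] \<phi>(1)[OF c.S.one_closed] r0 by simp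
    then have "\<phi> (\<chi> r) = \<phi> \<zero>\<^bsub>T\<^esub>" using z r by simp
    then show "\<chi> r = \<zero>\<^bsub>T\<^esub>" using \<phi>(4) r unfolding bij_betw_def by (auto dest!: inj_onD)
  qed
qed

text \<open>An infinite set has cardinality \<open>0\<close>, so the positivity assumption expresses
  that there are only finitely many classes.\<close>

lemma num_simple_modules_ge:
  fixes S :: "('a, 'c) ring_scheme" and F :: "'i \<Rightarrow> ('a, 'a set) module"
  assumes "num_simple_modules S > 0" "\<And>k. k \<in> I \<Longrightarrow> simple_module S (F k)"
    and "\<And>k l. k \<in> I \<Longrightarrow> l \<in> I \<Longrightarrow> lmod_iso S (F k) (F l) \<Longrightarrow> k = l"
  shows "card I \<le> num_simple_modules S"
proof -
  let ?A = "{M :: ('a, 'a set) module. simple_module S M}"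
  let ?r = "{(M, N :: ('a, 'a set) module). simple_module S M \<and> simple_module S N \<and> lmod_iso S M N}"
  have fin: "finite (?A // ?r)" using assms(1) unfolding num_simple_modules_def by (rule card_ge_0_finite)
  have refl: "lmod_iso S M M" for M :: "('a, 'a set) module"
    unfolding lmod_iso_def lmod_hom_def by (intro exI[of _ "\<lambda>x. x"]) (auto simp: bij_betw_def)
  have "inj_on (\<lambda>k. ?r `` {F k}) I"
  proof (rule inj_onI)
    fix k l assume kl: "k \<in> I" "l \<in> I" "?r `` {F k} = ?r `` {F l}"
    have "F l \<in> ?r `` {F l}" using assms(2)[OF kl(2)] refl by simp
    then have "lmod_iso S (F k) (F l)" unfolding kl(3)[symmetric] by simp
    then show "k = l" by (rule assms(3)[OF kl(1,2)])
  qed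
  moreover have "(\<lambda>k. ?r `` {F k}) ` I \<subseteq> ?A // ?r" using assms(2) by (auto simp: quotient_def)
  ultimately show ?thesis unfolding num_simple_modules_def by (intro card_inj_on_le[OF _ _ fin])
qed

context exceptional_order
begin

definition "maxI s = {\<pi> s * r |r. r \<in> Rs s}"

lemma maxI_closed:
  assumes s: "s \<in> {1..a}"
  shows "0 \<in> maxI s" "x \<in> maxI s \<Longrightarrow> z \<in> maxI s \<Longrightarrow> x + z \<in> maxI s" "x \<in> maxI s \<Longrightarrow> - x \<in> maxI s"
    "x \<in> maxI s \<Longrightarrow> z \<in> maxI s \<Longrightarrow> x - z \<in> maxI s"
    "x \<in> maxI s \<Longrightarrow> z \<in> Rs s \<Longrightarrow> x * z \<in> maxI s" "x \<in> maxI s \<Longrightarrow> z \<in> Rs s \<Longrightarrow> z * x \<in> maxI s"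
    "x \<in> maxI s \<Longrightarrow> x \<in> Rs s" "u s \<notin> maxI s"
proof -
  show "0 \<in> maxI s" unfolding maxI_def using Rs_closed(2)[OF s] by force
  show "x \<in> maxI s \<Longrightarrow> z \<in> maxI s \<Longrightarrow> x + z \<in> maxI s" unfolding maxI_def using Rs_closed(3)[OF s] by (auto simp flip: distrib_left)
  show "x \<in> maxI s \<Longrightarrow> - x \<in> maxI s" unfolding maxI_def using Rs_closed(5)[OF s] by (auto simp flip: mult_minus_right)
  show "x \<in> maxI s \<Longrightarrow> z \<in> maxI s \<Longrightarrow> x - z \<in> maxI s" unfolding maxI_def using Rs_closed(6)[OF s] by (auto simp flip: right_diff_distrib)
  show *: "x \<in> maxI s \<Longrightarrow> z \<in> Rs s \<Longrightarrow> x * z \<in> maxI s" for x z unfolding maxI_def using Rs_closed(4)[OF s] by (auto simp: mult.assoc)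
  show **: "x \<in> maxI s \<Longrightarrow> x \<in> Rs s" for x unfolding maxI_def using Rs_closed(4)[OF s pi_Rs[OF s]] by auto
  show "x \<in> maxI s \<Longrightarrow> z \<in> Rs s \<Longrightarrow> z * x \<in> maxI s" using * Rs_comm[OF s, of z x] ** by metis
  show "u s \<notin> maxI s" unfolding maxI_def using pi_nonunit[OF s] by force
qed

lemma maxI_ideal: assumes s: "s \<in> {1..a}" shows "ideal (maxI s) (sub_rng (Rs s) (u s))"
proof (rule idealI[OF Rs_ring[OF s]])
  interpret ring "sub_rng (Rs s) (u s)" by (rule Rs_ring[OF s])
  show "subgroup (maxI s) (add_monoid (sub_rng (Rs s) (u s)))"
  proof (rule add.subgroupI)
    show "maxI s \<subseteq> carrier (sub_rng (Rs s) (u s))" "maxI s \<noteq> {}" using maxI_closed[OF s] by auto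
    show "\<ominus>\<^bsub>sub_rng (Rs s) (u s)\<^esub> x \<in> maxI s" if "x \<in> maxI s" for x
      using a_inv_sub_rng[OF Rs_ring[OF s] maxI_closed(7)[OF s that]] maxI_closed(3)[OF s that] by simp
  qed (use maxI_closed(2)[OF s] in simp)
qed (use maxI_closed(5,6)[OF s] in simp_all)

definition "residue s = sub_rng (Rs s) (u s) Quot maxI s"

definition "res_hom s i x = maxI s +>\<^bsub>sub_rng (Rs s) (u s)\<^esub> (coord i i x * \<epsilon> s)"

lemma Z_eps_Rs: "s \<in> {1..a} \<Longrightarrow> z \<in> Z \<Longrightarrow> z * \<epsilon> s \<in> Rs s" using Rs_iff by blast

lemma coord_Rs: assumes s: "s \<in> {1..a}" "i \<in> {1..n}" "x \<in> \<Gamma>" shows "coord i i x * \<epsilon> s \<in> Rs s"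
  using Z_eps_Rs[OF s(1) coord_Z[OF s(3,2,2)]] .

lemma unit_outside_maxI:
  assumes s: "s \<in> {1..a}" "r \<in> Rs s" "r \<notin> maxI s" shows "\<exists>t\<in>Rs s. r * t = u s"
  using Rs_unit[OF s(1,2)] s(3) unfolding maxI_def by blast

lemma coset_zero_iff: assumes s: "s \<in> {1..a}" "r \<in> Rs s"
  shows "maxI s +>\<^bsub>sub_rng (Rs s) (u s)\<^esub> r = maxI s \<longleftrightarrow> r \<in> maxI s"
proof -
  interpret ideal "maxI s" "sub_rng (Rs s) (u s)" by (rule maxI_ideal[OF s(1)])
  show ?thesis using a_rcos_const a_rcos_self[of r] s(2) by auto
qed

lemma residue_zero: "\<zero>\<^bsub>residue s\<^esub> = maxI s" unfolding residue_def FactRing_def by simp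

lemma residue_carrier: "carrier (residue s) = (+>\<^bsub>sub_rng (Rs s) (u s)\<^esub>) (maxI s) ` Rs s"
  unfolding residue_def FactRing_def A_RCOSETS_def' by auto

lemma w_maxI: assumes s: "s \<in> {1..a}" shows "w * \<epsilon> s \<in> maxI s"
proof -
  have "y s * \<pi> s = \<pi> s * y s" by (rule Rs_comm[OF s y_Rs[OF s] pi_Rs[OF s]])
  then show ?thesis unfolding w_eps[OF s] maxI_def using y_Rs[OF s] by blast
qed

lemma wZ_maxI: assumes s: "s \<in> {1..a}" "x \<in> wZ" shows "x * \<epsilon> s \<in> maxI s"
proof -
  obtain z where z: "x = w * z" "z \<in> Z" using s(2) unfolding wZ_def by auto
  show ?thesis unfolding z(1) eps_distrib[OF s(1), symmetric]
    by (rule maxI_closed(5)[OF s(1) w_maxI[OF s(1)] Z_eps_Rs[OF s(1) z(2)]])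
qed

lemma res_hom_zero_iff:
  assumes s: "s \<in> {1..a}" "i \<in> {1..n}" "x \<in> \<Gamma>"
  shows "res_hom s i x = \<zero>\<^bsub>residue s\<^esub> \<longleftrightarrow> coord i i x * \<epsilon> s \<in> maxI s"
  unfolding res_hom_def residue_zero by (rule coset_zero_iff[OF s(1) coord_Rs[OF s]])

text \<open>Diagonal entries multiply modulo \<open>wZ\<close>: for \<open>k \<noteq> i\<close> one
  of the positions \<open>(i, k)\<close> and \<open>(k, i)\<close> lies above the diagonal, so its
  entry is in \<open>wZ\<close>, which vanishes modulo \<open>\<pi> s\<close>.\<close>

lemma res_hom_ring_hom:
  assumes s: "s \<in> {1..a}" and i: "i \<in> {1..n}"
  shows "ring_hom_ring (sub_rng \<Gamma> f) (residue s) (res_hom s i)"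
proof -
  interpret ideal "maxI s" "sub_rng (Rs s) (u s)" by (rule maxI_ideal[OF s])
  interpret q: ring_hom_ring "sub_rng (Rs s) (u s)" "residue s" "(+>\<^bsub>sub_rng (Rs s) (u s)\<^esub>) (maxI s)"
    unfolding residue_def by (rule rcos_ring_hom_ring)
  note q_mult = q.hom_mult[unfolded sub_rng_simps] and q_add = q.hom_add[unfolded sub_rng_simps]
  show ?thesis
  proof (rule ring_hom_ringI2[OF Gamma_ring q.S.ring_axioms], rule ring_hom_memI)
    show "res_hom s i x \<in> carrier (residue s)" if "x \<in> carrier (sub_rng \<Gamma> f)" for x
      using q.hom_closed[of "coord i i x * \<epsilon> s"] coord_Rs[OF s i] that unfolding res_hom_def by simp
    show "res_hom s i (x \<oplus>\<^bsub>sub_rng \<Gamma> f\<^esub> z) = res_hom s i x \<oplus>\<^bsub>residue s\<^esub> res_hom s i z"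
      if "x \<in> carrier (sub_rng \<Gamma> f)" "z \<in> carrier (sub_rng \<Gamma> f)" for x z
      using q_add[of "coord i i x * \<epsilon> s" "coord i i z * \<epsilon> s"] coord_Rs[OF s i] that
      unfolding res_hom_def by (simp add: coord_add distrib_right)
    show "res_hom s i \<one>\<^bsub>sub_rng \<Gamma> f\<^esub> = \<one>\<^bsub>residue s\<^esub>"
      using q.hom_one coord_diag[OF C_closed(1) i i] unfolding res_hom_def by simp
    show "res_hom s i (x \<otimes>\<^bsub>sub_rng \<Gamma> f\<^esub> z) = res_hom s i x \<otimes>\<^bsub>residue s\<^esub> res_hom s i z"
      if xz': "x \<in> carrier (sub_rng \<Gamma> f)" "z \<in> carrier (sub_rng \<Gamma> f)" for x z
    proof -
      have xz: "x \<in> \<Gamma>" "z \<in> \<Gamma>" using xz' by auto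
      let ?d = "\<Sum>k\<in>{1..n} - {i}. coord i k x * coord k i z"
      have "?d \<in> wZ"
      proof (rule wZ_sum)
        fix k assume k: "k \<in> {1..n} - {i}"
        have "coord i k x \<in> cell i k" "coord k i z \<in> cell k i" using Gamma_coord_cell xz i k by auto
        then show "coord i k x * coord k i z \<in> wZ"
          using wZ_closed(4-6) k unfolding cell_def by (cases "i < k") auto
      qed
      then have d: "?d * \<epsilon> s \<in> maxI s" by (rule wZ_maxI[OF s])
      have "coord i i (x * z) = coord i i x * coord i i z + ?d"
        unfolding coord_mult[OF i i Gamma_H[OF xz(1)] Gamma_H[OF xz(2)]] using i by (simp add: sum.remove)
      then have "coord i i (x * z) * \<epsilon> s = (coord i i x * \<epsilon> s) * (coord i i z * \<epsilon> s) + ?d * \<epsilon> s"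
        unfolding eps_distrib[OF s] by (simp add: distrib_right)
      moreover have "maxI s +>\<^bsub>sub_rng (Rs s) (u s)\<^esub> (?d * \<epsilon> s) = \<zero>\<^bsub>residue s\<^esub>"
        unfolding residue_zero using d by (rule a_rcos_const)
      moreover have "coord i i x * \<epsilon> s \<in> Rs s" "coord i i z * \<epsilon> s \<in> Rs s" "?d * \<epsilon> s \<in> Rs s"
        using coord_Rs[OF s i] xz maxI_closed(7)[OF s d] by auto
      ultimately show ?thesis
        using q_add q_mult q.hom_closed Rs_closed(4)[OF s] unfolding res_hom_def by simp
    qed
  qed
qed

lemma Z_res_hom: "s \<in> {1..a} \<Longrightarrow> i \<in> {1..n} \<Longrightarrow> z \<in> Z \<Longrightarrow>
    res_hom s i z = maxI s +>\<^bsub>sub_rng (Rs s) (u s)\<^esub> (z * \<epsilon> s)"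
  unfolding res_hom_def using coord_diag[OF Z_C] by simp

lemma residue_simple:
  assumes s: "s \<in> {1..a}" and i: "i \<in> {1..n}"
  shows "simple_module (sub_rng \<Gamma> f) (hom_module (residue s) (res_hom s i))"
proof (rule hom_module_simple[OF res_hom_ring_hom[OF s i]])
  interpret c: ring_hom_ring "sub_rng \<Gamma> f" "residue s" "res_hom s i" by (rule res_hom_ring_hom[OF s i])
  interpret ideal "maxI s" "sub_rng (Rs s) (u s)" by (rule maxI_ideal[OF s])
  interpret q: ring_hom_ring "sub_rng (Rs s) (u s)" "residue s" "(+>\<^bsub>sub_rng (Rs s) (u s)\<^esub>) (maxI s)"
    unfolding residue_def by (rule rcos_ring_hom_ring)
  have one: "\<one>\<^bsub>residue s\<^esub> = maxI s +>\<^bsub>sub_rng (Rs s) (u s)\<^esub> u s" using q.hom_one by simp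
  show "\<one>\<^bsub>residue s\<^esub> \<noteq> \<zero>\<^bsub>residue s\<^esub>"
    unfolding one residue_zero coset_zero_iff[OF s Rs_closed(1)[OF s]] by (rule maxI_closed(8)[OF s])
  show "res_hom s i ` carrier (sub_rng \<Gamma> f) = carrier (residue s)"
  proof
    show "carrier (residue s) \<subseteq> res_hom s i ` carrier (sub_rng \<Gamma> f)"
    proof
      fix t assume "t \<in> carrier (residue s)"
      then obtain r where r: "r \<in> Rs s" "t = maxI s +>\<^bsub>sub_rng (Rs s) (u s)\<^esub> r" unfolding residue_carrier by auto
      obtain z where z: "z \<in> Z" "r = z * \<epsilon> s" using r(1) Rs_iff[OF s] by blast
      then show "t \<in> res_hom s i ` carrier (sub_rng \<Gamma> f)" using r(2) Z_res_hom[OF s i z(1)] Z_Gamma by auto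
    qed
  qed (use c.hom_closed in auto)
  fix x assume x: "x \<in> carrier (residue s)" "x \<noteq> \<zero>\<^bsub>residue s\<^esub>"
  then obtain r where r: "r \<in> Rs s" "x = maxI s +>\<^bsub>sub_rng (Rs s) (u s)\<^esub> r" unfolding residue_carrier by auto
  then have "r \<notin> maxI s" using x(2) coset_zero_iff[OF s] unfolding residue_zero by blast
  then obtain t where t: "t \<in> Rs s" "r * t = u s" using unit_outside_maxI[OF s r(1)] by blast
  have "t * r = u s" using Rs_comm[OF s t(1) r(1)] t(2) by simp
  then show "\<exists>y\<in>carrier (residue s). y \<otimes>\<^bsub>residue s\<^esub> x = \<one>\<^bsub>residue s\<^esub>"
    using q.hom_mult[of t r] q.hom_closed[of t] t(1) r unfolding one by (intro bexI[of _ "maxI s +>\<^bsub>sub_rng (Rs s) (u s)\<^esub> t"]) auto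
qed

lemma res_hom_M:
  assumes s: "s \<in> {1..a}" and ij: "i \<in> {1..n}" "j \<in> {1..n}"
  shows "res_hom s i (M j j) = \<zero>\<^bsub>residue s\<^esub> \<longleftrightarrow> i \<noteq> j"
proof -
  have "coord i i (M j j) = (if i = j then f else 0)"
    using coord_times_M[OF C_closed(1) ij(1,1,2,2)] H_f(1)[OF M_H[OF ij(2,2)]] by simp
  then show ?thesis
    unfolding res_hom_zero_iff[OF s ij(1) M_diag_Gamma[OF ij(2)]] using maxI_closed(1,8)[OF s] by simp
qed

text \<open>If \<open>Z\<close> had two maximal ideals, there would be \<open>n + 1\<close> simple modules.\<close>

lemma Z_local:
  assumes s: "s \<in> {1..a}" and t: "t \<in> {1..a}" and z: "z \<in> Z"
  shows "z * \<epsilon> s \<in> maxI s \<longleftrightarrow> z * \<epsilon> t \<in> maxI t"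
proof (rule ccontr)
  assume neq: "\<not> ?thesis"
  \<comment> \<open>The modules \<open>F 1, ..., F n\<close> belong to the component
    \<open>t\<close> and are separated by the idempotents \<open>M i i\<close>. The extra
    \<open>F 0\<close> belongs to \<open>s\<close> and shares its position only with
    \<open>F 1\<close>, from which \<open>z\<close> would separate it.\<close>
  define F where "F k = (if k = 0 then hom_module (residue s) (res_hom s 1) else hom_module (residue t) (res_hom t k))" for k
  have "card {0..n} \<le> num_simple_modules (sub_rng \<Gamma> f)"
  proof (rule num_simple_modules_ge[where F = F])
    show "num_simple_modules (sub_rng \<Gamma> f) > 0" using n_eq n_gt_1 by simp
    show "simple_module (sub_rng \<Gamma> f) (F k)" if "k \<in> {0..n}" for k
      unfolding F_def using residue_simple[OF s n_index(1)] residue_simple[OF t, of k] that by simp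
    fix k l assume kl: "k \<in> {0..n}" "l \<in> {0..n}" "lmod_iso (sub_rng \<Gamma> f) (F k) (F l)"
    show "k = l"
    proof (rule ccontr)
      assume ne: "k \<noteq> l"
      define s' i' where "s' k = (if k = 0 then s else t)" and "i' k = (if k = 0 then 1 else k)" for k :: nat
      have F': "F k = hom_module (residue (s' k)) (res_hom (s' k) (i' k))" for k unfolding F_def s'_def i'_def by simp
      have s': "s' k \<in> {1..a}" "s' l \<in> {1..a}" unfolding s'_def using s t by auto
      have i': "i' k \<in> {1..n}" "i' l \<in> {1..n}" unfolding i'_def using kl n_index by auto
      have ker: "res_hom (s' k) (i' k) x = \<zero>\<^bsub>residue (s' k)\<^esub> \<longleftrightarrow> res_hom (s' l) (i' l) x = \<zero>\<^bsub>residue (s' l)\<^esub>"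
        if "x \<in> \<Gamma>" for x
        using hom_module_iso_kernel[OF res_hom_ring_hom[OF s'(1) i'(1)] res_hom_ring_hom[OF s'(2) i'(2)]]
          kl(3) that unfolding F' by simp
      have "i' k = i' l"
        using ker[OF M_diag_Gamma[OF i'(1)]] res_hom_M[OF s'(1) i'(1,1)] res_hom_M[OF s'(2) i'(2,1)] by auto
      then have "s' k \<noteq> s' l \<longrightarrow> {s' k, s' l} = {s, t}" and "k = 0 \<or> l = 0"
        using ne unfolding i'_def s'_def by (auto split: if_splits)
      have "z * \<epsilon> (s' k) \<in> maxI (s' k) \<longleftrightarrow> z * \<epsilon> (s' l) \<in> maxI (s' l)"
        using ker[OF Z_Gamma[OF z]] res_hom_zero_iff[OF s'(1) i'(1) Z_Gamma[OF z]] res_hom_zero_iff[OF s'(2) i'(2) Z_Gamma[OF z]]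
          coord_diag[OF Z_C[OF z] i'(1,1)] coord_diag[OF Z_C[OF z] i'(2,2)] by simp
      moreover have "(s' k = s \<and> s' l = t) \<or> (s' k = t \<and> s' l = s)"
        using \<open>k = 0 \<or> l = 0\<close> ne unfolding s'_def by auto
      ultimately show False using neq by auto
    qed
  qed
  then show False using n_eq by simp
qed

text \<open>The residue field of \<open>Rs s\<close> is a simple \<open>\<Gamma>\<close>-module,
  hence one-dimensional over \<open>k\<close>: for a generator \<open>m0\<close>, the product
  \<open>r * m0\<close> is congruent to a scalar multiple of \<open>m0\<close>, and
  \<open>m0\<close> can be cancelled because it is not divisible by \<open>\<pi> s\<close>.\<close>

lemma residue_field_k:
  assumes s: "s \<in> {1..a}" and r: "r \<in> Rs s" shows "\<exists>c\<in>R. r - scal c (u s) \<in> maxI s"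
proof -
  interpret ideal "maxI s" "sub_rng (Rs s) (u s)" by (rule maxI_ideal[OF s])
  interpret q: ring_hom_ring "sub_rng (Rs s) (u s)" "residue s" "(+>\<^bsub>sub_rng (Rs s) (u s)\<^esub>) (maxI s)"
    unfolding residue_def by (rule rcos_ring_hom_ring)
  let ?co = "\<lambda>r. maxI s +>\<^bsub>sub_rng (Rs s) (u s)\<^esub> r"
  have "\<exists>m\<in>carrier (residue s). m \<noteq> \<zero>\<^bsub>residue s\<^esub> \<and>
      carrier (residue s) = {res_hom s 1 c \<otimes>\<^bsub>residue s\<^esub> m |c. c \<in> {scal c f |c. c \<in> R}}"
    using Gamma_basic[unfolded simples_one_dimensional_def, rule_format, OF residue_simple[OF s n_index(1)]]
    unfolding hom_module_simps .
  then obtain m where m: "m \<in> carrier (residue s)" "m \<noteq> \<zero>\<^bsub>residue s\<^esub>"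
    "carrier (residue s) = {res_hom s 1 c \<otimes>\<^bsub>residue s\<^esub> m |c. c \<in> {scal c f |c. c \<in> R}}" by blast
  obtain m0 where m0: "m0 \<in> Rs s" "m = ?co m0" using m(1) unfolding residue_carrier by auto
  have m0': "m0 \<notin> maxI s" using m(2) m0 coset_zero_iff[OF s] unfolding residue_zero by blast
  have rm: "r * m0 \<in> Rs s" using Rs_closed(4)[OF s r m0(1)] .
  then have "?co (r * m0) \<in> carrier (residue s)" unfolding residue_carrier by auto
  then obtain c where c: "c \<in> R" "?co (r * m0) = res_hom s 1 (scal c f) \<otimes>\<^bsub>residue s\<^esub> m" using m(3) by blast
  have "scal c f \<in> Z" by (rule Z_closed(5)[OF Z_closed(1) c(1)])
  then have "res_hom s 1 (scal c f) = ?co (scal c (u s))" using Z_res_hom[OF s n_index(1)] by simp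
  moreover have cu: "scal c (u s) \<in> Rs s" by (rule Rs_closed(7)[OF s Rs_closed(1)[OF s] c(1)])
  ultimately have "?co (r * m0) = ?co (scal c (u s) * m0)" using c(2) q.hom_mult[of "scal c (u s)" m0] m0 by simp
  moreover have cm: "scal c (u s) * m0 \<in> Rs s" by (rule Rs_closed(4)[OF s cu m0(1)])
  ultimately have "r * m0 \<in> ?co (scal c (u s) * m0)" using a_rcos_self[of "r * m0"] rm by simp
  then obtain h where h: "h \<in> maxI s" "r * m0 = h + scal c (u s) * m0" unfolding a_r_coset_def' by auto
  then have "(r - scal c (u s)) * m0 = h" by (simp add: left_diff_distrib)
  then obtain t where t: "t \<in> Rs s" "(r - scal c (u s)) * m0 = \<pi> s * t" using h(1) unfolding maxI_def by auto
  from pi_prime'[OF s Rs_closed(6)[OF s r cu] m0(1) t] m0' have "r - scal c (u s) \<in> maxI s"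
    unfolding maxI_def by blast
  then show ?thesis using c(1) by blast
qed

lemma scal_u_maxI_iff: assumes s: "s \<in> {1..a}" and r: "r \<in> R" shows "scal r (u s) \<in> maxI s \<longleftrightarrow> r \<in> pR"
proof
  assume *: "scal r (u s) \<in> maxI s"
  show "r \<in> pR"
  proof (rule ccontr)
    assume np: "r \<notin> pR"
    then have "inverse r \<in> R" "r \<noteq> 0" using R_unit[OF r] by auto
    have "scal (inverse r) (u s) \<in> Rs s" by (rule Rs_closed(7)[OF s Rs_closed(1)[OF s] \<open>inverse r \<in> R\<close>])
    from maxI_closed(5)[OF s * this] have "scal r (scal (inverse r) (u s * u s)) \<in> maxI s" by (simp add: mult.commute)
    then have "u s \<in> maxI s" using \<open>r \<noteq> 0\<close> u_unit(1)[OF s u_Zs[OF s]] by simp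
    then show False using maxI_closed(8)[OF s] by simp
  qed
next
  assume "r \<in> pR"
  then obtain c where c: "r = of_nat p * c" "c \<in> R" unfolding pR_def by auto
  obtain t where t: "t \<in> Rs s" "scal (of_nat p) (u s) = \<pi> s * t" using pi_dvd_p[OF s] by blast
  have "scal r (u s) = scal c (scal (of_nat p) (u s))" using c by (simp add: mult.commute)
  also have "\<dots> = \<pi> s * scal c t" unfolding t(2) by simp
  finally show "scal r (u s) \<in> maxI s" unfolding maxI_def using Rs_closed(7)[OF s t(1) c(2)] by blast
qed

end

section \<open>The index of \<open>wZ\<close> in the centre\<close>

context unramified_field
begin

definition "residue_card = card (SOME S. transversal R pR S)"

lemma add_closed_R: "add_closed R" unfolding add_closed_def by auto

lemma add_closed_pR: "add_closed pR" unfolding add_closed_def by (auto intro: pR_diff)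

lemma R_pR_transversal: obtains S where "transversal R pR S" "card S = residue_card"
proof -
  have "\<exists>S. transversal R pR S"
    using finite_residues transversal_exists[OF add_closed_pR _ add_closed_R] pR_R by (meson subsetI)
  from someI_ex[OF this] that show ?thesis unfolding residue_card_def by blast
qed

lemma residue_card_gt_1: "residue_card > 1"
proof -
  obtain S where S: "transversal R pR S" "card S = residue_card" by (rule R_pR_transversal)
  obtain s0 where s0: "s0 \<in> S" "0 - s0 \<in> pR" using transversalD(3)[OF S(1) R_zero] by blast
  obtain s1 where s1: "s1 \<in> S" "1 - s1 \<in> pR" using transversalD(3)[OF S(1) R_one] by blast
  have "s0 \<noteq> s1"
  proof
    assume "s0 = s1"
    then show False using pR_diff[OF s1(2) s0(2)] one_notin_pR by simp
  qed
  then have "card {s0, s1} \<le> card S" using s0 s1 transversalD(1)[OF S(1)] by (intro card_mono) auto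
  then show ?thesis using S(2) \<open>s0 \<noteq> s1\<close> by simp
qed

text \<open>Multiplication by \<open>p\<close> turns a transversal for \<open>p ^ m R\<close> in
  \<open>R\<close> into one for \<open>p ^ Suc m R\<close> in \<open>pR\<close>; the tower law does
  the rest.\<close>

lemma R_power_transversal: "\<exists>T. transversal R {of_nat p ^ m * x |x. x \<in> R} T \<and> card T = residue_card ^ m"
proof (induction m)
  case 0
  have "transversal R {of_nat p ^ 0 * x |x. x \<in> R} {0}"
    using add_closed_R by (intro transversalI) (auto simp: add_closed_R)
  then show ?case by (intro exI[of _ "{0}"]) simp
next
  case (Suc m)
  let ?B = "{of_nat p ^ m * x |x. x \<in> R}" and ?C = "{of_nat p ^ Suc m * x |x. x \<in> R}"
  have cl: "add_closed {of_nat p ^ m * x |x. x \<in> R}" for m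
    unfolding add_closed_def
  proof (intro conjI ballI)
    show "0 \<in> {of_nat p ^ m * x |x. x \<in> R}" using R_zero by force
    show "x - y \<in> {of_nat p ^ m * x |x. x \<in> R}" if "x \<in> {of_nat p ^ m * x |x. x \<in> R}" "y \<in> {of_nat p ^ m * x |x. x \<in> R}" for x y
      using that by (auto simp flip: right_diff_distrib)
  qed
  obtain T where T: "transversal R ?B T" "card T = residue_card ^ m" using Suc by blast
  have sub: "?B \<subseteq> R" by auto
  obtain T' where T': "transversal ((*) (of_nat p) ` R) ((*) (of_nat p) ` ?B) T'" "card T' = card T"
    using transversal_image[OF T(1) cl _ _ sub add_closed_R, of "(*) (of_nat p)"] p_nonzero
    by (auto simp: right_diff_distrib)
  have 1: "(*) (of_nat p) ` R = pR" unfolding pR_def by auto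
  have 2: "(*) (of_nat p) ` ?B = ?C" by (auto simp: mult.assoc image_iff)
  obtain S where S: "transversal R pR S" "card S = residue_card" by (rule R_pR_transversal)
  have "?C \<subseteq> pR" unfolding pR_def by (auto simp: mult.assoc)
  then obtain V where "transversal R ?C V" "card V = card S * card T'"
    using transversal_trans[OF S(1) T'(1)[unfolded 1 2] add_closed_R add_closed_pR cl] pR_R by blast
  then show ?case using S(2) T(2) T'(2) by (intro exI[of _ V]) simp
qed

end

context exceptional_order
begin

text \<open>The direct sum of the \<open>Rs s\<close>, an overorder of \<open>Z\<close> in which
  multiplication by \<open>w\<close> can be treated component by component.\<close>

definition "MM = {z \<in> C. \<forall>s\<in>{1..a}. z * \<epsilon> s \<in> Rs s}"

lemma add_closed_MM: "add_closed MM"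
  unfolding add_closed_def MM_def using C_closed(2,7) Rs_closed(2,6) by (auto simp: left_diff_distrib simp del: atLeastAtMost_iff)

lemma Z_MM: "Z \<subseteq> MM" unfolding MM_def using Z_C Z_eps_Rs by blast

lemma add_closed_Z: "add_closed Z" unfolding add_closed_def using Z_closed(2,7) by blast

lemma MM_mult: "x \<in> MM \<Longrightarrow> z \<in> MM \<Longrightarrow> x * z \<in> MM"
  unfolding MM_def using C_closed(4) Rs_closed(4) by (auto simp: eps_distrib[symmetric] simp del: atLeastAtMost_iff)

lemma MM_sumI:
  assumes "\<And>s. s \<in> {1..a} \<Longrightarrow> x s \<in> Rs s" shows "(\<Sum>s=1..a. x s) \<in> MM"
proof -
  have "(\<Sum>s=1..a. x s) * \<epsilon> t = x t" if "t \<in> {1..a}" for t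
    by (rule sum_eps_component[OF Rs_eps that]) (use assms in auto)
  then show ?thesis unfolding MM_def using assms C_sum[of "{1..a}" x] Rs_C by auto
qed

lemma C_eqI: assumes "x \<in> C" "z \<in> C" "\<And>s. s \<in> {1..a} \<Longrightarrow> x * \<epsilon> s = z * \<epsilon> s" shows "x = z"
proof -
  have "x = (\<Sum>s=1..a. x * \<epsilon> s)" by (rule H_sum_eps[OF C_H[OF assms(1)]])
  also have "\<dots> = (\<Sum>s=1..a. z * \<epsilon> s)" by (intro sum.cong refl assms(3))
  also have "\<dots> = z" by (rule H_sum_eps[OF C_H[OF assms(2)], symmetric])
  finally show ?thesis .
qed

text \<open>A filtration from \<open>MM\<close> at \<open>j = 0\<close> down to the multiples of
  \<open>w\<close> at \<open>j = a\<close>, see \<open>wMM_eq\<close>, with one residue field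
  removed in each step.\<close>

definition "MMf j = {z \<in> MM. \<forall>s\<in>{1..j}. z * \<epsilon> s \<in> maxI s}"

lemma add_closed_MMf: "j \<le> a \<Longrightarrow> add_closed (MMf j)"
  unfolding add_closed_def MMf_def using add_closedD(1,2)[OF add_closed_MM] maxI_closed(1,4)
  by (auto simp: left_diff_distrib)

text \<open>The quotient is the residue field of \<open>Rs t\<close> for \<open>t = Suc j\<close>.
  By \<open>residue_field_k\<close> it is represented by the \<open>scal c (u t)\<close> with
  \<open>c\<close> from a transversal of \<open>pR\<close> in \<open>R\<close>.\<close>

lemma MMf_step:
  assumes j: "j < a" shows "\<exists>T. transversal (MMf j) (MMf (Suc j)) T \<and> card T = residue_card"
proof -
  define t where "t = Suc j"
  have t: "t \<in> {1..a}" unfolding t_def using j by auto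
  obtain S where S: "transversal R pR S" "card S = residue_card" by (rule R_pR_transversal)
  have SR: "c \<in> S \<Longrightarrow> c \<in> R" for c using transversalD(2)[OF S(1)] by auto
  have ute: "u t * \<epsilon> t = u t" using eps_idem[OF exc_index[OF t]] by (simp add: mult.assoc)
  have ut: "scal c (u t) * \<epsilon> s = (if s = t then scal c (u t) else 0)" if "s \<in> {1..a}" for s c
  proof (cases "s = t")
    case True
    then show ?thesis using eps_idem[OF exc_index[OF t]] by (simp add: mult.assoc)
  next
    case False
    then have "\<epsilon> t * \<epsilon> s = 0" using eps_orth[OF exc_index[OF t] exc_index[OF that]] by simp
    then show ?thesis using False by (simp add: mult.assoc)
  qed
  have uMM: "scal c (u t) \<in> MMf j" if "c \<in> R" for c
  proof -
    have cu: "scal c (u t) \<in> Rs t" by (rule Rs_closed(7)[OF t Rs_closed(1)[OF t] that])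
    have "scal c (u t) * \<epsilon> s \<in> Rs s" if "s \<in> {1..a}" for s using ut[OF that] cu Rs_closed(2)[OF that] by simp
    moreover have "scal c (u t) * \<epsilon> s \<in> maxI s" if "s \<in> {1..j}" for s
    proof -
      have "s \<in> {1..a}" "s \<noteq> t" using that j unfolding t_def by auto
      then show ?thesis using ut maxI_closed(1) by simp
    qed
    ultimately show ?thesis unfolding MMf_def MM_def using Rs_C[OF t cu] by blast
  qed
  have eqS: "c = c'" if "c \<in> S" "c' \<in> S" "scal c (u t) - scal c' (u t) \<in> MMf (Suc j)" for c c'
  proof -
    have "(scal c (u t) - scal c' (u t)) * \<epsilon> t \<in> maxI t" using that(3) t_def unfolding MMf_def by auto
    then have "scal (c - c') (u t) \<in> maxI t" by (simp add: ute left_diff_distrib kg.scale_left_diff_distrib)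
    then have "c - c' \<in> pR" using scal_u_maxI_iff[OF t] SR that by auto
    then show ?thesis using transversal_inj[OF S(1) add_closed_pR] that by simp
  qed
  have "transversal (MMf j) (MMf (Suc j)) ((\<lambda>c. scal c (u t)) ` S)"
  proof (rule transversalI)
    show "add_closed (MMf (Suc j))" using j by (intro add_closed_MMf) simp
    show "finite ((\<lambda>c. scal c (u t)) ` S)" using transversalD(1)[OF S(1)] by simp
    show "(\<lambda>c. scal c (u t)) ` S \<subseteq> MMf j" using uMM SR by auto
    show "\<exists>r\<in>(\<lambda>c. scal c (u t)) ` S. x - r \<in> MMf (Suc j)" if x: "x \<in> MMf j" for x
    proof -
      have xt: "x * \<epsilon> t \<in> Rs t" using x t unfolding MMf_def MM_def by blast
      obtain c where c: "c \<in> R" "x * \<epsilon> t - scal c (u t) \<in> maxI t" using residue_field_k[OF t xt] by blast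
      obtain d where d: "d \<in> S" "c - d \<in> pR" using transversalD(3)[OF S(1) c(1)] by blast
      have "scal (c - d) (u t) \<in> maxI t" using scal_u_maxI_iff[OF t] d SR c(1) by auto
      then have "(x * \<epsilon> t - scal c (u t)) + scal (c - d) (u t) \<in> maxI t" by (rule maxI_closed(2)[OF t c(2)])
      then have new: "(x - scal d (u t)) * \<epsilon> t \<in> maxI t"
        by (simp add: ute left_diff_distrib kg.scale_left_diff_distrib)
      have xd: "x - scal d (u t) \<in> MMf j"
        by (rule add_closedD(2)[OF add_closed_MMf x uMM]) (use j SR d in auto)
      have "{1..Suc j} = insert t {1..j}" unfolding t_def by auto
      then have "x - scal d (u t) \<in> MMf (Suc j)" using new xd unfolding MMf_def by auto
      then show ?thesis using d by blast
    qed
    show "s = r" if "s \<in> (\<lambda>c. scal c (u t)) ` S" "r \<in> (\<lambda>c. scal c (u t)) ` S" "s - r \<in> MMf (Suc j)" for s r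
      using that eqS by blast
  qed
  moreover have "inj_on (\<lambda>c. scal c (u t)) S"
    using eqS add_closedD(1)[OF add_closed_MMf, of "Suc j"] j by (intro inj_onI) auto
  ultimately show ?thesis using S(2) by (intro exI[of _ "(\<lambda>c. scal c (u t)) ` S"]) (simp add: card_image)
qed

lemma MMf_transversal: "j \<le> a \<Longrightarrow> \<exists>T. transversal MM (MMf j) T \<and> card T = residue_card ^ j"
proof (induction j)
  case 0
  have "transversal MM (MMf 0) {0}"
    using add_closed_MM add_closedD(1)[OF add_closed_MM] by (intro transversalI) (auto simp: MMf_def)
  then show ?case by (intro exI[of _ "{0}"]) simp
next
  case (Suc j)
  obtain T where T: "transversal MM (MMf j) T" "card T = residue_card ^ j" using Suc by auto
  obtain T' where T': "transversal (MMf j) (MMf (Suc j)) T'" "card T' = residue_card" using MMf_step[of j] Suc by auto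
  have "MMf j \<subseteq> MM" "MMf (Suc j) \<subseteq> MMf j" unfolding MMf_def by auto
  then obtain V where "transversal MM (MMf (Suc j)) V" "card V = card T * card T'"
    using transversal_trans[OF T(1) T'(1) add_closed_MM add_closed_MMf add_closed_MMf] Suc.prems by auto
  then show ?case using T(2) T'(2) by (intro exI[of _ V]) simp
qed

lemma w_MM: "w \<in> MM" using w_Z Z_MM by blast

lemma y_inverse: assumes s: "s \<in> {1..a}" shows "\<exists>t\<in>Rs s. y s * t = u s"
  using y_unit[OF s] unfolding Units_def by auto

text \<open>The \<open>y s\<close> are units, so in each component \<open>w\<close> generates the
  maximal ideal.\<close>

lemma wMM_eq: "MMf a = (*) w ` MM"
proof
  show "(*) w ` MM \<subseteq> MMf a"
    unfolding MMf_def using MM_mult[OF w_MM] maxI_closed(5)[OF _ w_maxI]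
    by (auto simp: eps_distrib[symmetric] MM_def simp del: atLeastAtMost_iff)
  show "MMf a \<subseteq> (*) w ` MM"
  proof
    fix z assume z: "z \<in> MMf a"
    have "\<exists>r\<in>Rs s. z * \<epsilon> s = y s * \<pi> s * r" if s: "s \<in> {1..a}" for s
    proof -
      obtain r where r: "r \<in> Rs s" "z * \<epsilon> s = \<pi> s * r" using z s unfolding MMf_def maxI_def by blast
      obtain t where t: "t \<in> Rs s" "y s * t = u s" using y_inverse[OF s] by blast
      have "y s * \<pi> s * (t * r) = \<pi> s * (y s * t) * r"
        using Rs_comm[OF s y_Rs[OF s] pi_Rs[OF s]] by (metis mult.assoc)
      also have "\<dots> = z * \<epsilon> s" unfolding t(2) r(2) using Rs_u(1)[OF s pi_Rs[OF s]] by simp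
      finally show ?thesis using Rs_closed(4)[OF s t(1) r(1)] by metis
    qed
    then obtain r where r: "\<And>s. s \<in> {1..a} \<Longrightarrow> r s \<in> Rs s \<and> z * \<epsilon> s = y s * \<pi> s * r s" by metis
    define m where "m = (\<Sum>s=1..a. r s)"
    have m: "m \<in> MM" unfolding m_def using r by (intro MM_sumI) blast
    have "z = w * m"
    proof (rule C_eqI)
      show "z \<in> C" "w * m \<in> C" using z m w_C C_closed(4) unfolding MMf_def MM_def by auto
      fix s assume s: "s \<in> {1..a}"
      have "m * \<epsilon> s = r s" unfolding m_def by (rule sum_eps_component[OF Rs_eps s]) (use r in auto)
      then show "z * \<epsilon> s = w * m * \<epsilon> s" using r[OF s] unfolding eps_distrib[OF s, symmetric] w_eps[OF s] by simp
    qed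
    then show "z \<in> (*) w ` MM" using m by blast
  qed
qed

lemma w_injective: assumes z: "z \<in> MM" "w * z = 0" shows "z = 0"
proof (rule C_eqI)
  show "z \<in> C" "0 \<in> C" using z C_closed(2) unfolding MM_def by auto
  fix s assume s: "s \<in> {1..a}"
  have "(w * \<epsilon> s) * (z * \<epsilon> s) = 0" unfolding eps_distrib[OF s] z(2) by simp
  moreover have "w * \<epsilon> s \<noteq> 0"
  proof
    assume "w * \<epsilon> s = 0"
    then have "y s = 0" using Zs_no_zero_divisors[OF s Rs_Zs[OF y_Rs[OF s]] Rs_Zs[OF pi_Rs[OF s]]]
      pi_nonzero[OF s] w_eps[OF s] by auto
    then show False using y_inverse[OF s] u_nonzero[OF s] by auto
  qed
  moreover have "w * \<epsilon> s \<in> Zs s" "z * \<epsilon> s \<in> Zs s" using eps_component_C[OF s] w_C z(1) unfolding MM_def by auto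
  ultimately show "z * \<epsilon> s = 0 * \<epsilon> s" using Zs_no_zero_divisors[OF s, of "w * \<epsilon> s" "z * \<epsilon> s"] by simp
qed

text \<open>The multiples of \<open>w ^ j\<close> have finite index in \<open>MM\<close> and lie in
  \<open>Z\<close> for large \<open>j\<close>. Squeezing \<open>Z\<close> between such a lattice and
  \<open>MM\<close> shows that its index is finite.\<close>

definition "WJ j = (\<lambda>z. w ^ j * z) ` MM"

lemma WJ_Suc: "WJ (Suc j) = (*) w ` WJ j" unfolding WJ_def by (auto simp: mult.assoc image_iff)

lemma WJ_MM: "WJ j \<subseteq> MM"
proof (induction j)
  case (Suc j)
  then show ?case unfolding WJ_Suc using MM_mult[OF w_MM] by auto
qed (auto simp: WJ_def)

lemma add_closed_WJ: "add_closed (WJ j)"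
proof (induction j)
  case (Suc j)
  show ?case unfolding add_closed_def WJ_Suc
  proof (intro conjI ballI)
    show "0 \<in> (*) w ` WJ j" using add_closedD(1)[OF Suc] by force
    show "x - z \<in> (*) w ` WJ j" if "x \<in> (*) w ` WJ j" "z \<in> (*) w ` WJ j" for x z
      using that add_closedD(2)[OF Suc] by (auto simp flip: right_diff_distrib)
  qed
qed (use add_closed_MM in \<open>simp add: WJ_def\<close>)

lemma WJ_transversal: "\<exists>T. transversal MM (WJ j) T"
proof (induction j)
  case 0
  have "transversal MM (WJ 0) {0}"
    using add_closed_MM add_closedD(1)[OF add_closed_MM] by (intro transversalI) (auto simp: WJ_def)
  then show ?case by blast
next
  case (Suc j)
  then obtain T where T: "transversal MM (WJ j) T" by blast
  obtain T' where T': "transversal ((*) w ` MM) ((*) w ` WJ j) T'"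
    using transversal_image[where \<phi> = "(*) w", OF T add_closed_WJ right_diff_distrib w_injective WJ_MM add_closed_MM]
    by blast
  obtain S where S: "transversal MM ((*) w ` MM) S" using MMf_transversal[OF order_refl] unfolding wMM_eq by blast
  have cl: "add_closed ((*) w ` MM)" using add_closed_MMf[OF order_refl] unfolding wMM_eq .
  have A: "(*) w ` MM \<subseteq> MM" using MM_mult[OF w_MM] by auto
  have B: "(*) w ` WJ j \<subseteq> (*) w ` MM" using WJ_MM by auto
  have cl': "add_closed ((*) w ` WJ j)" using add_closed_WJ[of "Suc j"] unfolding WJ_Suc .
  show ?case using transversal_trans[OF S T' add_closed_MM cl cl' A B] unfolding WJ_Suc by blast
qed

text \<open>One power of \<open>p\<close> puts all \<open>\<epsilon> s\<close> with
  \<open>s \<le> a\<close> into \<open>RG\<close>. Each component of an element of \<open>MM\<close>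
  is the component of some element of \<open>Z\<close>, so after scaling by this power it lies in
  \<open>Z\<close>.\<close>

lemma p_power_MM: "\<exists>N. \<forall>z\<in>MM. scal (of_nat p ^ N) z \<in> Z"
proof -
  have "\<forall>s. \<exists>m. scal (of_nat p ^ m) (\<epsilon> s) \<in> RG" using RG_dense by blast
  then obtain m where m: "\<And>s. scal (of_nat p ^ m s) (\<epsilon> s) \<in> RG" by metis
  define N where "N = (\<Sum>s=1..a. m s)"
  have N: "scal (of_nat p ^ N) (\<epsilon> s) \<in> RG" if "s \<in> {1..a}" for s
  proof -
    have "m s \<le> N" unfolding N_def using that by (intro member_le_sum) auto
    then have "(of_nat p ^ N :: 'k) = of_nat p ^ (N - m s) * of_nat p ^ m s" by (simp flip: power_add)
    then have "scal (of_nat p ^ N) (\<epsilon> s) = scal (of_nat p ^ (N - m s)) (scal (of_nat p ^ m s) (\<epsilon> s))" by simp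
    then show ?thesis using m[of s] RG_scal[of "of_nat p ^ (N - m s)"] by (metis R_of_nat of_nat_power)
  qed
  have "scal (of_nat p ^ N) z \<in> Z" if z: "z \<in> MM" for z
  proof -
    have "scal (of_nat p ^ N) (z * \<epsilon> s) \<in> Z" if s: "s \<in> {1..a}" for s
    proof -
      obtain t where t: "t \<in> Z" "z * \<epsilon> s = t * \<epsilon> s" using z s Rs_iff[OF s] unfolding MM_def by blast
      obtain x where x: "x \<in> RG" "t = f * x * f" using Z_Gamma[OF t(1)] unfolding Gamma_iff by blast
      have "scal (of_nat p ^ N) (t * \<epsilon> s) = f * (x * scal (of_nat p ^ N) (\<epsilon> s)) * f"
        unfolding x(2) using eps_central[OF exc_index[OF s], of f] by (simp add: mult.assoc)
      then have "scal (of_nat p ^ N) (t * \<epsilon> s) \<in> \<Gamma>"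
        using RG_cut_Gamma[OF RG_mult[OF x(1) N[OF s]]] by (simp only:)
      moreover have "scal (of_nat p ^ N) (t * \<epsilon> s) \<in> C" by (intro C_closed(5) C_eps exc_index[OF s] Z_C t)
      ultimately show ?thesis unfolding Z_iff t(2) by simp
    qed
    then have "(\<Sum>s=1..a. scal (of_nat p ^ N) (z * \<epsilon> s)) \<in> Z" by (intro Z_sum)
    moreover have "z = (\<Sum>s=1..a. z * \<epsilon> s)" using z H_sum_eps[OF C_H] unfolding MM_def by blast
    ultimately show ?thesis by (metis kg.scale_sum_right)
  qed
  then show ?thesis by blast
qed

lemma w_power_eps: assumes s: "s \<in> {1..a}" shows "w ^ j * u s \<in> Rs s"
proof (induction j)
  case (Suc j)
  have "w ^ Suc j * u s = w * (w ^ j * u s) * \<epsilon> s"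
    using Rs_eps[OF s Suc] by (simp add: mult.assoc)
  also have "\<dots> = (w * \<epsilon> s) * ((w ^ j * u s) * \<epsilon> s)" unfolding eps_distrib[OF s] ..
  also have "\<dots> = (w * \<epsilon> s) * (w ^ j * u s)" unfolding Rs_eps[OF s Suc] ..
  finally show ?case using Rs_closed(4)[OF s] Suc Z_eps_Rs[OF s w_Z] by simp
qed (use Rs_closed(1)[OF s] in simp)

lemma w_power_dvd_p: "\<exists>J. \<forall>s\<in>{1..a}. \<exists>t\<in>Rs s. w ^ J * u s = scal (of_nat p) t"
proof -
  have one: "\<exists>J. \<exists>t\<in>Rs s. w ^ J * u s = scal (of_nat p) t" if s: "s \<in> {1..a}" for s
  proof -
    obtain N t where t: "t \<in> Rs s" "\<pi> s ^ N * u s = scal (of_nat p) t" using pi_power_dvd_p[OF s] by blast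
    have "w ^ j * u s = (\<pi> s ^ j * u s) * (y s ^ j * u s)" for j
    proof (induction j)
      case (Suc j)
      have R: "\<pi> s ^ j * u s \<in> Rs s" "y s ^ j * u s \<in> Rs s" using Rs_power[OF s] pi_Rs[OF s] y_Rs[OF s] by auto
      have "w ^ Suc j * u s = w * (w ^ j * u s) * \<epsilon> s"
        using Rs_eps[OF s w_power_eps[OF s]] by (simp add: mult.assoc)
      also have "\<dots> = (w * \<epsilon> s) * ((w ^ j * u s) * \<epsilon> s)" unfolding eps_distrib[OF s] ..
      also have "\<dots> = (y s * \<pi> s) * (w ^ j * u s)" unfolding Rs_eps[OF s w_power_eps[OF s]] w_eps[OF s] ..
      also have "\<dots> = (\<pi> s * y s) * ((\<pi> s ^ j * u s) * (y s ^ j * u s))"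
        unfolding Suc using Rs_comm[OF s y_Rs[OF s] pi_Rs[OF s]] by simp
      also have "\<dots> = \<pi> s * (y s * (\<pi> s ^ j * u s)) * (y s ^ j * u s)" by (simp only: mult.assoc)
      also have "y s * (\<pi> s ^ j * u s) = (\<pi> s ^ j * u s) * y s" by (rule Rs_comm[OF s y_Rs[OF s] R(1)])
      finally show ?case by (simp add: mult.assoc)
    qed (use u_unit(1)[OF s u_Zs[OF s]] in simp)
    from this[of N] have "w ^ N * u s = scal (of_nat p) (t * (y s ^ N * u s))" unfolding t(2) by simp
    then show ?thesis using Rs_closed(4)[OF s t(1) Rs_power[OF s y_Rs[OF s]]] by blast
  qed
  then obtain J where J: "\<And>s. s \<in> {1..a} \<Longrightarrow> \<exists>t\<in>Rs s. w ^ J s * u s = scal (of_nat p) t" by metis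
  define N where "N = (\<Sum>s=1..a. J s)"
  have "\<exists>t\<in>Rs s. w ^ N * u s = scal (of_nat p) t" if s: "s \<in> {1..a}" for s
  proof -
    have "J s \<le> N" unfolding N_def using that by (intro member_le_sum) auto
    then have "w ^ N = w ^ (N - J s) * w ^ J s" by (simp flip: power_add)
    moreover obtain t where t: "t \<in> Rs s" "w ^ J s * u s = scal (of_nat p) t" using J[OF s] by blast
    ultimately have "w ^ N * u s = scal (of_nat p) (w ^ (N - J s) * t)" by (simp add: mult.assoc)
    also have "w ^ (N - J s) * t = w ^ (N - J s) * u s * t" using Rs_u(2)[OF s t(1)] by (simp add: mult.assoc)
    finally show ?thesis using Rs_closed(4)[OF s w_power_eps[OF s] t(1)] by blast
  qed
  then show ?thesis by blast
qed

text \<open>Some \<open>w ^ J\<close> maps \<open>MM\<close> into \<open>p MM\<close>, and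
  \<open>p ^ N MM\<close> lies in \<open>Z\<close>; hence \<open>w ^ (J * N)\<close> maps
  \<open>MM\<close> into \<open>Z\<close>.\<close>

lemma WJ_p: "\<exists>J. WJ J \<subseteq> Z"
proof -
  obtain N where N: "\<And>z. z \<in> MM \<Longrightarrow> scal (of_nat p ^ N) z \<in> Z" using p_power_MM by blast
  obtain J where J: "\<And>s. s \<in> {1..a} \<Longrightarrow> \<exists>t\<in>Rs s. w ^ J * u s = scal (of_nat p) t" using w_power_dvd_p by blast
  have step: "\<exists>m\<in>MM. w ^ J * z = scal (of_nat p) m" if z: "z \<in> MM" for z
  proof -
    have zC: "z \<in> C" "\<And>s. s \<in> {1..a} \<Longrightarrow> z * \<epsilon> s \<in> Rs s" using z unfolding MM_def by auto
    have "\<exists>r\<in>Rs s. w ^ J * (z * \<epsilon> s) = scal (of_nat p) r" if s: "s \<in> {1..a}" for s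
    proof -
      obtain t where t: "t \<in> Rs s" "w ^ J * u s = scal (of_nat p) t" using J[OF s] by blast
      have "w ^ J * (z * \<epsilon> s) = w ^ J * (u s * (z * \<epsilon> s))" using Rs_u(2)[OF s zC(2)[OF s]] by simp
      also have "\<dots> = scal (of_nat p) (t * (z * \<epsilon> s))" using t(2) by (metis mult.assoc scal_mult_left)
      finally show ?thesis using Rs_closed(4)[OF s t(1) zC(2)[OF s]] by blast
    qed
    then obtain r where r: "\<And>s. s \<in> {1..a} \<Longrightarrow> r s \<in> Rs s \<and> w ^ J * (z * \<epsilon> s) = scal (of_nat p) (r s)" by metis
    have "w ^ J * z = w ^ J * (\<Sum>s=1..a. z * \<epsilon> s)" using H_sum_eps[OF C_H[OF zC(1)]] by simp
    also have "\<dots> = (\<Sum>s=1..a. scal (of_nat p) (r s))"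
      unfolding sum_distrib_left by (intro sum.cong refl) (use r in blast)
    also have "\<dots> = scal (of_nat p) (\<Sum>s=1..a. r s)" by (simp add: kg.scale_sum_right)
    finally show ?thesis using MM_sumI[of r] r by blast
  qed
  have powers: "\<exists>m\<in>MM. w ^ (J * k) * z = scal (of_nat p ^ k) m" if "z \<in> MM" for z k
    using that
  proof (induction k arbitrary: z)
    case (Suc k)
    obtain m where m: "m \<in> MM" "w ^ J * z = scal (of_nat p) m" using step[OF Suc.prems] by blast
    obtain m' where m': "m' \<in> MM" "w ^ (J * k) * m = scal (of_nat p ^ k) m'" using Suc.IH[OF m(1)] by blast
    have "J * Suc k = J * k + J" by simp
    then have "w ^ (J * Suc k) * z = w ^ (J * k) * (w ^ J * z)" by (simp only: power_add mult.assoc)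
    also have "\<dots> = scal (of_nat p ^ Suc k) m'" unfolding m(2) using m'(2) by (simp add: mult.commute)
    finally show ?case using m'(1) by blast
  qed simp
  have "WJ (J * N) \<subseteq> Z"
  proof
    fix x assume "x \<in> WJ (J * N)"
    then obtain z where z: "z \<in> MM" "x = w ^ (J * N) * z" unfolding WJ_def by auto
    then obtain m where "m \<in> MM" "x = scal (of_nat p ^ N) m" using powers by blast
    then show "x \<in> Z" using N by simp
  qed
  then show ?thesis ..
qed

lemma MM_Z_transversal: "\<exists>S. transversal MM Z S"
proof -
  obtain J where J: "WJ J \<subseteq> Z" using WJ_p by blast
  obtain T where "transversal MM (WJ J) T" using WJ_transversal by blast
  from transversal_quotient_submodules(1)[OF add_closed_MM add_closed_Z add_closed_WJ Z_MM J this] show ?thesis .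
qed

lemma wZ_image: "wZ = (*) w ` Z" unfolding wZ_def by auto

lemma add_closed_wZ: "add_closed wZ"
  unfolding add_closed_def
proof (intro conjI ballI)
  show "x - z \<in> wZ" if "x \<in> wZ" "z \<in> wZ" for x z
    using wZ_closed(2)[OF that(1) wZ_closed(3)[OF that(2)]] by simp
qed (rule wZ_closed)

text \<open>Multiplication by \<open>w\<close> has the same index on \<open>Z\<close> as on
  \<open>MM\<close>, where the filtration \<open>MMf\<close> evaluates it.\<close>

lemma index_wZ: "\<exists>T. transversal Z wZ T \<and> card T = residue_card ^ a"
proof -
  obtain J where J: "WJ J \<subseteq> Z" using WJ_p by blast
  have sub: "WJ (Suc J) \<subseteq> wZ" unfolding WJ_Suc wZ_image using J by auto
  have wZ_Z: "wZ \<subseteq> Z" using wZ_closed(6) by blast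
  obtain V where V: "transversal MM (WJ (Suc J)) V" using WJ_transversal by blast
  obtain V' where V': "transversal Z (WJ (Suc J)) V'"
    using transversal_quotient_submodules(2)[OF add_closed_MM add_closed_Z add_closed_WJ Z_MM _ V] sub wZ_Z by blast
  obtain T where T: "transversal Z wZ T"
    using transversal_quotient_submodules(1)[OF add_closed_Z add_closed_wZ add_closed_WJ wZ_Z sub V'] by blast
  obtain S0 where S0: "transversal MM Z S0" using MM_Z_transversal by blast
  obtain S where S: "transversal MM ((*) w ` MM) S" "card S = residue_card ^ a"
    using MMf_transversal[OF order_refl] unfolding wMM_eq by blast
  have "card S = card T"
  proof (rule transversal_endomorphism[OF add_closed_MM add_closed_Z Z_MM S0 _ w_injective _ _ S(1)])
    show "transversal Z ((*) w ` Z) T" using T unfolding wZ_image .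
    show "(*) w ` Z \<subseteq> Z" using wZ_Z unfolding wZ_image .
    show "(*) w ` MM \<subseteq> MM" using MM_mult[OF w_MM] by auto
  qed (simp_all add: right_diff_distrib)
  then show ?thesis using T S(2) by metis
qed

text \<open>By \<open>Z_local\<close> the element \<open>z\<close> is a unit in every component,
  hence in \<open>MM\<close>, so multiplication by \<open>z\<close> has index \<open>1\<close> on
  \<open>MM\<close>. It then has index \<open>1\<close> on \<open>Z\<close> too, and
  \<open>f\<close> is a multiple of \<open>z\<close> in \<open>Z\<close>.\<close>

lemma Z_unit:
  assumes z: "z \<in> Z" and s: "s \<in> {1..a}" "z * \<epsilon> s \<notin> maxI s"
  shows "\<exists>t\<in>Z. z * t = f"
proof -
  have "\<exists>t\<in>Rs s. (z * \<epsilon> s) * t = u s" if "s \<in> {1..a}" for s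
    using unit_outside_maxI[OF that Z_eps_Rs[OF that z]] Z_local[OF s(1) that z] s(2) by blast
  then obtain t where t: "\<And>s. s \<in> {1..a} \<Longrightarrow> t s \<in> Rs s \<and> (z * \<epsilon> s) * t s = u s" by metis
  define z' where "z' = (\<Sum>s=1..a. t s)"
  have z': "z' \<in> MM" unfolding z'_def using t by (intro MM_sumI) blast
  have zM: "z \<in> MM" using z Z_MM by blast
  have zz': "z * z' = f"
  proof (rule C_eqI)
    show "z * z' \<in> C" "f \<in> C" using MM_mult[OF zM z'] C_closed(1) unfolding MM_def by auto
    fix s assume s: "s \<in> {1..a}"
    have "z' * \<epsilon> s = t s" unfolding z'_def by (rule sum_eps_component[OF Rs_eps s]) (use t in auto)
    then show "z * z' * \<epsilon> s = f * \<epsilon> s" using t[OF s] unfolding eps_distrib[OF s, symmetric] by simp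
  qed
  have z'z: "z' * z = f" using zz' C_comm[OF Z_C[OF z] C_H, of z'] z' unfolding MM_def by auto
  have img: "(*) z ` MM = MM"
  proof
    show "(*) z ` MM \<subseteq> MM" using MM_mult[OF zM] by auto
    show "MM \<subseteq> (*) z ` MM"
    proof
      fix x assume x: "x \<in> MM"
      then have "x = z * (z' * x)" using H_f(1)[OF C_H] zz' unfolding MM_def by (auto simp flip: mult.assoc)
      then show "x \<in> (*) z ` MM" using MM_mult[OF z' x] by blast
    qed
  qed
  obtain J where J: "WJ J \<subseteq> Z" using WJ_p by blast
  \<comment> \<open>This gives \<open>z Z\<close> finite index in \<open>Z\<close>, which has to be
    known before indices can be compared.\<close>
  have WJ_J: "WJ J \<subseteq> (*) z ` Z"
  proof
    fix x assume "x \<in> WJ J"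
    then obtain m where m: "m \<in> MM" "x = w ^ J * m" unfolding WJ_def by auto
    have xC: "x \<in> C" using \<open>x \<in> WJ J\<close> J Z_C by blast
    have mC: "m \<in> C" and z'C: "z' \<in> C" using m z' unfolding MM_def by auto
    have "z' * x = x * z'" by (rule C_comm[OF z'C C_H[OF xC]])
    also have "\<dots> = w ^ J * (m * z')" unfolding m(2) by (rule mult.assoc)
    finally have "z' * x \<in> WJ J" unfolding WJ_def using MM_mult[OF m(1) z'] by blast
    moreover have "x = z * (z' * x)" using zz' H_f(1)[OF C_H[OF xC]] by (simp flip: mult.assoc)
    ultimately show "x \<in> (*) z ` Z" using J by blast
  qed
  have zZ: "(*) z ` Z \<subseteq> Z" using Z_closed(4)[OF z] by auto
  have cl: "add_closed ((*) z ` Z)" unfolding add_closed_def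
  proof (intro conjI ballI)
    show "0 \<in> (*) z ` Z" using Z_closed(2) by force
    show "x - x' \<in> (*) z ` Z" if "x \<in> (*) z ` Z" "x' \<in> (*) z ` Z" for x x'
      using that Z_closed(7) by (auto simp flip: right_diff_distrib)
  qed
  obtain V where V: "transversal MM (WJ J) V" using WJ_transversal by blast
  obtain V' where V': "transversal Z (WJ J) V'"
    using transversal_quotient_submodules(2)[OF add_closed_MM add_closed_Z add_closed_WJ Z_MM J V] by blast
  obtain T where T: "transversal Z ((*) z ` Z) T"
    using transversal_quotient_submodules(1)[OF add_closed_Z cl add_closed_WJ zZ WJ_J V'] by blast
  obtain S0 where S0: "transversal MM Z S0" using MM_Z_transversal by blast
  have S: "transversal MM ((*) z ` MM) {0}" unfolding img
    using add_closed_MM add_closedD(1)[OF add_closed_MM] by (intro transversalI) auto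
  have "card {0 :: 'g \<Rightarrow>\<^sub>0 'k} = card T"
  proof (rule transversal_endomorphism[OF add_closed_MM add_closed_Z Z_MM S0 _ _ _ zZ S T])
    show "(*) z ` MM \<subseteq> MM" using img by simp
    show "x = 0" if x: "x \<in> MM" "z * x = 0" for x
    proof -
      have "x = z' * (z * x)" using z'z H_f(1)[OF C_H] x(1) unfolding MM_def by (auto simp flip: mult.assoc)
      then show ?thesis using x(2) by simp
    qed
  qed (simp_all add: right_diff_distrib)
  then obtain t0 where t0: "T = {t0}" by (metis card_1_singletonE card.empty card_insert_disjoint empty_iff finite.emptyI One_nat_def)
  \<comment> \<open>With a single coset, \<open>0\<close> and \<open>f\<close> are congruent modulo
    \<open>z Z\<close>.\<close>
  have "0 - t0 \<in> (*) z ` Z" "f - t0 \<in> (*) z ` Z"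
    using transversalD(3)[OF T Z_closed(2)] transversalD(3)[OF T Z_closed(1)] t0 by auto
  from add_closedD(2)[OF cl this(2,1)] show ?thesis by auto
qed

end

section \<open>The Brauer tree and the corners of the order\<close>

text \<open>Sending each vertex other than a root to an edge towards the root is injective.\<close>

lemma connected_card_edges:
  fixes ends :: "'h \<Rightarrow> 'v set"
  assumes "finite V" "\<And>h. h \<in> P \<Longrightarrow> ends h \<subseteq> V \<and> card (ends h) = 2"
    and conn: "\<And>v w. v \<in> V \<Longrightarrow> w \<in> V \<Longrightarrow> (v, w) \<in> {(v, w). \<exists>h \<in> P. v \<in> ends h \<and> w \<in> ends h}\<^sup>*"
  shows "card V \<le> card (ends ` P) + 1"
proof (cases "V = {}")
  case False
  then obtain v0 where v0: "v0 \<in> V" by auto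
  let ?r = "{(v, w). \<exists>h \<in> P. v \<in> ends h \<and> w \<in> ends h}"
  define d where "d v = (LEAST k. (v0, v) \<in> ?r ^^ k)" for v
  have d: "(v0, v) \<in> ?r ^^ d v" if "v \<in> V" for v
  proof -
    have "\<exists>k. (v0, v) \<in> ?r ^^ k" using conn[OF v0 that] unfolding rtrancl_power .
    then show ?thesis unfolding d_def by (rule LeastI_ex)
  qed
  have parent: "\<exists>h. h \<in> P \<and> v \<in> ends h \<and> (\<exists>u\<in>ends h. d u < d v)" if v: "v \<in> V - {v0}" for v
  proof -
    have "d v \<noteq> 0"
    proof
      assume "d v = 0"
      then show False using d[of v] v by auto
    qed
    then obtain k where k: "d v = Suc k" by (cases "d v") auto
    then obtain u where u: "(v0, u) \<in> ?r ^^ k" "(u, v) \<in> ?r" using d[of v] v by auto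
    have "d u \<le> k" unfolding d_def using u(1) by (rule Least_le)
    moreover obtain h where "h \<in> P" "u \<in> ends h" "v \<in> ends h" using u(2) by auto
    ultimately show ?thesis using k by (intro exI[of _ h] conjI bexI[of _ u]) auto
  qed
  then obtain g where g: "\<And>v. v \<in> V - {v0} \<Longrightarrow> g v \<in> P \<and> v \<in> ends (g v) \<and> (\<exists>u\<in>ends (g v). d u < d v)" by metis
  have "inj_on (\<lambda>v. ends (g v)) (V - {v0})"
  proof (rule inj_onI, rule ccontr)
    fix v v' assume v: "v \<in> V - {v0}" "v' \<in> V - {v0}" "ends (g v) = ends (g v')" "v \<noteq> v'"
    have "{v, v'} \<subseteq> ends (g v)" using g v by auto
    moreover have "card (ends (g v)) = 2" using g v assms(2) by blast
    moreover from this have "finite (ends (g v))" by (metis card.infinite zero_neq_numeral)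
    ultimately have "ends (g v) = {v, v'}" using v(4) card_subset_eq[of "ends (g v)" "{v, v'}"] by simp
    then have "d v' < d v" "d v < d v'" using g[OF v(1)] g[OF v(2)] v(3) by auto
    then show False by simp
  qed
  moreover have "(\<lambda>v. ends (g v)) ` (V - {v0}) \<subseteq> ends ` P" using g by auto
  moreover have "finite (ends ` P)" using assms(1,2) finite_subset[of "ends ` P" "Pow V"] by auto
  ultimately have "card (V - {v0}) \<le> card (ends ` P)" by (metis card_image card_mono)
  then show ?thesis using v0 assms(1) by simp
qed simp

context unramified_field
begin

text \<open>If \<open>\<kappa>\<close> had the exact denominator \<open>p ^ j\<close> with
  \<open>j > 0\<close>, then \<open>\<kappa> ^ Suc N\<close> would have the denominator
  \<open>p ^ (j * Suc N)\<close>, which a fixed \<open>d\<close> cannot clear for all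
  \<open>N\<close>.\<close>

lemma bounded_powers:
  assumes "d \<noteq> 0" "\<And>N. d * \<kappa> ^ Suc N \<in> R" shows "\<kappa> \<in> R"
proof (rule ccontr)
  assume n: "\<kappa> \<notin> R"
  obtain j0 where "of_nat p ^ j0 * \<kappa> \<in> R" using dense by blast
  then have jR: "of_nat p ^ (LEAST j. of_nat p ^ j * \<kappa> \<in> R) * \<kappa> \<in> R" by (rule LeastI)
  define j where "j = (LEAST j. of_nat p ^ j * \<kappa> \<in> R)"
  have "j \<noteq> 0"
  proof
    assume "j = 0"
    then show False using jR n unfolding j_def[symmetric] by simp
  qed
  then obtain i where i: "j = Suc i" by (cases j) auto
  define r where "r = of_nat p ^ j * \<kappa>"
  have r: "r \<in> R" unfolding r_def j_def by (rule jR)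
  have "r \<notin> pR"
  proof
    assume "r \<in> pR"
    then obtain x where x: "x \<in> R" "of_nat p * (of_nat p ^ i * \<kappa>) = of_nat p * x"
      unfolding pR_def r_def i by (auto simp: mult.assoc)
    then have "of_nat p ^ i * \<kappa> \<in> R" using p_nonzero by simp
    then have "j \<le> i" unfolding j_def by (rule Least_le)
    then show False using i by simp
  qed
  then have ir: "inverse r \<in> R" "r \<noteq> 0" using R_unit[OF r] by auto
  \<comment> \<open>At most a factor \<open>p ^ l\<close> is cleared by \<open>d\<close>, so the
    exponent \<open>Suc l\<close> leaves a factor \<open>p\<close> over and puts \<open>1\<close>
    into \<open>pR\<close>.\<close>
  obtain l where l: "of_nat p ^ l * inverse d \<in> R" using dense by blast
  define W where "W = of_nat p ^ l * inverse d * (inverse r ^ Suc l * (d * \<kappa> ^ Suc l))"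
  have WR: "W \<in> R" unfolding W_def by (rule R_mult[OF l R_mult[OF R_power[OF ir(1)] assms(2)]])
  have "W = of_nat p ^ l * \<kappa> ^ Suc l * inverse r ^ Suc l"
    unfolding W_def using assms(1) by (simp add: field_simps)
  then have "of_nat p * (W * (of_nat p ^ i) ^ Suc l)
      = (of_nat p ^ Suc l * \<kappa> ^ Suc l * (of_nat p ^ i) ^ Suc l) * inverse r ^ Suc l"
    by (simp add: mult_ac)
  also have "of_nat p ^ Suc l * \<kappa> ^ Suc l * (of_nat p ^ i) ^ Suc l = r ^ Suc l"
    unfolding r_def i by (simp only: power_mult_distrib[symmetric] power_Suc mult_ac)
  also have "r ^ Suc l * inverse r ^ Suc l = 1" using ir(2) by (simp flip: power_mult_distrib del: power_Suc)
  finally have "1 \<in> pR" unfolding pR_def using R_mult[OF WR R_power[OF R_power[OF R_of_nat]]] by (metis (mono_tags, lifting) mem_Collect_eq)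
  then show False using one_notin_pR by simp
qed

end

context exceptional_order
begin

lemma ends_equiv:
  assumes "idem_equiv (sub_rng (block_of R b) b) h h'" "h \<in> PR" "h' \<in> PR"
  shows "ends h = ends h'"
proof -
  have imp: "h' * \<epsilon> s \<noteq> 0"
    if uw: "u' * w' = h" "w' * u' = h'" "h * h = h" "h * \<epsilon> s \<noteq> 0" "s \<in> {1..a+e}" for u' w' h h' s
  proof
    assume h0: "h' * \<epsilon> s = 0"
    have "h * \<epsilon> s = u' * w' * (u' * w') * \<epsilon> s" using uw(1,3) by simp
    also have "\<dots> = u' * (w' * u') * (w' * \<epsilon> s)" by (simp only: mult.assoc)
    also have "w' * \<epsilon> s = \<epsilon> s * w'" using eps_central[OF uw(5)] by simp
    finally have "h * \<epsilon> s = u' * (h' * \<epsilon> s) * w'" using uw(2) by (simp only: mult.assoc)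
    then show False using h0 uw(4) by simp
  qed
  obtain u' w' where uw: "u' * w' = h" "w' * u' = h'" using assms(1) unfolding idem_equiv_def by auto
  have hh: "h * h = h" "h' * h' = h'" using prim_idem assms(2,3) unfolding PR_def by auto
  have "h * \<epsilon> s \<noteq> 0 \<longleftrightarrow> h' * \<epsilon> s \<noteq> 0" if "s \<in> {1..a+e}" for s
    using imp[OF uw hh(1) _ that] imp[OF uw(2,1) hh(2) _ that] by blast
  moreover have "s \<in> {1..a+e}" if "s \<in> V" "V \<in> brauer_vertices a e" for s V
    using that unfolding brauer_vertices_def by auto
  ultimately show ?thesis unfolding ends_def by blast
qed

lemma PR_nonempty: "PR \<noteq> {}"
proof
  assume "PR = {}"
  then have "PI = {}" using PI_PR by blast
  then show False using PI_sum b_nonzero by simp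
qed

lemma finite_vertices: "finite (brauer_vertices a e)" unfolding brauer_vertices_def by simp

lemma ends_vertices: "ends h \<subseteq> brauer_vertices a e" unfolding ends_def by auto

text \<open>A tree has no multiple edges. The number of classes of edges is one less than that of
  vertices, and connectedness requires at least as many different end sets; so the map from classes
  to end sets is injective.\<close>

lemma ends_inj:
  assumes "h \<in> PR" "h' \<in> PR" "ends h = ends h'"
  shows "idem_equiv (sub_rng (block_of R b) b) h h'"
proof (rule ccontr)
  assume neq: "\<not> ?thesis"
  define r where "r = {(h, h'). h \<in> PR \<and> h' \<in> PR \<and> idem_equiv (sub_rng (block_of R b) b) h h'}"
  have refl: "(h, h) \<in> r" if "h \<in> PR" for h
  proof -
    have "h \<in> block_of R b" "h * h = h"
      using that unfolding PR_def primitive_idem_def primitive_idem_in_def by auto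
    then have "idem_equiv (sub_rng (block_of R b) b) h h" unfolding idem_equiv_def sub_rng_simps by blast
    then show ?thesis unfolding r_def using that by blast
  qed
  have r_ends: "ends h = ends h'" if "(h, h') \<in> r" for h h'
    using that ends_equiv unfolding r_def by blast
  have card: "card (PR // r) + 1 = card (brauer_vertices a e)" unfolding r_def by (rule tree_card)
  obtain h0 where h0: "h0 \<in> PR" using PR_nonempty by auto
  have "2 \<le> card (brauer_vertices a e)"
    using card_mono[OF finite_vertices ends_vertices, of h0] ends_card[OF h0] by simp
  then have fin: "finite (PR // r)" using card by (intro card_ge_0_finite) simp
  define G where "G c = ends (SOME x. x \<in> c)" for c
  have G: "G (r `` {h}) = ends h" if "h \<in> PR" for h
  proof -
    have "(SOME x. x \<in> r `` {h}) \<in> r `` {h}" by (rule someI[of _ h]) (use refl[OF that] in blast)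
    then show ?thesis unfolding G_def using r_ends by blast
  qed
  have img: "G ` (PR // r) = ends ` PR"
  proof
    show "G ` (PR // r) \<subseteq> ends ` PR" using G by (auto simp: quotient_def)
    show "ends ` PR \<subseteq> G ` (PR // r)"
    proof
      fix v assume "v \<in> ends ` PR"
      then obtain h where h: "h \<in> PR" "v = ends h" by auto
      then have "r `` {h} \<in> PR // r" by (auto simp: quotient_def)
      then show "v \<in> G ` (PR // r)" using G[OF h(1)] h(2) by blast
    qed
  qed
  have "card (brauer_vertices a e) \<le> card (ends ` PR) + 1"
    by (rule connected_card_edges[OF finite_vertices _ tree_connected]) (use ends_vertices ends_card in auto)
  then have "card (PR // r) \<le> card (G ` (PR // r))" unfolding img using card by simp
  then have "inj_on G (PR // r)" using card_image_le[OF fin, of G] by (intro eq_card_imp_inj_on[OF fin]) simp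
  moreover have "r `` {h} \<in> PR // r" "r `` {h'} \<in> PR // r" using assms by (auto simp: quotient_def)
  moreover have "G (r `` {h}) = G (r `` {h'})" using G assms by simp
  ultimately have "r `` {h} = r `` {h'}" by (auto dest: inj_onD)
  then have "(h, h') \<in> r" using refl[OF assms(2)] by blast
  then show False using neq unfolding r_def by blast
qed

text \<open>The projection of the group ring to the exceptional vertex. It contains \<open>f\<close>
  and \<open>\<Gamma>\<close>, which need not lie in \<open>RG\<close>.\<close>

definition "eRG = {\<epsilon>e * x |x. x \<in> RG}"

lemma eRG_mult_RG: "x \<in> eRG \<Longrightarrow> z \<in> RG \<Longrightarrow> x * z \<in> eRG"
  unfolding eRG_def by (auto simp: mult.assoc)

lemma RG_mult_eRG: assumes "x \<in> eRG" "z \<in> RG" shows "z * x \<in> eRG"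
proof -
  obtain x' where x': "x = \<epsilon>e * x'" "x' \<in> RG" using assms(1) unfolding eRG_def by auto
  have "z * x = \<epsilon>e * (z * x')" unfolding x'(1) using ee_central[of z] by (metis mult.assoc)
  then show ?thesis unfolding eRG_def using x'(2) assms(2) by blast
qed

lemma eRG_ee: assumes "x \<in> eRG" shows "\<epsilon>e * x = x" "x * \<epsilon>e = x"
proof -
  show "\<epsilon>e * x = x" using assms ee_idem unfolding eRG_def by (auto simp flip: mult.assoc)
  then show "x * \<epsilon>e = x" using ee_central by metis
qed

lemma eRG_mult: assumes "x \<in> eRG" "z \<in> eRG" shows "x * z \<in> eRG"
proof -
  obtain z' where z': "z = \<epsilon>e * z'" "z' \<in> RG" using assms(2) unfolding eRG_def by auto
  have "x * z = x * \<epsilon>e * z'" unfolding z'(1) by (simp only: mult.assoc)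
  then show ?thesis using eRG_ee(2)[OF assms(1)] eRG_mult_RG[OF assms(1) z'(2)] by simp
qed

text \<open>Elements of the group ring on which \<open>\<epsilon>e\<close> acts as the identity form an ideal of \<open>\<epsilon>e RG\<close>.\<close>

lemma eRG_RG:
  assumes "x \<in> eRG" "r \<in> RG" "r * \<epsilon>e = r" shows "x * r \<in> RG" "r * x \<in> RG"
proof -
  obtain x' where x': "x = \<epsilon>e * x'" "x' \<in> RG" using assms(1) unfolding eRG_def by auto
  have "x * r = x' * (r * \<epsilon>e)" unfolding x'(1) using ee_central[of "x' * r"] by (simp add: mult.assoc)
  then show "x * r \<in> RG" unfolding assms(3) using x'(2) assms(2) by auto
  have "r * x = r * \<epsilon>e * x'" unfolding x'(1) by (simp only: mult.assoc)
  then show "r * x \<in> RG" unfolding assms(3) using x'(2) assms(2) by auto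
qed

lemma f_eRG: "f \<in> eRG" using f_RG unfolding eRG_def by blast

lemma Gamma_eRG: assumes "x \<in> \<Gamma>" shows "x \<in> eRG"
proof -
  obtain z where z: "z \<in> RG" "x = f * z * f" using assms unfolding Gamma_iff by auto
  show ?thesis unfolding z(2) by (rule eRG_mult[OF eRG_mult_RG[OF f_eRG z(1)] f_eRG])
qed

lemma eRG_Gamma: assumes "x \<in> eRG" "x \<in> H" shows "x \<in> \<Gamma>"
proof -
  obtain x' where x': "x = \<epsilon>e * x'" "x' \<in> RG" using assms(1) unfolding eRG_def by auto
  have "x = f * (\<epsilon>e * x') * f" using H_f[OF assms(2)] x'(1) by simp
  also have "\<dots> = (f * \<epsilon>e) * x' * f" by (simp only: mult.assoc)
  finally show ?thesis unfolding f_ee using RG_cut_Gamma[OF x'(2)] by simp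
qed

lemma E_diag_nonzero: assumes s: "s \<in> {1..a}" and i: "i \<in> {1..n}" shows "E s i i \<noteq> 0"
proof
  assume E0: "E s i i = 0"
  have "E s k k = 0" if k: "k \<in> {1..n}" for k
  proof -
    have "E s k i * E s i i * E s i k = E s k k" using E_mult[OF s k i i i] E_mult[OF s k i i k] by simp
    then show ?thesis using E0 by simp
  qed
  then have "u s = 0" using sum_E[OF s] by (metis (no_types, lifting) sum.neutral)
  then show False using u_nonzero[OF s] by simp
qed

text \<open>Krull--Schmidt: as \<open>Z\<close> is local, one of the summands of \<open>M i i = \<Sum> M i i h M i i\<close> is a unit.\<close>

lemma M_equiv_primitive:
  assumes i: "i \<in> {1..n}"
  shows "\<exists>h \<alpha> \<beta>. h \<in> PR \<and> {1..a} \<in> ends h \<and> \<alpha> \<in> eRG \<and> \<beta> \<in> eRG \<and> \<alpha> * \<beta> = M i i \<and> \<beta> * \<alpha> = h * \<epsilon>e \<and>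
    M i i * \<alpha> = \<alpha> \<and> \<beta> * M i i = \<beta> \<and> \<alpha> * h = \<alpha> \<and> h * \<beta> = \<beta>"
proof -
  have one: "1 \<in> {1..a}" using a_pos by auto
  have MM: "M i i * M i i = M i i" using M_mult[OF i i i i] by simp
  have fM: "f * M i i = M i i" "M i i * f = M i i" using H_f[OF M_H[OF i i]] by auto
  define z where "z h = coord i i (f * h * f)" for h
  have zZ: "z h \<in> Z" if "h \<in> PI" for h
    unfolding z_def by (intro coord_Z[OF RG_cut_Gamma i i] prim_RG PI_prim that)
  have zM: "z h * M i i = M i i * h * M i i" for h
  proof -
    have "z h * M i i = M i i * (f * h * f) * M i i" unfolding z_def by (rule coord_times_M_corner[OF i i])
    then show ?thesis using fM by (metis mult.assoc)
  qed
  have "(\<Sum>h\<in>PI. z h) = coord i i (\<Sum>h\<in>PI. f * h * f)" unfolding z_def coord_sum ..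
  also have "(\<Sum>h\<in>PI. f * h * f) = f * \<Sum>PI * f" by (simp only: sum_distrib_left sum_distrib_right)
  also have "\<dots> = f" unfolding PI_sum using f_b f_idem by simp
  also have "coord i i f = f" using coord_diag[OF C_closed(1) i i] by simp
  finally have sum: "(\<Sum>h\<in>PI. z h) = f" .
  have "\<exists>h\<in>PI. z h * \<epsilon> 1 \<notin> maxI 1"
  proof (rule ccontr)
    assume all: "\<not> ?thesis"
    have "(\<Sum>h\<in>P. z h * \<epsilon> 1) \<in> maxI 1" if "P \<subseteq> PI" for P
      using finite_subset[OF that PI_finite] that all maxI_closed(1,2)[OF one]
      by (induction P rule: finite_induct) auto
    then have "(\<Sum>h\<in>PI. z h) * \<epsilon> 1 \<in> maxI 1" unfolding sum_distrib_right by blast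
    then show False using sum maxI_closed(8)[OF one] by simp
  qed
  then obtain h where h: "h \<in> PI" "z h * \<epsilon> 1 \<notin> maxI 1" by blast
  note hprim = PI_prim[OF h(1)] and hPR = PI_PR[OF h(1)]
  obtain t where t: "t \<in> Z" "z h * t = f" using Z_unit[OF zZ[OF h(1)] one h(2)] by blast
  have tM: "t * M i i = M i i * t" by (rule C_comm[OF Z_C[OF t(1)] M_H[OF i i]])
  define \<alpha> where "\<alpha> = M i i * h"
  define \<beta> where "\<beta> = h * (M i i * t)"
  have \<alpha>e: "\<alpha> \<in> eRG" unfolding \<alpha>_def by (rule eRG_mult_RG[OF Gamma_eRG[OF M_diag_Gamma[OF i]] prim_RG[OF hprim]])
  have \<beta>e: "\<beta> \<in> eRG" unfolding \<beta>_def
    by (rule RG_mult_eRG[OF Gamma_eRG[OF Gamma_mult[OF M_diag_Gamma[OF i] Z_Gamma[OF t(1)]]] prim_RG[OF hprim]])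
  have hh: "h * h = h" by (rule prim_idem[OF hprim])
  have ab: "\<alpha> * \<beta> = M i i"
  proof -
    have "\<alpha> * \<beta> = M i i * (h * h) * M i i * t" unfolding \<alpha>_def \<beta>_def by (simp only: mult.assoc)
    also have "\<dots> = z h * (M i i * t)" unfolding hh zM[symmetric] by (rule mult.assoc)
    also have "\<dots> = z h * t * M i i" unfolding tM[symmetric] by (rule mult.assoc[symmetric])
    finally show ?thesis unfolding t(2) fM .
  qed
  have M\<alpha>: "M i i * \<alpha> = \<alpha>" unfolding \<alpha>_def using MM by (simp flip: mult.assoc)
  have \<beta>M: "\<beta> * M i i = \<beta>"
  proof -
    have "\<beta> * M i i = h * (M i i * (t * M i i))" unfolding \<beta>_def by (simp only: mult.assoc)
    also have "\<dots> = h * (M i i * M i i * t)" unfolding tM by (simp only: mult.assoc)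
    finally show ?thesis unfolding MM \<beta>_def .
  qed
  have \<alpha>h: "\<alpha> * h = \<alpha>" unfolding \<alpha>_def using hh by (simp add: mult.assoc)
  have h\<beta>: "h * \<beta> = \<beta>" unfolding \<beta>_def using hh by (simp flip: mult.assoc)
  \<comment> \<open>The component of \<open>\<beta> * \<alpha>\<close> at \<open>s\<close> is a
    nonzero idempotent in the field \<open>L s * h\<close>, hence its identity
    \<open>h * \<epsilon> s\<close>.\<close>
  have comp: "h * \<epsilon> s \<noteq> 0 \<and> \<beta> * \<alpha> * \<epsilon> s = h * \<epsilon> s" if s: "s \<in> {1..a}" for s
  proof -
    note s' = exc_index[OF s]
    define q where "q = \<beta> * \<alpha> * \<epsilon> s"
    have "\<alpha> * q * \<beta> = (\<alpha> * \<beta>) * (\<alpha> * \<beta>) * \<epsilon> s"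
      unfolding q_def by (simp only: mult.assoc eps_central[OF s', of \<beta>])
    then have "\<alpha> * q * \<beta> = E s i i" unfolding ab MM using M_eps[OF s i i] by simp
    then have q0: "q \<noteq> 0" using E_diag_nonzero[OF s i] by auto
    have qh: "q = \<beta> * \<alpha> * (h * \<epsilon> s)" unfolding q_def using \<alpha>h by (metis mult.assoc)
    then have nz: "h * \<epsilon> s \<noteq> 0" using q0 by auto
    have "q * h = q"
    proof -
      have "q * h = \<beta> * (\<alpha> * h) * \<epsilon> s" unfolding q_def by (simp only: mult.assoc eps_central[OF s', of h])
      then show ?thesis unfolding \<alpha>h q_def .
    qed
    moreover have "h * q = q" unfolding q_def using h\<beta> by (simp flip: mult.assoc)
    ultimately have hqh: "h * q * h = q" by simp
    have q\<epsilon>: "q * \<epsilon> s = q" unfolding q_def using eps_idem[OF s'] by (simp add: mult.assoc)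
    have "b * \<epsilon> s = \<epsilon> s" using b_central[of "\<epsilon> s"] eps_b[OF s'] by simp
    then have "q * b * \<epsilon> s = q" using q\<epsilon> by (simp add: mult.assoc)
    then have "q \<in> {x * b * \<epsilon> s |x. True}" by (intro CollectI exI[of _ q] conjI TrueI) (rule sym)
    then have "h * q * h \<in> {h * x * h |x. x \<in> {x * b * \<epsilon> s |x. True}}" by blast
    then have "q \<in> {z * h |z. z \<in> L s}" unfolding hqh ends_local[OF hPR exc_vertex[OF hPR s nz] s] .
    then obtain \<zeta> where \<zeta>: "\<zeta> \<in> L s" "q = \<zeta> * h" by blast
    then have "\<zeta> \<noteq> 0" using q0 by auto
    then obtain \<xi> where \<xi>: "\<xi> \<in> L s" "\<zeta> * \<xi> = \<epsilon> s" using L_inverse[OF s \<zeta>(1)] by blast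
    have \<xi>\<zeta>: "\<xi> * \<zeta> = \<epsilon> s" using L_comm[OF s' \<zeta>(1), of \<xi>] \<xi>(2) by (rule subst)
    have qq: "q * q = q"
    proof -
      have "q * q = \<beta> * (\<alpha> * \<beta>) * \<alpha> * \<epsilon> s"
        unfolding q_def eps_distrib[OF s] by (simp only: mult.assoc)
      then show ?thesis unfolding ab mult.assoc[of \<beta>] M\<alpha> q_def .
    qed
    have "\<xi> * q = h * \<epsilon> s"
      unfolding \<zeta>(2) mult.assoc[symmetric] \<xi>\<zeta> by (rule eps_central[OF s'])
    then have "h * \<epsilon> s * q = h * \<epsilon> s" using qq by (metis mult.assoc)
    moreover have "h * \<epsilon> s * q = q"
      using q\<epsilon> \<open>h * q = q\<close> by (simp add: mult.assoc eps_central[OF s', of q])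
    ultimately show ?thesis using nz unfolding q_def by simp
  qed
  have "\<beta> * \<alpha> = \<beta> * \<alpha> * \<epsilon>e" using eRG_ee(2)[OF \<alpha>e] by (simp add: mult.assoc)
  also have "\<dots> = (\<Sum>s=1..a. \<beta> * \<alpha> * \<epsilon> s)" unfolding \<epsilon>e_def sum_distrib_left ..
  also have "\<dots> = (\<Sum>s=1..a. h * \<epsilon> s)" by (intro sum.cong refl) (use comp in blast)
  also have "\<dots> = h * \<epsilon>e" unfolding \<epsilon>e_def sum_distrib_left ..
  finally have ba: "\<beta> * \<alpha> = h * \<epsilon>e" .
  have "{1..a} \<in> ends h" using exc_vertex[OF hPR one] comp[OF one] by blast
  then show ?thesis using hPR \<alpha>e \<beta>e ab ba M\<alpha> \<beta>M \<alpha>h h\<beta> by blast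
qed

text \<open>An equivalence would give \<open>\<gamma>\<close> in the corner \<open>(1, n)\<close>
  and \<open>\<delta>\<close> in the corner \<open>(n, 1)\<close> of \<open>\<Gamma>\<close> with
  \<open>\<gamma> * \<delta> = M 1 1\<close>. But \<open>\<gamma>\<close> has all entries of its
  first row in \<open>wZ\<close>, so \<open>f\<close> would lie in \<open>wZ\<close> and vanish
  modulo \<open>\<pi> 1\<close>.\<close>

lemma not_equiv_1n:
  assumes 1: "h \<in> PR" "\<alpha> \<in> eRG" "\<beta> \<in> eRG" "\<alpha> * \<beta> = M 1 1" "M 1 1 * \<alpha> = \<alpha>" "\<beta> * M 1 1 = \<beta>" "\<alpha> * h = \<alpha>"
    and n: "h' \<in> PR" "\<alpha>' \<in> eRG" "\<beta>' \<in> eRG" "\<beta>' * \<alpha>' = h' * \<epsilon>e" "M n n * \<alpha>' = \<alpha>'" "\<beta>' * M n n = \<beta>'"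
  shows "\<not> idem_equiv (sub_rng (block_of R b) b) h h'"
proof
  assume "idem_equiv (sub_rng (block_of R b) b) h h'"
  then obtain u' w' where uw: "u' \<in> block_of R b" "w' \<in> block_of R b" "u' * w' = h" "w' * u' = h'"
    unfolding idem_equiv_def by auto
  have uR: "u' \<in> RG" "w' \<in> RG" using uw(1,2) b_RG unfolding block_of_def by auto
  have hh: "h * h = h" using prim_idem 1(1) unfolding PR_def by auto
  note i1 = n_index(1) and i2 = n_index(2)
  define \<gamma> where "\<gamma> = \<alpha> * u' * \<beta>'"
  define \<delta> where "\<delta> = \<alpha>' * w' * \<beta>"
  have "\<gamma> * \<delta> = \<alpha> * u' * (\<beta>' * \<alpha>') * w' * \<beta>" unfolding \<gamma>_def \<delta>_def by (simp only: mult.assoc)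
  also have "\<dots> = \<alpha> * u' * (w' * u') * (\<epsilon>e * (w' * \<beta>))" unfolding n(4) uw(4)[symmetric] by (simp only: mult.assoc)
  also have "\<epsilon>e * (w' * \<beta>) = w' * \<beta>" by (rule eRG_ee(1)[OF RG_mult_eRG[OF 1(3) uR(2)]])
  also have "\<alpha> * u' * (w' * u') * (w' * \<beta>) = \<alpha> * ((u' * w') * (u' * w')) * \<beta>" by (simp only: mult.assoc)
  also have "\<dots> = M 1 1" unfolding uw(3) hh 1(7) by (rule 1(4))
  finally have gd: "\<gamma> * \<delta> = M 1 1" .
  have \<gamma>M: "M 1 1 * \<gamma> = \<gamma>" "\<gamma> * M n n = \<gamma>"
    unfolding \<gamma>_def using 1(5) n(6) by (simp_all add: mult.assoc) (simp flip: mult.assoc)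
  have \<delta>M: "M n n * \<delta> = \<delta>" "\<delta> * M 1 1 = \<delta>"
    unfolding \<delta>_def using n(5) 1(6) by (simp_all add: mult.assoc) (simp flip: mult.assoc)
  have inH: "x \<in> H" if "M j j * x = x" "x * M k k = x" "j \<in> {1..n}" "k \<in> {1..n}" for x j k
  proof -
    have "f * x = f * M j j * x" "x * f = x * (M k k * f)" using that by (simp_all add: mult.assoc) (simp flip: mult.assoc)
    then show ?thesis using H_f[OF M_H[OF that(3,3)]] H_f[OF M_H[OF that(4,4)]] that unfolding H_def by simp
  qed
  have \<gamma>H: "\<gamma> \<in> H" by (rule inH[OF \<gamma>M i1 i2])
  have \<delta>H: "\<delta> \<in> H" by (rule inH[OF \<delta>M i2 i1])
  have \<gamma>G: "\<gamma> \<in> \<Gamma>" unfolding \<gamma>_def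
    by (rule eRG_Gamma[OF eRG_mult[OF eRG_mult_RG[OF 1(2) uR(1)] n(3)] \<gamma>H[unfolded \<gamma>_def]])
  have \<delta>G: "\<delta> \<in> \<Gamma>" unfolding \<delta>_def
    by (rule eRG_Gamma[OF eRG_mult[OF eRG_mult_RG[OF n(2) uR(2)] 1(3)] \<delta>H[unfolded \<delta>_def]])
  have c11: "coord 1 1 \<gamma> = 0"
  proof -
    have "M k 1 * \<gamma> * M 1 k = 0" if "k \<in> {1..n}" for k
    proof -
      have "M k 1 * \<gamma> * M 1 k = M k 1 * \<gamma> * (M n n * M 1 k)" using \<gamma>M(2) by (metis mult.assoc)
      then show ?thesis using M_mult[OF i2 i2 i1 that] n_gt_1 by simp
    qed
    then show ?thesis unfolding coord_def by (intro sum.neutral) blast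
  qed
  have "coord 1 1 (\<gamma> * \<delta>) = (\<Sum>k=1..n. coord 1 k \<gamma> * coord k 1 \<delta>)" by (rule coord_mult[OF i1 i1 \<gamma>H \<delta>H])
  also have "\<dots> \<in> wZ"
  proof (rule wZ_sum)
    fix k assume k: "k \<in> {1..n}"
    show "coord 1 k \<gamma> * coord k 1 \<delta> \<in> wZ"
    proof (cases "k = 1")
      case False
      then have "coord 1 k \<gamma> \<in> wZ" using Gamma_coord_cell[OF \<gamma>G i1 k] k unfolding cell_def by auto
      then show ?thesis by (rule wZ_closed(4)[OF _ coord_Z[OF \<delta>G k i1]])
    qed (simp only: c11 mult_zero_left wZ_closed(1))
  qed
  also have "coord 1 1 (\<gamma> * \<delta>) = f"
    unfolding gd using coord_times_M[OF C_closed(1) i1 i1 i1 i1] H_f(1)[OF M_H[OF i1 i1]] by simp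
  finally have "f \<in> wZ" .
  moreover have "1 \<in> {1..a}" using a_pos by auto
  ultimately show False using wZ_maxI maxI_closed(8) by blast
qed

section \<open>Corners of \<open>\<Gamma>\<close> inside \<open>RG\<close>\<close>

lemma RG_b_split: "x * b = x \<Longrightarrow> x = (\<Sum>s=1..a+e. x * \<epsilon> s)"
  using b_eq_sum_eps by (metis sum_distrib_left)

lemma ee_if_nonexc_zero:
  assumes "x * b = x" "\<And>s. s \<in> {a+1..a+e} \<Longrightarrow> x * \<epsilon> s = 0" shows "x * \<epsilon>e = x"
proof -
  have "(\<Sum>s=1..a+e. x * \<epsilon> s) = (\<Sum>s=1..a. x * \<epsilon> s)"
    using assms(2) by (intro sum.mono_neutral_right) auto
  also have "\<dots> = x * \<epsilon>e" unfolding \<epsilon>e_def sum_distrib_left ..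
  finally show ?thesis using RG_b_split[OF assms(1)] by simp
qed

lemma nonexc_vertex:
  assumes "h \<in> PR" "{1..a} \<in> ends h"
  obtains t where "t \<in> {a+1..a+e}" "ends h = {{1..a}, {t}}" "h * \<epsilon> t \<noteq> 0"
    "\<And>s. s \<in> {a+1..a+e} \<Longrightarrow> s \<noteq> t \<Longrightarrow> h * \<epsilon> s = 0"
proof -
  obtain V1 V2 where V12: "ends h = {V1, V2}" "V1 \<noteq> V2" using ends_card[OF assms(1)] unfolding card_2_iff by auto
  have "\<exists>V. ends h = {{1..a}, V} \<and> V \<noteq> {1..a}"
  proof (cases "V1 = {1..a}")
    case False
    then have "V2 = {1..a}" using assms(2) V12(1) by auto
    then show ?thesis using V12 by (intro exI[of _ V1]) auto
  qed (use V12 in auto)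
  then obtain V where V: "ends h = {{1..a}, V}" "V \<noteq> {1..a}" by blast
  then have "V \<in> brauer_vertices a e" using ends_vertices[of h] by auto
  then obtain t where t: "V = {t}" "t \<in> {a+1..a+e}" using V(2) unfolding brauer_vertices_def by auto
  have "h * \<epsilon> t \<noteq> 0" using ends_all[OF assms(1), of V t] V t by auto
  moreover have "h * \<epsilon> s = 0" if s: "s \<in> {a+1..a+e}" "s \<noteq> t" for s
  proof (rule ccontr)
    assume "h * \<epsilon> s \<noteq> 0"
    then have "{s} \<in> ends h" unfolding ends_def brauer_vertices_def using s by auto
    then have "{s} = {1..a}" using V(1) t(1) s(2) by auto
    then have "s \<in> {1..a}" by blast
    then show False using s by auto
  qed
  ultimately show ?thesis using that t V(1) by blast
qed

text \<open>Moved to the block, the corner element becomes \<open>\<epsilon>e * (h * g * h')\<close>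
  with \<open>g\<close> in \<open>RG\<close>. Since \<open>h\<close> and \<open>h'\<close> have no
  nonexceptional vertex in common, \<open>\<epsilon>e\<close> acts on \<open>h * g * h'\<close> as
  the identity, so nothing is projected away and the element is in \<open>RG\<close>. By
  \<open>eRG_RG\<close> it stays there when moved back.\<close>

lemma corner_1n_RG: assumes x: "x \<in> \<Gamma>" shows "M 1 1 * x * M n n \<in> RG"
proof -
  note i1 = n_index(1) and i2 = n_index(2)
  obtain h \<alpha> \<beta> where 1: "h \<in> PR" "{1..a} \<in> ends h" "\<alpha> \<in> eRG" "\<beta> \<in> eRG" "\<alpha> * \<beta> = M 1 1"
    "M 1 1 * \<alpha> = \<alpha>" "\<beta> * M 1 1 = \<beta>" "\<alpha> * h = \<alpha>" "h * \<beta> = \<beta>"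
    using M_equiv_primitive[OF i1] by metis
  obtain h' \<alpha>' \<beta>' where n: "h' \<in> PR" "{1..a} \<in> ends h'" "\<alpha>' \<in> eRG" "\<beta>' \<in> eRG" "\<alpha>' * \<beta>' = M n n"
    "\<beta>' * \<alpha>' = h' * \<epsilon>e" "M n n * \<alpha>' = \<alpha>'" "\<beta>' * M n n = \<beta>'" "\<alpha>' * h' = \<alpha>'"
    using M_equiv_primitive[OF i2] by metis
  have "\<not> idem_equiv (sub_rng (block_of R b) b) h h'"
    by (rule not_equiv_1n[OF 1(1,3,4,5,6,7,8) n(1,3,4,6,7,8)])
  then have ne: "ends h \<noteq> ends h'" using ends_inj[OF 1(1) n(1)] by blast
  obtain t where t: "ends h = {{1..a}, {t}}" "\<And>s. s \<in> {a+1..a+e} \<Longrightarrow> s \<noteq> t \<Longrightarrow> h * \<epsilon> s = 0"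
    using nonexc_vertex[OF 1(1,2)] by metis
  obtain t' where t': "ends h' = {{1..a}, {t'}}" "\<And>s. s \<in> {a+1..a+e} \<Longrightarrow> s \<noteq> t' \<Longrightarrow> h' * \<epsilon> s = 0"
    using nonexc_vertex[OF n(1,2)] by metis
  have tt: "t \<noteq> t'" using ne t(1) t'(1) by auto
  have hprim: "primitive_idem (sub_rng (block_of R b) b) h" "primitive_idem (sub_rng (block_of R b) b) h'"
    using 1(1) n(1) unfolding PR_def by auto
  have "\<beta> * x * \<alpha>' \<in> eRG" by (rule eRG_mult[OF eRG_mult[OF 1(4) Gamma_eRG[OF x]] n(3)])
  then obtain g where g: "\<beta> * x * \<alpha>' = \<epsilon>e * g" "g \<in> RG" unfolding eRG_def by blast
  define r where "r = h * g * h'"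
  have rR: "r \<in> RG" unfolding r_def using prim_RG[OF hprim(1)] prim_RG[OF hprim(2)] g(2) by auto
  \<comment> \<open>On each nonexceptional component \<open>h\<close> or \<open>h'\<close> vanishes,
    because their second vertices \<open>t\<close> and \<open>t'\<close> differ.\<close>
  have re: "r * \<epsilon>e = r"
  proof (rule ee_if_nonexc_zero)
    show "r * b = r" unfolding r_def using prim_b(1)[OF hprim(2)] by (simp add: mult.assoc)
    fix s assume s: "s \<in> {a+1..a+e}"
    then have s': "s \<in> {1..a+e}" by auto
    have "r * \<epsilon> s = h * g * (h' * \<epsilon> s)" unfolding r_def by (rule mult.assoc)
    moreover have "r * \<epsilon> s = h * \<epsilon> s * (g * h')" unfolding r_def by (simp only: mult.assoc eps_central[OF s', of "g * h'"])
    ultimately show "r * \<epsilon> s = 0" using t(2)[OF s] t'(2)[OF s] tt by (cases "s = t") auto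
  qed
  have "\<beta> * x * \<alpha>' = (h * \<beta>) * x * (\<alpha>' * h')" unfolding 1(9) n(9) ..
  also have "\<dots> = h * (\<beta> * x * \<alpha>') * h'" by (simp only: mult.assoc)
  also have "\<dots> = \<epsilon>e * (h * g * h')" unfolding g(1) using ee_central[of h] by (metis mult.assoc)
  also have "\<dots> = r" using re ee_central[of r] unfolding r_def by simp
  finally have eq: "\<beta> * x * \<alpha>' = r" .
  have "M 1 1 * x * M n n = \<alpha> * r * \<beta>'" unfolding eq[symmetric] 1(5)[symmetric] n(5)[symmetric] by (simp only: mult.assoc)
  moreover have "\<alpha> * r \<in> RG" by (rule eRG_RG(1)[OF 1(3) rR re])
  moreover have "\<alpha> * r * \<epsilon>e = \<alpha> * r" unfolding mult.assoc re ..
  ultimately show ?thesis using eRG_RG(2)[OF n(4), of "\<alpha> * r"] by simp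
qed

text \<open>The corner of the block at \<open>h\<close> sees only the exceptional vertex and one
  further vertex \<open>t\<close>, where it reduces to scalars. Lifting \<open>z\<close> to this
  corner and subtracting its scalar at \<open>t\<close> leaves an element of \<open>RG\<close>
  supported on the exceptional vertex.\<close>

lemma Z_decomposition: assumes z: "z \<in> Z" shows "\<exists>c\<in>R. (z - scal c f) * M 1 1 \<in> RG"
proof -
  note i1 = n_index(1)
  obtain h \<alpha> \<beta> where 1: "h \<in> PR" "{1..a} \<in> ends h" "\<alpha> \<in> eRG" "\<beta> \<in> eRG" "\<alpha> * \<beta> = M 1 1"
    "\<beta> * \<alpha> = h * \<epsilon>e" "M 1 1 * \<alpha> = \<alpha>" "\<beta> * M 1 1 = \<beta>" "\<alpha> * h = \<alpha>" "h * \<beta> = \<beta>"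
    using M_equiv_primitive[OF i1] by metis
  have hprim: "primitive_idem (sub_rng (block_of R b) b) h" using 1(1) unfolding PR_def by auto
  note hR = prim_RG[OF hprim] and hb = prim_b[OF hprim] and hh = prim_idem[OF hprim]
  obtain t where t: "t \<in> {a+1..a+e}" "ends h = {{1..a}, {t}}" "h * \<epsilon> t \<noteq> 0"
    "\<And>s. s \<in> {a+1..a+e} \<Longrightarrow> s \<noteq> t \<Longrightarrow> h * \<epsilon> s = 0"
    using nonexc_vertex[OF 1(1,2)] by metis
  have t': "t \<in> {1..a+e}" using t(1) by auto
  have "\<beta> * z * \<alpha> \<in> eRG" by (rule eRG_mult[OF eRG_mult[OF 1(4) Gamma_eRG[OF Z_Gamma[OF z]]] 1(3)])
  then obtain g where g: "\<beta> * z * \<alpha> = \<epsilon>e * g" "g \<in> RG" unfolding eRG_def by blast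
  define x where "x = h * g * h"
  have xR: "x \<in> RG" unfolding x_def using hR g(2) by auto
  have "b * \<epsilon> t = \<epsilon> t" using b_central[of "\<epsilon> t"] eps_b[OF t'] by simp
  then have "g * \<epsilon> t = g * b * \<epsilon> t" by (simp add: mult.assoc)
  then have "g * \<epsilon> t \<in> {x * b * \<epsilon> t |x. True}" by blast
  then have "h * (g * \<epsilon> t) * h \<in> {h * x * h |x. x \<in> {x * b * \<epsilon> t |x. True}}" by blast
  moreover have "{t} \<in> ends h" using t(2) by simp
  ultimately have "h * (g * \<epsilon> t) * h \<in> {z * h |z. z \<in> L t}" using ends_local[OF 1(1) _ singletonI] by (simp only:)
  then obtain \<zeta> where \<zeta>: "h * (g * \<epsilon> t) * h = \<zeta> * h" "\<zeta> \<in> L t" by blast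
  have "L t = {scal c (\<epsilon> t) |c. True}" unfolding L_def by (rule nonexceptional[OF t(1)])
  then obtain \<kappa> where "\<zeta> = scal \<kappa> (\<epsilon> t)" using \<zeta>(2) by blast
  with \<zeta>(1) have "h * (g * \<epsilon> t) * h = scal \<kappa> (\<epsilon> t) * h" by simp
  moreover have "h * (g * \<epsilon> t) * h = x * \<epsilon> t" unfolding x_def by (simp only: mult.assoc eps_central[OF t', of h])
  ultimately have \<kappa>: "x * \<epsilon> t = scal \<kappa> (h * \<epsilon> t)" using eps_central[OF t', of h] by simp
  have hx: "x * h = x" "h * x = x" unfolding x_def using hh by (simp_all add: mult.assoc) (simp flip: mult.assoc)
  have pow: "x ^ Suc N * \<epsilon> t = scal (\<kappa> ^ Suc N) (h * \<epsilon> t)" for N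
  proof (induction N)
    case (Suc N)
    have "x ^ Suc (Suc N) * \<epsilon> t = x * (x ^ Suc N * \<epsilon> t)" by (simp add: mult.assoc)
    also have "\<dots> = scal (\<kappa> ^ Suc N) (x * h * \<epsilon> t)" unfolding Suc by (simp add: mult.assoc)
    also have "\<dots> = scal (\<kappa> ^ Suc (Suc N)) (h * \<epsilon> t)" unfolding hx \<kappa> by (simp add: mult.commute)
    finally show ?case .
  qed (simp add: \<kappa>)
  \<comment> \<open>The powers of \<open>x\<close> remain in \<open>RG\<close>, and their components
    at \<open>t\<close> are the powers of \<open>\<kappa>\<close> times a fixed nonzero element; so
    the denominators are bounded.\<close>
  have \<kappa>R: "\<kappa> \<in> R"
  proof -
    obtain m where m: "scal (of_nat p ^ m) (\<epsilon> t) \<in> RG" using RG_dense by blast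
    obtain k where k: "Poly_Mapping.lookup (h * \<epsilon> t) k \<noteq> 0" using t(3) by (metis poly_mapping_eqI lookup_zero)
    have "of_nat p ^ m * Poly_Mapping.lookup (h * \<epsilon> t) k * \<kappa> ^ Suc N \<in> R" for N
    proof -
      have "x ^ Suc N \<in> RG" by (induction N) (use xR in auto)
      from RG_mult[OF this m] have "scal (of_nat p ^ m) (x ^ Suc N * \<epsilon> t) \<in> RG" by (simp only: scal_mult_right)
      then have "of_nat p ^ m * (\<kappa> ^ Suc N * Poly_Mapping.lookup (h * \<epsilon> t) k) \<in> R"
        unfolding pow group_ring_def by (simp del: power_Suc add: mult.assoc)
      then show ?thesis by (simp only: mult_ac)
    qed
    from bounded_powers[OF _ this] show ?thesis using k p_nonzero by simp
  qed
  \<comment> \<open>Subtracting \<open>\<kappa> h\<close> removes the component at \<open>t\<close>,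
    the only nonexceptional one.\<close>
  define r where "r = x - scal \<kappa> h"
  have rR: "r \<in> RG" unfolding r_def using xR hR \<kappa>R by auto
  have re: "r * \<epsilon>e = r"
  proof (rule ee_if_nonexc_zero)
    show "r * b = r" unfolding r_def x_def using hb by (simp add: left_diff_distrib mult.assoc)
    fix s assume s: "s \<in> {a+1..a+e}"
    then have s': "s \<in> {1..a+e}" by auto
    have "x * \<epsilon> s = h * g * (h * \<epsilon> s)" unfolding x_def by (rule mult.assoc)
    then show "r * \<epsilon> s = 0" using t(4)[OF s] \<kappa> unfolding r_def by (cases "s = t") (auto simp: left_diff_distrib)
  qed
  have "\<beta> * z * \<alpha> = (h * \<beta>) * z * (\<alpha> * h)" unfolding 1(9,10) ..
  also have "\<dots> = h * (\<beta> * z * \<alpha>) * h" by (simp only: mult.assoc)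
  also have "\<dots> = \<epsilon>e * (h * g * h)" unfolding g(1) using ee_central[of h] by (metis mult.assoc)
  also have "\<dots> = x * \<epsilon>e" unfolding x_def by (rule ee_central)
  finally have bza: "\<beta> * z * \<alpha> = x * \<epsilon>e" .
  have "(z - scal \<kappa> f) * M 1 1 = z * M 1 1 - scal \<kappa> (M 1 1)"
    using H_f(1)[OF M_H[OF i1 i1]] by (simp add: left_diff_distrib)
  also have "z * M 1 1 = \<alpha> * (\<beta> * z * \<alpha>) * \<beta>"
  proof -
    have MM: "M 1 1 * M 1 1 = M 1 1" using M_mult[OF i1 i1 i1 i1] by simp
    have "\<alpha> * (\<beta> * z * \<alpha>) * \<beta> = M 1 1 * z * M 1 1" unfolding 1(5)[symmetric] by (simp only: mult.assoc)
    also have "\<dots> = z * (M 1 1 * M 1 1)" unfolding C_comm[OF Z_C[OF z] M_H[OF i1 i1], symmetric] by (rule mult.assoc)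
    finally show ?thesis unfolding MM ..
  qed
  also have "scal \<kappa> (M 1 1) = \<alpha> * scal \<kappa> (h * \<epsilon>e) * \<beta>"
  proof -
    have "\<alpha> * (h * \<epsilon>e) * \<beta> = \<alpha> * h * (\<epsilon>e * \<beta>)" by (simp only: mult.assoc)
    then have "\<alpha> * (h * \<epsilon>e) * \<beta> = M 1 1" unfolding 1(9) eRG_ee(1)[OF 1(4)] 1(5) .
    then show ?thesis by simp
  qed
  also have "\<alpha> * (\<beta> * z * \<alpha>) * \<beta> - \<alpha> * scal \<kappa> (h * \<epsilon>e) * \<beta> = \<alpha> * (r * \<epsilon>e) * \<beta>"
    unfolding bza r_def by (simp add: left_diff_distrib right_diff_distrib)
  finally have eq: "(z - scal \<kappa> f) * M 1 1 = \<alpha> * r * \<beta>" unfolding re .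
  have "\<alpha> * r \<in> RG" by (rule eRG_RG(1)[OF 1(3) rR re])
  moreover have "\<alpha> * r * \<epsilon>e = \<alpha> * r" unfolding mult.assoc re ..
  ultimately have "(z - scal \<kappa> f) * M 1 1 \<in> RG" unfolding eq by (rule eRG_RG(2)[OF 1(4)])
  with \<kappa>R show ?thesis by (rule bexI[rotated])
qed

end

section \<open>The trace dual\<close>

context exceptional_order
begin

lemma RG_coeff1: "x \<in> RG \<Longrightarrow> coeff1 x \<in> R"
  unfolding group_ring_def coeff1_def by blast

lemma wZ_M1n_RG: assumes "z \<in> wZ" shows "z * M 1 n \<in> RG"
proof -
  note i1 = n_index(1) and i2 = n_index(2)
  obtain z' where z': "z = w * z'" "z' \<in> Z" using assms unfolding wZ_def by blast
  have zC: "z \<in> C" using Z_C[OF wZ_closed(6)[OF assms]] .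
  have "z * M 1 n = w * (z' * M 1 n)" unfolding z'(1) by (rule mult.assoc)
  also have "z' * M 1 n = M 1 n * z'" by (rule C_comm[OF Z_C[OF z'(2)] M_H[OF i1 i2]])
  finally have "z * M 1 n = w * M 1 n * z'" by (simp only: mult.assoc)
  then have "z * M 1 n \<in> \<Gamma>" using Gamma_mult[OF wM_Gamma[OF i1 i2] Z_Gamma[OF z'(2)]] by simp
  from corner_1n_RG[OF this] have "M 1 1 * (z * M 1 n) * M n n \<in> RG" .
  also have "M 1 1 * (z * M 1 n) * M n n = z * M 1 n"
  proof -
    have "M 1 1 * (z * M 1 n) * M n n = (M 1 1 * z) * (M 1 n * M n n)" by (simp only: mult.assoc)
    also have "M 1 1 * z = z * M 1 1" by (rule C_comm[OF zC M_H[OF i1 i1], symmetric])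
    also have "M 1 n * M n n = M 1 n" using M_mult[OF i1 i2 i2 i2] by simp
    also have "z * M 1 1 * M 1 n = z * M 1 n" using M_mult[OF i1 i1 i1 i2] by (simp add: mult.assoc)
    finally show ?thesis .
  qed
  finally show ?thesis .
qed

lemma eRG_fixed: "x \<in> H \<Longrightarrow> x * \<epsilon>e = x"
  using f_ee(1) H_f(2)[of x] by (metis mult.assoc)

lemma product_M_n1: assumes "z \<in> C" "x \<in> C" shows "(z * M 1 n) * (x * M n 1) = x * z * M 1 1"
proof -
  note i1 = n_index(1) and i2 = n_index(2)
  have "(z * M 1 n) * (x * M n 1) = z * (M 1 n * x) * M n 1" by (simp only: mult.assoc)
  also have "M 1 n * x = x * M 1 n" by (rule C_comm[OF assms(2) M_H[OF i1 i2], symmetric])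
  also have "z * (x * M 1 n) * M n 1 = (z * x) * (M 1 n * M n 1)" by (simp only: mult.assoc)
  also have "z * x = x * z" by (rule C_comm[OF assms(1) C_H[OF assms(2)]])
  also have "M 1 n * M n 1 = M 1 1" using M_mult[OF i1 i2 i2 i1] by simp
  finally show ?thesis .
qed

text \<open>The symmetrizing form of \<open>RG\<close> pairs the corner \<open>(1, n)\<close> of \<open>\<Gamma>\<close> with the corner \<open>(n, 1)\<close>.\<close>

lemma wZ_iff: assumes z: "z \<in> C" shows "z \<in> wZ \<longleftrightarrow> (\<forall>x\<in>Z. coeff1 (x * z * M 1 1) \<in> R)"
proof
  note i1 = n_index(1) and i2 = n_index(2)
  assume zw: "z \<in> wZ"
  show "\<forall>x\<in>Z. coeff1 (x * z * M 1 1) \<in> R"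
  proof
    fix x assume x: "x \<in> Z"
    have "x * M n 1 \<in> \<Gamma>" using Gamma_mult[OF Z_Gamma[OF x] M_lower_Gamma[of 1 n]] n_gt_1 by simp
    moreover have "z * M 1 n * \<epsilon>e = z * M 1 n" by (rule eRG_fixed[OF H_closed(4)[OF C_H[OF z] M_H[OF i1 i2]]])
    ultimately have "(z * M 1 n) * (x * M n 1) \<in> RG" by (intro eRG_RG(2)[OF Gamma_eRG wZ_M1n_RG[OF zw]])
    then show "coeff1 (x * z * M 1 1) \<in> R" unfolding product_M_n1[OF z Z_C[OF x]] by (rule RG_coeff1)
  qed
next
  note i1 = n_index(1) and i2 = n_index(2)
  assume R: "\<forall>x\<in>Z. coeff1 (x * z * M 1 1) \<in> R"
  have "z * M 1 n \<in> RG"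
  proof (rule RG_self_dual)
    fix g :: "'g \<Rightarrow>\<^sub>0 'k" assume g: "g \<in> RG"
    \<comment> \<open>By symmetry of \<open>coeff1\<close>, pairing with \<open>g\<close> involves
      only the corner \<open>M n n * g * M 1 1\<close>, whose entry \<open>x\<close> lies in
      \<open>Z\<close>.\<close>
    define x where "x = coord n 1 (f * g * f)"
    have x: "x \<in> Z" unfolding x_def by (rule coord_Z[OF RG_cut_Gamma[OF g] i2 i1])
    have "x * M n 1 = M n n * (f * g * f) * M 1 1" unfolding x_def by (rule coord_times_M_corner[OF i2 i1])
    also have "\<dots> = (M n n * f) * g * (f * M 1 1)" by (simp only: mult.assoc)
    finally have xM: "x * M n 1 = M n n * g * M 1 1" unfolding H_f(1)[OF M_H[OF i1 i1]] H_f(2)[OF M_H[OF i2 i2]] .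
    have "coeff1 (x * z * M 1 1) = coeff1 ((z * M 1 n) * (x * M n 1))" unfolding product_M_n1[OF z Z_C[OF x]] ..
    also have "\<dots> = coeff1 ((z * (M 1 n * M n n) * g) * M 1 1)" unfolding xM by (simp only: mult.assoc)
    also have "\<dots> = coeff1 (M 1 1 * (z * (M 1 n * M n n) * g))" by (rule coeff1_commute)
    also have "M 1 n * M n n = M 1 n" using M_mult[OF i1 i2 i2 i2] by simp
    also have "M 1 1 * (z * M 1 n * g) = (M 1 1 * z) * M 1 n * g" by (simp only: mult.assoc)
    also have "M 1 1 * z = z * M 1 1" by (rule C_comm[OF z M_H[OF i1 i1], symmetric])
    also have "z * M 1 1 * M 1 n = z * M 1 n" using M_mult[OF i1 i1 i1 i2] by (simp add: mult.assoc)
    finally show "coeff1 (z * M 1 n * g) \<in> R" using R x by metis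
  qed
  from RG_cut_Gamma[OF this] have "z * M 1 n \<in> \<Gamma>"
    using H_f[OF H_closed(4)[OF C_H[OF z] M_H[OF i1 i2]]] by simp
  from Gamma_coord_cell[OF this i1 i2] show "z \<in> wZ"
    using coord_times_M[OF z i1 i2 i1 i2] n_gt_1 by (simp add: cell_def)
qed

text \<open>By \<open>Z_decomposition\<close>, \<open>z - scal c f\<close> has integral pairings
  with all of \<open>Z\<close>, which characterizes \<open>wZ\<close>.\<close>

lemma Z_mod_wZ: assumes z: "z \<in> Z" shows "\<exists>c\<in>R. z - scal c f \<in> wZ"
proof -
  note i1 = n_index(1)
  obtain c where c: "c \<in> R" "(z - scal c f) * M 1 1 \<in> RG" using Z_decomposition[OF z] by blast
  have t: "z - scal c f \<in> C" using c(1) z by (intro Z_C Z_closed)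
  have "coeff1 (x * (z - scal c f) * M 1 1) \<in> R" if x: "x \<in> Z" for x
  proof -
    have "x * ((z - scal c f) * M 1 1) \<in> RG"
      by (rule eRG_RG(1)[OF Gamma_eRG[OF Z_Gamma[OF x]] c(2) eRG_fixed[OF H_closed(4)[OF C_H[OF t] M_H[OF i1 i1]]]])
    then show ?thesis by (simp only: mult.assoc RG_coeff1)
  qed
  then have "z - scal c f \<in> wZ" using wZ_iff[OF t] by blast
  then show ?thesis using c(1) by blast
qed

section \<open>The valuation of the trace constant\<close>

definition "deg_exc = (\<Sum>s=1..a. kg.dim (L s))"

text \<open>From \<open>p ^ a - e * deg_exc = 1\<close> the number \<open>deg_exc\<close> is prime
  to \<open>p\<close>.\<close>

lemma inverse_deg: "inverse (of_nat deg_exc) \<in> R" "(of_nat deg_exc :: 'k) \<noteq> 0"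
proof -
  have "p ^ a = e * deg_exc + 1" using degree_sum p_gt_1 unfolding deg_exc_def by simp
  then have "of_nat p ^ a = (of_nat (e * deg_exc + 1) :: 'k)" by (metis of_nat_power)
  then have eq: "of_nat p ^ a - of_nat e * of_nat deg_exc = (1::'k)" by simp
  have "(of_nat p ^ a :: 'k) = of_nat p * of_nat p ^ (a - 1)" using a_pos by (simp flip: power_Suc)
  then have pa: "(of_nat p ^ a :: 'k) \<in> pR" unfolding pR_def using R_power[OF R_of_nat] by blast
  have n: "(of_nat deg_exc :: 'k) \<notin> pR"
  proof
    assume "(of_nat deg_exc :: 'k) \<in> pR"
    from pR_diff[OF pa pR_mult[OF this R_of_nat[of e]]] show False using one_notin_pR eq by simp
  qed
  then show "inverse (of_nat deg_exc) \<in> R" by (intro R_unit R_of_nat)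
  show "(of_nat deg_exc :: 'k) \<noteq> 0" using n pR_zero by metis
qed

lemma coeff1_M11: "coeff1 (M 1 1) = cst * of_nat deg_exc"
  using trace_formula[OF C_closed(1)] H_f(1)[OF M_H[OF n_index(1) n_index(1)]] tr_f unfolding deg_exc_def by simp

text \<open>Pairing \<open>scal r f\<close> with \<open>f\<close> gives
  \<open>r * cst * deg_exc\<close>, where \<open>deg_exc\<close> is a unit. Conversely it is enough
  to test against \<open>R f + wZ\<close>, and elements of \<open>wZ\<close> pair integrally with
  \<open>f\<close>.\<close>

lemma scal_f_wZ_iff: assumes r: "r \<in> R" shows "scal r f \<in> wZ \<longleftrightarrow> cst * r \<in> R"
proof
  note i1 = n_index(1)
  have fM: "f * M 1 1 = M 1 1" by (rule H_f(1)[OF M_H[OF i1 i1]])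
  have rf: "scal r f \<in> C" by (rule C_closed(5)[OF C_closed(1)])
  {
    assume "scal r f \<in> wZ"
    then have "coeff1 (f * scal r f * M 1 1) \<in> R" using wZ_iff[OF rf] Z_closed(1) by blast
    also have "coeff1 (f * scal r f * M 1 1) = r * (cst * of_nat deg_exc)"
      using f_idem coeff1_M11 fM by (simp add: coeff1_scal)
    finally have "r * (cst * of_nat deg_exc) * inverse (of_nat deg_exc) \<in> R" using inverse_deg(1) by (rule R_mult)
    moreover have "r * (c * d) * inverse d = c * r" if "d \<noteq> 0" for c d :: 'k using that by simp
    ultimately show "cst * r \<in> R" using inverse_deg(2) by metis
  }
  assume cr: "cst * r \<in> R"
  have "coeff1 (x * scal r f * M 1 1) \<in> R" if x: "x \<in> Z" for x
  proof -
    obtain c where c: "c \<in> R" "x - scal c f \<in> wZ" using Z_mod_wZ[OF x] by blast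
    define t where "t = x - scal c f"
    have t: "t \<in> wZ" "t \<in> Z" using c(2) wZ_closed(6) unfolding t_def by auto
    have "coeff1 (f * t * M 1 1) \<in> R" using wZ_iff[OF Z_C[OF t(2)]] t(1) Z_closed(1) by blast
    then have tR: "coeff1 (t * M 1 1) \<in> R" unfolding H_f(1)[OF Z_H[OF t(2)]] .
    have "x * scal r f * M 1 1 = scal r (x * M 1 1)" using H_f(2)[OF Z_H[OF x]] by simp
    also have "x * M 1 1 = scal c (M 1 1) + t * M 1 1" unfolding t_def using fM by (simp add: left_diff_distrib)
    finally have "coeff1 (x * scal r f * M 1 1) = r * (c * (cst * of_nat deg_exc) + coeff1 (t * M 1 1))"
      by (simp only: coeff1_scal coeff1_add coeff1_M11)
    also have "\<dots> = (cst * r) * (c * of_nat deg_exc) + r * coeff1 (t * M 1 1)" by (simp add: algebra_simps)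
    also have "\<dots> \<in> R" by (intro R_add R_mult cr c(1) R_of_nat r tR)
    finally show ?thesis .
  qed
  then show "scal r f \<in> wZ" using wZ_iff[OF rf] by blast
qed

text \<open>As \<open>Z = R f + wZ\<close>, the map \<open>r \<mapsto> scal r f\<close> carries
  transversals of \<open>R\<close> modulo \<open>R \<inter> wZ\<close> to transversals of
  \<open>Z\<close> modulo \<open>wZ\<close>.\<close>

lemma index_conductor:
  assumes T: "transversal R {r \<in> R. cst * r \<in> R} T" shows "card T = residue_card ^ a"
proof -
  let ?S = "{r \<in> R. cst * r \<in> R}" and ?h = "\<lambda>r. scal r f"
  have S: "add_closed ?S" unfolding add_closed_def using R_diff by (auto simp: right_diff_distrib)
  have scal_diff: "scal r f - scal t f = scal (r - t) f" for r t by (simp add: kg.scale_left_diff_distrib)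
  have inj: "r = t" if rt: "r \<in> T" "t \<in> T" "scal r f - scal t f \<in> wZ" for r t
  proof -
    have rR: "r - t \<in> R" using rt(1,2) transversalD(2)[OF T] by (intro R_diff) auto
    have "r - t \<in> ?S" using rt(3) scal_f_wZ_iff[OF rR] rR unfolding scal_diff by simp
    then show ?thesis by (rule transversal_inj[OF T S rt(1,2)])
  qed
  have "transversal Z wZ (?h ` T)"
  proof (rule transversalI[OF add_closed_wZ])
    show "finite (?h ` T)" using transversalD(1)[OF T] by simp
    show "?h ` T \<subseteq> Z" using transversalD(2)[OF T] Z_closed(5)[OF Z_closed(1)] by auto
    show "\<exists>s\<in>?h ` T. x - s \<in> wZ" if x: "x \<in> Z" for x
    proof -
      obtain c where c: "c \<in> R" "x - scal c f \<in> wZ" using Z_mod_wZ[OF x] by blast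
      obtain t where t: "t \<in> T" "c - t \<in> ?S" using transversalD(3)[OF T c(1)] by blast
      then have "scal (c - t) f \<in> wZ" using scal_f_wZ_iff[of "c - t"] by simp
      then have "(x - scal c f) + (scal c f - scal t f) \<in> wZ" unfolding scal_diff by (rule wZ_closed(2)[OF c(2)])
      then show ?thesis using t(1) by auto
    qed
    show "s = t" if "s \<in> ?h ` T" "t \<in> ?h ` T" "s - t \<in> wZ" for s t using that inj by auto
  qed
  moreover obtain V where "transversal Z wZ V" "card V = residue_card ^ a" using index_wZ by blast
  ultimately have "card (?h ` T) = residue_card ^ a" using transversal_card_unique add_closed_wZ by metis
  moreover have "inj_on ?h T" by (rule inj_onI) (rule inj, auto simp: wZ_closed(1))
  ultimately show ?thesis by (simp add: card_image)
qed

text \<open>For the least \<open>k\<close> with \<open>p ^ k * cst\<close> in \<open>R\<close> this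
  product is a unit, so the submodule in \<open>index_conductor\<close> is \<open>p ^ k R\<close>,
  of index \<open>residue_card ^ k\<close>. Comparing the two indices gives
  \<open>k = a\<close>.\<close>

lemma cst_valuation: "cst * of_nat p ^ a \<in> R" "inverse (cst * of_nat p ^ a) \<in> R" "cst \<noteq> 0"
proof -
  \<comment> \<open>Otherwise the index would be \<open>1\<close>, against \<open>a \<ge> 1\<close>.
    It follows that \<open>k\<close> is positive, which allows it to be lowered below.\<close>
  have nR: "cst \<notin> R"
  proof
    assume "cst \<in> R"
    then have S: "{r \<in> R. cst * r \<in> R} = R" by auto
    have "transversal R {r \<in> R. cst * r \<in> R} {0}" unfolding S using add_closed_R by (intro transversalI) auto
    from index_conductor[OF this] have "residue_card ^ a = 1" by simp
    then show False using residue_card_gt_1 a_pos by simp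
  qed
  then show nz: "cst \<noteq> 0" by auto
  define k where "k = (LEAST k. of_nat p ^ k * cst \<in> R)"
  have k: "of_nat p ^ k * cst \<in> R" unfolding k_def by (rule LeastI_ex[OF dense])
  have k0: "k \<noteq> 0" using k nR by (metis mult_1 power_0)
  define \<nu> where "\<nu> = of_nat p ^ k * cst"
  have "\<nu> \<notin> pR"
  proof
    assume "\<nu> \<in> pR"
    then obtain x where x: "\<nu> = of_nat p * x" "x \<in> R" unfolding pR_def by blast
    have "of_nat p * (of_nat p ^ (k - 1) * cst) = \<nu>" unfolding \<nu>_def using k0
      by (simp flip: power_Suc mult.assoc)
    then have "of_nat p ^ (k - 1) * cst \<in> R" using x p_nonzero by simp
    from Least_le[of "\<lambda>k. of_nat p ^ k * cst \<in> R", OF this] show False using k0 unfolding k_def[symmetric] by simp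
  qed
  then have inv: "inverse \<nu> \<in> R" using R_unit[of \<nu>] k unfolding \<nu>_def by blast
  have \<nu>0: "\<nu> \<noteq> 0" unfolding \<nu>_def using nz p_nonzero by simp
  have pk: "(of_nat p ^ k :: 'k) \<noteq> 0" using p_nonzero by simp
  have "{r \<in> R. cst * r \<in> R} = {of_nat p ^ k * x |x. x \<in> R}"
  proof (intro equalityI subsetI)
    fix r assume r: "r \<in> {r \<in> R. cst * r \<in> R}"
    have "r = of_nat p ^ k * (inverse \<nu> * (cst * r))" unfolding \<nu>_def using pk nz by (simp add: field_simps)
    then show "r \<in> {of_nat p ^ k * x |x. x \<in> R}" using R_mult[OF inv] r by blast
  next
    fix r assume "r \<in> {of_nat p ^ k * x |x. x \<in> R}"
    then obtain x where x: "r = of_nat p ^ k * x" "x \<in> R" by blast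
    have "cst * r = \<nu> * x" unfolding x \<nu>_def by (simp add: ac_simps)
    moreover have "\<nu> * x \<in> R" "r \<in> R" using k x unfolding \<nu>_def by auto
    ultimately show "r \<in> {r \<in> R. cst * r \<in> R}" by simp
  qed
  then obtain T where "transversal R {r \<in> R. cst * r \<in> R} T" "card T = residue_card ^ k"
    using R_power_transversal[of k] by auto
  then have "residue_card ^ k = residue_card ^ a" using index_conductor by metis
  then have "k = a" using residue_card_gt_1 by (simp add: power_inject_exp)
  then show "cst * of_nat p ^ a \<in> R" "inverse (cst * of_nat p ^ a) \<in> R"
    using k inv unfolding \<nu>_def by (simp_all only: mult.commute)
qed

section \<open>The dual lattice and the generators of \<open>\<Gamma>\<close>\<close>

lemma C_sum_Zs: "{\<Sum>s=1..a. z s |z. \<forall>s\<in>{1..a}. z s \<in> Zs s} = C"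
proof (intro equalityI subsetI)
  fix x assume "x \<in> {\<Sum>s=1..a. z s |z. \<forall>s\<in>{1..a}. z s \<in> Zs s}"
  then obtain z where z: "x = (\<Sum>s=1..a. z s)" "\<forall>s\<in>{1..a}. z s \<in> Zs s" by blast
  show "x \<in> C" unfolding z(1) using z(2) by (intro C_sum) (rule Zs_C, assumption, rule bspec)
next
  fix x assume x: "x \<in> C"
  have "\<forall>s\<in>{1..a}. x * \<epsilon> s \<in> Zs s"
  proof
    fix s assume s: "s \<in> {1..a}"
    then show "x * \<epsilon> s \<in> Zs s"
      using Zs_iff[OF s] C_eps[OF exc_index[OF s] x] eps_idem[OF exc_index[OF s]] by (simp add: mult.assoc)
  qed
  with H_sum_eps[OF C_H[OF x]] show "x \<in> {\<Sum>s=1..a. z s |z. \<forall>s\<in>{1..a}. z s \<in> Zs s}"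
    by (intro CollectI exI[of _ "\<lambda>s. x * \<epsilon> s"] conjI)
qed

lemma trace_dual_iff: "x \<in> trace_dual R a \<epsilon> Zs Z \<longleftrightarrow> x \<in> C \<and> (\<forall>z\<in>Z. tr (z * x) \<in> R)"
proof -
  have "(\<Sum>s=1..a. alg_trace (Zs s) ((z * \<epsilon> s) * (x * \<epsilon> s))) = tr (z * x)" for z
    unfolding tr_def by (intro sum.cong refl) (simp only: eps_distrib)
  then show ?thesis unfolding trace_dual_def C_sum_Zs by simp
qed

lemma trace_dual_wZ: assumes x: "x \<in> C" shows "x \<in> trace_dual R a \<epsilon> Zs Z \<longleftrightarrow> scal (of_nat p ^ a) x \<in> wZ"
proof -
  let ?\<nu> = "cst * of_nat p ^ a"
  have nu: "?\<nu> * t \<in> R \<longleftrightarrow> t \<in> R" for t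
  proof
    assume "?\<nu> * t \<in> R"
    then have "inverse ?\<nu> * (?\<nu> * t) \<in> R" by (rule R_mult[OF cst_valuation(2)])
    moreover have "inverse c * (c * t) = t" if "c \<noteq> 0" for c :: 'k using that by (simp flip: mult.assoc)
    moreover have "?\<nu> \<noteq> 0" using cst_valuation(3) p_nonzero by simp
    ultimately show "t \<in> R" by metis
  qed (rule R_mult[OF cst_valuation(1)])
  have "coeff1 (z * scal (of_nat p ^ a) x * M 1 1) = ?\<nu> * tr (z * x)" if z: "z \<in> Z" for z
  proof -
    have "coeff1 (z * scal (of_nat p ^ a) x * M 1 1) = of_nat p ^ a * coeff1 (z * x * M 1 1)" by (simp add: coeff1_scal)
    also have "coeff1 (z * x * M 1 1) = cst * tr (z * x)" by (rule trace_formula[OF C_closed(4)[OF Z_C[OF z] x]])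
    finally show ?thesis by (simp only: ac_simps)
  qed
  then show ?thesis unfolding trace_dual_iff wZ_iff[OF C_closed(5)[OF x]] using x nu by simp
qed

lemma trace_dual_scaled: "{scal (of_nat (p ^ a)) z |z. z \<in> trace_dual R a \<epsilon> Zs Z} = wZ"
proof (intro equalityI subsetI)
  fix t assume "t \<in> {scal (of_nat (p ^ a)) z |z. z \<in> trace_dual R a \<epsilon> Zs Z}"
  then obtain z where z: "t = scal (of_nat p ^ a) z" "z \<in> trace_dual R a \<epsilon> Zs Z" by auto
  then show "t \<in> wZ" using trace_dual_wZ trace_dual_iff by blast
next
  fix t assume t: "t \<in> wZ"
  define z where "z = scal (inverse (of_nat p ^ a)) t"
  have tz: "t = scal (of_nat (p ^ a)) z" unfolding z_def using p_nonzero by simp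
  have zC: "z \<in> C" unfolding z_def using wZ_closed(6)[OF t] by (intro C_closed Z_C)
  have "z \<in> trace_dual R a \<epsilon> Zs Z" using trace_dual_wZ[OF zC] t tz by simp
  then show "t \<in> {scal (of_nat (p ^ a)) z |z. z \<in> trace_dual R a \<epsilon> Zs Z}" using tz by blast
qed

lemma generate_subset_Gamma:
  assumes "S \<subseteq> \<Gamma>" shows "generate_ring (sub_rng \<Gamma> f) S \<subseteq> \<Gamma>"
proof
  fix x assume "x \<in> generate_ring (sub_rng \<Gamma> f) S"
  then show "x \<in> \<Gamma>"
  proof (induction rule: generate_ring.induct)
    case (incl h)
    then show ?case using assms by blast
  next
    case (a_inv h)
    then show ?case using a_inv_sub_rng[OF Gamma_ring] by (simp add: Gamma_minus)
  qed (auto simp: f_Gamma Gamma_add Gamma_mult)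
qed

lemma generate_ring_mono_gen:
  assumes "S \<subseteq> generate_ring A S'" shows "generate_ring A S \<subseteq> generate_ring A S'"
proof
  fix x assume "x \<in> generate_ring A S"
  then show "x \<in> generate_ring A S'"
    by (induction rule: generate_ring.induct) (use assms in \<open>auto intro: generate_ring.intros\<close>)
qed

lemma Gamma_generated:
  assumes x: "\<And>s. s \<in> {1..a} \<Longrightarrow> x s \<in> Rs s"
    and eq: "wZ = {(\<Sum>s=1..a. x s * \<pi> s) * z |z. z \<in> Z}"
  shows "generate_ring (sub_rng \<Gamma> f) (order_gens a n Z E x \<pi>) = \<Gamma>"
proof -
  note i1 = n_index(1) and i2 = n_index(2)
  define w' where "w' = (\<Sum>s=1..a. x s * \<pi> s)"
  let ?S = "order_gens a n Z E x \<pi>" and ?g = "\<Sum>s=1..a. x s * \<pi> s * E s 1 n"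
  have g: "?g = w' * M 1 n" unfolding w'_def
  proof (rule sum_times_M[OF _ i1 i2, symmetric])
    fix s assume s: "s \<in> {1..a}"
    show "x s * \<pi> s \<in> C \<and> x s * \<pi> s * \<epsilon> s = x s * \<pi> s"
      using C_closed(4)[OF Rs_C[OF s x[OF s]] Rs_C[OF s pi_Rs[OF s]]] Rs_eps[OF s pi_Rs[OF s]] by (simp add: mult.assoc)
  qed
  have w'C: "w' \<in> C" unfolding w'_def by (rule C_sum, rule C_closed(4); rule Rs_C; (assumption | erule x pi_Rs))
  have "w \<in> wZ" unfolding wZ_def using H_f(2)[OF C_H[OF w_C]] Z_closed(1) by force
  then obtain z0 where z0: "w = w' * z0" "z0 \<in> Z" unfolding eq w'_def by blast
  have "w' \<in> {w' * z |z. z \<in> Z}" using H_f(2)[OF C_H[OF w'C]] Z_closed(1) by force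
  then have "w' \<in> wZ" unfolding eq w'_def .
  then obtain z1 where z1: "w' = w * z1" "z1 \<in> Z" unfolding wZ_def by blast
  have 1: "w * M 1 n = z0 * (w' * M 1 n)"
    unfolding z0(1) C_comm[OF w'C Z_H[OF z0(2)]] by (rule mult.assoc)
  have 2: "w' * M 1 n = z1 * (w * M 1 n)"
    unfolding z1(1) C_comm[OF w_C Z_H[OF z1(2)]] by (rule mult.assoc)
  have "?g \<in> \<Gamma>" unfolding g 2 by (rule Gamma_mult[OF Z_Gamma[OF z1(2)] wM_Gamma[OF i1 i2]])
  then have "?S \<subseteq> \<Gamma>"
    using Z_Gamma diag_Gamma coord_sub unfolding order_gens_def Un_subset_iff subset_iff by fast
  then have le: "generate_ring (sub_rng \<Gamma> f) ?S \<subseteq> \<Gamma>" by (rule generate_subset_Gamma)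
  have "(\<Sum>s=1..a. y s * \<pi> s * E s 1 n) \<in> generate_ring (sub_rng \<Gamma> f) ?S"
  proof -
    have "z0 \<in> ?S" "w' * M 1 n \<in> ?S" unfolding order_gens_def g using z0(2) by auto
    then have "z0 \<otimes>\<^bsub>sub_rng \<Gamma> f\<^esub> (w' * M 1 n) \<in> generate_ring (sub_rng \<Gamma> f) ?S"
      by (intro generate_ring.eng_mult generate_ring.incl)
    then show ?thesis unfolding wM_1n[symmetric] 1 by simp
  qed
  moreover have "order_gens a n Z E y \<pi> \<subseteq> ?S \<union> {\<Sum>s=1..a. y s * \<pi> s * E s 1 n}"
    unfolding order_gens_def by (rule Un_mono[OF Un_upper1 subset_refl])
  moreover have "?S \<subseteq> generate_ring (sub_rng \<Gamma> f) ?S" by (rule subsetI) (rule generate_ring.incl)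
  ultimately have "order_gens a n Z E y \<pi> \<subseteq> generate_ring (sub_rng \<Gamma> f) ?S"
    by (elim subset_trans) (rule Un_least, assumption, rule insert_subsetI[OF _ empty_subsetI])
  from generate_ring_mono_gen[OF this] show ?thesis using le y_gen by blast
qed

end

theorem theorem2p5:
  fixes p a e n :: nat
    and Q R :: "'k::field_char_0 set" and v :: "'k \<Rightarrow> real"
    and b f :: "'g::{finite,group_add} \<Rightarrow>\<^sub>0 'k"
    and D :: "'g set"
    and \<epsilon> :: "nat \<Rightarrow> 'g \<Rightarrow>\<^sub>0 'k"
    and A :: "nat \<Rightarrow> ('g \<Rightarrow>\<^sub>0 'k) set"
    and B \<Lambda> \<Gamma> Z :: "('g \<Rightarrow>\<^sub>0 'k) set"
    and u \<pi> y idem :: "nat \<Rightarrow> 'g \<Rightarrow>\<^sub>0 'k"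
    and K\<Gamma> Zs Rs \<Gamma>s :: "nat \<Rightarrow> ('g \<Rightarrow>\<^sub>0 'k) set"
    and E :: "nat \<Rightarrow> nat \<Rightarrow> nat \<Rightarrow> 'g \<Rightarrow>\<^sub>0 'k"
  \<comment> \<open>the block \<open>B\<close>\<close>
  assumes prime: "Factorial_Ring.prime p"
    and unramified: "unramified_ext p Q v R"
    and block_idem: "central_primitive_idem (sub_rng (group_ring R) 1) b"
    and B_eq: "B = block_of R b"
    and defect: "defect_group R b D" "cyclic_group (grp\<lparr>carrier := D\<rparr>)" "card D = p ^ a"
    and splitting: "splits (red_block p R b) (red_scalars p R b)"
    and e_eq: "e = num_simple_modules (red_block p R b)"
  \<comment> \<open>the simple components \<open>A s\<close> of \<open>KB\<close>\<close>
    and eps: "bij_betw \<epsilon> {1..a+e} {c. central_primitive_idem (sub_rng {x * b |x. True} b) c}"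
    and A_eq: "\<And>s. A s = {x * b * \<epsilon> s |x. True}"
    and nonexceptional: "\<And>s. s \<in> {a+1..a+e} \<Longrightarrow>
          ring_center (sub_rng (A s) (\<epsilon> s)) = {scal c (\<epsilon> s) |c. True}"
    and exceptional: "\<And>s. s \<in> {1..a} \<Longrightarrow>
          totally_ramified p R (ring_center (sub_rng (A s) (\<epsilon> s))) (\<epsilon> s)"
          "\<And>s. s \<in> {1..a} \<Longrightarrow>
          e * kg.dim (ring_center (sub_rng (A s) (\<epsilon> s))) = p ^ s - p ^ (s - 1)"
    and tree: "brauer_tree R b a e \<epsilon>"
  \<comment> \<open>the basic order \<open>\<Gamma> = f\<Lambda>f\<close> of \<open>\<Lambda> = (\<epsilon> 1 + \<dots> + \<epsilon> a) B\<close>\<close>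
    and Lambda_eq: "\<Lambda> = {(\<Sum>s=1..a. \<epsilon> s) * x |x. x \<in> B}"
    and basic_idem: "f \<in> \<Lambda>" "f * f = f" "Idl\<^bsub>sub_rng \<Lambda> (\<Sum>s=1..a. \<epsilon> s)\<^esub> {f} = \<Lambda>"
    and Gamma_eq: "\<Gamma> = {f * x * f |x. x \<in> \<Lambda>}"
    and Gamma_basic: "simples_one_dimensional (sub_rng \<Gamma> f) {scal c f |c. c \<in> R}"
    and n_eq: "n = num_simple_modules (sub_rng \<Gamma> f)"
    and n_gt_1: "n > 1"
    and Z_eq: "Z = ring_center (sub_rng \<Gamma> f)"
    and u_eq: "\<And>s. u s = f * \<epsilon> s"
    and Gammas_eq: "\<And>s. \<Gamma>s s = {x * \<epsilon> s |x. x \<in> \<Gamma>}"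
    and KGamma_eq: "\<And>s. K\<Gamma> s = {x * \<epsilon> s |x. x \<in> kg.span \<Gamma>}"
    and Zs_eq: "\<And>s. Zs s = ring_center (sub_rng (K\<Gamma> s) (u s))"
    and Rs_eq: "\<And>s. Rs s = ring_of_integers R (Zs s) (u s)"
    and pi_prime: "\<And>s. s \<in> {1..a} \<Longrightarrow> \<pi> s \<in> Rs s \<and> ring_prime\<^bsub>sub_rng (Rs s) (u s)\<^esub> (\<pi> s)"
  \<comment> \<open>the idempotents \<open>e\<^sub>1, \<dots>, e\<^sub>n\<close> and their cyclic ordering\<close>
    and idem_Gamma: "\<And>i. i \<in> {1..n} \<Longrightarrow> idem i \<in> \<Gamma>"
    and idem_orth: "\<And>i j. i \<in> {1..n} \<Longrightarrow> j \<in> {1..n} \<Longrightarrow>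
          idem i * idem j = (if i = j then idem i else 0)"
    and idem_lift: "bij_betw (\<lambda>i. jacobson_radical (sub_rng \<Gamma> f) +>\<^bsub>sub_rng \<Gamma> f\<^esub> idem i) {1..n}
          {c. central_primitive_idem (sub_rng \<Gamma> f Quot jacobson_radical (sub_rng \<Gamma> f)) c}"
    and idem_order: "\<And>s i. s \<in> {1..a} \<Longrightarrow> i \<in> {1..n} \<Longrightarrow>
          uniserial_with (sub_rng (\<Gamma>s s) (u s))
            (quot_module {x * idem i |x. x \<in> \<Gamma>s s} {\<pi> s * (x * idem i) |x. x \<in> \<Gamma>s s})
            n (\<lambda>j. idem ((i - 1 + j) mod n + 1) * \<epsilon> s)"
  \<comment> \<open>the coordinates, \<open>E s i j = e\<^sup>s\<^sub>i\<^sub>j\<close>\<close>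
    and units: "\<And>s. s \<in> {1..a} \<Longrightarrow> mat_units n (u s) (E s)"
          "\<And>s i j. s \<in> {1..a} \<Longrightarrow> i \<in> {1..n} \<Longrightarrow> j \<in> {1..n} \<Longrightarrow> E s i j \<in> K\<Gamma> s"
    and coord_K: "\<And>s. s \<in> {1..a} \<Longrightarrow>
          K\<Gamma> s = {\<Sum>i=1..n. \<Sum>j=1..n. c i j * E s i j |c. \<forall>i\<in>{1..n}. \<forall>j\<in>{1..n}. c i j \<in> Zs s}"
    and coord_Gamma: "\<And>s. s \<in> {1..a} \<Longrightarrow>
          \<Gamma>s s = {\<Sum>i=1..n. \<Sum>j=1..n. c i j * E s i j |c.
            \<forall>i\<in>{1..n}. \<forall>j\<in>{1..n}. c i j \<in> Rs s \<and> (i < j \<longrightarrow> c i j \<in> {\<pi> s * r |r. r \<in> Rs s})}"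
    and coord_idem: "\<And>i. i \<in> {1..n} \<Longrightarrow> idem i = (\<Sum>s=1..a. E s i i)"
    and coord_sub: "\<And>i. i \<in> {1..n-1} \<Longrightarrow> (\<Sum>s=1..a. E s (i+1) i) \<in> \<Gamma>"
    and y_unit: "\<And>s. s \<in> {1..a} \<Longrightarrow> y s \<in> Units (sub_rng (Rs s) (u s))"
    and y_elem: "(\<Sum>s=1..a. y s * \<pi> s * E s 1 n) \<in> {idem 1 * x * idem n |x. x \<in> \<Gamma>}"
    and y_gen: "generate_ring (sub_rng \<Gamma> f) (order_gens a n Z E y \<pi>) = \<Gamma>"
  shows "(\<exists>x. (\<forall>s\<in>{1..a}. x s \<in> Units (sub_rng (Rs s) (u s))) \<and>
             {scal (of_nat (p ^ a)) z |z. z \<in> trace_dual R a \<epsilon> Zs Z} =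
             {(\<Sum>s=1..a. x s * \<pi> s) * z |z. z \<in> Z}) \<and>
         (\<forall>x. (\<forall>s\<in>{1..a}. x s \<in> Units (sub_rng (Rs s) (u s))) \<and>
             {scal (of_nat (p ^ a)) z |z. z \<in> trace_dual R a \<epsilon> Zs Z} =
             {(\<Sum>s=1..a. x s * \<pi> s) * z |z. z \<in> Z} \<longrightarrow>
             generate_ring (sub_rng \<Gamma> f) (order_gens a n Z E x \<pi>) = \<Gamma>)"
proof -
  \<comment> \<open>For \<open>a = 0\<close> all \<open>idem i\<close> are empty sums, so they could
    not lift \<open>n > 1\<close> different idempotents.\<close>
  have "a \<noteq> 0"
  proof
    assume "a = 0"
    then have "idem 1 = 0" "idem 2 = 0" using coord_idem[of 1] coord_idem[of 2] n_gt_1 by auto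
    then show False using inj_onD[OF bij_betw_imp_inj_on[OF idem_lift], of 1 2] n_gt_1 by simp
  qed
  then have a_pos: "a \<ge> 1" by simp
  have diag_Gamma: "(\<Sum>s=1..a. E s i i) \<in> \<Gamma>" if "i \<in> {1..n}" for i
    using idem_Gamma[OF that] coord_idem[OF that] by simp
  have y_elem': "(\<Sum>s=1..a. y s * \<pi> s * E s 1 n) \<in> {(\<Sum>s=1..a. E s 1 1) * x * (\<Sum>s=1..a. E s n n) |x. x \<in> \<Gamma>}"
  proof -
    have "idem 1 = (\<Sum>s=1..a. E s 1 1)" "idem n = (\<Sum>s=1..a. E s n n)" using coord_idem n_gt_1 by auto
    then show ?thesis using y_elem by simp
  qed
  interpret exceptional_order p Q R v a e n b f \<epsilon> \<Gamma> Z \<pi> y Zs Rs E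
    by (intro exceptional_order.intro unramified_field.intro exceptional_order_axioms.intro;
      (rule prime unramified block_idem eps nonexceptional[unfolded A_eq] exceptional[unfolded A_eq] tree
        basic_idem[unfolded Lambda_eq B_eq] Gamma_eq[unfolded Lambda_eq B_eq] Gamma_basic n_eq n_gt_1 a_pos Z_eq
        Zs_eq[unfolded KGamma_eq u_eq] Rs_eq[unfolded u_eq] pi_prime[unfolded u_eq] units[unfolded KGamma_eq u_eq]
        coord_K[unfolded KGamma_eq] coord_Gamma[unfolded Gammas_eq] diag_Gamma coord_sub y_unit[unfolded u_eq]
        y_elem' y_gen; assumption))
  \<comment> \<open>Once the scaled dual is rewritten to \<open>wZ\<close>, the given units
    \<open>y\<close> are witnesses for the first claim.\<close>
  show ?thesis unfolding trace_dual_scaled u_eq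
  proof (intro conjI exI[of _ y] allI impI)
    show "\<forall>s\<in>{1..a}. y s \<in> Units (sub_rng (Rs s) (f * \<epsilon> s))" using y_unit unfolding u_eq by blast
    show "wZ = {(\<Sum>s=1..a. y s * \<pi> s) * z |z. z \<in> Z}" unfolding wZ_def w_def ..
  next
    fix x assume x: "(\<forall>s\<in>{1..a}. x s \<in> Units (sub_rng (Rs s) (f * \<epsilon> s))) \<and>
      wZ = {(\<Sum>s=1..a. x s * \<pi> s) * z |z. z \<in> Z}"
    show "generate_ring (sub_rng \<Gamma> f) (order_gens a n Z E x \<pi>) = \<Gamma>"
    proof (rule Gamma_generated)
      show "x s \<in> Rs s" if "s \<in> {1..a}" for s using bspec[OF conjunct1[OF x] that] unfolding Units_def by simp
    qed (rule conjunct2[OF x])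
  qed
qed

end
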